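(* Let $\bar u=\{u_1,\dots,u_n\}$ and $\bar v=\{v_1,\dots,v_n\}$ be sets of (generic) complex parameters with $\#\bar u=\#\bar v=n$. Consider the multiple action of the reflection transfer matrix on the off-shell Bethe vector, $$\hat t(\bar v)\,\hat{\mathbb{B}}(\bar u)=\sum\hat R(\bar v\,|\,\bar\eta_{\rm I},\bar\eta_{\rm II})\;\hat{\mathbb{B}}(\bar\eta_{\rm II}),\qquad\bar\eta=\{\bar u,\bar v\},$$ where the sum is taken over partitions of $\bar\eta$ into two disjoint subsets $\bar\eta_{\rm I},\bar\eta_{\rm II}$ such that $\#\bar\eta_{\rm I}=\#\bar\eta_{\rm II}$. Then the coefficient of $\hat{\mathbb{B}}(\bar v)$ in this multiple action coincides with the scalar product $S(\bar v|\bar u)=\hat{\mathbb{C}}(\bar v)\,\hat{\mathbb{B}}(\bar u)$ of on-shell and off-shell Bethe vectors: $$S(\bar v|\bar u)=\hat R(\bar v\,|\,\bar u,\bar v),$$ where the set $\bar v$ satisfies the Bethe equations $$\frac{(v_i+\xi_+-\frac c2)(v_i+\xi_--\frac c2)}{(v_i-\xi_++\frac c2)(v_i-\xi_-+\frac c2)}\,\frac{\lambda_1(v_i)\lambda_2(-v_i)}{\lambda_1(-v_i)\lambda_2(v_i)}=\prod_{j\ne i}\frac{f(v_i,v_j)f(v_i,-v_j)}{f(v_j,v_i)f(-v_j,v_i)},\qquad i=1,\dots,n,$$ and the set $\bar u$ is free (off-shell).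
   Context: Let $c$ be a nonzero complex constant, $\xi_\pm\in\mathbb{C}$, and put $g(u,v)=\frac{c}{u-v}$, $f(u,v)=\frac{u-v+c}{u-v}$. Let $R(u,v)=\mathbf 1\otimes\mathbf 1+g(u,v)\mathbf P$ on $\mathbb{C}^2\otimes\mathbb{C}^2$, with $\mathbf P$ the permutation operator. The matrix $T(u)=(T_{ij}(u))_{i,j=1,2}$ has entries that are operators on a space $\mathcal H$ and satisfies $R(u,v)T^{(1)}(u)T^{(2)}(v)=T^{(2)}(v)T^{(1)}(u)R(u,v)$, where $T^{(i)}$ acts in the $i$-th tensor factor. There are a vacuum $|0\rangle\in\mathcal H$ and a dual vacuum $\langle0|\in\mathcal H^*$ (with $\langle0|0\rangle=1$) such that $T_{ii}(u)|0\rangle=\lambda_i(u)|0\rangle$, $T_{21}(u)|0\rangle=0$, $\langle0|T_{ii}(u)=\lambda_i(u)\langle0|$, $\langle0|T_{12}(u)=0$. The complex-valued functions $\lambda_1,\lambda_2$ are free functional parameters (generalized model): no specific form is assumed. Let $K(u,\xi)=\mathrm{diag}(\xi+u,\ \xi-u)$ and let $\sigma_2$ be the second Pauli matrix. The reflection monodromy matrix and the reflection transfer matrix are $$\mathcal T(u)=T(u)\,K\bigl(u-\tfrac c2,\xi_-\bigr)\,\sigma_2\,T^{t}(-u)\,\sigma_2,\qquad \hat t(u)=\mathrm{Tr}\,K\bigl(u+\tfrac c2,\xi_+\bigr)\mathcal T(u),$$ where $T^t$ is the transpose of the $2\times2$ matrix. One has $[\hat t(u),\hat t(v)]=0$. For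 a set $\bar u$, $\bar u_j=\bar u\setminus\{u_j\}$ and $-\bar u=\{-u_1,\dots,-u_n\}$. A function, or a family of commuting operators, with a set as argument means the product over that set; empty products equal $1$. Bethe vectors: $\hat{\mathbb{B}}(\bar u)=\mathcal T_{12}(u_1)\cdots\mathcal T_{12}(u_n)|0\rangle$ (symmetric in $\bar u$). Dual Bethe vectors are constructed in the similar way from the dual vacuum: $\hat{\mathbb{C}}(\bar v)=\langle0|\mathcal T_{21}(v_1)\cdots\mathcal T_{21}(v_n)$. Single action of the reflection transfer matrix (known fact): $$\hat t(z)\,\hat{\mathbb{B}}(\bar u)=\hat\tau(z|\bar u)\,\hat{\mathbb{B}}(\bar u)-\frac1c\sum_j\frac{2u_j}{c+2u_j}\,\frac{c+2z}{c}\,g(z,u_j)g(z,-u_j)\mathop{\rm res}_{w=u_j}\hat\tau(w|\bar u)\ \hat{\mathbb{B}}(\{z\}\cup\bar u_j),$$ where $$\hat\tau(z|\bar u)=\tfrac{2z+c}{2z}(z+\xi_+-\tfrac c2)(z+\xi_--\tfrac c2)f(\bar u,z)f(-\bar u,z)\lambda_1(z)\lambda_2(-z)+\tfrac{2z-c}{2z}(z-\xi_++\tfrac c2)(z-\xi_-+\tfrac c2)f(z,\bar u)f(z,-\bar u)\lambda_1(-z)\lambda_2(z),$$ and the residue at $w=u_j$ is computed regarding $\lambda_1,\lambda_2$ as regular at $\pm u_j$. The coefficients $\hat R(\bar v|\bar\eta_{\rm I},\bar\eta_{\rm II})$ are those obtained by applying this formula successively for $z=v_1,\dots,v_n$ to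 $\hat{\mathbb{B}}(\bar u)$ and collecting the total coefficient of each $\hat{\mathbb{B}}(\bar\eta_{\rm II})$; $\hat R(\bar v|\bar u,\bar v)$ is the total coefficient of $\hat{\mathbb{B}}(\bar v)$.
   Formalization: With the dual Bethe vector taken literally, S = R fails (rescaling T at the points ±v changes S but not R); what is proved is S = F·R with an explicit factor F depending on v (and c, ξ±, λ1, λ2) but not u; generic v includes v_i+v_j+c ≠ 0 for i ≠ j. *)

theory Defs
  imports "HOL-Complex_Analysis.Complex_Analysis"
begin

no_notation fps_nth (infixl \<open>$\<close> 75)

definition g_rat :: "complex \<Rightarrow> complex \<Rightarrow> complex \<Rightarrow> complex" where
  "g_rat c u v = c / (u - v)"

definition f_rat :: "complex \<Rightarrow> complex \<Rightarrow> complex \<Rightarrow> complex" where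
  "f_rat c u v = (u - v + c) / (u - v)"


text \<open>Matrices whose entries are operators on \<open>'h\<close>, multiplied with composition of entries.
  Scalar matrices enter through \<^term>\<open>lift_mat\<close>.\<close>

definition op_mult :: "('h::ab_group_add \<Rightarrow> 'h)^'k^'m \<Rightarrow> ('h \<Rightarrow> 'h)^'n^'k \<Rightarrow> ('h \<Rightarrow> 'h)^'n^'m"
    (infixl \<open>\<odot>\<close> 70) where
  "A \<odot> B = (\<chi> i j. (\<lambda>x. \<Sum>k\<in>UNIV. (A $ i $ k) ((B $ k $ j) x)))"

definition op_trace :: "('h::ab_group_add \<Rightarrow> 'h)^'n^'n \<Rightarrow> 'h \<Rightarrow> 'h" where
  "op_trace A = (\<lambda>x. \<Sum>i\<in>UNIV. (A $ i $ i) x)"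

definition lift_mat :: "(complex \<Rightarrow> 'h \<Rightarrow> 'h) \<Rightarrow> complex^'n^'m \<Rightarrow> ('h \<Rightarrow> 'h)^'n^'m" where
  "lift_mat smul M = (\<chi> i j. smul (M $ i $ j))"


text \<open>The index type \<open>2 \<times> 2\<close> labels the standard basis of the tensor square of \<open>\<complex>\<^sup>2\<close>.\<close>

definition tensor1 :: "('h::ab_group_add \<Rightarrow> 'h)^2^2 \<Rightarrow> ('h \<Rightarrow> 'h)^(2 \<times> 2)^(2 \<times> 2)" where
  "tensor1 A = (\<chi> i j. if snd i = snd j then A $ fst i $ fst j else (\<lambda>_. 0))"

definition tensor2 :: "('h::ab_group_add \<Rightarrow> 'h)^2^2 \<Rightarrow> ('h \<Rightarrow> 'h)^(2 \<times> 2)^(2 \<times> 2)" where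
  "tensor2 A = (\<chi> i j. if fst i = fst j then A $ snd i $ snd j else (\<lambda>_. 0))"

definition perm_mat :: "complex^(2 \<times> 2)^(2 \<times> 2)" where
  "perm_mat = (\<chi> i j. if i = prod.swap j then 1 else 0)"

definition R_mat :: "complex \<Rightarrow> complex \<Rightarrow> complex \<Rightarrow> complex^(2 \<times> 2)^(2 \<times> 2)" where
  "R_mat c u v = mat 1 + mat (g_rat c u v) ** perm_mat"


text \<open>\<open>D\<close> is the set of spectral parameters at which the monodromy matrix \<open>T\<close> is defined, so that
  \<open>T\<close> may have poles outside \<open>D\<close>. The exchange relation is required for \<open>u \<noteq> v\<close> only, since
  \<^term>\<open>g_rat c u v\<close> has a pole at \<open>u = v\<close>. The dual vacuum is a linear functional, on which operators act
  by composition from the right.\<close>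

locale generalized_model = vector_space smul
  for smul :: "complex \<Rightarrow> 'h::ab_group_add \<Rightarrow> 'h" +
  fixes c :: complex
    and D :: "complex set"
    and T :: "complex \<Rightarrow> ('h \<Rightarrow> 'h)^2^2"
    and vac :: 'h
    and dvac :: "'h \<Rightarrow> complex"
    and l1 l2 :: "complex \<Rightarrow> complex"
  assumes c_nonzero: "c \<noteq> 0"
    and D_uminus: "\<And>u. u \<in> D \<Longrightarrow> - u \<in> D"
    and T_linear: "\<And>u i j. u \<in> D \<Longrightarrow> Vector_Spaces.linear smul smul (T u $ i $ j)"
    and RTT: "\<And>u v. u \<in> D \<Longrightarrow> v \<in> D \<Longrightarrow> u \<noteq> v \<Longrightarrow>
        lift_mat smul (R_mat c u v) \<odot> tensor1 (T u) \<odot> tensor2 (T v)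
      = tensor2 (T v) \<odot> tensor1 (T u) \<odot> lift_mat smul (R_mat c u v)"
    and dvac_linear: "Vector_Spaces.linear smul (*) dvac"
    and dvac_vac: "dvac vac = 1"
    and T11_vac: "\<And>u. u \<in> D \<Longrightarrow> (T u $ 1 $ 1) vac = smul (l1 u) vac"
    and T22_vac: "\<And>u. u \<in> D \<Longrightarrow> (T u $ 2 $ 2) vac = smul (l2 u) vac"
    and T21_vac: "\<And>u. u \<in> D \<Longrightarrow> (T u $ 2 $ 1) vac = 0"
    and dvac_T11: "\<And>u x. u \<in> D \<Longrightarrow> dvac ((T u $ 1 $ 1) x) = l1 u * dvac x"
    and dvac_T22: "\<And>u x. u \<in> D \<Longrightarrow> dvac ((T u $ 2 $ 2) x) = l2 u * dvac x"
    and dvac_T12: "\<And>u x. u \<in> D \<Longrightarrow> dvac ((T u $ 1 $ 2) x) = 0"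


definition K_mat :: "complex \<Rightarrow> complex \<Rightarrow> complex^2^2" where
  "K_mat u xi = vector [vector [xi + u, 0], vector [0, xi - u]]"

definition sigma2 :: "complex^2^2" where
  "sigma2 = vector [vector [0, - \<i>], vector [\<i>, 0]]"

definition refl_monodromy ::
  "(complex \<Rightarrow> 'h::ab_group_add \<Rightarrow> 'h) \<Rightarrow> complex \<Rightarrow> complex \<Rightarrow> (complex \<Rightarrow> ('h \<Rightarrow> 'h)^2^2)
   \<Rightarrow> complex \<Rightarrow> ('h \<Rightarrow> 'h)^2^2" where
  "refl_monodromy smul c xm T u =
     T u \<odot> lift_mat smul (K_mat (u - c/2) xm) \<odot> lift_mat smul sigma2
       \<odot> transpose (T (- u)) \<odot> lift_mat smul sigma2"

definition refl_transfer ::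
  "(complex \<Rightarrow> 'h::ab_group_add \<Rightarrow> 'h) \<Rightarrow> complex \<Rightarrow> complex \<Rightarrow> complex
   \<Rightarrow> (complex \<Rightarrow> ('h \<Rightarrow> 'h)^2^2) \<Rightarrow> complex \<Rightarrow> 'h \<Rightarrow> 'h" where
  "refl_transfer smul c xp xm T u =
     op_trace (lift_mat smul (K_mat (u + c/2) xp) \<odot> refl_monodromy smul c xm T u)"


text \<open>Sets of parameters are listed without repetition. A Bethe vector does not depend on the order of
  its parameters, so \<open>bethe_vector_of_set\<close> may use any enumeration of the set.\<close>

definition bethe_vector ::
  "(complex \<Rightarrow> 'h::ab_group_add \<Rightarrow> 'h) \<Rightarrow> complex \<Rightarrow> complex \<Rightarrow> (complex \<Rightarrow> ('h \<Rightarrow> 'h)^2^2)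
   \<Rightarrow> 'h \<Rightarrow> complex list \<Rightarrow> 'h" where
  "bethe_vector smul c xm T vac us = foldr (\<lambda>u. refl_monodromy smul c xm T u $ 1 $ 2) us vac"

definition bethe_vector_of_set ::
  "(complex \<Rightarrow> 'h::ab_group_add \<Rightarrow> 'h) \<Rightarrow> complex \<Rightarrow> complex \<Rightarrow> (complex \<Rightarrow> ('h \<Rightarrow> 'h)^2^2)
   \<Rightarrow> 'h \<Rightarrow> complex set \<Rightarrow> 'h" where
  "bethe_vector_of_set smul c xm T vac U =
     bethe_vector smul c xm T vac (SOME us. distinct us \<and> set us = U)"

definition dual_bethe_vector ::
  "(complex \<Rightarrow> 'h::ab_group_add \<Rightarrow> 'h) \<Rightarrow> complex \<Rightarrow> complex \<Rightarrow> (complex \<Rightarrow> ('h \<Rightarrow> 'h)^2^2)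
   \<Rightarrow> ('h \<Rightarrow> complex) \<Rightarrow> complex list \<Rightarrow> 'h \<Rightarrow> complex" where
  "dual_bethe_vector smul c xm T dvac vs =
     (\<lambda>x. dvac (foldr (\<lambda>v. refl_monodromy smul c xm T v $ 2 $ 1) vs x))"

definition refl_scalar_product ::
  "(complex \<Rightarrow> 'h::ab_group_add \<Rightarrow> 'h) \<Rightarrow> complex \<Rightarrow> complex \<Rightarrow> (complex \<Rightarrow> ('h \<Rightarrow> 'h)^2^2)
   \<Rightarrow> 'h \<Rightarrow> ('h \<Rightarrow> complex) \<Rightarrow> complex list \<Rightarrow> complex list \<Rightarrow> complex" where
  "refl_scalar_product smul c xm T vac dvac vs us =
     dual_bethe_vector smul c xm T dvac vs (bethe_vector smul c xm T vac us)"


text \<open>\<open>tau_kernel\<close> is the eigenvalue with \<open>\<lambda>\<^sub>1(z)\<lambda>\<^sub>2(-z)\<close> and \<open>\<lambda>\<^sub>1(-z)\<lambda>\<^sub>2(z)\<close> replaced by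
  independent numbers \<open>a\<close> and \<open>b\<close>. The poles of the eigenvalue at the points of \<open>U\<close> are simple.
  A residue in which \<open>\<lambda>\<^sub>1, \<lambda>\<^sub>2\<close> count as regular is therefore obtained by freezing \<open>a\<close> and \<open>b\<close> at the pole,
  which makes sense for arbitrary functions \<open>\<lambda>\<^sub>1, \<lambda>\<^sub>2\<close>. See \<open>residue_tau_hat\<close> for the agreement with
  the residue of the full eigenvalue.\<close>

definition tau_kernel ::
  "complex \<Rightarrow> complex \<Rightarrow> complex \<Rightarrow> complex \<Rightarrow> complex \<Rightarrow> complex \<Rightarrow> complex set \<Rightarrow> complex" where
  "tau_kernel c xp xm a b z U =
     (2*z + c) / (2*z) * (z + xp - c/2) * (z + xm - c/2)
       * (\<Prod>u\<in>U. f_rat c u z) * (\<Prod>u\<in>U. f_rat c (- u) z) * a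
   + (2*z - c) / (2*z) * (z - xp + c/2) * (z - xm + c/2)
       * (\<Prod>u\<in>U. f_rat c z u) * (\<Prod>u\<in>U. f_rat c z (- u)) * b"

definition tau_hat ::
  "complex \<Rightarrow> complex \<Rightarrow> complex \<Rightarrow> (complex \<Rightarrow> complex) \<Rightarrow> (complex \<Rightarrow> complex)
   \<Rightarrow> complex \<Rightarrow> complex set \<Rightarrow> complex" where
  "tau_hat c xp xm l1 l2 z U = tau_kernel c xp xm (l1 z * l2 (- z)) (l1 (- z) * l2 z) z U"

definition tau_residue ::
  "complex \<Rightarrow> complex \<Rightarrow> complex \<Rightarrow> (complex \<Rightarrow> complex) \<Rightarrow> (complex \<Rightarrow> complex)
   \<Rightarrow> complex \<Rightarrow> complex set \<Rightarrow> complex" where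
  "tau_residue c xp xm l1 l2 u U =
     residue (\<lambda>w. tau_kernel c xp xm (l1 u * l2 (- u)) (l1 (- u) * l2 u) w U) u"

lemma residue_tau_kernel:
  assumes "finite U" "u \<in> U" "- u \<notin> U" and "A analytic_on {u}" "B analytic_on {u}"
  shows "residue (\<lambda>w. tau_kernel c xp xm (A w) (B w) w U) u =
     (2*u + c) / (2*u) * (u + xp - c/2) * (u + xm - c/2)
       * (- c * (\<Prod>x\<in>U - {u}. f_rat c x u)) * (\<Prod>x\<in>U. f_rat c (- x) u) * A u
   + (2*u - c) / (2*u) * (u - xp + c/2) * (u - xm + c/2)
       * (c * (\<Prod>x\<in>U - {u}. f_rat c u x)) * (\<Prod>x\<in>U. f_rat c u (- x)) * B u"
proof -
  have nz: "u \<noteq> 0" using assms by auto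
  have ne: "- x - u \<noteq> 0" "u + x \<noteq> 0" if "x \<in> U" for x
  proof -
    have "x \<noteq> - u" using assms(3) that by auto
    then show "- x - u \<noteq> 0" "u + x \<noteq> 0"
      by (auto simp: eq_neg_iff_add_eq_0 add.commute diff_eq_eq)
  qed
  define P where "P = (\<lambda>w. (2*w + c) / (2*w) * (w + xp - c/2) * (w + xm - c/2)
       * (- (u - w + c) * (\<Prod>x\<in>U - {u}. f_rat c x w)) * (\<Prod>x\<in>U. f_rat c (- x) w) * A w
     + (2*w - c) / (2*w) * (w - xp + c/2) * (w - xm + c/2)
       * ((w - u + c) * (\<Prod>x\<in>U - {u}. f_rat c w x)) * (\<Prod>x\<in>U. f_rat c w (- x)) * B w)"
  have "P analytic_on {u}"
    unfolding P_def f_rat_def using assms nz ne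
    by (intro analytic_intros) (auto simp: algebra_simps)
  then obtain S where S: "open S" "u \<in> S" "P holomorphic_on S"
    by (auto simp: analytic_at)
  have "tau_kernel c xp xm (A w) (B w) w U = P w / (w - u)" if "w \<noteq> u" for w
  proof -
    have 1: "(\<Prod>x\<in>U. f_rat c x w) = f_rat c u w * (\<Prod>x\<in>U - {u}. f_rat c x w)"
      "(\<Prod>x\<in>U. f_rat c w x) = f_rat c w u * (\<Prod>x\<in>U - {u}. f_rat c w x)"
      using assms by (simp_all add: prod.remove)
    have 2: "f_rat c u w = - (u - w + c) / (w - u)" "f_rat c w u = (w - u + c) / (w - u)"
      using that by (simp_all add: f_rat_def divide_simps) (simp add: algebra_simps)
    have gen: "k * (e / d * p) * q * a + l * (e' / d * p') * q' * b
        = (k * (e * p) * q * a + l * (e' * p') * q' * b) / d"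
      for k e d p q a l e' p' q' b :: complex
      by (simp add: add_divide_distrib)
    show ?thesis
      unfolding tau_kernel_def P_def 1 2 by (rule gen)
  qed
  then have "residue (\<lambda>w. tau_kernel c xp xm (A w) (B w) w U) u = residue (\<lambda>w. P w / (w - u)) u"
    by (intro residue_cong) (auto simp: eventually_at_filter)
  also have "\<dots> = P u"
    using residue_simple[OF S(1,2,3)] by simp
  finally show ?thesis by (simp add: P_def)
qed

lemma residue_tau_hat:
  assumes "finite U" "u \<in> U" "- u \<notin> U"
    and "l1 analytic_on {u, - u}" "l2 analytic_on {u, - u}"
  shows "residue (\<lambda>w. tau_hat c xp xm l1 l2 w U) u = tau_residue c xp xm l1 l2 u U"
proof -
  have "l analytic_on {u}" "(\<lambda>w. l (- w)) analytic_on {u}"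
    if "l analytic_on {u, - u}" for l :: "complex \<Rightarrow> complex"
  proof -
    show "l analytic_on {u}" using that by (rule analytic_on_subset) auto
    have "l \<circ> uminus analytic_on {u}"
      by (intro analytic_on_compose analytic_intros analytic_on_subset[OF that]) auto
    then show "(\<lambda>w. l (- w)) analytic_on {u}" by (simp add: o_def)
  qed
  with assms show ?thesis
    unfolding tau_hat_def tau_residue_def
    by (subst (1 2) residue_tau_kernel) (auto intro!: analytic_intros)
qed


definition unwanted_coeff ::
  "complex \<Rightarrow> complex \<Rightarrow> complex \<Rightarrow> (complex \<Rightarrow> complex) \<Rightarrow> (complex \<Rightarrow> complex)
   \<Rightarrow> complex \<Rightarrow> complex \<Rightarrow> complex set \<Rightarrow> complex" where
  "unwanted_coeff c xp xm l1 l2 z u U =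
     - (1 / c) * (2*u / (c + 2*u)) * ((c + 2*z) / c) * g_rat c z u * g_rat c z (- u)
       * tau_residue c xp xm l1 l2 u U"

text \<open>The coefficient of the Bethe vector with parameter set \<open>W\<close> after the single-action formula has
  been applied to the Bethe vector with parameter set \<open>U\<close>, first for the head of the list \<open>vs\<close>,
  then successively for the remaining entries.\<close>

fun action_coeff ::
  "complex \<Rightarrow> complex \<Rightarrow> complex \<Rightarrow> (complex \<Rightarrow> complex) \<Rightarrow> (complex \<Rightarrow> complex)
   \<Rightarrow> complex list \<Rightarrow> complex set \<Rightarrow> complex set \<Rightarrow> complex" where
  "action_coeff c xp xm l1 l2 [] U W = (if U = W then 1 else 0)"
| "action_coeff c xp xm l1 l2 (z # zs) U W =
     tau_hat c xp xm l1 l2 z U * action_coeff c xp xm l1 l2 zs U W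
   + (\<Sum>u\<in>U. unwanted_coeff c xp xm l1 l2 z u U
        * action_coeff c xp xm l1 l2 zs (insert z (U - {u})) W)"

text \<open>The arguments \<open>etaI\<close> and \<open>etaII\<close> partition the union of \<open>set vs\<close> and the initial parameter
  set, so the latter is \<open>etaI \<union> etaII - set vs\<close>.\<close>

definition R_hat ::
  "complex \<Rightarrow> complex \<Rightarrow> complex \<Rightarrow> (complex \<Rightarrow> complex) \<Rightarrow> (complex \<Rightarrow> complex)
   \<Rightarrow> complex list \<Rightarrow> complex set \<Rightarrow> complex set \<Rightarrow> complex" where
  "R_hat c xp xm l1 l2 vs etaI etaII =
     action_coeff c xp xm l1 l2 vs (etaI \<union> etaII - set vs) etaII"


definition bethe_equations ::
  "complex \<Rightarrow> complex \<Rightarrow> complex \<Rightarrow> (complex \<Rightarrow> complex) \<Rightarrow> (complex \<Rightarrow> complex)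
   \<Rightarrow> complex list \<Rightarrow> bool" where
  "bethe_equations c xp xm l1 l2 vs \<longleftrightarrow>
     (\<forall>i<length vs.
        ((vs!i + xp - c/2) * (vs!i + xm - c/2)) / ((vs!i - xp + c/2) * (vs!i - xm + c/2))
          * ((l1 (vs!i) * l2 (- (vs!i))) / (l1 (- (vs!i)) * l2 (vs!i)))
      = (\<Prod>j\<in>{..<length vs} - {i}.
           (f_rat c (vs!i) (vs!j) * f_rat c (vs!i) (- (vs!j)))
           / (f_rat c (vs!j) (vs!i) * f_rat c (- (vs!j)) (vs!i))))"

text \<open>Genericity means that no denominator in the formulas involved vanishes. The first conjunct of
  \<open>generic_parameters\<close> says that all the parameters and their negatives are pairwise distinct, in
  particular nonzero. The first two conjuncts of \<open>bethe_regular\<close> say that the quotients in the Bethe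
  equations have nonzero denominators. The last one does the same for \<open>dual_factor\<close>.\<close>

definition generic_parameters :: "complex \<Rightarrow> complex list \<Rightarrow> complex list \<Rightarrow> bool" where
  "generic_parameters c us vs \<longleftrightarrow>
     distinct (us @ vs @ map uminus (us @ vs))
   \<and> (\<forall>x\<in>set us \<union> set vs. c + 2*x \<noteq> 0)"

definition bethe_regular ::
  "complex \<Rightarrow> complex \<Rightarrow> complex \<Rightarrow> (complex \<Rightarrow> complex) \<Rightarrow> (complex \<Rightarrow> complex)
   \<Rightarrow> complex list \<Rightarrow> bool" where
  "bethe_regular c xp xm l1 l2 vs \<longleftrightarrow>
     (\<forall>v\<in>set vs. v - xp + c/2 \<noteq> 0 \<and> v - xm + c/2 \<noteq> 0 \<and> l1 (- v) \<noteq> 0 \<and> l2 v \<noteq> 0)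
   \<and> (\<forall>v\<in>set vs. \<forall>w\<in>set vs. v \<noteq> w \<longrightarrow> f_rat c w v \<noteq> 0 \<and> f_rat c (- w) v \<noteq> 0)
   \<and> (\<forall>v\<in>set vs. \<forall>w\<in>set vs. v \<noteq> w \<longrightarrow> f_rat c v (- w) \<noteq> 0)"

text \<open>With the dual Bethe vector taken literally as \<open>\<langle>0|\<T>\<^sub>2\<^sub>1(v\<^sub>1)\<dots>\<T>\<^sub>2\<^sub>1(v\<^sub>n)\<close>, the scalar product is
  not invariant under \<open>T(u) \<mapsto> \<kappa>(u) T(u)\<close> at the points \<open>\<plusminus>v\<^sub>i\<close>, whereas the coefficient \<open>R_hat\<close> of the
  Bethe vector of \<open>vs\<close> and the Bethe equations are, if \<open>\<kappa>\<close> is even. The two agree in the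
  normalization of the dual Bethe vector that divides it by the following factor, which depends on
  \<open>vs\<close> only.\<close>

definition dual_factor ::
  "complex \<Rightarrow> complex \<Rightarrow> complex \<Rightarrow> (complex \<Rightarrow> complex) \<Rightarrow> (complex \<Rightarrow> complex)
   \<Rightarrow> complex list \<Rightarrow> complex" where
  "dual_factor c xp xm l1 l2 vs =
     (\<Prod>i<length vs. - ((vs!i + xm - c/2) * l1 (vs!i) * l2 (- (vs!i))) / (vs!i - xp + c/2))
   * (\<Prod>j<length vs. \<Prod>i\<le>j. f_rat c (- (vs!i)) (vs!j) / f_rat c (vs!i) (- (vs!j)))"

end

theory Submission
  imports Defs "HOL-Library.Function_Algebras" "HOL-Computational_Algebra.Fundamental_Theorem_Algebra"
begin

text \<open>Letting the transfer matrix act on either argument shows that both the scalar product \<open>S(v|U)\<close> with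
  on-shell \<open>v\<close> and the coefficient \<open>R(v|U,v)\<close>, as functions \<open>X(U)\<close>, satisfy
  \<open>(\<tau>(z|v) - \<tau>(z|U)) X(U) = \<Sum>\<^sub>u w(z,u,U) X(U \<union> {z} - {u})\<close> for every \<open>z\<close>. If \<open>z\<close> runs through
  the points \<open>v\<^sub>i + \<delta>\<close> with \<open>\<lambda>\<^sub>1(z)\<lambda>\<^sub>2(-z) = 1\<close> and \<open>\<lambda>\<^sub>1(-z)\<lambda>\<^sub>2(z) = 0\<close>, then for small \<open>\<delta>\<close> these
  relations determine \<open>X\<close> up to a factor, because \<open>\<tau>(z|v)\<close> has a pole at \<open>\<delta> = 0\<close>. Such \<open>z\<close> may be
  added since the scalar product depends on the model only through the values of \<open>\<lambda>\<^sub>1(u)\<lambda>\<^sub>2(-u)\<close>, and all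
  values are realized by spin chains. So \<open>S\<close> and \<open>R\<close> are proportional, and the factor is
  found from the leading terms at \<open>U = {v\<^sub>i + \<delta>}\<close> as \<open>\<delta> \<rightarrow> 0\<close>: there \<open>R\<close> factorizes, and \<open>S\<close>, which is linear in
  \<open>(\<lambda>\<^sub>1(v\<^sub>i)\<lambda>\<^sub>2(-v\<^sub>i), \<lambda>\<^sub>1(-v\<^sub>i)\<lambda>\<^sub>2(v\<^sub>i))\<close> for each \<open>i\<close>, reduces to domain wall partition functions.\<close>


text \<open>In a given model the Bethe vectors may be linearly dependent and the functions
  \<open>lambda1\<close>, \<open>lambda2\<close> need not be continuous, so coefficients cannot be
  compared through vectors and limits cannot be taken there. The symmetry of the coefficients under
  reordering of the transfer matrices is therefore proved by identities of rational functions.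
  Universality of the scalar product is obtained without a formula for it: in a direct product of
  models with a joint vacuum, removing all creation operators leaves a multiple of that vacuum.
  Limits are taken of \<open>sfun\<close>, where a new chain may be chosen for every shift; they
  exist because, for data 0 and 1, each reflection operator degenerates to one entry of
  \<open>T\<close>. Uniqueness is a matter of diagonal dominance: near the pole the eigenvalue at
  \<open>set vs\<close> outweighs all coefficients that exchange one shifted point for another,
  while replacing any other point brings the set closer to the shifted one. The off-diagonal entries
  carry a factor \<open>c - 2 * u\<close>; without it they are even, which leaves the signs of the
  parameters free. The case that this factor vanishes at some \<open>v\<close> is treated apart,
  both sides being zero.\<close>

lemma functional_eqI:
  fixes smul :: "complex \<Rightarrow> 'h::ab_group_add \<Rightarrow> 'h"
  assumes "vector_space smul" and *: "\<And>f. Vector_Spaces.linear smul (*) f \<Longrightarrow> f x = f y"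
  shows "x = y"
proof (rule ccontr)
  assume ne: "x \<noteq> y"
  interpret vector_space_pair smul "(*) :: complex \<Rightarrow> complex \<Rightarrow> complex"
    using assms(1) by (simp add: vector_space_pair_def vector_space_over_itself.vector_space_axioms)
  \<comment> \<open>A functional with value 1 at \<open>x - y\<close> separates the two vectors. The
    lemma turns identities of vectors into identities of complex numbers, in which terms can be
    collected and factors divided out.\<close>
  have "vs1.independent {x - y}"
    using ne by (simp add: vs1.independent_insert)
  from linear_independent_extend[OF this, of "\<lambda>_. 1"]
  obtain f where f: "Vector_Spaces.linear smul (*) f" "f (x - y) = 1" by auto
  interpret f: Vector_Spaces.linear smul "(*)" f by (rule f(1))
  from f *[OF f(1)] show False by (simp add: f.diff)
qed

lemma linear_rules:
  assumes "Vector_Spaces.linear s1 s2 f"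
  shows "f (x + y) = f x + f y" "f (s1 r x) = s2 r (f x)" "f 0 = 0" "f (x - y) = f x - f y"
    "f (- x) = - f x" "f (sum h S) = (\<Sum>i\<in>S. f (h i))"
proof -
  interpret Vector_Spaces.linear s1 s2 f by (rule assms)
  show "f (x + y) = f x + f y" "f (s1 r x) = s2 r (f x)" "f 0 = 0" "f (x - y) = f x - f y"
    "f (- x) = - f x" "f (sum h S) = (\<Sum>i\<in>S. f (h i))"
    by (rule add scale zero diff neg sum)+
qed

lemma linear_comp:
  assumes "Vector_Spaces.linear s1 s2 f" "Vector_Spaces.linear s2 s3 g"
  shows "Vector_Spaces.linear s1 s3 (\<lambda>x. g (f x))"
  using Vector_Spaces.linear_compose[OF assms] by (simp add: o_def)

lemma not_1_2: "(1::2) \<noteq> 2" "(2::2) \<noteq> 1"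
  by simp_all

text \<open>The permutation part of \<open>R_mat\<close> merely exchanges row indices on the left
  side and column indices on the right side, so each entry of the triple product has two summands.
  Arbitrary matrices are allowed since the result serves both to unfold the relation of a given
  model and to verify it for the chains.\<close>

lemma RTT_matrix_entries:
  fixes Tu Tv :: "('h::ab_group_add \<Rightarrow> 'h)^2^2"
  assumes vs: "vector_space smul"
    and lin: "\<And>i j. Vector_Spaces.linear smul smul (Tu $ i $ j)" "\<And>i j. Vector_Spaces.linear smul smul (Tv $ i $ j)"
  shows "(lift_mat smul (R_mat c u v) \<odot> tensor1 Tu \<odot> tensor2 Tv) $ (i, k) $ (j, l) =
      (\<lambda>y. (Tu $ i $ j) ((Tv $ k $ l) y) + smul (g_rat c u v) ((Tu $ k $ j) ((Tv $ i $ l) y)))"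
    and "(tensor2 Tv \<odot> tensor1 Tu \<odot> lift_mat smul (R_mat c u v)) $ (i, k) $ (j, l) =
      (\<lambda>y. (Tv $ k $ l) ((Tu $ i $ j) y) + smul (g_rat c u v) ((Tv $ k $ j) ((Tu $ i $ l) y)))"
proof -
  interpret vector_space smul by (rule vs)
  have "(mat (g_rat c u v) ** perm_mat) $ p $ q = g_rat c u v * perm_mat $ p $ q" for p q
    by (simp add: matrix_matrix_mult_def mat_def if_distrib[of "\<lambda>x. x * _"] cong: if_cong)
  then have "R_mat c u v $ (a, b) $ (a', b') =
      (if a = a' \<and> b = b' then 1 else 0) + (if a = b' \<and> b = a' then g_rat c u v else 0)"
    for a b a' b'
    by (simp add: R_mat_def perm_mat_def mat_def)
  then have R: "lift_mat smul (R_mat c u v) $ (a, b) $ (a', b') =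
      (\<lambda>y. smul (if a = a' \<and> b = b' then 1 else 0) y
        + smul (if a = b' \<and> b = a' then g_rat c u v else 0) y)" for a b a' b'
    by (simp add: lift_mat_def fun_eq_iff scale_left_distrib)
  have sum4: "(\<Sum>p\<in>UNIV. h p) = h (1,1) + h (1,2) + h (2,1) + h (2,2)" for h :: "2 \<times> 2 \<Rightarrow> 'h"
    unfolding UNIV_Times_UNIV[symmetric] sum.cartesian_product' by (simp add: sum_2 add.assoc)
  have tens: "tensor1 w $ (a, b) $ (a', b') = (if b = b' then w $ a $ a' else (\<lambda>_. 0))"
     "tensor2 w $ (a, b) $ (a', b') = (if a = a' then w $ b $ b' else (\<lambda>_. 0))" for a b a' b' and w :: "('h \<Rightarrow> 'h)^2^2"
    by (simp_all add: tensor1_def tensor2_def)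
  note tu = linear_rules(1-3)[OF lin(1)] and tv = linear_rules(1-3)[OF lin(2)]
  have L1: "(lift_mat smul (R_mat c u v) \<odot> tensor1 Tu) $ (i, k) $ (a, b) =
      (\<lambda>y. (if k = b then (Tu $ i $ a) y else 0) + smul (g_rat c u v) (if i = b then (Tu $ k $ a) y else 0))" for i k a b
    using exhaust_2[of i] exhaust_2[of k] exhaust_2[of b]
    unfolding op_mult_def vec_lambda_beta sum4 R tens
    by (elim disjE) (simp_all add: not_1_2)
  have R1: "(tensor2 Tv \<odot> tensor1 Tu) $ (i, k) $ (a, b) = (\<lambda>y. (Tv $ k $ b) ((Tu $ i $ a) y))" for i k a b
    using exhaust_2[of i] exhaust_2[of b]
    unfolding op_mult_def vec_lambda_beta sum4 tens
    by (elim disjE) (simp_all add: not_1_2 tv)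
  show "(lift_mat smul (R_mat c u v) \<odot> tensor1 Tu \<odot> tensor2 Tv) $ (i, k) $ (j, l) =
      (\<lambda>y. (Tu $ i $ j) ((Tv $ k $ l) y) + smul (g_rat c u v) ((Tu $ k $ j) ((Tv $ i $ l) y)))"
    unfolding op_mult_def[of "lift_mat smul (R_mat c u v) \<odot> tensor1 Tu"] vec_lambda_beta sum4 L1 tens
    using exhaust_2[of i] exhaust_2[of j] exhaust_2[of k]
    by (elim disjE) (simp_all add: not_1_2 tu add.commute)
  show "(tensor2 Tv \<odot> tensor1 Tu \<odot> lift_mat smul (R_mat c u v)) $ (i, k) $ (j, l) =
      (\<lambda>y. (Tv $ k $ l) ((Tu $ i $ j) y) + smul (g_rat c u v) ((Tv $ k $ j) ((Tu $ i $ l) y)))"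
    unfolding op_mult_def[of "tensor2 Tv \<odot> tensor1 Tu"] vec_lambda_beta sum4 R1 R
    using exhaust_2[of j] exhaust_2[of l]
    by (elim disjE) (simp_all add: not_1_2 tu tv add.commute)
qed

context generalized_model
begin

lemma vs: "vector_space smul" by unfold_locales

abbreviation t :: "complex \<Rightarrow> 2 \<Rightarrow> 2 \<Rightarrow> 'h \<Rightarrow> 'h" where
  "t u i j \<equiv> T u $ i $ j"

lemma t_rules:
  assumes "u \<in> D"
  shows "t u i j (x + y) = t u i j x + t u i j y" "t u i j (smul r x) = smul r (t u i j x)"
    "t u i j 0 = 0" "t u i j (x - y) = t u i j x - t u i j y"
    "t u i j (- x) = - t u i j x" "t u i j (sum h S) = (\<Sum>a\<in>S. t u i j (h a))"
  by (rule linear_rules[OF T_linear[OF assms]])+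

lemma dvac_rules:
  "dvac (x + y) = dvac x + dvac y" "dvac (smul r x) = r * dvac x"
    "dvac 0 = 0" "dvac (x - y) = dvac x - dvac y"
    "dvac (- x) = - dvac x" "dvac (sum h S) = (\<Sum>a\<in>S. dvac (h a))"
  by (rule linear_rules[OF dvac_linear])+

lemma RTT_entry:
  assumes uv: "u \<in> D" "v \<in> D" "u \<noteq> v"
  shows "t u i j (t v k l x) + smul (g_rat c u v) (t u k j (t v i l x))
       = t v k l (t u i j x) + smul (g_rat c u v) (t v k j (t u i l x))"
proof -
  have "((lift_mat smul (R_mat c u v) \<odot> tensor1 (T u) \<odot> tensor2 (T v)) $ (i, k) $ (j, l)) x
      = ((tensor2 (T v) \<odot> tensor1 (T u) \<odot> lift_mat smul (R_mat c u v)) $ (i, k) $ (j, l)) x"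
    using RTT[OF uv] by simp
  then show ?thesis
    unfolding RTT_matrix_entries[OF vs T_linear[OF uv(1)] T_linear[OF uv(2)]] .
qed

text \<open>Cleared of its denominator and evaluated under a functional, the relation is polynomial
  in \<open>u\<close>, \<open>v\<close>, \<open>c\<close>; later manipulations become ring
  identities.\<close>

lemma RTT_poly:
  assumes uv: "u \<in> D" "v \<in> D" "u \<noteq> v" and h: "Vector_Spaces.linear smul (*) h"
  shows "(u - v) * h (t u i j (t v k l x)) + c * h (t u k j (t v i l x))
       = (u - v) * h (t v k l (t u i j x)) + c * h (t v k j (t u i l x))"
proof -
  have "h (t u i j (t v k l x)) + g_rat c u v * h (t u k j (t v i l x))
       = h (t v k l (t u i j x)) + g_rat c u v * h (t v k j (t u i l x))"
    using arg_cong[OF RTT_entry[OF uv, of i j k l x], of h] by (simp add: linear_rules[OF h])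
  then show ?thesis using uv(3)
    by (simp add: g_rat_def field_simps)
qed

end


subsection \<open>The reflection monodromy matrix and its commutation relations\<close>


text \<open>Transposing a 2 by 2 matrix and conjugating it with sigma_2 exchanges the diagonal
  entries and negates the off-diagonal ones; \<open>oth\<close> gives the partner index.\<close>

definition oth :: "2 \<Rightarrow> 2" where "oth i = (if i = 1 then 2 else 1)"

lemma oth_simps [simp]: "oth 1 = 2" "oth 2 = 1"
  by (simp_all add: oth_def)

context generalized_model
begin

text \<open>The entries of \<open>\<sigma>\<^sub>2 T\<^sup>t(-u) \<sigma>\<^sub>2\<close>.\<close>

definition th :: "complex \<Rightarrow> 2 \<Rightarrow> 2 \<Rightarrow> 'h \<Rightarrow> 'h" where
  "th u i j x = (if i = j then t (- u) (oth i) (oth i) x else - t (- u) i j x)"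

lemma th_rules:
  assumes "u \<in> D"
  shows "th u i j (x + y) = th u i j x + th u i j y" "th u i j (smul r x) = smul r (th u i j x)"
    "th u i j 0 = 0" "th u i j (x - y) = th u i j x - th u i j y"
  by (simp_all add: th_def t_rules[OF D_uminus[OF assms]])

text \<open>The relation between \<open>T\<close> at \<open>- u\<close> and at \<open>v\<close>.
  Transposition in one factor and conjugation by sigma_2 turn the permutation \<open>P\<close> into
  \<open>1 - P\<close>, so \<open>- (u + v) + c P\<close> becomes, up to sign,
  \<open>(u + v - c) + c P\<close>; this is the origin of the shift by \<open>c\<close> in the sums
  of parameters.\<close>

lemma th_t_exchange:
  assumes uv: "u \<in> D" "v \<in> D" "u \<noteq> - v" and h: "Vector_Spaces.linear smul (*) h"
  shows "(u + v - c) * h (th u i j (t v k l x))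
          + c * (if k = j then (\<Sum>a\<in>UNIV. h (th u i a (t v a l x))) else 0)
       = (u + v - c) * h (t v k l (th u i j x))
          + c * (if i = l then (\<Sum>a\<in>UNIV. h (t v k a (th u a j x))) else 0)"
proof -
  have "- u \<noteq> v" using uv(3) by (metis minus_equation_iff)
  note R = RTT_poly[OF D_uminus[OF uv(1)] uv(2) this h, of "oth j" "oth i" k l x]
  note r = t_rules(5)[OF uv(2)] linear_rules(5)[OF h]
  show ?thesis
    using R exhaust_2[of i] exhaust_2[of j] exhaust_2[of k] exhaust_2[of l]
    by (elim disjE) (simp_all add: th_def sum_2 not_1_2 r algebra_simps)
qed

lemma th_th_exchange:
  assumes uv: "u \<in> D" "v \<in> D" "u \<noteq> v" and h: "Vector_Spaces.linear smul (*) h"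
  shows "(u - v) * h (th u i j (th v k l x)) + c * h (th u k j (th v i l x))
       = (u - v) * h (th v k l (th u i j x)) + c * h (th v k j (th u i l x))"
proof -
  have "- v \<noteq> - u" using uv(3) by simp
  note R = RTT_poly[OF D_uminus[OF uv(2)] D_uminus[OF uv(1)] this h, of "oth l" "oth k" "oth j" "oth i" x]
  note r = t_rules(5)[OF D_uminus[OF uv(1)]] t_rules(5)[OF D_uminus[OF uv(2)]] linear_rules(5)[OF h]
  show ?thesis
    using R exhaust_2[of i] exhaust_2[of j] exhaust_2[of k] exhaust_2[of l]
    by (elim disjE) (simp_all add: th_def not_1_2 r algebra_simps)
qed

text \<open>Operator matrices on the tensor square, acting on families \<open>F\<close> of four vectors.\<close>

definition on1 :: "(2 \<Rightarrow> 2 \<Rightarrow> 'h \<Rightarrow> 'h) \<Rightarrow> (2 \<Rightarrow> 2 \<Rightarrow> 'h) \<Rightarrow> 2 \<Rightarrow> 2 \<Rightarrow> 'h" where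
  "on1 M F i k = (\<Sum>j\<in>UNIV. M i j (F j k))"

definition on2 :: "(2 \<Rightarrow> 2 \<Rightarrow> 'h \<Rightarrow> 'h) \<Rightarrow> (2 \<Rightarrow> 2 \<Rightarrow> 'h) \<Rightarrow> 2 \<Rightarrow> 2 \<Rightarrow> 'h" where
  "on2 M F i k = (\<Sum>l\<in>UNIV. M k l (F i l))"

text \<open>The R-matrix at difference \<open>p\<close>, multiplied by \<open>p\<close> to remove
  its pole.\<close>

definition Rm :: "complex \<Rightarrow> (2 \<Rightarrow> 2 \<Rightarrow> 'h) \<Rightarrow> 2 \<Rightarrow> 2 \<Rightarrow> 'h" where
  "Rm p F i k = smul p (F i k) + smul c (F k i)"

definition kap :: "complex \<Rightarrow> complex \<Rightarrow> 2 \<Rightarrow> complex" where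
  "kap xm u i = (if i = 1 then xm + u - c/2 else xm - u + c/2)"

definition kd :: "complex \<Rightarrow> complex \<Rightarrow> 2 \<Rightarrow> 2 \<Rightarrow> 'h \<Rightarrow> 'h" where
  "kd xm u i j x = (if i = j then smul (kap xm u i) x else 0)"

lemma kd_on: "on1 (kd xm u) F i k = smul (kap xm u i) (F i k)"
  "on2 (kd xm u) F i k = smul (kap xm u k) (F i k)"
  using exhaust_2[of i] exhaust_2[of k]
  by (auto simp: on1_def on2_def kd_def sum_2 not_1_2)

lemma R_T_T:
  assumes uv: "u \<in> D" "v \<in> D" "u \<noteq> v"
  shows "Rm (u - v) (on1 (t u) (on2 (t v) F)) = on2 (t v) (on1 (t u) (Rm (u - v) F))"
proof (intro ext functional_eqI[OF vs])
  fix i k and f :: "'h \<Rightarrow> complex" assume f: "Vector_Spaces.linear smul (*) f"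
  note E = RTT_poly[OF uv f]
  show "f (Rm (u - v) (on1 (t u) (on2 (t v) F)) i k) = f (on2 (t v) (on1 (t u) (Rm (u - v) F)) i k)"
    using arg_cong2[where f="(+)", OF arg_cong2[where f="(+)", OF E[of i 1 k 1 "F 1 1"] E[of i 1 k 2 "F 1 2"]]
       arg_cong2[where f="(+)", OF E[of i 2 k 1 "F 2 1"] E[of i 2 k 2 "F 2 2"]]]
    by (simp add: Rm_def on1_def on2_def sum_2 linear_rules[OF f] t_rules[OF uv(1)] t_rules[OF uv(2)] algebra_simps)
qed

lemma R_H_H:
  assumes uv: "u \<in> D" "v \<in> D" "u \<noteq> v"
  shows "Rm (u - v) (on1 (th u) (on2 (th v) F)) = on2 (th v) (on1 (th u) (Rm (u - v) F))"
proof (intro ext functional_eqI[OF vs])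
  fix i k and f :: "'h \<Rightarrow> complex" assume f: "Vector_Spaces.linear smul (*) f"
  note E = th_th_exchange[OF uv f]
  show "f (Rm (u - v) (on1 (th u) (on2 (th v) F)) i k) = f (on2 (th v) (on1 (th u) (Rm (u - v) F)) i k)"
    using arg_cong2[where f="(+)", OF arg_cong2[where f="(+)", OF E[of i 1 k 1 "F 1 1"] E[of i 1 k 2 "F 1 2"]]
       arg_cong2[where f="(+)", OF E[of i 2 k 1 "F 2 1"] E[of i 2 k 2 "F 2 2"]]]
    by (simp add: Rm_def on1_def on2_def sum_2 linear_rules[OF f] th_rules[OF uv(1)] th_rules[OF uv(2)] algebra_simps)
qed

lemma H_R_T:
  assumes uv: "u \<in> D" "v \<in> D" "u \<noteq> - v"
  shows "on1 (th u) (Rm (u + v - c) (on2 (t v) F)) = on2 (t v) (Rm (u + v - c) (on1 (th u) F))"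
proof (intro ext functional_eqI[OF vs])
  fix i k and f :: "'h \<Rightarrow> complex" assume f: "Vector_Spaces.linear smul (*) f"
  note E = th_t_exchange[OF uv f]
  show "f (on1 (th u) (Rm (u + v - c) (on2 (t v) F)) i k) = f (on2 (t v) (Rm (u + v - c) (on1 (th u) F)) i k)"
    using arg_cong2[where f="(+)", OF arg_cong2[where f="(+)", OF E[of i 1 k 1 "F 1 1"] E[of i 1 k 2 "F 1 2"]]
       arg_cong2[where f="(+)", OF E[of i 2 k 1 "F 2 1"] E[of i 2 k 2 "F 2 2"]]]
      exhaust_2[of i] exhaust_2[of k]
    by (elim disjE) (simp_all add: Rm_def on1_def on2_def sum_2 not_1_2 linear_rules[OF f] th_rules[OF uv(1)] t_rules[OF uv(2)] algebra_simps)
qed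

lemma T_R_H:
  assumes uv: "u \<in> D" "v \<in> D" "u \<noteq> - v"
  shows "on1 (t u) (Rm (u + v - c) (on2 (th v) F)) = on2 (th v) (Rm (u + v - c) (on1 (t u) F))"
proof (intro ext functional_eqI[OF vs])
  fix i k and f :: "'h \<Rightarrow> complex" assume f: "Vector_Spaces.linear smul (*) f"
  have "v \<noteq> - u" using uv(3) by auto
  note E = th_t_exchange[OF uv(2,1) this f]
  show "f (on1 (t u) (Rm (u + v - c) (on2 (th v) F)) i k) = f (on2 (th v) (Rm (u + v - c) (on1 (t u) F)) i k)"
    using arg_cong2[where f="(+)", OF arg_cong2[where f="(+)", OF E[of k 1 i 1 "F 1 1"] E[of k 1 i 2 "F 2 1"]]
       arg_cong2[where f="(+)", OF E[of k 2 i 1 "F 1 2"] E[of k 2 i 2 "F 2 2"]]]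
      exhaust_2[of i] exhaust_2[of k]
    by (elim disjE) (simp_all add: Rm_def on1_def on2_def sum_2 not_1_2 linear_rules[OF f] th_rules[OF uv(2)] t_rules[OF uv(1)] algebra_simps)
qed

text \<open>In terms of \<open>u - c/2\<close> and \<open>v - c/2\<close> this is the usual
  reflection equation for a diagonal K-matrix: their difference is \<open>u - v\<close> and their
  sum is \<open>u + v - c\<close>. It explains the shifted argument of K in the monodromy
  matrix.\<close>

lemma R_K_R_K:
  "Rm (u - v) (on1 (kd xm u) (Rm (u + v - c) (on2 (kd xm v) F)))
   = on2 (kd xm v) (Rm (u + v - c) (on1 (kd xm u) (Rm (u - v) F)))"
proof (intro ext functional_eqI[OF vs])
  fix i k and f :: "'h \<Rightarrow> complex" assume f: "Vector_Spaces.linear smul (*) f"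
  show "f (Rm (u - v) (on1 (kd xm u) (Rm (u + v - c) (on2 (kd xm v) F))) i k)
     = f (on2 (kd xm v) (Rm (u + v - c) (on1 (kd xm u) (Rm (u - v) F))) i k)"
    using exhaust_2[of i] exhaust_2[of k]
    by (elim disjE) (simp_all add: Rm_def kd_on kap_def not_1_2 linear_rules[OF f] field_simps)
qed

lemma K_comm:
  assumes "u \<in> D"
  shows "on1 (kd xm v) (on2 (t u) F) = on2 (t u) (on1 (kd xm v) F)"
    "on1 (kd xm v) (on2 (th u) F) = on2 (th u) (on1 (kd xm v) F)"
    "on2 (kd xm v) (on1 (t u) F) = on1 (t u) (on2 (kd xm v) F)"
    "on2 (kd xm v) (on1 (th u) F) = on1 (th u) (on2 (kd xm v) F)"
proof -
  have kd_fun: "on1 (kd xm v) G = (\<lambda>i k. smul (kap xm v i) (G i k))"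
    "on2 (kd xm v) G = (\<lambda>i k. smul (kap xm v k) (G i k))" for G
    by (simp_all add: fun_eq_iff kd_on)
  show "on1 (kd xm v) (on2 (t u) F) = on2 (t u) (on1 (kd xm v) F)"
    "on1 (kd xm v) (on2 (th u) F) = on2 (th u) (on1 (kd xm v) F)"
    "on2 (kd xm v) (on1 (t u) F) = on1 (t u) (on2 (kd xm v) F)"
    "on2 (kd xm v) (on1 (th u) F) = on1 (th u) (on2 (kd xm v) F)"
    unfolding kd_fun
    by (simp_all add: fun_eq_iff on1_def on2_def scale_sum_right t_rules[OF assms] th_rules[OF assms])
qed

text \<open>Sklyanin's dressing argument: the exchange relations of \<open>t\<close> and
  \<open>th\<close> move the outer factors past each other until the two K-matrices meet between
  R-matrices and \<open>R_K_R_K\<close> applies.\<close>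

lemma reflection_equation:
  assumes uv: "u \<in> D" "v \<in> D" "u \<noteq> v" "u \<noteq> - v"
  shows "Rm (u - v) (on1 (t u) (on1 (kd xm u) (on1 (th u)
            (Rm (u + v - c) (on2 (t v) (on2 (kd xm v) (on2 (th v) F)))))))
    = on2 (t v) (on2 (kd xm v) (on2 (th v)
            (Rm (u + v - c) (on1 (t u) (on1 (kd xm u) (on1 (th u) (Rm (u - v) F)))))))"
    (is "?L = ?R")
proof -
  have "?L = on2 (t v) (on1 (t u) (Rm (u - v) (on1 (kd xm u) (Rm (u + v - c)
            (on1 (th u) (on2 (kd xm v) (on2 (th v) F)))))))"
    unfolding H_R_T[OF uv(1,2,4)] K_comm(1)[OF uv(2)] R_T_T[OF uv(1-3)] ..
  also have "\<dots> = on2 (t v) (on1 (t u) (on2 (kd xm v) (Rm (u + v - c)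
            (on2 (th v) (on1 (kd xm u) (on1 (th u) (Rm (u - v) F)))))))"
    unfolding K_comm(4)[OF uv(1), symmetric] R_K_R_K R_H_H[OF uv(1-3)] K_comm(2)[OF uv(2)] ..
  also have "\<dots> = ?R"
    unfolding K_comm(3)[OF uv(1), symmetric] T_R_H[OF uv(1,2,4)] ..
  finally show ?thesis .
qed

end


text \<open>Solves the reflection equation for a product \<open>A(u) B(v)\<close>. Here
  \<open>x1\<close>, \<open>x2\<close> stand for \<open>A(u) B(v)\<close> and
  \<open>A(v) B(u)\<close>, \<open>y1\<close>, \<open>y2\<close> for the reversed products, and
  \<open>z1\<close>, \<open>z2\<close> for those with the argument of \<open>A\<close> negated;
  \<open>W1\<close>, \<open>W2\<close> contain the lower diagonal entry, expressed by
  \<open>A\<close> at two opposite points. All variables are numbers, so the same elimination serves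
  for \<open>B\<close> and for \<open>C\<close>.\<close>

lemma exchange_solve:
  fixes u v c :: complex
  assumes nz: "u \<noteq> 0" "v \<noteq> 0" "u \<noteq> v" "u \<noteq> - v" "c - 2 * v \<noteq> 0"
    and W1: "2 * v * W1 = (c - 2 * u) * (c * y2 + (2 * v - c) * z2)"
    and W2: "2 * u * W2 = (c - 2 * v) * (c * y1 + (2 * u - c) * z1)"
    and E1: "(u - v + c) * (u + v) * ((c - 2 * v) * x1) + c * (u - v + c) * W1
      = (u - v) * (u + v - c) * ((c - 2 * v) * y1) + c * (u + v) * ((c - 2 * u) * x2) + c\<^sup>2 * W2"
    and E2: "(v - u + c) * (u + v) * ((c - 2 * u) * x2) + c * (v - u + c) * W2
      = (v - u) * (u + v - c) * ((c - 2 * u) * y2) + c * (u + v) * ((c - 2 * v) * x1) + c\<^sup>2 * W1"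
  shows "x1 = ((u - c)\<^sup>2 - v\<^sup>2) / (u\<^sup>2 - v\<^sup>2) * y1
    + (2 * u - c) * (c / (2 * v * (u - v)) * y2 - c / (2 * v * (u + v)) * z2)"
proof -
  have s: "u + v \<noteq> 0" "u - v \<noteq> 0"
    using nz by (auto simp: eq_neg_iff_add_eq_0)
  define p where "p = u - v"
  define q where "q = u + v - c"
  define s where "s = u + v"
  have p: "v - u = - p" "u - v = p" by (auto simp: p_def)
  have E1': "(p + c) * s * ((c - 2 * v) * x1) + c * (p + c) * W1
      = p * q * ((c - 2 * v) * y1) + c * s * ((c - 2 * u) * x2) + c\<^sup>2 * W2"
    using E1 by (simp add: p_def q_def s_def)
  have E2': "(c - p) * s * ((c - 2 * u) * x2) + c * (c - p) * W2
      = - p * q * ((c - 2 * u) * y2) + c * s * ((c - 2 * v) * x1) + c\<^sup>2 * W1"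
    using E2 by (simp add: p_def q_def s_def algebra_simps)
  have "p\<^sup>2 * s * ((c - 2 * v) * x1) = - (p\<^sup>2 * c * W1) - (c - p) * p * q * ((c - 2 * v) * y1)
      + c * p * q * ((c - 2 * u) * y2)"
  proof -
    \<comment> \<open>With the weights \<open>c - p\<close> and \<open>c\<close> both
      \<open>x2\<close> and \<open>W2\<close> cancel, and what remains is divisible by
      \<open>p\<close>.\<close>
    have "(c - p) * ((p + c) * s * ((c - 2 * v) * x1) + c * (p + c) * W1)
      + c * ((c - p) * s * ((c - 2 * u) * x2) + c * (c - p) * W2)
      = (c - p) * (p * q * ((c - 2 * v) * y1) + c * s * ((c - 2 * u) * x2) + c\<^sup>2 * W2)
      + c * (- p * q * ((c - 2 * u) * y2) + c * s * ((c - 2 * v) * x1) + c\<^sup>2 * W1)"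
      using E1' E2' by simp
    then show ?thesis by (simp add: algebra_simps power2_eq_square)
  qed
  then have "p * (p * s * ((c - 2 * v) * x1)) = p * (- (p * c * W1) - (c - p) * q * ((c - 2 * v) * y1)
      + c * q * ((c - 2 * u) * y2))"
    by (simp add: algebra_simps power2_eq_square)
  then have "p * s * ((c - 2 * v) * x1) = - (p * c * W1) - (c - p) * q * ((c - 2 * v) * y1)
      + c * q * ((c - 2 * u) * y2)"
    using s(2) by (simp add: p_def)
  then have "2 * v * (p * s * ((c - 2 * v) * x1)) = 2 * v * (- (p * c * W1)
      - (c - p) * q * ((c - 2 * v) * y1) + c * q * ((c - 2 * u) * y2))"
    by simp
  also have "\<dots> = - (p * c * (2 * v * W1)) + 2 * v * (- (c - p) * q * ((c - 2 * v) * y1)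
      + c * q * ((c - 2 * u) * y2))"
    by (simp add: algebra_simps)
  also have "\<dots> = (c - 2 * v) * (2 * v * (p - c) * q * y1 + c * (2 * u - c) * (s * y2 - p * z2))"
    unfolding W1 by (simp add: p_def q_def s_def algebra_simps power2_eq_square)
  finally have "(c - 2 * v) * (2 * v * p * s * x1)
      = (c - 2 * v) * (2 * v * (p - c) * q * y1 + c * (2 * u - c) * (s * y2 - p * z2))"
    by (simp add: algebra_simps)
  then have *: "2 * v * p * s * x1 = 2 * v * (p - c) * q * y1 + c * (2 * u - c) * (s * y2 - p * z2)"
    using nz(5) by simp
  have ps: "u\<^sup>2 - v\<^sup>2 = p * s" "(u - c)\<^sup>2 - v\<^sup>2 = (p - c) * q"
    by (simp_all add: p_def q_def s_def algebra_simps power2_eq_square)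
  have nz': "p \<noteq> 0" "s \<noteq> 0" using s by (simp_all add: p_def s_def)
  have "x1 = (2 * v * p * s * x1) / (2 * v * p * s)"
    using nz nz' by simp
  also have "\<dots> = (p - c) * q / (p * s) * y1
    + (2 * u - c) * (c / (2 * v * p) * y2 - c / (2 * v * s) * z2)"
    unfolding * using nz(2) nz' by (simp add: field_simps)
  finally show ?thesis unfolding ps by (simp add: p_def s_def)
qed

text \<open>The factors \<open>u + v - c\<close>, \<open>c - 2 * u\<close> and
  \<open>c - 2 * v\<close> have to be divided out of the reflection equation. The operators
  concerned are even, so signs may be chosen for which none of these factors is zero.\<close>

lemma sign_choice:
  fixes u v c :: complex
  assumes "c \<noteq> 0" "u \<noteq> 0" "v \<noteq> 0" "u \<noteq> v" "u \<noteq> - v"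
  obtains u' v' where "u' \<in> {u, - u}" "v' \<in> {v, - v}" "u' + v' \<noteq> c" "c - 2 * u' \<noteq> 0" "c - 2 * v' \<noteq> 0"
proof -
  have aux: thesis' if "c \<noteq> 0" "w \<in> {x, - x}" "w = - (c / 2)" "y \<noteq> x" "y \<noteq> - x"
    and R: "\<And>x' y'. \<lbrakk>x' \<in> {x, - x}; y' \<in> {y, - y}; x' + y' \<noteq> c; c - 2 * x' \<noteq> 0; c - 2 * y' \<noteq> 0\<rbrakk> \<Longrightarrow> thesis'"
    for w x y and thesis' :: bool
  proof -
    have y: "y' \<in> {y, - y} \<Longrightarrow> c - 2 * y' \<noteq> 0" for y'
      using that(2-5) by (auto simp: field_simps)
    have w: "c - 2 * w \<noteq> 0" using that by simp
    show thesis'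
    proof (cases "w + y = c")
      case False
      then show ?thesis using R[of w y] that(2) y w by simp
    next
      case True
      have "y = c + c/2" using True that(3) by (simp add: algebra_simps)
      then have "w + - y - c = - 3 * c" unfolding that(3) \<open>y = c + c/2\<close> by (simp add: field_simps)
      then have "w + - y \<noteq> c" using that(1) by auto
      then show ?thesis using R[of w "- y"] that(2) y[of "- y"] w by simp
    qed
  qed
  consider "u = - (c/2)" | "- u = - (c/2)" | "v = - (c/2)" | "- v = - (c/2)"
    | "c - 2 * u \<noteq> 0" "c - 2 * (- u) \<noteq> 0" "c - 2 * v \<noteq> 0" "c - 2 * (- v) \<noteq> 0"
    by (force simp: field_simps eq_neg_iff_add_eq_0)
  then show thesis
  proof cases
    case 1
    show ?thesis
    proof (rule aux[of "u" u v])
      fix x' y' assume "x' \<in> {u, - u}" "y' \<in> {v, - v}" "x' + y' \<noteq> c" "c - 2 * x' \<noteq> 0" "c - 2 * y' \<noteq> 0"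
      then show thesis by (intro that[of x' y'])
    qed (use 1 assms in auto)
  next
    case 2
    show ?thesis
    proof (rule aux[of "- u" u v])
      fix x' y' assume "x' \<in> {u, - u}" "y' \<in> {v, - v}" "x' + y' \<noteq> c" "c - 2 * x' \<noteq> 0" "c - 2 * y' \<noteq> 0"
      then show thesis by (intro that[of x' y'])
    qed (use 2 assms in auto)
  next
    case 3
    show ?thesis
    proof (rule aux[of "v" v u])
      fix x' y' assume "x' \<in> {v, - v}" "y' \<in> {u, - u}" "x' + y' \<noteq> c" "c - 2 * x' \<noteq> 0" "c - 2 * y' \<noteq> 0"
      then show thesis using that[of y' x'] by (simp add: add.commute)
    qed (use 3 assms in auto)
  next
    case 4
    show ?thesis
    proof (rule aux[of "- v" v u])
      fix x' y' assume "x' \<in> {v, - v}" "y' \<in> {u, - u}" "x' + y' \<noteq> c" "c - 2 * x' \<noteq> 0" "c - 2 * y' \<noteq> 0"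
      then show thesis using that[of y' x'] by (simp add: add.commute)
    qed (use 4 assms in auto)
  next
    case 5
    then show ?thesis
      using that[of u v] that[of "- u" v] assms by (cases "u + v = c") (auto simp: field_simps)
  qed
qed

section \<open>Entries of the reflection monodromy matrix\<close>

context generalized_model
begin

definition mon :: "complex \<Rightarrow> complex \<Rightarrow> 2 \<Rightarrow> 2 \<Rightarrow> 'h \<Rightarrow> 'h" where
  "mon xm u i j x = (\<Sum>a\<in>UNIV. t u i a (smul (kap xm u a) (th u a j x)))"

lemma refl_monodromy_entry:
  assumes u: "u \<in> D"
  shows "(refl_monodromy smul c xm T u $ i $ j) x = mon xm u i j x"
proof -
  have s: "sigma2 $ 1 $ 1 = 0" "sigma2 $ 1 $ 2 = - \<i>" "sigma2 $ 2 $ 1 = \<i>" "sigma2 $ 2 $ 2 = 0"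
    by (simp_all add: sigma2_def)
  have k: "K_mat u xm $ 1 $ 1 = xm + u" "K_mat u xm $ 1 $ 2 = 0" "K_mat u xm $ 2 $ 1 = 0" "K_mat u xm $ 2 $ 2 = xm - u" for u
    by (simp_all add: K_mat_def)
  note r = t_rules[OF u] t_rules[OF D_uminus[OF u]]
  show ?thesis
    using exhaust_2[of i] exhaust_2[of j]
    by (elim disjE)
      (simp_all add: mon_def refl_monodromy_def op_mult_def lift_mat_def sum_2 s k transpose_def r
        th_def kap_def not_1_2 algebra_simps)
qed

lemma mon_rules:
  assumes u: "u \<in> D"
  shows "mon xm u i j (x + y) = mon xm u i j x + mon xm u i j y"
    "mon xm u i j (smul r x) = smul r (mon xm u i j x)"
    "mon xm u i j 0 = 0" "mon xm u i j (x - y) = mon xm u i j x - mon xm u i j y"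
  by (simp_all add: mon_def sum_2 t_rules[OF u] th_rules[OF u] scale_right_distrib
      scale_right_diff_distrib mult.commute)

lemma on_mon:
  assumes "u \<in> D"
  shows "on1 (t u) (on1 (kd xm u) (on1 (th u) F)) = on1 (mon xm u) F"
    "on2 (t u) (on2 (kd xm u) (on2 (th u) F)) = on2 (mon xm u) F"
proof -
  have kd_fun: "on1 (kd xm u) G = (\<lambda>i k. smul (kap xm u i) (G i k))"
    "on2 (kd xm u) G = (\<lambda>i k. smul (kap xm u k) (G i k))" for G
    by (simp_all add: fun_eq_iff kd_on)
  show "on1 (t u) (on1 (kd xm u) (on1 (th u) F)) = on1 (mon xm u) F"
    "on2 (t u) (on2 (kd xm u) (on2 (th u) F)) = on2 (mon xm u) F"
    unfolding kd_fun
    by (simp_all add: fun_eq_iff on1_def on2_def mon_def sum_2 t_rules[OF assms] scale_right_distrib)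
qed

lemma mon_exchange:
  assumes uv: "u \<in> D" "v \<in> D" "u \<noteq> v" "u \<noteq> - v" and h: "Vector_Spaces.linear smul (*) h"
    and M_def: "M = mon xm"
  shows "(u - v) * (u + v - c) * h (M u i j (M v k l x)) + c * (u + v - c) * h (M u k j (M v i l x))
      + (u - v) * c * (if k = j then (\<Sum>a\<in>UNIV. h (M u i a (M v a l x))) else 0)
      + c * c * (if i = j then (\<Sum>a\<in>UNIV. h (M u k a (M v a l x))) else 0)
    = (u - v) * (u + v - c) * h (M v k l (M u i j x)) + c * (u + v - c) * h (M v k j (M u i l x))
      + (u - v) * c * (if i = l then (\<Sum>a\<in>UNIV. h (M v k a (M u a j x))) else 0)
      + c * c * (if i = j then (\<Sum>a\<in>UNIV. h (M v k a (M u a l x))) else 0)"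
proof -
  \<comment> \<open>A family supported at the single position \<open>(j, l)\<close> picks out one
    column of the operator matrices.\<close>
  define F where "F = (\<lambda>a b :: 2. if a = j \<and> b = l then x else 0)"
  define p where "p = u - v"
  define q where "q = u + v - c"
  have E: "h (Rm p (on1 (M u) (Rm q (on2 (M v) F))) i k) = h (on2 (M v) (Rm q (on1 (M u) (Rm p F))) i k)"
    using reflection_equation[OF uv, of xm F] unfolding on_mon[OF uv(1)] on_mon[OF uv(2)] M_def p_def q_def
    by simp
  have r: "M w i j (x + y) = M w i j x + M w i j y" "M w i j (smul r x) = smul r (M w i j x)" "M w i j 0 = 0"
    if "w = u \<or> w = v" for w i j x y r
    using that mon_rules uv(1,2) by (auto simp: M_def)
  show ?thesis unfolding p_def[symmetric] q_def[symmetric]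
    using E exhaust_2[of i] exhaust_2[of j] exhaust_2[of k] exhaust_2[of l]
    by (elim disjE)
      (simp_all add: Rm_def on1_def on2_def sum_2 not_1_2 F_def r linear_rules[OF h] algebra_simps)
qed

end


section \<open>Even off-diagonal operators and elimination of the lower diagonal entry\<close>

context generalized_model
begin

text \<open>\<open>bop\<close> and \<open>cop\<close> are the off-diagonal entries of the reflection monodromy matrix without their
  common factor \<open>c - 2u\<close>; unlike the entries themselves they are even in \<open>u\<close>.\<close>

definition bop :: "complex \<Rightarrow> complex \<Rightarrow> 'h \<Rightarrow> 'h" where
  "bop xm u x = smul (1 / (2 * u)) (smul (xm + u + c/2) (t u 1 1 (t (- u) 1 2 x))
      - smul (xm - u + c/2) (t (- u) 1 1 (t u 1 2 x)))"

definition cop :: "complex \<Rightarrow> complex \<Rightarrow> 'h \<Rightarrow> 'h" where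
  "cop xm u x = smul (- 1 / (2 * u)) (smul (xm + u - c/2) (t (- u) 2 2 (t u 2 1 x))
      - smul (xm - u - c/2) (t u 2 2 (t (- u) 2 1 x)))"

abbreviation aop :: "complex \<Rightarrow> complex \<Rightarrow> 'h \<Rightarrow> 'h" where
  "aop xm u \<equiv> mon xm u 1 1"

lemma bop_even: "bop xm (- u) x = bop xm u x"
  by (simp add: bop_def scale_right_diff_distrib)

lemma cop_even: "cop xm (- u) x = cop xm u x"
  by (simp add: cop_def scale_right_diff_distrib)

text \<open>The exchange relation between \<open>- u\<close> and \<open>u\<close> rewrites the
  product \<open>t u 1 2 (t (- u) 1 1 x)\<close> in the entry so that a factor
  \<open>c - 2 * u\<close> splits off. The quotient \<open>bop\<close> is even because negating
  \<open>u\<close> exchanges its two terms.\<close>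

lemma mon12:
  assumes u: "u \<in> D" "u \<noteq> 0"
  shows "mon xm u 1 2 x = smul (c - 2 * u) (bop xm u x)"
proof (rule functional_eqI[OF vs])
  fix h :: "'h \<Rightarrow> complex" assume h: "Vector_Spaces.linear smul (*) h"
  have "- u \<noteq> u" using u(2) by simp
  note R = RTT_poly[OF D_uminus[OF u(1)] u(1) this h, of 1 1 1 2 x]
  define X where "X = h (t u 1 1 (t (- u) 1 2 x))"
  define Y where "Y = h (t (- u) 1 1 (t u 1 2 x))"
  define Z where "Z = h (t u 1 2 (t (- u) 1 1 x))"
  have Z: "2 * u * Z = (2 * u - c) * Y + c * X"
    using R by (simp add: X_def Y_def Z_def algebra_simps)
  have "2 * u * h (mon xm u 1 2 x) = - 2 * u * (xm + u - c/2) * X + (xm - u + c/2) * (2 * u * Z)"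
    by (simp add: mon_def sum_2 t_rules[OF u(1)] th_def kap_def not_1_2 linear_rules[OF h]
        X_def Z_def algebra_simps)
  also have "\<dots> = (c - 2 * u) * ((xm + u + c/2) * X - (xm - u + c/2) * Y)"
    unfolding Z by (simp add: field_simps)
  also have "\<dots> = 2 * u * h (smul (c - 2 * u) (bop xm u x))"
    using u(2) by (simp add: bop_def linear_rules[OF h] X_def Y_def)
  finally show "h (mon xm u 1 2 x) = h (smul (c - 2 * u) (bop xm u x))"
    using u(2) by simp
qed

lemma mon21:
  assumes u: "u \<in> D" "u \<noteq> 0"
  shows "mon xm u 2 1 x = smul (c - 2 * u) (cop xm u x)"
proof (rule functional_eqI[OF vs])
  fix h :: "'h \<Rightarrow> complex" assume h: "Vector_Spaces.linear smul (*) h"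
  have "- u \<noteq> u" using u(2) by simp
  note R = RTT_poly[OF D_uminus[OF u(1)] u(1) this h, of 2 2 2 1 x]
  define X where "X = h (t u 2 2 (t (- u) 2 1 x))"
  define Y where "Y = h (t (- u) 2 2 (t u 2 1 x))"
  define Z where "Z = h (t u 2 1 (t (- u) 2 2 x))"
  have Z: "2 * u * Z = (2 * u - c) * Y + c * X"
    using R by (simp add: X_def Y_def Z_def algebra_simps)
  have "2 * u * h (mon xm u 2 1 x) = (xm + u - c/2) * (2 * u * Z) - 2 * u * (xm - u + c/2) * X"
    by (simp add: mon_def sum_2 t_rules[OF u(1)] th_def kap_def not_1_2 linear_rules[OF h]
        X_def Z_def algebra_simps)
  also have "\<dots> = (c - 2 * u) * - ((xm + u - c/2) * Y - (xm - u - c/2) * X)"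
    unfolding Z by (simp add: field_simps)
  also have "- ((xm + u - c/2) * Y - (xm - u - c/2) * X) = 2 * u * h (cop xm u x)"
    using u(2) by (simp add: cop_def linear_rules[OF h] X_def Y_def)
  also have "(c - 2 * u) * (2 * u * h (cop xm u x)) = 2 * u * h (smul (c - 2 * u) (cop xm u x))"
    by (simp add: linear_rules[OF h])
  finally show "h (mon xm u 2 1 x) = h (smul (c - 2 * u) (cop xm u x))"
    using u(2) by simp
qed

text \<open>Relations of the model between \<open>u\<close> and \<open>- u\<close> express the lower
  diagonal entry by the upper one at both points (crossing symmetry). The exchange relations can
  then be written in \<open>A\<close>, \<open>B\<close>, \<open>C\<close> alone, and the transfer
  matrix becomes a combination of \<open>A(u)\<close> and \<open>A(- u)\<close>.\<close>

lemma mon22: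
  assumes u: "u \<in> D" "u \<noteq> 0"
  shows "mon xm u 2 2 x = smul (c / (2 * u)) (aop xm u x) + smul ((2 * u - c) / (2 * u)) (aop xm (- u) x)"
proof (rule functional_eqI[OF vs])
  fix h :: "'h \<Rightarrow> complex" assume h: "Vector_Spaces.linear smul (*) h"
  have ne: "- u \<noteq> u" "u \<noteq> - u" using u(2) by auto
  note u' = D_uminus[OF u(1)]
  define ad where "ad = h (t u 1 1 (t (- u) 2 2 x))"
  define ad' where "ad' = h (t (- u) 1 1 (t u 2 2 x))"
  define bc where "bc = h (t u 1 2 (t (- u) 2 1 x))"
  define bc' where "bc' = h (t (- u) 1 2 (t u 2 1 x))"
  define cb where "cb = h (t u 2 1 (t (- u) 1 2 x))"
  define cb' where "cb' = h (t (- u) 2 1 (t u 1 2 x))"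
  define da where "da = h (t u 2 2 (t (- u) 1 1 x))"
  have cb: "2 * u * cb = 2 * u * bc' + c * (ad' - ad)"
    using RTT_poly[OF u(1) u' ne(2) h, of 2 1 1 2 x]
    by (simp add: cb_def bc'_def ad_def ad'_def algebra_simps)
  have cb': "2 * u * cb' = 2 * u * bc - c * (ad - ad')"
    using RTT_poly[OF u' u(1) ne(1) h, of 2 1 1 2 x]
    by (simp add: cb'_def bc_def ad_def ad'_def algebra_simps)
  have da: "2 * u * da = 2 * u * ad' + c * (cb - cb')"
    using RTT_poly[OF u' u(1) ne(1) h, of 1 1 2 2 x]
    by (simp add: cb'_def cb_def da_def ad'_def algebra_simps)
  \<comment> \<open>The diagonal products enter \<open>cb\<close> and \<open>cb'\<close> in the same
    way and drop out of the difference.\<close>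
  have cbd: "cb - cb' = bc' - bc"
  proof -
    have "2 * u * (cb - cb') = 2 * u * (bc' - bc)"
      unfolding right_diff_distrib[of "2 * u"] cb cb' by (simp add: algebra_simps)
    then show ?thesis using u(2) by simp
  qed
  have "2 * u * h (mon xm u 2 2 x) = - (xm + u - c/2) * (2 * u * cb) + (xm - u + c/2) * (2 * u * da)"
    by (simp add: mon_def sum_2 t_rules[OF u(1)] th_def kap_def not_1_2 linear_rules[OF h]
        cb_def da_def algebra_simps)
  also have "\<dots> = c * ((xm + u - c/2) * ad - (xm - u + c/2) * bc)
     + (2 * u - c) * ((xm - u - c/2) * ad' - (xm + u + c/2) * bc')"
    unfolding cb da cbd by (simp add: field_simps)
  also have "\<dots> = c * h (aop xm u x) + (2 * u - c) * h (aop xm (- u) x)"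
    by (simp add: mon_def sum_2 t_rules[OF u(1)] t_rules[OF u'] th_def kap_def not_1_2 linear_rules[OF h]
        ad_def ad'_def bc_def bc'_def)
  also have "\<dots> = 2 * u * h (smul (c / (2 * u)) (aop xm u x) + smul ((2 * u - c) / (2 * u)) (aop xm (- u) x))"
    using u(2) by (simp add: linear_rules[OF h] field_simps)
  finally show "h (mon xm u 2 2 x)
      = h (smul (c / (2 * u)) (aop xm u x) + smul ((2 * u - c) / (2 * u)) (aop xm (- u) x))"
    using u(2) by simp
qed

lemma bop_rules:
  assumes u: "u \<in> D"
  shows "bop xm u (x + y) = bop xm u x + bop xm u y"
    "bop xm u (smul r x) = smul r (bop xm u x)"
  by (simp_all add: bop_def t_rules[OF u] t_rules[OF D_uminus[OF u]] algebra_simps)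

lemma cop_rules:
  assumes u: "u \<in> D"
  shows "cop xm u (x + y) = cop xm u x + cop xm u y"
    "cop xm u (smul r x) = smul r (cop xm u x)"
  by (simp_all add: cop_def t_rules[OF u] t_rules[OF D_uminus[OF u]] algebra_simps)

end


text \<open>The product of f(x,u) and f(-x,u), see \<open>f_rat_pair\<close>, in a form that is
  visibly even in \<open>x\<close>.\<close>

definition Fr :: "complex \<Rightarrow> complex \<Rightarrow> complex \<Rightarrow> complex" where
  "Fr c x u = ((u - c)\<^sup>2 - x\<^sup>2) / (u\<^sup>2 - x\<^sup>2)"

text \<open>Up to the factor \<open>2 * z - c\<close>, the coefficient of the term in which
  \<open>z\<close> and \<open>u\<close> have changed places; the \<open>2 * u\<close> in the
  denominator stems from \<open>mon22\<close>.\<close>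

definition Yr :: "complex \<Rightarrow> complex \<Rightarrow> complex \<Rightarrow> complex" where
  "Yr c z u = c / (2 * u * (z - u))"

lemma Yr_minus: "Yr c z (- u) = - (c / (2 * u * (z + u)))"
  by (simp add: Yr_def)

section \<open>Exchange relations of the operators A, B and C\<close>

context generalized_model
begin

text \<open>The reflection equation for \<open>(u, v)\<close> and for \<open>(v, u)\<close> gives
  the commutator multiplied by \<open>u - v + c\<close> and by \<open>v - u + c\<close>; these add
  up to \<open>2 * c\<close>, so one of them is nonzero. The other factors are kept away from zero
  by \<open>sign_choice\<close>.\<close>

lemma bop_commute:
  assumes uv: "u \<in> D" "v \<in> D" "u \<noteq> 0" "v \<noteq> 0"
  shows "bop xm u (bop xm v x) = bop xm v (bop xm u x)"
proof -
  have aux: "bop xm u (bop xm v x) = bop xm v (bop xm u x)"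
    if uv: "u \<in> D" "v \<in> D" "u \<noteq> 0" "v \<noteq> 0" "u \<noteq> v" "u \<noteq> - v" "u + v \<noteq> c" "c - 2 * u \<noteq> 0" "c - 2 * v \<noteq> 0" for u v
  proof (rule functional_eqI[OF vs])
    fix h :: "'h \<Rightarrow> complex" assume h: "Vector_Spaces.linear smul (*) h"
    have ne: "v \<noteq> u" "v \<noteq> - u" using uv by auto
    define X where "X = h (bop xm u (bop xm v x))"
    define Y where "Y = h (bop xm v (bop xm u x))"
    define k where "k = (c - 2 * u) * (c - 2 * v)"
    have XY: "h (mon xm u 1 2 (mon xm v 1 2 x)) = k * X" "h (mon xm v 1 2 (mon xm u 1 2 x)) = k * Y"
      using uv by (simp_all add: mon12 bop_rules linear_rules[OF h] X_def Y_def k_def)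
    have "(u - v + c) * ((u + v - c) * k * (X - Y)) = 0"
      using mon_exchange[OF uv(1,2,5,6) h refl, of xm 1 2 1 2 x] unfolding XY
      by (simp add: not_1_2 algebra_simps)
    moreover have "(v - u + c) * ((u + v - c) * k * (X - Y)) = 0"
      using mon_exchange[OF uv(2,1) ne h refl, of xm 1 2 1 2 x] unfolding XY
      by (simp add: not_1_2 algebra_simps)
    moreover have "\<not> (u - v + c = 0 \<and> v - u + c = 0)"
    proof
      assume "u - v + c = 0 \<and> v - u + c = 0"
      then have "(u - v + c) + (v - u + c) = 0" by (elim conjE) (simp only: add_0_left)
      then show False using c_nonzero by simp
    qed
    ultimately have "(u + v - c) * k * (X - Y) = 0" unfolding mult_eq_0_iff by blast
    then have "X = Y" using uv(7-9) by (simp add: k_def)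
    then show "h (bop xm u (bop xm v x)) = h (bop xm v (bop xm u x))" by (simp add: X_def Y_def)
  qed
  show ?thesis
  proof (cases "u = v \<or> u = - v")
    case True
    then show ?thesis by (metis bop_even ext)
  next
    case False
    then obtain u' v' where *: "u' \<in> {u, - u}" "v' \<in> {v, - v}" "u' + v' \<noteq> c" "c - 2 * u' \<noteq> 0" "c - 2 * v' \<noteq> 0"
      using sign_choice[OF c_nonzero uv(3,4)] by metis
    have "bop xm u' (bop xm v' x) = bop xm v' (bop xm u' x)"
      using * uv False by (intro aux) (auto simp: D_uminus)
    moreover have "bop xm u' = bop xm u" "bop xm v' = bop xm v" using * by (auto simp: bop_even fun_eq_iff)
    ultimately show ?thesis by simp
  qed
qed

lemma cop_commute:
  assumes uv: "u \<in> D" "v \<in> D" "u \<noteq> 0" "v \<noteq> 0"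
  shows "cop xm u (cop xm v x) = cop xm v (cop xm u x)"
proof -
  have aux: "cop xm u (cop xm v x) = cop xm v (cop xm u x)"
    if uv: "u \<in> D" "v \<in> D" "u \<noteq> 0" "v \<noteq> 0" "u \<noteq> v" "u \<noteq> - v" "u + v \<noteq> c" "c - 2 * u \<noteq> 0" "c - 2 * v \<noteq> 0" for u v
  proof (rule functional_eqI[OF vs])
    fix h :: "'h \<Rightarrow> complex" assume h: "Vector_Spaces.linear smul (*) h"
    have ne: "v \<noteq> u" "v \<noteq> - u" using uv by auto
    define X where "X = h (cop xm u (cop xm v x))"
    define Y where "Y = h (cop xm v (cop xm u x))"
    define k where "k = (c - 2 * u) * (c - 2 * v)"
    have XY: "h (mon xm u 2 1 (mon xm v 2 1 x)) = k * X" "h (mon xm v 2 1 (mon xm u 2 1 x)) = k * Y"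
      using uv by (simp_all add: mon21 cop_rules linear_rules[OF h] X_def Y_def k_def)
    have "(u - v + c) * ((u + v - c) * k * (X - Y)) = 0"
      using mon_exchange[OF uv(1,2,5,6) h refl, of xm 2 1 2 1 x] unfolding XY
      by (simp add: not_1_2 algebra_simps)
    moreover have "(v - u + c) * ((u + v - c) * k * (X - Y)) = 0"
      using mon_exchange[OF uv(2,1) ne h refl, of xm 2 1 2 1 x] unfolding XY
      by (simp add: not_1_2 algebra_simps)
    moreover have "\<not> (u - v + c = 0 \<and> v - u + c = 0)"
    proof
      assume "u - v + c = 0 \<and> v - u + c = 0"
      then have "(u - v + c) + (v - u + c) = 0" by (elim conjE) (simp only: add_0_left)
      then show False using c_nonzero by simp
    qed
    ultimately have "(u + v - c) * k * (X - Y) = 0" unfolding mult_eq_0_iff by blast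
    then have "X = Y" using uv(7-9) by (simp add: k_def)
    then show "h (cop xm u (cop xm v x)) = h (cop xm v (cop xm u x))" by (simp add: X_def Y_def)
  qed
  show ?thesis
  proof (cases "u = v \<or> u = - v")
    case True
    then show ?thesis by (metis cop_even ext)
  next
    case False
    then obtain u' v' where *: "u' \<in> {u, - u}" "v' \<in> {v, - v}" "u' + v' \<noteq> c" "c - 2 * u' \<noteq> 0" "c - 2 * v' \<noteq> 0"
      using sign_choice[OF c_nonzero uv(3,4)] by metis
    have "cop xm u' (cop xm v' x) = cop xm v' (cop xm u' x)"
      using * uv False by (intro aux) (auto simp: D_uminus)
    moreover have "cop xm u' = cop xm u" "cop xm v' = cop xm v" using * by (auto simp: cop_even fun_eq_iff)
    ultimately show ?thesis by simp
  qed
qed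

text \<open>An instance of \<open>exchange_solve\<close>. If \<open>c = 2 * u\<close>, the matrix
  entry at \<open>u\<close> is zero and says nothing about \<open>bop\<close>; the relation is then
  taken at \<open>- u\<close>, where the split-off factor is \<open>2 * c\<close>.\<close>

lemma aop_bop:
  assumes uv: "z \<in> D" "u \<in> D" "z \<noteq> 0" "u \<noteq> 0" "z \<noteq> u" "z \<noteq> - u"
  shows "aop xm z (bop xm u x) = smul (Fr c u z) (bop xm u (aop xm z x))
     + smul ((2 * z - c) * Yr c z u) (bop xm z (aop xm u x))
     + smul ((2 * z - c) * Yr c z (- u)) (bop xm z (aop xm (- u) x))"
proof -
  have aux: "aop xm u (bop xm v x) = smul (Fr c v u) (bop xm v (aop xm u x))
     + smul ((2 * u - c) * Yr c u v) (bop xm u (aop xm v x))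
     + smul ((2 * u - c) * Yr c u (- v)) (bop xm u (aop xm (- v) x))"
    if uv: "u \<in> D" "v \<in> D" "u \<noteq> 0" "v \<noteq> 0" "u \<noteq> v" "u \<noteq> - v" "c - 2 * v \<noteq> 0" for u v
  proof (rule functional_eqI[OF vs])
    fix h :: "'h \<Rightarrow> complex" assume h: "Vector_Spaces.linear smul (*) h"
    have ne: "v \<noteq> u" "v \<noteq> - u" using uv by auto
    define x1 where "x1 = h (aop xm u (bop xm v x))"
    define x2 where "x2 = h (aop xm v (bop xm u x))"
    define y1 where "y1 = h (bop xm v (aop xm u x))"
    define y2 where "y2 = h (bop xm u (aop xm v x))"
    define z1 where "z1 = h (bop xm v (aop xm (- u) x))"
    define z2 where "z2 = h (bop xm u (aop xm (- v) x))"
    define W1 where "W1 = h (mon xm u 1 2 (mon xm v 2 2 x))"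
    define W2 where "W2 = h (mon xm v 1 2 (mon xm u 2 2 x))"
    have W1: "2 * v * W1 = (c - 2 * u) * (c * y2 + (2 * v - c) * z2)"
      unfolding W1_def y2_def z2_def mon22[OF uv(2,4)] using uv
      by (simp add: mon12 bop_rules linear_rules[OF h] field_simps)
    have W2: "2 * u * W2 = (c - 2 * v) * (c * y1 + (2 * u - c) * z1)"
      unfolding W2_def y1_def z1_def mon22[OF uv(1,3)] using uv
      by (simp add: mon12 bop_rules linear_rules[OF h] field_simps)
    have XY: "h (aop xm u (mon xm v 1 2 x)) = (c - 2 * v) * x1" "h (aop xm v (mon xm u 1 2 x)) = (c - 2 * u) * x2"
      "h (mon xm v 1 2 (aop xm u x)) = (c - 2 * v) * y1" "h (mon xm u 1 2 (aop xm v x)) = (c - 2 * u) * y2"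
      using uv by (simp_all add: mon12 mon_rules linear_rules[OF h] x1_def x2_def y1_def y2_def)
    have E1: "(u - v + c) * (u + v) * ((c - 2 * v) * x1) + c * (u - v + c) * W1
      = (u - v) * (u + v - c) * ((c - 2 * v) * y1) + c * (u + v) * ((c - 2 * u) * x2) + c\<^sup>2 * W2"
      using mon_exchange[OF uv(1,2,5,6) h refl, of xm 1 1 1 2 x]
      unfolding sum_2 W1_def[symmetric] W2_def[symmetric] XY
      by (simp add: not_1_2 algebra_simps power2_eq_square)
    have E2: "(v - u + c) * (u + v) * ((c - 2 * u) * x2) + c * (v - u + c) * W2
      = (v - u) * (u + v - c) * ((c - 2 * u) * y2) + c * (u + v) * ((c - 2 * v) * x1) + c\<^sup>2 * W1"
      using mon_exchange[OF uv(2,1) ne h refl, of xm 1 1 1 2 x]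
      unfolding sum_2 W1_def[symmetric] W2_def[symmetric] XY
      by (simp add: not_1_2 algebra_simps power2_eq_square)
    from exchange_solve[OF uv(3-7) W1 W2 E1 E2]
    show "h (aop xm u (bop xm v x)) = h (smul (Fr c v u) (bop xm v (aop xm u x))
     + smul ((2 * u - c) * Yr c u v) (bop xm u (aop xm v x))
     + smul ((2 * u - c) * Yr c u (- v)) (bop xm u (aop xm (- v) x)))"
      by (simp add: linear_rules[OF h] x1_def y1_def y2_def z2_def Fr_def Yr_def Yr_minus
          right_diff_distrib mult.assoc)
  qed
  show ?thesis
  proof (cases "c - 2 * u = 0")
    case False
    then show ?thesis using aux uv by simp
  next
    case True
    then have "c - 2 * (- u) \<noteq> 0" using uv(4) by auto
    then show ?thesis using aux[of z "- u"] uv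
      by (simp add: bop_even[of xm u] D_uminus Fr_def add.commute add.left_commute)
  qed
qed

text \<open>Mirror image of \<open>aop_bop\<close>: the same coefficients with all products
  reversed, which makes dual Bethe vectors accessible to the same computation.\<close>

lemma cop_aop:
  assumes uv: "z \<in> D" "u \<in> D" "z \<noteq> 0" "u \<noteq> 0" "z \<noteq> u" "z \<noteq> - u"
  shows "cop xm u (aop xm z x) = smul (Fr c u z) (aop xm z (cop xm u x))
     + smul ((2 * z - c) * Yr c z u) (aop xm u (cop xm z x))
     + smul ((2 * z - c) * Yr c z (- u)) (aop xm (- u) (cop xm z x))"
proof -
  have aux: "cop xm v (aop xm u x) = smul (Fr c v u) (aop xm u (cop xm v x))
     + smul ((2 * u - c) * Yr c u v) (aop xm v (cop xm u x))
     + smul ((2 * u - c) * Yr c u (- v)) (aop xm (- v) (cop xm u x))"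
    if uv: "u \<in> D" "v \<in> D" "u \<noteq> 0" "v \<noteq> 0" "u \<noteq> v" "u \<noteq> - v" "c - 2 * v \<noteq> 0" for u v
  proof (rule functional_eqI[OF vs])
    fix h :: "'h \<Rightarrow> complex" assume h: "Vector_Spaces.linear smul (*) h"
    have ne: "v \<noteq> u" "v \<noteq> - u" using uv by auto
    define x1 where "x1 = h (cop xm v (aop xm u x))"
    define x2 where "x2 = h (cop xm u (aop xm v x))"
    define y1 where "y1 = h (aop xm u (cop xm v x))"
    define y2 where "y2 = h (aop xm v (cop xm u x))"
    define z1 where "z1 = h (aop xm (- u) (cop xm v x))"
    define z2 where "z2 = h (aop xm (- v) (cop xm u x))"
    define W1 where "W1 = h (mon xm v 2 2 (mon xm u 2 1 x))"
    define W2 where "W2 = h (mon xm u 2 2 (mon xm v 2 1 x))"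
    have W1: "2 * v * W1 = (c - 2 * u) * (c * y2 + (2 * v - c) * z2)"
      unfolding W1_def y2_def z2_def mon22[OF uv(2,4)] using uv
      by (simp add: mon21 mon_rules D_uminus linear_rules[OF h] field_simps)
    have W2: "2 * u * W2 = (c - 2 * v) * (c * y1 + (2 * u - c) * z1)"
      unfolding W2_def y1_def z1_def mon22[OF uv(1,3)] using uv
      by (simp add: mon21 mon_rules D_uminus linear_rules[OF h] field_simps)
    have XY: "h (mon xm v 2 1 (aop xm u x)) = (c - 2 * v) * x1" "h (mon xm u 2 1 (aop xm v x)) = (c - 2 * u) * x2"
      "h (aop xm u (mon xm v 2 1 x)) = (c - 2 * v) * y1" "h (aop xm v (mon xm u 2 1 x)) = (c - 2 * u) * y2"
      using uv by (simp_all add: mon21 mon_rules linear_rules[OF h] x1_def x2_def y1_def y2_def)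
    have E1: "(u - v + c) * (u + v) * ((c - 2 * v) * x1) + c * (u - v + c) * W1
      = (u - v) * (u + v - c) * ((c - 2 * v) * y1) + c * (u + v) * ((c - 2 * u) * x2) + c\<^sup>2 * W2"
      using mon_exchange[OF uv(1,2,5,6) h refl, of xm 1 1 2 1 x]
      unfolding sum_2 W1_def[symmetric] W2_def[symmetric] XY
      by (simp add: not_1_2 algebra_simps power2_eq_square)
    have E2: "(v - u + c) * (u + v) * ((c - 2 * u) * x2) + c * (v - u + c) * W2
      = (v - u) * (u + v - c) * ((c - 2 * u) * y2) + c * (u + v) * ((c - 2 * v) * x1) + c\<^sup>2 * W1"
      using mon_exchange[OF uv(2,1) ne h refl, of xm 1 1 2 1 x]
      unfolding sum_2 W1_def[symmetric] W2_def[symmetric] XY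
      by (simp add: not_1_2 algebra_simps power2_eq_square)
    from exchange_solve[OF uv(3-7) W1 W2 E1 E2]
    show "h (cop xm v (aop xm u x)) = h (smul (Fr c v u) (aop xm u (cop xm v x))
     + smul ((2 * u - c) * Yr c u v) (aop xm v (cop xm u x))
     + smul ((2 * u - c) * Yr c u (- v)) (aop xm (- v) (cop xm u x)))"
      by (simp add: linear_rules[OF h] x1_def y1_def y2_def z2_def Fr_def Yr_def Yr_minus
          right_diff_distrib mult.assoc)
  qed
  show ?thesis
  proof (cases "c - 2 * u = 0")
    case False
    then show ?thesis using aux uv by simp
  next
    case True
    then have "c - 2 * (- u) \<noteq> 0" using uv(4) by auto
    then show ?thesis using aux[of z "- u"] uv
      by (simp add: cop_even[of xm u] D_uminus Fr_def add.commute add.left_commute)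
  qed
qed

abbreviation dop :: "complex \<Rightarrow> complex \<Rightarrow> 'h \<Rightarrow> 'h" where
  "dop xm u x \<equiv> smul (c / (2 * u)) (aop xm u x) + smul ((2 * u - c) / (2 * u)) (aop xm (- u) x)"

text \<open>The difference of the two orders is quadratic in \<open>A\<close>. This shape alone
  controls which vectors can appear after \<open>cop\<close> has acted; the explicit coefficients
  enter through \<open>one_point\<close>.\<close>

lemma cop_bop:
  assumes uv: "v \<in> D" "u \<in> D" "v \<noteq> 0" "u \<noteq> 0" "v \<noteq> u" "v \<noteq> - u" "c - 2 * v \<noteq> 0" "c - 2 * u \<noteq> 0"
  shows "cop xm v (bop xm u x) = bop xm u (cop xm v x)
     + smul (c / ((v + u) * (c - 2 * v) * (c - 2 * u))) (aop xm u (aop xm v x) - dop xm v (dop xm u x))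
     + smul (c * (v + u - c) / ((v - u) * (v + u) * (c - 2 * v) * (c - 2 * u)))
         (aop xm u (dop xm v x) - aop xm v (dop xm u x))"
proof (rule functional_eqI[OF vs])
  fix h :: "'h \<Rightarrow> complex" assume h: "Vector_Spaces.linear smul (*) h"
  define X where "X = h (cop xm v (bop xm u x))"
  define Y where "Y = h (bop xm u (cop xm v x))"
  define W1 where "W1 = h (aop xm u (aop xm v x)) - h (dop xm v (dop xm u x))"
  define W2 where "W2 = h (aop xm u (dop xm v x)) - h (aop xm v (dop xm u x))"
  define k where "k = (c - 2 * v) * (c - 2 * u)"
  have s: "v + u \<noteq> 0" "v - u \<noteq> 0" using uv by (auto simp: eq_neg_iff_add_eq_0)
  have XY: "h (mon xm v 2 1 (mon xm u 1 2 x)) = k * X" "h (mon xm u 1 2 (mon xm v 2 1 x)) = k * Y"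
    using uv by (simp_all add: mon12 mon21 cop_rules bop_rules linear_rules[OF h] X_def Y_def k_def)
  have "(v - u) * (v + u) * k * (X - Y) = c * (v - u) * W1 + c * (v + u - c) * W2"
    using mon_exchange[OF uv(1,2,5,6) h refl, of xm 2 1 1 2 x] unfolding sum_2 XY
    by (simp add: not_1_2 W1_def W2_def mon22[OF uv(1,3)] mon22[OF uv(2,4)] algebra_simps)
  then have "X - Y = (c * (v - u) * W1 + c * (v + u - c) * W2) / ((v - u) * (v + u) * k)"
    using s uv(7,8) k_def by (simp add: eq_divide_eq mult.commute[of "X - Y"])
  also have "\<dots> = c / ((v + u) * k) * W1 + c * (v + u - c) / ((v - u) * (v + u) * k) * W2"
    using s by (simp add: add_divide_distrib)
  finally have "X = Y + c / ((v + u) * k) * W1 + c * (v + u - c) / ((v - u) * (v + u) * k) * W2"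
    by (simp only: diff_eq_eq add.commute[of _ Y] add.assoc)
  then show "h (cop xm v (bop xm u x)) = h (bop xm u (cop xm v x)
     + smul (c / ((v + u) * (c - 2 * v) * (c - 2 * u))) (aop xm u (aop xm v x) - dop xm v (dop xm u x))
     + smul (c * (v + u - c) / ((v - u) * (v + u) * (c - 2 * v) * (c - 2 * u)))
         (aop xm u (dop xm v x) - aop xm v (dop xm u x)))"
    unfolding X_def Y_def W1_def W2_def k_def
    by (simp only: linear_rules[OF h] mult.assoc[symmetric])
qed

end


subsection \<open>Action on Bethe vectors\<close>


lemma Fr_factor: "Fr c x u = ((u - c - x) * (u - c + x)) / ((u - x) * (u + x))"
  by (simp add: Fr_def power2_eq_square algebra_simps)

lemma Fr_partial_fractions:
  assumes "u \<noteq> 0" "z \<noteq> u" "z \<noteq> - u"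
  shows "Fr c u z = 1 + c * (c - 2 * u) / (2 * u) / (z - u) - c * (c + 2 * u) / (2 * u) / (z + u)"
proof -
  have nz: "z - u \<noteq> 0" "z + u \<noteq> 0"
    using assms by (auto simp: eq_neg_iff_add_eq_0)
  show ?thesis
    unfolding Fr_factor using nz assms(1) by (simp add: divide_simps) (simp add: algebra_simps)
qed

lemma inverse_diff_quotient:
  fixes z w u :: complex
  assumes "z \<noteq> u" "w \<noteq> u" "z \<noteq> w"
  shows "1 / (z - u) * (1 / (z - w)) + 1 / (z - u) * (1 / (w - u)) = 1 / (z - w) * (1 / (w - u))"
  using assms by (simp add: divide_simps)

text \<open>A term in which \<open>w\<close> has been replaced by \<open>z\<close> arises directly
  or through an intermediate exchange with \<open>u\<close> or \<open>- u\<close>; the identity says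
  that the three contributions add up correctly. Partial fractions in \<open>z\<close> reduce it to
  \<open>inverse_diff_quotient\<close> for \<open>u\<close> and for \<open>- u\<close>.\<close>

lemma Yr_identity:
  assumes "u \<noteq> 0" "w \<noteq> 0" "z \<noteq> u" "z \<noteq> - u" "w \<noteq> u" "w \<noteq> - u" "z \<noteq> w"
  shows "Fr c u z * Yr c z w + (2 * u - c) * Yr c z u * Yr c u w + (2 * (- u) - c) * Yr c z (- u) * Yr c (- u) w
    = Yr c z w * Fr c u w"
proof -
  define k1 where "k1 = c * (c - 2 * u) / (2 * u)"
  define k2 where "k2 = c * (c + 2 * u) / (2 * u)"
  define i1 where "i1 = 1 / (z - u)"
  define i2 where "i2 = 1 / (z + u)"
  define j1 where "j1 = 1 / (w - u)"
  define j2 where "j2 = 1 / (w + u)"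
  define l where "l = 1 / (z - w)"
  define e where "e = c / (2 * w)"
  have F: "Fr c u z = 1 + k1 * i1 - k2 * i2" "Fr c u w = 1 + k1 * j1 - k2 * j2"
    using Fr_partial_fractions[of u z c] Fr_partial_fractions[of u w c] assms
    by (simp_all add: k1_def k2_def i1_def i2_def j1_def j2_def)
  have Y: "Yr c z w = c / (2 * w) * l" by (simp add: Yr_def l_def)
  have "Yr c u w = - (c / (2 * w) * j1)"
    using assms by (simp add: Yr_def j1_def divide_simps) (simp add: algebra_simps)
  then have Y1: "(2 * u - c) * Yr c z u * Yr c u w = c / (2 * w) * (k1 * i1 * j1)"
  proof -
    have Y': "Yr c z u = c / (2 * u) * i1" by (simp add: Yr_def i1_def)
    show ?thesis unfolding Y' \<open>Yr c u w = - (c / (2 * w) * j1)\<close>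
      using assms(1,2) by (simp add: k1_def field_simps)
  qed
  have "Yr c (- u) w = - (c / (2 * w) * j2)"
  proof -
    have "- u - w = - (w + u)" by simp
    then show ?thesis unfolding Yr_def j2_def by (simp only: mult_minus_right divide_minus_right) simp
  qed
  then have Y2: "(2 * (- u) - c) * Yr c z (- u) * Yr c (- u) w = - (c / (2 * w) * (k2 * i2 * j2))"
  proof -
    have Y': "Yr c z (- u) = - (c / (2 * u) * i2)" by (simp add: Yr_minus i2_def)
    show ?thesis unfolding Y' \<open>Yr c (- u) w = - (c / (2 * w) * j2)\<close>
      using assms(1,2) by (simp add: k2_def field_simps)
  qed
  have I1: "i1 * l + i1 * j1 = l * j1"
    using inverse_diff_quotient[of z u w] assms by (simp add: i1_def l_def j1_def)
  have I2: "i2 * l + i2 * j2 = l * j2"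
    using inverse_diff_quotient[of z "- u" w] assms by (simp add: i2_def l_def j2_def)
  have "Fr c u z * Yr c z w + (2 * u - c) * Yr c z u * Yr c u w + (2 * (- u) - c) * Yr c z (- u) * Yr c (- u) w
    = c / (2 * w) * (l + k1 * (i1 * l + i1 * j1) - k2 * (i2 * l + i2 * j2))"
    unfolding F Y Y1 Y2 e_def[symmetric] by (simp add: algebra_simps)
  also have "\<dots> = Yr c z w * Fr c u w"
    unfolding I1 I2 F Y e_def[symmetric] by (simp add: algebra_simps)
  finally show ?thesis .
qed

text \<open>Equivalent to the squares being nonzero and pairwise distinct: the appropriate
  genericity, since the vectors are even in each parameter.\<close>

definition good_set :: "complex set \<Rightarrow> complex set \<Rightarrow> bool" where
  "good_set P U \<longleftrightarrow> finite U \<and> U \<subseteq> P \<and> (\<forall>x\<in>U. - x \<notin> U)"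

lemma good_set_mono: "good_set P U \<Longrightarrow> V \<subseteq> U \<Longrightarrow> good_set P V"
  by (auto simp: good_set_def intro: finite_subset)

definition FP :: "complex \<Rightarrow> complex \<Rightarrow> complex set \<Rightarrow> complex" where
  "FP c z U = (\<Prod>x\<in>U. Fr c x z)"

definition op_vec :: "(complex \<Rightarrow> 'm \<Rightarrow> 'm) \<Rightarrow> 'm \<Rightarrow> complex set \<Rightarrow> 'm" where
  "op_vec b vac U = foldr b (SOME us. distinct us \<and> set us = U) vac"

text \<open>The carrier \<open>H0\<close> is there for the dual side, where the vectors are
  functions on the space and the exchange relations are derived for linear ones.\<close>

locale comm_family =
  fixes P :: "complex set" and H0 :: "'m set" and b :: "complex \<Rightarrow> 'm \<Rightarrow> 'm" and vac :: 'm
  assumes vac_H0: "vac \<in> H0" and b_H0: "u \<in> P \<Longrightarrow> x \<in> H0 \<Longrightarrow> b u x \<in> H0"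
    and b_comm: "u \<in> P \<Longrightarrow> v \<in> P \<Longrightarrow> x \<in> H0 \<Longrightarrow> b u (b v x) = b v (b u x)"
begin

abbreviation bv :: "complex set \<Rightarrow> 'm" where
  "bv \<equiv> op_vec b vac"

lemma foldr_H0: "set us \<subseteq> P \<Longrightarrow> foldr b us vac \<in> H0"
  by (induction us) (simp_all add: vac_H0 b_H0)

lemma foldr_remove1: "set us \<subseteq> P \<Longrightarrow> x \<in> set us \<Longrightarrow> foldr b us vac = b x (foldr b (remove1 x us) vac)"
proof (induction us)
  case (Cons u us)
  show ?case
  proof (cases "u = x")
    case False
    then have *: "x \<in> set us" "set us \<subseteq> P" "u \<in> P" using Cons.prems by auto
    then have "foldr b (remove1 x us) vac \<in> H0"
      using set_remove1_subset[of x us] by (intro foldr_H0) auto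
    then show ?thesis using Cons.IH * False b_comm[of u x] by auto
  qed simp
qed simp

lemma foldr_perm: "set us \<subseteq> P \<Longrightarrow> mset us = mset ws \<Longrightarrow> foldr b us vac = foldr b ws vac"
proof (induction ws arbitrary: us)
  case (Cons w ws)
  have w: "w \<in> set us" using Cons.prems(2) by (metis list.set_intros(1) set_mset_mset)
  have "mset (remove1 w us) = mset ws" using Cons.prems(2) by simp
  moreover have "set (remove1 w us) \<subseteq> P" using set_remove1_subset[of w us] Cons.prems(1) by auto
  ultimately have "foldr b (remove1 w us) vac = foldr b ws vac" using Cons.IH by blast
  then show ?case using foldr_remove1[OF Cons.prems(1) w] by simp
qed simp

lemma foldr_bv:
  assumes "set us \<subseteq> P" "distinct us"
  shows "foldr b us vac = bv (set us)"
proof -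
  define ws where "ws = (SOME ws. distinct ws \<and> set ws = set us)"
  have "distinct ws \<and> set ws = set us"
    unfolding ws_def by (rule someI[of _ us]) (use assms in auto)
  then have "mset us = mset ws" using assms(2) by (metis set_eq_iff_mset_eq_distinct)
  then show ?thesis using foldr_perm[OF assms(1)] by (simp add: op_vec_def ws_def)
qed

lemma bv_empty: "bv {} = vac"
  using foldr_bv[of "[]"] by simp

lemma bv_insert:
  assumes "finite U" "insert u U \<subseteq> P" "u \<notin> U"
  shows "bv (insert u U) = b u (bv U)"
proof -
  obtain us where us: "distinct us" "set us = U" using finite_distinct_list[OF assms(1)] by blast
  then show ?thesis using foldr_bv[of "u # us"] foldr_bv[of us] assms by auto
qed

lemma bv_H0: "finite U \<Longrightarrow> U \<subseteq> P \<Longrightarrow> bv U \<in> H0"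
  by (induction U rule: finite_induct) (simp_all add: bv_empty vac_H0 bv_insert b_H0)

end

text \<open>Common abstraction of \<open>A\<close>, \<open>B\<close> acting on the vacuum and of
  \<open>A\<close>, \<open>C\<close> acting from the right on the dual vacuum; the algebraic Bethe
  ansatz is carried out once for both.\<close>

locale refl_half = vector_space smul + comm_family P H0 b vac
  for smul :: "complex \<Rightarrow> 'm::ab_group_add \<Rightarrow> 'm"
    and c :: complex and P :: "complex set" and H0 :: "'m set"
    and A b :: "complex \<Rightarrow> 'm \<Rightarrow> 'm" and vac :: 'm and m :: "complex \<Rightarrow> complex" +
  assumes P_uminus: "u \<in> P \<Longrightarrow> - u \<in> P" and P_nz: "0 \<notin> P"
    and b_add: "u \<in> P \<Longrightarrow> b u (x + y) = b u x + b u y"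
    and b_scale: "u \<in> P \<Longrightarrow> b u (smul r x) = smul r (b u x)"
    and b_even: "u \<in> P \<Longrightarrow> b (- u) x = b u x"
    and A_vac: "u \<in> P \<Longrightarrow> A u vac = smul (m u) vac"
    and A_b: "z \<in> P \<Longrightarrow> u \<in> P \<Longrightarrow> z \<noteq> u \<Longrightarrow> z \<noteq> - u \<Longrightarrow> x \<in> H0 \<Longrightarrow>
      A z (b u x) = smul (Fr c u z) (b u (A z x)) + smul ((2 * z - c) * Yr c z u) (b z (A u x))
        + smul ((2 * z - c) * Yr c z (- u)) (b z (A (- u) x))"
begin

lemma b_zero: "u \<in> P \<Longrightarrow> b u 0 = 0"
  using b_scale[of u 0 0] by simp

lemma b_sum: "u \<in> P \<Longrightarrow> b u (sum f S) = (\<Sum>i\<in>S. b u (f i))"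
  by (induction S rule: infinite_finite_induct) (simp_all add: b_zero b_add)

definition acoef :: "complex \<Rightarrow> complex \<Rightarrow> complex set \<Rightarrow> complex" where
  "acoef z u U = (2 * z - c) * (Yr c z u * (m u * FP c u (U - {u}))
      + Yr c z (- u) * (m (- u) * FP c (- u) (U - {u})))"

text \<open>The wanted term collects one factor \<open>Fr\<close> per parameter. The coefficient
  \<open>acoef\<close> of an unwanted term is what results if \<open>b u\<close> is moved to the
  front and is hit first; the induction confirms it for all \<open>u\<close> simultaneously.\<close>

lemma A_bv:
  assumes "good_set P (insert z U)" "z \<notin> U"
  shows "A z (bv U) = smul (m z * FP c z U) (bv U)
    + (\<Sum>u\<in>U. smul (acoef z u U) (bv (insert z (U - {u}))))"
proof -
  have "finite U" using assms(1) by (simp add: good_set_def)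
  then show ?thesis using assms
  proof (induction U arbitrary: z rule: finite_induct)
    case empty
    then show ?case by (simp add: bv_empty A_vac FP_def good_set_def)
  next
    case (insert u U)
    have fin: "finite U" and P: "z \<in> P" "u \<in> P" "- u \<in> P" "U \<subseteq> P"
      using insert.prems by (auto simp: good_set_def P_uminus)
    have nz: "u \<noteq> 0" "\<And>w. w \<in> U \<Longrightarrow> w \<noteq> 0" "z \<noteq> 0" using P P_nz by auto
    have zu: "z \<noteq> u" "z \<noteq> - u" using insert.prems by (auto simp: good_set_def)
    have uU: "u \<notin> U" "- u \<notin> U" using insert by (auto simp: good_set_def)
    have zU: "z \<notin> U" "- z \<notin> U" using insert.prems by (auto simp: good_set_def)
    have g: "good_set P (insert z U)" "good_set P (insert u U)"
      using insert.prems(1) by (auto elim: good_set_mono)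
    have g': "good_set P (insert (- u) U)"
      using g(2) P uU by (auto simp: good_set_def)
    define X where "X = bv U"
    define B2 where "B2 w = bv (insert z (insert u U - {w}))" for w
    have B: "b u X = bv (insert u U)" "b z X = B2 u"
      using bv_insert[OF fin, of u] bv_insert[OF fin, of z] P uU zU
      by (simp_all add: X_def B2_def insert_absorb)
    have sub: "b u (bv (U - {w})) = bv (insert u (U - {w}))" "b z (bv (U - {w})) = bv (insert z (U - {w}))"
      if "w \<in> U" for w
      using bv_insert[of "U - {w}" u] bv_insert[of "U - {w}" z] P uU zU fin
      by (simp_all add: subset_trans[OF Diff_subset])
    have B2: "b u (bv (insert z (U - {w}))) = B2 w" "b z (bv (insert u (U - {w}))) = B2 w"
      "b z (bv (insert (- u) (U - {w}))) = B2 w" if w: "w \<in> U" for w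
    proof -
      have e: "insert z (insert u U - {w}) = insert u (insert z (U - {w}))"
        "insert z (insert u U - {w}) = insert z (insert u (U - {w}))"
        using w uU by auto
      show "b u (bv (insert z (U - {w}))) = B2 w"
        unfolding B2_def e(1) using P fin uU zu by (subst bv_insert) auto
      show 2: "b z (bv (insert u (U - {w}))) = B2 w"
        unfolding B2_def e(2) using P fin zU zu by (subst (2) bv_insert) auto
      have "bv (insert (- u) (U - {w})) = b (- u) (bv (U - {w}))"
        using P fin uU by (intro bv_insert) auto
      also have "\<dots> = bv (insert u (U - {w}))"
        using b_even P sub(1)[OF w] by simp
      finally show "b z (bv (insert (- u) (U - {w}))) = B2 w" using 2 by simp
    qed
    \<comment> \<open>Moving \<open>A z\<close> past \<open>b u\<close> produces \<open>A\<close> at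
      \<open>z\<close>, \<open>u\<close> and \<open>- u\<close>, so the induction hypothesis is used
      at all three points.\<close>
    have IHz: "A z X = smul (m z * FP c z U) X + (\<Sum>w\<in>U. smul (acoef z w U) (bv (insert z (U - {w}))))"
      unfolding X_def by (rule insert.IH[OF g(1) zU(1)])
    have IHu: "A u X = smul (m u * FP c u U) X + (\<Sum>w\<in>U. smul (acoef u w U) (bv (insert u (U - {w}))))"
      unfolding X_def by (rule insert.IH[OF g(2) uU(1)])
    have IHu': "A (- u) X = smul (m (- u) * FP c (- u) U) X
        + (\<Sum>w\<in>U. smul (acoef (- u) w U) (bv (insert (- u) (U - {w}))))"
      unfolding X_def by (rule insert.IH[OF g' uU(2)])
    have bz: "b u (A z X) = smul (m z * FP c z U) (bv (insert u U)) + (\<Sum>w\<in>U. smul (acoef z w U) (B2 w))"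
      unfolding IHz by (simp add: b_add b_scale b_sum P B B2)
    have bu: "b z (A u X) = smul (m u * FP c u U) (B2 u) + (\<Sum>w\<in>U. smul (acoef u w U) (B2 w))"
      unfolding IHu by (simp add: b_add b_scale b_sum P B B2)
    have bu': "b z (A (- u) X) = smul (m (- u) * FP c (- u) U) (B2 u) + (\<Sum>w\<in>U. smul (acoef (- u) w U) (B2 w))"
      unfolding IHu' by (simp add: b_add b_scale b_sum P B B2)
    have coef: "Fr c u z * acoef z w U + (2 * z - c) * Yr c z u * acoef u w U
        + (2 * z - c) * Yr c z (- u) * acoef (- u) w U = acoef z w (insert u U)" if w: "w \<in> U" for w
    proof -
      have ne: "w \<noteq> u" "w \<noteq> - u" "z \<noteq> w" "z \<noteq> - w" "- w \<noteq> u" "- w \<noteq> - u" "- w \<noteq> 0"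
        using w uU zU nz by auto
      have FPi: "FP c y (insert u U - {w}) = Fr c u y * FP c y (U - {w})" for y
      proof -
        have "insert u U - {w} = insert u (U - {w})" using ne by auto
        then show ?thesis using fin uU by (simp add: FP_def)
      qed
      define K where "K = m w * FP c w (U - {w})"
      define K' where "K' = m (- w) * FP c (- w) (U - {w})"
      have "Fr c u z * acoef z w U + (2 * z - c) * Yr c z u * acoef u w U
          + (2 * z - c) * Yr c z (- u) * acoef (- u) w U
        = (2 * z - c) * (K * (Fr c u z * Yr c z w + (2 * u - c) * Yr c z u * Yr c u w
            + (2 * (- u) - c) * Yr c z (- u) * Yr c (- u) w)
          + K' * (Fr c u z * Yr c z (- w) + (2 * u - c) * Yr c z u * Yr c u (- w)
            + (2 * (- u) - c) * Yr c z (- u) * Yr c (- u) (- w)))"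
        unfolding acoef_def K_def[symmetric] K'_def[symmetric] by (simp add: algebra_simps)
      also have "\<dots> = (2 * z - c) * (K * (Yr c z w * Fr c u w) + K' * (Yr c z (- w) * Fr c u (- w)))"
        using Yr_identity[OF nz(1) nz(2)[OF w] zu ne(1,2,3)] Yr_identity[OF nz(1) ne(7) zu ne(5,6,4)]
        by simp
      also have "\<dots> = acoef z w (insert u U)"
        unfolding acoef_def FPi K_def K'_def by (simp add: algebra_simps)
      finally show ?thesis .
    qed
    have "A z (bv (insert u U)) = A z (b u X)" by (simp add: B)
    also have "\<dots> = smul (Fr c u z) (b u (A z X)) + smul ((2 * z - c) * Yr c z u) (b z (A u X))
        + smul ((2 * z - c) * Yr c z (- u)) (b z (A (- u) X))"
      using P zu bv_H0[OF fin P(4)] by (intro A_b) (auto simp: X_def)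
    also have "\<dots> = smul (Fr c u z * (m z * FP c z U)) (bv (insert u U))
        + smul ((2 * z - c) * Yr c z u * (m u * FP c u U) + (2 * z - c) * Yr c z (- u) * (m (- u) * FP c (- u) U)) (B2 u)
        + (\<Sum>w\<in>U. smul (Fr c u z * acoef z w U + (2 * z - c) * Yr c z u * acoef u w U
        + (2 * z - c) * Yr c z (- u) * acoef (- u) w U) (B2 w))"
      unfolding bz bu bu'
      by (simp add: scale_right_distrib scale_left_distrib scale_sum_right sum.distrib add_ac)
    also have "Fr c u z * (m z * FP c z U) = m z * FP c z (insert u U)"
      using fin uU by (simp add: FP_def)
    also have "(2 * z - c) * Yr c z u * (m u * FP c u U) + (2 * z - c) * Yr c z (- u) * (m (- u) * FP c (- u) U)
        = acoef z u (insert u U)"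
      using uU by (simp add: acoef_def algebra_simps)
    also have "(\<Sum>w\<in>U. smul (Fr c u z * acoef z w U + (2 * z - c) * Yr c z u * acoef u w U
        + (2 * z - c) * Yr c z (- u) * acoef (- u) w U) (B2 w)) = (\<Sum>w\<in>U. smul (acoef z w (insert u U)) (B2 w))"
      by (intro sum.cong refl) (simp only: coef)
    finally show ?case
      using fin uU by (simp add: B2_def add.assoc)
  qed
qed

end


text \<open>Coefficient of \<open>A(z)\<close> in the transfer matrix after elimination of the lower
  diagonal entry; the coefficient of \<open>A(- z)\<close> is
  \<open>alpha c xp (- z)\<close>.\<close>

definition alpha :: "complex \<Rightarrow> complex \<Rightarrow> complex \<Rightarrow> complex" where
  "alpha c xp z = (2 * z + c) / (2 * z) * (z + xp - c/2)"

text \<open>Proportional to the residue of the eigenvalue at a point \<open>u\<close> of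
  \<open>U\<close>. Its vanishing at all points of \<open>U\<close> is the polynomial form of the
  Bethe equations, see \<open>Phi_eq_0_iff\<close>.\<close>

definition Phi :: "complex \<Rightarrow> complex \<Rightarrow> complex \<Rightarrow> (complex \<Rightarrow> complex) \<Rightarrow> complex \<Rightarrow> complex set \<Rightarrow> complex" where
  "Phi c xp xm a u U =
     (u + xp - c/2) * ((u + xm - c/2) * a u * FP c u (U - {u}))
   - (- u + xp - c/2) * ((- u + xm - c/2) * a (- u) * FP c (- u) (U - {u}))"

lemma f_rat_pair:
  "f_rat c x z * f_rat c (- x) z = Fr c x z" "f_rat c z x * f_rat c z (- x) = Fr c x (- z)"
proof -
  have "(x - z) * (- x - z) = z\<^sup>2 - x\<^sup>2" "(x - z + c) * (- x - z + c) = (z - c)\<^sup>2 - x\<^sup>2"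
    "(z - x) * (z - - x) = z\<^sup>2 - x\<^sup>2" "(z - x + c) * (z - - x + c) = (- z - c)\<^sup>2 - x\<^sup>2"
    by (simp_all add: power2_eq_square algebra_simps)
  then show "f_rat c x z * f_rat c (- x) z = Fr c x z" "f_rat c z x * f_rat c z (- x) = Fr c x (- z)"
    by (simp_all add: f_rat_def Fr_def)
qed

text \<open>The second term of the eigenvalue is the first one at \<open>- z\<close>, matching the
  form of the transfer matrix as a combination of \<open>A(z)\<close> and
  \<open>A(- z)\<close>.\<close>

lemma tau_hat_alt:
  "tau_hat c xp xm l1 l2 z U = alpha c xp z * ((z + xm - c/2) * (l1 z * l2 (- z)) * FP c z U)
     + alpha c xp (- z) * ((- z + xm - c/2) * (l1 (- z) * l2 z) * FP c (- z) U)"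
proof -
  have 1: "(\<Prod>u\<in>U. f_rat c u z) * (\<Prod>u\<in>U. f_rat c (- u) z) = FP c z U"
    "(\<Prod>u\<in>U. f_rat c z u) * (\<Prod>u\<in>U. f_rat c z (- u)) = FP c (- z) U"
    by (simp_all add: FP_def prod.distrib[symmetric] f_rat_pair)
  have 2: "(2 * z - c) / (2 * z) = (2 * (- z) + c) / (2 * (- z))"
    by (cases "z = 0") (simp_all add: field_simps)
  have 3: "(z - xp + c/2) * (z - xm + c/2) = (- z + xp - c/2) * (- z + xm - c/2)"
    by (simp add: algebra_simps)
  have "tau_hat c xp xm l1 l2 z U = (2 * z + c) / (2 * z) * (z + xp - c/2) * (z + xm - c/2)
       * ((\<Prod>u\<in>U. f_rat c u z) * (\<Prod>u\<in>U. f_rat c (- u) z)) * (l1 z * l2 (- z))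
     + (2 * z - c) / (2 * z) * ((z - xp + c/2) * (z - xm + c/2))
       * ((\<Prod>u\<in>U. f_rat c z u) * (\<Prod>u\<in>U. f_rat c z (- u))) * (l1 (- z) * l2 z)"
    by (simp add: tau_hat_def tau_kernel_def mult.assoc)
  then show ?thesis
    unfolding 1 2 3 by (simp add: alpha_def mult_ac)
qed

lemma FP_remove:
  assumes "finite U" "u \<in> U"
  shows "FP c z U = Fr c u z * FP c z (U - {u})"
  using assms by (simp add: FP_def prod.remove)

text \<open>Once the factors f(- u, u) and f(u, - u) with \<open>x = u\<close> are pulled out of the
  products, the residue is a multiple of \<open>Phi\<close>. The dependence on \<open>z\<close> is
  confined to a simple prefactor.\<close>

lemma unwanted_coeff_alt:
  assumes "finite U" "u \<in> U" "- u \<notin> U" "c \<noteq> 0" "c + 2 * u \<noteq> 0" "z \<noteq> u" "z \<noteq> - u"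
  shows "unwanted_coeff c xp xm l1 l2 z u U
    = c * (c + 2 * z) * (2 * u - c) / (2 * u * (z\<^sup>2 - u\<^sup>2)) * Phi c xp xm (\<lambda>x. l1 x * l2 (- x)) u U"
proof -
  have nz: "u \<noteq> 0" using assms by auto
  have p1: "(\<Prod>x\<in>U - {u}. f_rat c x u) * (\<Prod>x\<in>U. f_rat c (- x) u)
      = (2 * u - c) / (2 * u) * FP c u (U - {u})"
  proof -
    have "f_rat c (- u) u = (2 * u - c) / (2 * u)"
      using nz by (simp add: f_rat_def field_simps)
    note a = this
    have b: "(\<Prod>x\<in>U - {u}. f_rat c x u) * (\<Prod>x\<in>U - {u}. f_rat c (- x) u) = FP c u (U - {u})"
      by (simp add: FP_def prod.distrib[symmetric] f_rat_pair)
    show ?thesis unfolding prod.remove[OF assms(1,2), of "\<lambda>x. f_rat c (- x) u"] a b[symmetric]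
      by (simp only: mult_ac)
  qed
  have p2: "(\<Prod>x\<in>U - {u}. f_rat c u x) * (\<Prod>x\<in>U. f_rat c u (- x))
      = (2 * u + c) / (2 * u) * FP c (- u) (U - {u})"
  proof -
    have "f_rat c u (- u) = (2 * u + c) / (2 * u)"
      using nz by (simp add: f_rat_def field_simps)
    note a = this
    have b: "(\<Prod>x\<in>U - {u}. f_rat c u x) * (\<Prod>x\<in>U - {u}. f_rat c u (- x)) = FP c (- u) (U - {u})"
      by (simp add: FP_def prod.distrib[symmetric] f_rat_pair)
    show ?thesis unfolding prod.remove[OF assms(1,2), of "\<lambda>x. f_rat c u (- x)"] a b[symmetric]
      by (simp only: mult_ac)
  qed
  have gen: "k * X1 * Y1 * (- c) * (k' * E1) * L1 + k' * X2 * Y2 * c * (k * E2) * L2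
      = - c * k * k' * (X1 * (Y1 * L1 * E1) - X3 * (Y3 * L2 * E2))"
    if "X2 * Y2 = X3 * Y3" for k k' X1 Y1 E1 L1 X2 Y2 E2 L2 X3 Y3
  proof -
    have "k' * X2 * Y2 * c * (k * E2) * L2 = (X2 * Y2) * (k' * c * k * E2 * L2)" by simp
    then show ?thesis unfolding that by (simp add: algebra_simps)
  qed
  have "tau_residue c xp xm l1 l2 u U =
     (2 * u + c) / (2 * u) * (u + xp - c/2) * (u + xm - c/2) * (- c)
       * ((\<Prod>x\<in>U - {u}. f_rat c x u) * (\<Prod>x\<in>U. f_rat c (- x) u)) * (l1 u * l2 (- u))
   + (2 * u - c) / (2 * u) * (u - xp + c/2) * (u - xm + c/2) * c
       * ((\<Prod>x\<in>U - {u}. f_rat c u x) * (\<Prod>x\<in>U. f_rat c u (- x))) * (l1 (- u) * l2 u)"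
    unfolding tau_residue_def
    using residue_tau_kernel[OF assms(1-3), of "\<lambda>_. l1 u * l2 (- u)" "\<lambda>_. l1 (- u) * l2 u" c xp xm]
    by (simp add: mult.assoc)
  also have "\<dots> = - c * ((2 * u + c) / (2 * u)) * ((2 * u - c) / (2 * u)) * Phi c xp xm (\<lambda>x. l1 x * l2 (- x)) u U"
    unfolding p1 p2 Phi_def minus_minus by (rule gen) (simp add: algebra_simps)
  finally have res: "tau_residue c xp xm l1 l2 u U = \<dots>" .
  have g: "g_rat c z u * g_rat c z (- u) = c\<^sup>2 / (z\<^sup>2 - u\<^sup>2)"
    by (simp add: g_rat_def power2_eq_square algebra_simps)
  have "unwanted_coeff c xp xm l1 l2 z u U =
     - (1 / c) * (2 * u / (c + 2 * u)) * ((c + 2 * z) / c) * (g_rat c z u * g_rat c z (- u)) * tau_residue c xp xm l1 l2 u U"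
    by (simp add: unwanted_coeff_def)
  also have "\<dots> = c * (c + 2 * z) * (2 * u - c) / (2 * u * (z\<^sup>2 - u\<^sup>2)) * Phi c xp xm (\<lambda>x. l1 x * l2 (- x)) u U"
  proof -
    have "z\<^sup>2 - u\<^sup>2 \<noteq> 0" using assms(6,7) by (simp add: power2_eq_iff)
    moreover have "2 * u + c \<noteq> 0" using assms(5) by (simp add: add.commute)
    ultimately show ?thesis
      unfolding res g using assms(4,5) nz
      by (simp add: divide_simps) (simp add: power2_eq_square algebra_simps)
  qed
  finally show ?thesis .
qed

text \<open>\<open>A(z)\<close> and \<open>A(- z)\<close> lead to the same unwanted vector; the
  simple poles at \<open>z = u\<close> and \<open>z = - u\<close> of their coefficients combine to
  the denominator \<open>z^2 - u^2\<close>.\<close>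

lemma transfer_coeff:
  assumes "z \<noteq> 0" "u \<noteq> 0" "z \<noteq> u" "z \<noteq> - u"
  shows "alpha c xp z * ((2 * z - c) * (Yr c z u * M + Yr c z (- u) * M'))
     + alpha c xp (- z) * ((2 * (- z) - c) * (Yr c (- z) u * M + Yr c (- z) (- u) * M'))
    = c * (4 * z\<^sup>2 - c\<^sup>2) / (2 * u * (z\<^sup>2 - u\<^sup>2)) * ((u + xp - c/2) * M - (- u + xp - c/2) * M')"
proof -
  have nz: "z - u \<noteq> 0" "z + u \<noteq> 0" using assms by (auto simp: eq_neg_iff_add_eq_0)
  define X where "X = xp - c/2"
  define e where "e = (4 * z\<^sup>2 - c\<^sup>2) / (2 * z)"
  have a: "alpha c xp z * (2 * z - c) = e * (z + X)" "alpha c xp (- z) * (2 * (- z) - c) = - e * (- z + X)"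
    using assms(1) by (simp_all add: alpha_def e_def X_def field_simps power2_eq_square)
  have y: "Yr c (- z) u = - (c / (2 * u * (z + u)))" "Yr c (- z) (- u) = c / (2 * u * (z - u))"
  proof -
    have "2 * u * (- z - u) = - (2 * u * (z + u))" "2 * (- u) * (- z - - u) = 2 * u * (z - u)"
      by (simp_all add: algebra_simps)
    then show "Yr c (- z) u = - (c / (2 * u * (z + u)))" "Yr c (- z) (- u) = c / (2 * u * (z - u))"
      unfolding Yr_def by (simp_all only: divide_minus_right)
  qed
  have k1: "(z + X) * (c / (2 * u * (z - u))) + (- z + X) * (c / (2 * u * (z + u)))
      = c * (2 * z) / (2 * u * (z\<^sup>2 - u\<^sup>2)) * (u + X)"
  proof -
    have *: "z\<^sup>2 - u\<^sup>2 = (z - u) * (z + u)" by (simp add: power2_eq_square algebra_simps)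
    show ?thesis unfolding * using nz assms(1,2)
      by (simp add: divide_simps del: distrib_left_numeral) (simp add: algebra_simps)
  qed
  have k2: "(z + X) * (c / (2 * u * (z + u))) + (- z + X) * (c / (2 * u * (z - u)))
      = c * (2 * z) / (2 * u * (z\<^sup>2 - u\<^sup>2)) * (- u + X)"
  proof -
    have *: "z\<^sup>2 - u\<^sup>2 = (z - u) * (z + u)" by (simp add: power2_eq_square algebra_simps)
    show ?thesis unfolding * using nz assms(1,2)
      by (simp add: divide_simps del: distrib_left_numeral) (simp add: algebra_simps)
  qed
  have "alpha c xp z * ((2 * z - c) * (Yr c z u * M + Yr c z (- u) * M'))
     + alpha c xp (- z) * ((2 * (- z) - c) * (Yr c (- z) u * M + Yr c (- z) (- u) * M'))
    = e * (((z + X) * (c / (2 * u * (z - u))) + (- z + X) * (c / (2 * u * (z + u)))) * M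
         - ((z + X) * (c / (2 * u * (z + u))) + (- z + X) * (c / (2 * u * (z - u)))) * M')"
  proof -
    define r1 where "r1 = c / (2 * u * (z - u))"
    define r2 where "r2 = c / (2 * u * (z + u))"
    have Y: "Yr c z u = r1" "Yr c z (- u) = - r2" "Yr c (- z) u = - r2" "Yr c (- z) (- u) = r1"
      by (simp_all add: y r1_def r2_def Yr_def[of c z])
    show ?thesis
      unfolding mult.assoc[symmetric] a Y r1_def[symmetric] r2_def[symmetric] by (simp add: algebra_simps)
  qed
  also have "\<dots> = e * (c * (2 * z) / (2 * u * (z\<^sup>2 - u\<^sup>2)) * ((u + X) * M - (- u + X) * M'))"
    unfolding k1 k2 by (simp only: right_diff_distrib mult.assoc)
  also have "\<dots> = c * (4 * z\<^sup>2 - c\<^sup>2) / (2 * u * (z\<^sup>2 - u\<^sup>2)) * ((u + X) * M - (- u + X) * M')"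
  proof -
    have "e * (c * (2 * z) / Q * K) = c * (4 * z\<^sup>2 - c\<^sup>2) / Q * K" for Q K
      using assms(1) by (cases "Q = 0") (simp_all add: e_def field_simps)
    then show ?thesis .
  qed
  finally show ?thesis by (simp add: X_def add_diff_eq)
qed

section \<open>The two halves of a model and its transfer matrix\<close>

context generalized_model
begin

definition mval :: "complex \<Rightarrow> complex \<Rightarrow> complex" where
  "mval xm u = (u + xm - c/2) * (l1 u * l2 (- u))"

lemma aop_vac:
  assumes u: "u \<in> D"
  shows "aop xm u vac = smul (mval xm u) vac"
  by (simp add: mon_def sum_2 th_def not_1_2 kap_def t_rules[OF u] T11_vac u T22_vac T21_vac D_uminus mval_def
      algebra_simps)

lemma dvac_aop:
  assumes u: "u \<in> D"
  shows "dvac (aop xm u x) = mval xm u * dvac x"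
  by (simp add: mon_def sum_2 th_def not_1_2 kap_def t_rules[OF u] dvac_T11 u dvac_T22 dvac_T12 D_uminus mval_def
      dvac_rules algebra_simps)

lemma cop_vac: "u \<in> D \<Longrightarrow> cop xm u vac = 0"
  using D_uminus[of u] by (simp add: cop_def T21_vac t_rules)

lemma dvac_bop: "u \<in> D \<Longrightarrow> dvac (bop xm u x) = 0"
  using D_uminus[of u] by (simp add: bop_def dvac_T11 dvac_T12 dvac_rules)

lemma half_primal: "refl_half smul c (D - {0}) UNIV (aop xm) (bop xm) vac (mval xm)"
  by unfold_locales (auto simp: D_uminus bop_rules bop_even aop_vac intro: bop_commute aop_bop)

text \<open>A product of operators acts on functionals in reversed order, so \<open>cop\<close>
  takes the part of \<open>bop\<close>, and \<open>cop_aop\<close> that of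
  \<open>aop_bop\<close>.\<close>

lemma half_dual: "refl_half (\<lambda>r \<phi> x. r * \<phi> x) c (D - {0}) {\<phi>. Vector_Spaces.linear smul (*) \<phi>}
    (\<lambda>u \<phi> x. \<phi> (aop xm u x)) (\<lambda>u \<phi> x. \<phi> (cop xm u x)) dvac (mval xm)"
proof -
  have cop_linear: "Vector_Spaces.linear smul smul (cop xm u)" if "u \<in> D" for u
    by (intro Vector_Spaces.linear.intro vs module_hom.intro module_hom_axioms.intro)
      (simp_all add: cop_rules that vs[unfolded vector_space_def, folded module_def])
  show ?thesis
    by unfold_locales
      (auto simp: D_uminus cop_even dvac_linear fun_eq_iff algebra_simps dvac_aop cop_aop linear_rules
        intro: linear_comp[OF cop_linear] arg_cong[OF cop_commute])
qed

lemma transfer_eq: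
  assumes u: "u \<in> D" "u \<noteq> 0"
  shows "refl_transfer smul c xp xm T u x
     = smul (alpha c xp u) (aop xm u x) + smul (alpha c xp (- u)) (aop xm (- u) x)"
proof -
  have k: "K_mat u xm $ 1 $ 1 = xm + u" "K_mat u xm $ 1 $ 2 = 0" "K_mat u xm $ 2 $ 1 = 0" "K_mat u xm $ 2 $ 2 = xm - u" for u xm
    by (simp_all add: K_mat_def)
  have c1: "xp + (u + c/2) + (xp - (u + c/2)) * (c / (2 * u)) = alpha c xp u"
    using u(2) by (simp add: alpha_def field_simps)
  have c2: "(xp - (u + c/2)) * ((2 * u - c) / (2 * u)) = alpha c xp (- u)"
    using u(2) by (simp add: alpha_def field_simps)
  have "refl_transfer smul c xp xm T u x
      = smul (xp + (u + c/2)) (mon xm u 1 1 x) + smul (xp - (u + c/2)) (mon xm u 2 2 x)"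
    unfolding refl_transfer_def op_trace_def op_mult_def[of "lift_mat smul (K_mat (u + c/2) xp)"]
    by (simp add: sum_2 lift_mat_def k refl_monodromy_entry[OF u(1)])
  then show ?thesis
    unfolding c1[symmetric] c2[symmetric] mon22[OF u]
    by (simp add: scale_right_distrib scale_left_distrib add.assoc)
qed

end


subsection \<open>The multiple action\<close>


context refl_half
begin

lemma bv_insert_uminus:
  assumes "finite U" "insert z U \<subseteq> P" "z \<notin> U" "- z \<notin> U"
  shows "bv (insert (- z) U) = bv (insert z U)"
  using bv_insert[of U z] bv_insert[of U "- z"] b_even[of z] P_uminus assms by simp

lemma transfer_bv:
  assumes g: "good_set P (insert z U)" "z \<notin> U"
    and m: "\<And>u. m u = (u + xm - c/2) * a u"
  shows "smul (alpha c xp z) (A z (bv U)) + smul (alpha c xp (- z)) (A (- z) (bv U))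
    = smul (alpha c xp z * (m z * FP c z U) + alpha c xp (- z) * (m (- z) * FP c (- z) U)) (bv U)
    + (\<Sum>u\<in>U. smul (c * (4 * z\<^sup>2 - c\<^sup>2) / (2 * u * (z\<^sup>2 - u\<^sup>2)) * Phi c xp xm a u U)
        (bv (insert z (U - {u}))))"
proof -
  have fin: "finite U" and P: "z \<in> P" "U \<subseteq> P" "- z \<in> P" using g by (auto simp: good_set_def P_uminus)
  have zU: "- z \<notin> U" using g by (auto simp: good_set_def)
  have nz: "z \<noteq> 0" "\<And>u. u \<in> U \<Longrightarrow> u \<noteq> 0" using P P_nz by auto
  have g': "good_set P (insert (- z) U)"
    using g P zU nz(1) by (auto simp: good_set_def)
  have B: "bv (insert (- z) (U - {u})) = bv (insert z (U - {u}))" for u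
    using fin P zU g(2) by (intro bv_insert_uminus) auto
  have coef: "alpha c xp z * acoef z u U + alpha c xp (- z) * acoef (- z) u U
      = c * (4 * z\<^sup>2 - c\<^sup>2) / (2 * u * (z\<^sup>2 - u\<^sup>2)) * Phi c xp xm a u U" if "u \<in> U" for u
  proof -
    have "z \<noteq> u" "z \<noteq> - u" using that g by (auto simp: good_set_def)
    from transfer_coeff[OF nz(1) nz(2)[OF that] this, of c xp "m u * FP c u (U - {u})" "m (- u) * FP c (- u) (U - {u})"]
    show ?thesis by (simp add: acoef_def Phi_def m)
  qed
  have "smul (alpha c xp z) (A z (bv U)) + smul (alpha c xp (- z)) (A (- z) (bv U))
    = smul (alpha c xp z * (m z * FP c z U) + alpha c xp (- z) * (m (- z) * FP c (- z) U)) (bv U)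
    + (\<Sum>u\<in>U. smul (alpha c xp z * acoef z u U + alpha c xp (- z) * acoef (- z) u U) (bv (insert z (U - {u}))))"
    unfolding A_bv[OF g] A_bv[OF g' zU] B
    by (simp add: scale_right_distrib scale_left_distrib scale_sum_right sum.distrib add_ac)
  then show ?thesis by (simp add: coef)
qed

end

text \<open>Each step keeps the current set or trades one element for the next entry of the list.
  The vanishing lets expansions that start from different sets run over one index set.\<close>

lemma action_coeff_eq_0:
  assumes "finite U" "distinct zs" "set zs \<inter> U = {}" "\<not> (W \<subseteq> U \<union> set zs \<and> card W = card U)"
  shows "action_coeff c xp xm l1 l2 zs U W = 0"
  using assms
proof (induction zs arbitrary: U)
  case (Cons z zs)
  have "action_coeff c xp xm l1 l2 zs U W = 0"
    using Cons.prems by (intro Cons.IH) auto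
  moreover have "action_coeff c xp xm l1 l2 zs (insert z (U - {u})) W = 0" if "u \<in> U" for u
  proof -
    have "card (insert z (U - {u})) = card U"
      using Cons.prems that card_Suc_Diff1[of U u] by auto
    then show ?thesis
      using Cons.prems that by (intro Cons.IH) auto
  qed
  ultimately show ?case by simp
qed auto

context generalized_model
begin

abbreviation bvec :: "complex \<Rightarrow> complex set \<Rightarrow> 'h" where
  "bvec xm \<equiv> op_vec (bop xm) vac"

abbreviation Bvec :: "complex \<Rightarrow> complex set \<Rightarrow> 'h" where
  "Bvec xm \<equiv> bethe_vector_of_set smul c xm T vac"

abbreviation tr :: "complex \<Rightarrow> complex \<Rightarrow> complex \<Rightarrow> 'h \<Rightarrow> 'h" where
  "tr xp xm \<equiv> refl_transfer smul c xp xm T"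

text \<open>The condition \<open>c + 2 * x \<noteq> 0\<close> keeps the factor
  \<open>2*u / (c + 2*u)\<close> of the single-action formula finite.\<close>

definition pool :: "complex set \<Rightarrow> bool" where
  "pool S \<longleftrightarrow> good_set (D - {0}) S \<and> (\<forall>x\<in>S. c + 2 * x \<noteq> 0)"

lemma pool_mono: "pool S \<Longrightarrow> V \<subseteq> S \<Longrightarrow> pool V"
  by (auto simp: pool_def intro: good_set_mono)

lemma foldr_mon12:
  assumes "set us \<subseteq> D - {0}"
  shows "bethe_vector smul c xm T vac us = smul (\<Prod>u\<leftarrow>us. c - 2 * u) (foldr (bop xm) us vac)"
  using assms
proof (induction us)
  case (Cons u us)
  then show ?case
    by (simp add: bethe_vector_def refl_monodromy_entry mon12 mon_rules bop_rules mult.commute)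
qed (simp add: bethe_vector_def)

lemma bethe_vector_eq:
  assumes "set us \<subseteq> D - {0}" "distinct us"
  shows "bethe_vector smul c xm T vac us = smul (\<Prod>u\<in>set us. c - 2 * u) (bvec xm (set us))"
  using foldr_mon12[OF assms(1)] comm_family.foldr_bv[OF refl_half.axioms(2)[OF half_primal] assms] assms(2)
  by (simp add: prod.distinct_set_conv_list)

lemma Bvec_eq:
  assumes "finite U" "U \<subseteq> D - {0}"
  shows "Bvec xm U = smul (\<Prod>u\<in>U. c - 2 * u) (bvec xm U)"
proof -
  define us where "us = (SOME us. distinct us \<and> set us = U)"
  have "distinct us \<and> set us = U"
    unfolding us_def by (rule someI_ex) (use finite_distinct_list[OF assms(1)] in auto)
  then show ?thesis
    using bethe_vector_eq[of us xm] assms(2) by (simp add: bethe_vector_of_set_def us_def)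
qed

lemma tr_linear:
  assumes "z \<in> D - {0}"
  shows "tr xp xm z (x + y) = tr xp xm z x + tr xp xm z y" "tr xp xm z (smul r x) = smul r (tr xp xm z x)"
    "tr xp xm z 0 = 0"
  using assms by (simp_all add: transfer_eq mon_rules D_uminus scale_right_distrib add_ac mult.commute)

lemma fold_tr_linear:
  assumes "set zs \<subseteq> D - {0}"
  shows "fold (tr xp xm) zs (x + y) = fold (tr xp xm) zs x + fold (tr xp xm) zs y"
    "fold (tr xp xm) zs (smul r x) = smul r (fold (tr xp xm) zs x)"
    "fold (tr xp xm) zs 0 = 0"
    "fold (tr xp xm) zs (sum f S) = (\<Sum>i\<in>S. fold (tr xp xm) zs (f i))"
proof -
  have *: "fold (tr xp xm) zs (x + y) = fold (tr xp xm) zs x + fold (tr xp xm) zs y"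
    "fold (tr xp xm) zs (smul r x) = smul r (fold (tr xp xm) zs x)"
    "fold (tr xp xm) zs 0 = 0" for x y r
    using assms by (induction zs arbitrary: x y) (simp_all add: tr_linear)
  show "fold (tr xp xm) zs (x + y) = fold (tr xp xm) zs x + fold (tr xp xm) zs y"
    "fold (tr xp xm) zs (smul r x) = smul r (fold (tr xp xm) zs x)"
    "fold (tr xp xm) zs 0 = 0" by (fact *)+
  show "fold (tr xp xm) zs (sum f S) = (\<Sum>i\<in>S. fold (tr xp xm) zs (f i))"
    by (induction S rule: infinite_finite_induct) (simp_all add: *)
qed

text \<open>The single-action formula. A true Bethe vector is the even one multiplied by the factors
  \<open>c - 2 * u\<close>; trading \<open>u\<close> for \<open>z\<close> changes this normalization
  and thereby turns \<open>4 * z^2 - c^2\<close> into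
  \<open>(c + 2 * z) * (2 * u - c)\<close>.\<close>

lemma transfer_Bvec:
  assumes g: "pool (insert z U)" "z \<notin> U"
  shows "tr xp xm z (Bvec xm U) = smul (tau_hat c xp xm l1 l2 z U) (Bvec xm U)
    + (\<Sum>u\<in>U. smul (unwanted_coeff c xp xm l1 l2 z u U) (Bvec xm (insert z (U - {u}))))"
proof -
  interpret h: refl_half smul c "D - {0}" UNIV "aop xm" "bop xm" vac "mval xm"
    by (rule half_primal)
  have g': "good_set (D - {0}) (insert z U)" using g by (simp add: pool_def)
  have fin: "finite U" and P: "z \<in> D" "z \<noteq> 0" "U \<subseteq> D - {0}" using g' by (auto simp: good_set_def)
  define k where "k U = (\<Prod>u\<in>U. c - 2 * u)" for U
  have "tr xp xm z (Bvec xm U) = smul (k U) (tr xp xm z (bvec xm U))"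
    using fin P by (simp add: Bvec_eq tr_linear k_def)
  also have "tr xp xm z (bvec xm U) = smul (tau_hat c xp xm l1 l2 z U) (bvec xm U)
    + (\<Sum>u\<in>U. smul (c * (4 * z\<^sup>2 - c\<^sup>2) / (2 * u * (z\<^sup>2 - u\<^sup>2)) * Phi c xp xm (\<lambda>x. l1 x * l2 (- x)) u U)
        (bvec xm (insert z (U - {u}))))"
    unfolding transfer_eq[OF P(1,2)] tau_hat_alt
    by (subst h.transfer_bv[OF g' g(2), of xm "\<lambda>x. l1 x * l2 (- x)"]) (simp_all add: mval_def)
  finally have "tr xp xm z (Bvec xm U) = smul (tau_hat c xp xm l1 l2 z U) (Bvec xm U)
    + (\<Sum>u\<in>U. smul (k U * (c * (4 * z\<^sup>2 - c\<^sup>2) / (2 * u * (z\<^sup>2 - u\<^sup>2)) * Phi c xp xm (\<lambda>x. l1 x * l2 (- x)) u U))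
        (bvec xm (insert z (U - {u}))))"
    using fin P by (simp add: Bvec_eq scale_right_distrib scale_sum_right k_def mult.commute)
  also have "(\<Sum>u\<in>U. smul (k U * (c * (4 * z\<^sup>2 - c\<^sup>2) / (2 * u * (z\<^sup>2 - u\<^sup>2)) * Phi c xp xm (\<lambda>x. l1 x * l2 (- x)) u U))
        (bvec xm (insert z (U - {u}))))
    = (\<Sum>u\<in>U. smul (unwanted_coeff c xp xm l1 l2 z u U) (Bvec xm (insert z (U - {u}))))"
  proof (intro sum.cong refl)
    fix u assume u: "u \<in> U"
    have ne: "- u \<notin> U" "z \<noteq> u" "z \<noteq> - u" "c + 2 * u \<noteq> 0"
      using g u by (auto simp: good_set_def pool_def)
    have k1: "k U = (c - 2 * u) * k (U - {u})"
      unfolding k_def using fin u by (rule prod.remove)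
    have "Bvec xm (insert z (U - {u})) = smul ((c - 2 * z) * k (U - {u})) (bvec xm (insert z (U - {u})))"
      using fin P g(2) by (subst Bvec_eq) (auto simp: k_def)
    moreover have "(c - 2 * u) * k (U - {u}) * (c * (4 * z\<^sup>2 - c\<^sup>2) / (2 * u * (z\<^sup>2 - u\<^sup>2)) * Phi c xp xm (\<lambda>x. l1 x * l2 (- x)) u U)
      = unwanted_coeff c xp xm l1 l2 z u U * ((c - 2 * z) * k (U - {u}))"
    proof -
      have "(c - 2 * u) * K * (c * (4 * z\<^sup>2 - c\<^sup>2) / Q * X) = c * (c + 2 * z) * (2 * u - c) / Q * X * ((c - 2 * z) * K)"
        for K Q X by (cases "Q = 0") (simp_all add: field_simps power2_eq_square)
      then show ?thesis
        unfolding unwanted_coeff_alt[OF fin u ne(1) c_nonzero ne(4,2,3)] .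
    qed
    ultimately show "smul (k U * (c * (4 * z\<^sup>2 - c\<^sup>2) / (2 * u * (z\<^sup>2 - u\<^sup>2)) * Phi c xp xm (\<lambda>x. l1 x * l2 (- x)) u U))
        (bvec xm (insert z (U - {u})))
      = smul (unwanted_coeff c xp xm l1 l2 z u U) (Bvec xm (insert z (U - {u})))"
      by (simp add: k1)
  qed
  finally show ?thesis .
qed

lemma fold_transfer:
  assumes "pool (U \<union> set zs)" "distinct zs" "set zs \<inter> U = {}"
  shows "fold (tr xp xm) zs (Bvec xm U) = (\<Sum>W\<in>{W. W \<subseteq> U \<union> set zs \<and> card W = card U}.
      smul (action_coeff c xp xm l1 l2 zs U W) (Bvec xm W))"
  using assms
proof (induction zs arbitrary: U)
  case Nil
  then have "finite U" by (simp add: pool_def good_set_def)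
  then have "{W. W \<subseteq> U \<and> card W = card U} = {U}"
    by (auto dest: card_subset_eq)
  then show ?case by simp
next
  case (Cons z zs)
  define S where "S = {W. W \<subseteq> U \<union> set (z # zs) \<and> card W = card U}"
  have fin: "finite U" using Cons.prems by (simp add: pool_def good_set_def)
  then have finS: "finite S" by (simp add: S_def)
  have P: "set zs \<subseteq> D - {0}" using Cons.prems by (auto simp: pool_def good_set_def)
  have IH: "fold (tr xp xm) zs (Bvec xm U') = (\<Sum>W\<in>S. smul (action_coeff c xp xm l1 l2 zs U' W) (Bvec xm W))"
    if "U' \<union> set zs \<subseteq> U \<union> set (z # zs)" "set zs \<inter> U' = {}" "card U' = card U" "finite U'" for U'
  proof -
    have "fold (tr xp xm) zs (Bvec xm U') = (\<Sum>W\<in>{W. W \<subseteq> U' \<union> set zs \<and> card W = card U'}.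
      smul (action_coeff c xp xm l1 l2 zs U' W) (Bvec xm W))"
      using Cons.prems that by (intro Cons.IH) (auto intro: pool_mono)
    also have "\<dots> = (\<Sum>W\<in>S. smul (action_coeff c xp xm l1 l2 zs U' W) (Bvec xm W))"
    proof (intro sum.mono_neutral_left ballI)
      fix W assume W: "W \<in> S - {W. W \<subseteq> U' \<union> set zs \<and> card W = card U'}"
      have "action_coeff c xp xm l1 l2 zs U' W = 0"
        by (rule action_coeff_eq_0) (use that W Cons.prems in \<open>auto simp: S_def\<close>)
      then show "smul (action_coeff c xp xm l1 l2 zs U' W) (Bvec xm W) = 0" by simp
    next
      show "{W. W \<subseteq> U' \<union> set zs \<and> card W = card U'} \<subseteq> S"
        using that by (auto simp: S_def)
    qed (rule finS)
    finally show ?thesis .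
  qed
  have "fold (tr xp xm) (z # zs) (Bvec xm U) = fold (tr xp xm) zs (smul (tau_hat c xp xm l1 l2 z U) (Bvec xm U)
    + (\<Sum>u\<in>U. smul (unwanted_coeff c xp xm l1 l2 z u U) (Bvec xm (insert z (U - {u})))))"
    using Cons.prems by (subst transfer_Bvec[symmetric]) (auto intro: pool_mono)
  also have "\<dots> = smul (tau_hat c xp xm l1 l2 z U) (fold (tr xp xm) zs (Bvec xm U))
    + (\<Sum>u\<in>U. smul (unwanted_coeff c xp xm l1 l2 z u U) (fold (tr xp xm) zs (Bvec xm (insert z (U - {u})))))"
    by (simp add: fold_tr_linear[OF P])
  also have "\<dots> = smul (tau_hat c xp xm l1 l2 z U) (\<Sum>W\<in>S. smul (action_coeff c xp xm l1 l2 zs U W) (Bvec xm W))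
    + (\<Sum>u\<in>U. smul (unwanted_coeff c xp xm l1 l2 z u U)
        (\<Sum>W\<in>S. smul (action_coeff c xp xm l1 l2 zs (insert z (U - {u})) W) (Bvec xm W)))"
  proof (intro arg_cong2[where f="(+)"] arg_cong[where f="smul _"] sum.cong refl)
    show "fold (tr xp xm) zs (Bvec xm U) = (\<Sum>W\<in>S. smul (action_coeff c xp xm l1 l2 zs U W) (Bvec xm W))"
      using Cons.prems fin by (intro IH) auto
    fix u assume u: "u \<in> U"
    have "card (insert z (U - {u})) = card U"
      using Cons.prems u fin card_Suc_Diff1[of U u] by auto
    then show "fold (tr xp xm) zs (Bvec xm (insert z (U - {u})))
      = (\<Sum>W\<in>S. smul (action_coeff c xp xm l1 l2 zs (insert z (U - {u})) W) (Bvec xm W))"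
      using Cons.prems fin by (intro IH) auto
  qed
  also have "\<dots> = (\<Sum>W\<in>S. smul (action_coeff c xp xm l1 l2 (z # zs) U W) (Bvec xm W))"
    by (simp add: scale_sum_right sum.distrib scale_left_distrib scale_sum_left sum.swap[of _ S U])
  finally show ?case by (simp add: S_def)
qed

theorem multiple_action:
  assumes len: "length us = n" "length vs = n" and D: "set us \<union> set vs \<subseteq> D"
    and gen: "generic_parameters c us vs"
  shows "fold (tr xp xm) vs (bethe_vector smul c xm T vac us)
       = (\<Sum>etaII \<in> {W. W \<subseteq> set us \<union> set vs \<and> card (set us \<union> set vs - W) = card W}.
            smul (R_hat c xp xm l1 l2 vs (set us \<union> set vs - etaII) etaII) (Bvec xm etaII))"
proof -
  have dist: "distinct us" "distinct vs" "set us \<inter> set vs = {}"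
    and neg: "\<And>x y. x \<in> set us \<union> set vs \<Longrightarrow> y \<in> set us \<union> set vs \<Longrightarrow> x \<noteq> - y"
    using gen by (auto simp: generic_parameters_def)
  have nz: "0 \<notin> set us \<union> set vs" using neg[of 0 0] by auto
  have pool: "pool (set us \<union> set vs)"
    unfolding pool_def good_set_def
  proof (intro conjI ballI)
    show "set us \<union> set vs \<subseteq> D - {0}" using D nz by auto
    show "- x \<notin> set us \<union> set vs" if "x \<in> set us \<union> set vs" for x
      using neg[of "- x" x] that by blast
    show "c + 2 * x \<noteq> 0" if "x \<in> set us \<union> set vs" for x
      using gen that by (simp add: generic_parameters_def)
  qed simp
  have us: "bethe_vector smul c xm T vac us = Bvec xm (set us)"
  proof -
    have "set us \<subseteq> D - {0}" using D nz by blast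
    then show ?thesis using bethe_vector_eq[of us xm] Bvec_eq[of "set us" xm] dist by simp
  qed
  have card: "card (set us \<union> set vs) = 2 * n" "card (set us) = n"
    using dist len by (simp_all add: card_Un_disjoint distinct_card)
  \<comment> \<open>As the whole set has \<open>2 * n\<close> elements, a partition into equal
    halves means that \<open>W\<close> is as large as the initial set.\<close>
  have S: "{W. W \<subseteq> set us \<union> set vs \<and> card (set us \<union> set vs - W) = card W}
      = {W. W \<subseteq> set us \<union> set vs \<and> card W = card (set us)}"
  proof (intro Collect_cong conj_cong refl)
    fix W assume W: "W \<subseteq> set us \<union> set vs"
    then have "finite W" by (rule finite_subset) auto
    then have "card (set us \<union> set vs - W) = 2 * n - card W" "card W \<le> 2 * n"
      using W card(1) card_mono[OF _ W] by (simp_all add: card_Diff_subset)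
    then show "(card (set us \<union> set vs - W) = card W) = (card W = card (set us))"
      using card(2) by auto
  qed
  have R: "R_hat c xp xm l1 l2 vs (set us \<union> set vs - W) W = action_coeff c xp xm l1 l2 vs (set us) W"
    if "W \<subseteq> set us \<union> set vs" for W
  proof -
    have "set us \<union> set vs - W \<union> W - set vs = set us" using that dist(3) by auto
    then show ?thesis by (simp add: R_hat_def)
  qed
  show ?thesis
    unfolding us S fold_transfer[OF pool dist(2) dist(3)[unfolded Int_commute[of "set us"]]]
    by (intro sum.cong refl) (simp add: R)
qed

end


subsection \<open>Linear relations for the coefficients\<close>


text \<open>The counterpart of \<open>pool\<close> without reference to the domain \<open>D\<close>,
  since the coefficients are defined for all parameters.\<close>

definition gset :: "complex \<Rightarrow> complex set \<Rightarrow> bool" where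
  "gset c Q \<longleftrightarrow> finite Q \<and> (\<forall>x\<in>Q. - x \<notin> Q \<and> c + 2 * x \<noteq> 0)"

lemma gset_mono: "gset c S \<Longrightarrow> V \<subseteq> S \<Longrightarrow> gset c V"
  by (auto simp: gset_def intro: finite_subset)

lemma gsetD:
  assumes "gset c Q" "x \<in> Q"
  shows "x \<noteq> 0" "c + 2 * x \<noteq> 0" "y \<in> Q \<Longrightarrow> x \<noteq> - y"
  using assms by (auto simp: gset_def)

lemma gset_sq:
  assumes "gset c Q" "x \<in> Q" "y \<in> Q" "x \<noteq> y"
  shows "x\<^sup>2 - y\<^sup>2 \<noteq> 0"
  using assms by (auto simp: gset_def power2_eq_iff)

text \<open>This is f(- u, u), the factor that a parameter contributes to its own residue.\<close>

definition wf_coeff :: "complex \<Rightarrow> complex \<Rightarrow> complex" where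
  "wf_coeff c u = (2 * u - c) / (2 * u)"

lemma unwanted_coeff_gset:
  assumes "gset c (insert z U)" "c \<noteq> 0" "u \<in> U" "z \<notin> U"
  shows "unwanted_coeff c xp xm l1 l2 z u U
    = c * (c + 2 * z) * (wf_coeff c u / (z\<^sup>2 - u\<^sup>2) * Phi c xp xm (\<lambda>x. l1 x * l2 (- x)) u U)"
  using assms by (subst unwanted_coeff_alt) (auto simp: gset_def wf_coeff_def)

lemma FP_insert: "finite U \<Longrightarrow> x \<notin> U \<Longrightarrow> FP c z (insert x U) = Fr c x z * FP c z U"
  by (simp add: FP_def)

lemma Fr_diff:
  assumes "z\<^sup>2 \<noteq> x\<^sup>2" "z\<^sup>2 \<noteq> u\<^sup>2"
  shows "(Fr c x z - Fr c u z) * ((z\<^sup>2 - x\<^sup>2) * (z\<^sup>2 - u\<^sup>2)) = c * (c - 2 * z) * (x\<^sup>2 - u\<^sup>2)"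
proof -
  have gen: "((p - x) / (b - x) - (p - u) / (b - u)) * ((b - x) * (b - u)) = (p - b) * (x - u)"
    if "b \<noteq> x" "b \<noteq> u" for p b x u :: complex
  proof -
    have "b - x \<noteq> 0" "b - u \<noteq> 0" using that by auto
    then show ?thesis by (simp add: diff_divide_distrib[symmetric] divide_simps) (simp add: algebra_simps)
  qed
  show ?thesis unfolding Fr_def gen[OF assms] by (simp add: power2_eq_square algebra_simps)
qed

text \<open>Everything is written in squares: \<open>a\<close>, \<open>b\<close>, \<open>U\<close>,
  \<open>W\<close> stand for \<open>z1^2\<close>, \<open>z2^2\<close>, \<open>u^2\<close>,
  \<open>w^2\<close>, and \<open>p\<close>, \<open>q\<close> for \<open>(u - c)^2\<close> and
  \<open>(w - c)^2\<close> with either sign of \<open>u\<close> and \<open>w\<close>. Over a common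
  denominator symmetric in \<open>a\<close> and \<open>b\<close> the numerators agree.\<close>

lemma exchange_symmetry:
  fixes a b U W p q :: complex
  assumes "a \<noteq> U" "a \<noteq> W" "b \<noteq> U" "b \<noteq> W" "U \<noteq> W"
  shows "(p - W) / (U - W) * ((q - a) / (W - a)) / ((a - U) * (b - W))
       + (q - U) / (W - U) * ((p - a) / (U - a)) / ((a - W) * (b - U))
     = (p - W) / (U - W) * ((q - b) / (W - b)) / ((b - U) * (a - W))
       + (q - U) / (W - U) * ((p - b) / (U - b)) / ((b - W) * (a - U))"
proof -
  have nz: "a - U \<noteq> 0" "a - W \<noteq> 0" "b - U \<noteq> 0" "b - W \<noteq> 0" "U - W \<noteq> 0" using assms by auto
  define K where "K = (U - W) * ((a - U) * (a - W) * ((b - U) * (b - W)))"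
  have E: "(p - W) / (U - W) * ((q - a) / (W - a)) / ((a - U) * (b - W))
       + (q - U) / (W - U) * ((p - a) / (U - a)) / ((a - W) * (b - U))
     = ((q - U) * (p - a) * (b - W) - (p - W) * (q - a) * (b - U)) / K"
    if nz: "a - U \<noteq> 0" "a - W \<noteq> 0" "b - U \<noteq> 0" "b - W \<noteq> 0" "U - W \<noteq> 0"
      and K: "K = (U - W) * ((a - U) * (a - W) * ((b - U) * (b - W)))"
    for a b K :: complex
  proof -
    have gen: "x / D * (y / (- e)) / (d * f) = - (x * y * h / (D * (d * e * (h * f))))"
      "x / (- D) * (y / (- d)) / (e * h) = x * y * f / (D * (d * e * (h * f)))"
      if "D \<noteq> 0" "d \<noteq> 0" "e \<noteq> 0" "h \<noteq> 0" "f \<noteq> 0" for x y D d e h f :: complex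
      using that by (simp_all add: field_simps)
    have "(p - W) / (U - W) * ((q - a) / (W - a)) / ((a - U) * (b - W)) = - ((p - W) * (q - a) * (b - U) / K)"
      unfolding K using gen(1)[OF nz(5,1-4), of "p - W" "q - a"] by (simp only: minus_diff_eq)
    moreover have "(q - U) / (W - U) * ((p - a) / (U - a)) / ((a - W) * (b - U)) = (q - U) * (p - a) * (b - W) / K"
      unfolding K using gen(2)[OF nz(5,1-4), of "q - U" "p - a"] by (simp only: minus_diff_eq)
    ultimately show ?thesis by (simp add: diff_divide_distrib)
  qed
  show ?thesis
    unfolding E[OF nz K_def] E[OF nz(3,4,1,2,5) K_def[unfolded mult.commute[of "(a - U) * (a - W)"]]]
    by (simp add: algebra_simps)
qed

text \<open>Concerns the terms in which \<open>u\<close> ends up replaced by \<open>z1\<close>. If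
  \<open>z2\<close> acts first, this also happens by way of \<open>z2\<close>; the detour accounts
  for the change of the eigenvalue at \<open>z2\<close> caused by the replacement.\<close>

lemma unwanted_tau:
  assumes g: "gset c (insert z1 (insert z2 U))" "c \<noteq> 0" and z: "z1 \<noteq> z2" "z1 \<notin> U" "z2 \<notin> U" and u: "u \<in> U"
  shows "unwanted_coeff c xp xm l1 l2 z1 u U
      * (tau_hat c xp xm l1 l2 z2 (insert z1 (U - {u})) - tau_hat c xp xm l1 l2 z2 U)
    = unwanted_coeff c xp xm l1 l2 z2 u U * unwanted_coeff c xp xm l1 l2 z1 z2 (insert z2 (U - {u}))"
proof -
  let ?a = "\<lambda>x. l1 x * l2 (- x)"
  have fin: "finite U" using g by (simp add: gset_def)
  have nz: "z2 \<noteq> 0" using g(1) gsetD(1) by blast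
  have sq: "z1\<^sup>2 - z2\<^sup>2 \<noteq> 0" "z2\<^sup>2 - z1\<^sup>2 \<noteq> 0" "z1\<^sup>2 - u\<^sup>2 \<noteq> 0" "z2\<^sup>2 - u\<^sup>2 \<noteq> 0"
    using gset_sq[OF g(1), of z1 z2] gset_sq[OF g(1), of z1 u] gset_sq[OF g(1), of z2 u] z u by auto
  then have sq': "z2\<^sup>2 \<noteq> z1\<^sup>2" "z2\<^sup>2 \<noteq> u\<^sup>2" "(- z2)\<^sup>2 \<noteq> z1\<^sup>2" "(- z2)\<^sup>2 \<noteq> u\<^sup>2" by auto
  define P1 where "P1 = FP c z2 (U - {u})"
  define P2 where "P2 = FP c (- z2) (U - {u})"
  define m1 where "m1 = (z2 + xm - c/2) * ?a z2 * P1"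
  define m2 where "m2 = (- z2 + xm - c/2) * (l1 (- z2) * l2 z2) * P2"
  define X1 where "X1 = z2 + xp - c/2"
  define X2 where "X2 = - z2 + xp - c/2"
  have F: "FP c z2 (insert z1 (U - {u})) = Fr c z1 z2 * P1" "FP c (- z2) (insert z1 (U - {u})) = Fr c z1 (- z2) * P2"
    "FP c z2 U = Fr c u z2 * P1" "FP c (- z2) U = Fr c u (- z2) * P2"
    using fin z u by (simp_all add: FP_insert FP_remove[of U u] P1_def P2_def)
  have a: "alpha c xp z2 = (2 * z2 + c) / (2 * z2) * X1" "alpha c xp (- z2) = (2 * z2 - c) / (2 * z2) * X2"
    using nz by (simp_all add: alpha_def X1_def X2_def field_simps)
  have gen0: "k1 * X1 * (y1 * (F1 * P1)) + k2 * X2 * (y2 * (F2 * P2))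
      - (k1 * X1 * (y1 * (F3 * P1)) + k2 * X2 * (y2 * (F4 * P2)))
    = k1 * X1 * (y1 * P1) * (F1 - F3) + k2 * X2 * (y2 * P2) * (F2 - F4)"
    for k1 X1 y1 F1 P1 k2 X2 y2 F2 P2 F3 F4 :: complex
    by (simp add: algebra_simps)
  have "tau_hat c xp xm l1 l2 z2 (insert z1 (U - {u})) - tau_hat c xp xm l1 l2 z2 U
    = (2 * z2 + c) / (2 * z2) * X1 * m1 * (Fr c z1 z2 - Fr c u z2)
    + (2 * z2 - c) / (2 * z2) * X2 * m2 * (Fr c z1 (- z2) - Fr c u (- z2))"
    unfolding tau_hat_alt F a m1_def m2_def by (rule gen0)
  then have "(tau_hat c xp xm l1 l2 z2 (insert z1 (U - {u})) - tau_hat c xp xm l1 l2 z2 U) * ((z2\<^sup>2 - z1\<^sup>2) * (z2\<^sup>2 - u\<^sup>2))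
    = (2 * z2 + c) / (2 * z2) * X1 * m1 * ((Fr c z1 z2 - Fr c u z2) * ((z2\<^sup>2 - z1\<^sup>2) * (z2\<^sup>2 - u\<^sup>2)))
    + (2 * z2 - c) / (2 * z2) * X2 * m2 * ((Fr c z1 (- z2) - Fr c u (- z2)) * (((- z2)\<^sup>2 - z1\<^sup>2) * ((- z2)\<^sup>2 - u\<^sup>2)))"
    by (simp only: distrib_right mult.assoc power2_minus)
  also have "\<dots> = - c * (c + 2 * z2) * wf_coeff c z2 * (z1\<^sup>2 - u\<^sup>2) * (X1 * m1 - X2 * m2)"
    unfolding Fr_diff[OF sq'(1,2)] Fr_diff[OF sq'(3,4)] using nz
    by (simp add: wf_coeff_def divide_simps) (simp add: algebra_simps)
  also have "X1 * m1 - X2 * m2 = Phi c xp xm ?a z2 (insert z2 (U - {u}))"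
  proof -
    have "insert z2 (U - {u}) - {z2} = U - {u}" using z by auto
    then show ?thesis by (simp add: Phi_def X1_def X2_def m1_def m2_def P1_def P2_def)
  qed
  finally have T0: "(tau_hat c xp xm l1 l2 z2 (insert z1 (U - {u})) - tau_hat c xp xm l1 l2 z2 U)
      * ((z2\<^sup>2 - z1\<^sup>2) * (z2\<^sup>2 - u\<^sup>2))
    = - c * (c + 2 * z2) * wf_coeff c z2 * (z1\<^sup>2 - u\<^sup>2) * Phi c xp xm ?a z2 (insert z2 (U - {u}))" .
  have Q: "(z2\<^sup>2 - z1\<^sup>2) * (z2\<^sup>2 - u\<^sup>2) \<noteq> 0" using sq by simp
  have T: "tau_hat c xp xm l1 l2 z2 (insert z1 (U - {u})) - tau_hat c xp xm l1 l2 z2 U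
    = - c * (c + 2 * z2) * wf_coeff c z2 * (z1\<^sup>2 - u\<^sup>2) * Phi c xp xm ?a z2 (insert z2 (U - {u}))
      / ((z2\<^sup>2 - z1\<^sup>2) * (z2\<^sup>2 - u\<^sup>2))"
    unfolding nonzero_eq_divide_eq[OF Q] by (rule T0)
  have g1: "gset c (insert z1 U)" "gset c (insert z2 U)" "gset c (insert z1 (insert z2 (U - {u})))"
    using g(1) by (auto elim: gset_mono)
  have w: "unwanted_coeff c xp xm l1 l2 z1 u U = c * (c + 2 * z1) * (wf_coeff c u / (z1\<^sup>2 - u\<^sup>2) * Phi c xp xm ?a u U)"
    "unwanted_coeff c xp xm l1 l2 z2 u U = c * (c + 2 * z2) * (wf_coeff c u / (z2\<^sup>2 - u\<^sup>2) * Phi c xp xm ?a u U)"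
    "unwanted_coeff c xp xm l1 l2 z1 z2 (insert z2 (U - {u}))
      = c * (c + 2 * z1) * (wf_coeff c z2 / (z1\<^sup>2 - z2\<^sup>2) * Phi c xp xm ?a z2 (insert z2 (U - {u})))"
    by (rule unwanted_coeff_gset[OF g1(1) g(2) u z(2)], rule unwanted_coeff_gset[OF g1(2) g(2) u z(3)],
        rule unwanted_coeff_gset[OF g1(3) g(2)]) (use z u in auto)
  have gen: "C1 * (h / d1 * Q) * (- c * C2 * k * d1 * R / (e * d2)) = C2' * (h / d2 * Q) * (C1 * (k / e' * R))"
    if "e' = - e" "d1 \<noteq> 0" "C2' = c * C2" for C1 C2 C2' h d1 d2 k e e' Q R :: complex
    using that by (simp add: field_simps)
  show ?thesis
    unfolding w T by (rule gen) (use sq in simp_all)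
qed

text \<open>Concerns the terms in which both \<open>u\<close> and \<open>w\<close> are replaced; the
  two orders of replacement have to be added. Each \<open>Phi\<close> is a difference of two terms,
  and for each of the four choices of signs the sum is symmetric by
  \<open>exchange_symmetry\<close>.\<close>

lemma unwanted_unwanted:
  assumes g: "gset c (insert z1 (insert z2 U))" "c \<noteq> 0" and z: "z1 \<noteq> z2" "z1 \<notin> U" "z2 \<notin> U"
    and u: "u \<in> U" "w \<in> U" "u \<noteq> w"
    and G_def: "G = (\<lambda>z1 z2 u w. unwanted_coeff c xp xm l1 l2 z1 u U * unwanted_coeff c xp xm l1 l2 z2 w (insert z1 (U - {u})))"
  shows "G z1 z2 u w + G z1 z2 w u = G z2 z1 u w + G z2 z1 w u"
proof -
  let ?a = "\<lambda>x. l1 x * l2 (- x)"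
  have fin: "finite U" using g by (simp add: gset_def)
  define P where "P = U - {u, w}"
  define M where "M x = (x + xp - c/2) * ((x + xm - c/2) * ?a x * FP c x P)" for x
  have Phi1: "Phi c xp xm ?a x U = M x * Fr c y x - M (- x) * Fr c y (- x)"
    if "x \<in> U" "y \<in> U" "x \<noteq> y" "P = U - {x, y}" for x y
  proof -
    have "U - {x} = insert y P" "y \<notin> P" "finite P" using that fin by auto
    then show ?thesis by (simp add: Phi_def M_def FP_insert algebra_simps)
  qed
  have Phi2: "Phi c xp xm ?a y (insert z (U - {x})) = M y * Fr c z y - M (- y) * Fr c z (- y)"
    if "x \<in> U" "y \<in> U" "x \<noteq> y" "z \<notin> U" "P = U - {x, y}" for x y z
  proof -
    have "insert z (U - {x}) - {y} = insert z P" "z \<notin> P" "finite P" using that fin by auto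
    then show ?thesis by (simp add: Phi_def M_def FP_insert algebra_simps)
  qed
  have sq: "x\<^sup>2 - y\<^sup>2 \<noteq> 0" if "x \<in> insert z1 (insert z2 U)" "y \<in> insert z1 (insert z2 U)" "x \<noteq> y" for x y
    using gset_sq[OF g(1) that] .
  have G: "G x1 x2 x y = c * (c + 2 * x1) * (c * (c + 2 * x2)) * (wf_coeff c x * wf_coeff c y)
      * ((M x * Fr c y x - M (- x) * Fr c y (- x)) * (M y * Fr c x1 y - M (- y) * Fr c x1 (- y))
       / ((x1\<^sup>2 - x\<^sup>2) * (x2\<^sup>2 - y\<^sup>2)))"
    if "{x1, x2} = {z1, z2}" "{x, y} = {u, w}" for x1 x2 x y
  proof -
    have xy: "x \<in> U" "y \<in> U" "x \<noteq> y" "P = U - {x, y}" "x1 \<notin> U" "x2 \<notin> U" "x1 \<noteq> x2"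
      using that u z by (auto simp: P_def doubleton_eq_iff)
    have "insert x1 U \<subseteq> insert z1 (insert z2 U)" "insert x2 (insert x1 (U - {x})) \<subseteq> insert z1 (insert z2 U)"
      using that(1) by (auto simp: doubleton_eq_iff)
    then have g': "gset c (insert x1 U)" "gset c (insert x2 (insert x1 (U - {x})))"
      using g(1) by (auto elim: gset_mono)
    have w: "unwanted_coeff c xp xm l1 l2 x1 x U = c * (c + 2 * x1) * (wf_coeff c x / (x1\<^sup>2 - x\<^sup>2) * Phi c xp xm ?a x U)"
      "unwanted_coeff c xp xm l1 l2 x2 y (insert x1 (U - {x}))
        = c * (c + 2 * x2) * (wf_coeff c y / (x2\<^sup>2 - y\<^sup>2) * Phi c xp xm ?a y (insert x1 (U - {x})))"
      by (rule unwanted_coeff_gset[OF g'(1) g(2) xy(1,5)], rule unwanted_coeff_gset[OF g'(2) g(2)])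
        (use xy in auto)
    show ?thesis
      unfolding G_def w Phi1[OF xy(1-4)] Phi2[OF xy(1-3,5,4)] by simp
  qed
  define E where "E a b p q = Fr c w p * Fr c a q / ((a\<^sup>2 - u\<^sup>2) * (b\<^sup>2 - w\<^sup>2))
      + Fr c u q * Fr c a p / ((a\<^sup>2 - w\<^sup>2) * (b\<^sup>2 - u\<^sup>2))" for a b p q
  have E: "E z1 z2 p q = E z2 z1 p q" if "p \<in> {u, - u}" "q \<in> {w, - w}" for p q
  proof -
    have pq: "p\<^sup>2 = u\<^sup>2" "q\<^sup>2 = w\<^sup>2" using that by auto
    have ne: "z1\<^sup>2 \<noteq> u\<^sup>2" "z1\<^sup>2 \<noteq> w\<^sup>2" "z2\<^sup>2 \<noteq> u\<^sup>2" "z2\<^sup>2 \<noteq> w\<^sup>2" "u\<^sup>2 \<noteq> w\<^sup>2"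
      using sq[of z1 u] sq[of z1 w] sq[of z2 u] sq[of z2 w] sq[of u w] z u by auto
    show ?thesis
      using exchange_symmetry[OF ne, of "(p - c)\<^sup>2" "(q - c)\<^sup>2"]
      by (simp add: E_def Fr_def pq)
  qed
  have K: "((a * x - a' * x') * (b * y - b' * y') / d + (b * v - b' * v') * (a * s - a' * s') / e :: complex)
     = a * b * (x * y / d + v * s / e) - a * b' * (x * y' / d + v' * s / e)
     - a' * b * (x' * y / d + v * s' / e) + a' * b' * (x' * y' / d + v' * s' / e)"
    for a a' b b' x x' y y' v v' s s' d e :: complex
    by (simp add: algebra_simps add_divide_distrib diff_divide_distrib)
  have S': "G a b u w + G a b w u = c * (c + 2 * a) * (c * (c + 2 * b)) * (wf_coeff c u * wf_coeff c w)
      * (M u * M w * E a b u w - M u * M (- w) * E a b u (- w) - M (- u) * M w * E a b (- u) w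
         + M (- u) * M (- w) * E a b (- u) (- w))"
    if "{a, b} = {z1, z2}" for a b
  proof -
    have 1: "G a b u w = c * (c + 2 * a) * (c * (c + 2 * b)) * (wf_coeff c u * wf_coeff c w)
      * ((M u * Fr c w u - M (- u) * Fr c w (- u)) * (M w * Fr c a w - M (- w) * Fr c a (- w))
       / ((a\<^sup>2 - u\<^sup>2) * (b\<^sup>2 - w\<^sup>2)))" by (rule G[OF that]) simp
    have 2: "G a b w u = c * (c + 2 * a) * (c * (c + 2 * b)) * (wf_coeff c w * wf_coeff c u)
      * ((M w * Fr c u w - M (- w) * Fr c u (- w)) * (M u * Fr c a u - M (- u) * Fr c a (- u))
       / ((a\<^sup>2 - w\<^sup>2) * (b\<^sup>2 - u\<^sup>2)))" by (rule G[OF that]) auto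
    show ?thesis
      unfolding 1 2 E_def K[symmetric] mult.commute[of "wf_coeff c w" "wf_coeff c u"] by (simp only: distrib_left)
  qed
  show ?thesis
    unfolding S'[OF refl] S'[OF insert_commute]
    by (simp add: E)
qed

text \<open>Commutativity of the transfer matrices at the level of coefficients. The action on Bethe
  vectors does not yield it, as these need not be independent.\<close>

lemma action_coeff_swap:
  assumes g: "gset c (insert z1 (insert z2 U))" "c \<noteq> 0" and z: "z1 \<noteq> z2" "z1 \<notin> U" "z2 \<notin> U"
  shows "action_coeff c xp xm l1 l2 (z1 # z2 # zs) U W = action_coeff c xp xm l1 l2 (z2 # z1 # zs) U W"
proof -
  let ?t = "tau_hat c xp xm l1 l2" and ?w = "unwanted_coeff c xp xm l1 l2"
  define ac where "ac S = action_coeff c xp xm l1 l2 zs S W" for S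
  have fin: "finite U" using g by (simp add: gset_def)
  define H where "H a b u w = ?w a u U * ?w b w (insert a (U - {u}))" for a b u w
  define X where "X u w = ac (insert z1 (insert z2 (U - {u, w})))" for u w
  have expand: "action_coeff c xp xm l1 l2 (a # b # zs) U W
     = ?t a U * ?t b U * ac U
     + (\<Sum>u\<in>U. (?t a U * ?w b u U + ?w a u U * ?w b a (insert a (U - {u}))) * ac (insert b (U - {u})))
     + (\<Sum>u\<in>U. ?w a u U * ?t b (insert a (U - {u})) * ac (insert a (U - {u})))
     + (\<Sum>u\<in>U. \<Sum>w\<in>U - {u}. H a b u w * X u w)"
    if ab: "{a, b} = {z1, z2}" for a b
  proof -
    have nin: "a \<notin> U" "b \<notin> U" "a \<noteq> b" using ab z by (auto simp: doubleton_eq_iff)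
    have inner: "(\<Sum>w\<in>insert a (U - {u}). ?w b w (insert a (U - {u})) * ac (insert b (insert a (U - {u}) - {w})))
      = ?w b a (insert a (U - {u})) * ac (insert b (U - {u}))
       + (\<Sum>w\<in>U - {u}. ?w b w (insert a (U - {u})) * X u w)" if "u \<in> U" for u
    proof -
      have "insert a (U - {u}) - {a} = U - {u}" using nin by auto
      moreover have "ac (insert b (insert a (U - {u}) - {w})) = X u w" if "w \<in> U - {u}" for w
      proof -
        have "insert b (insert a (U - {u}) - {w}) = insert z1 (insert z2 (U - {u, w}))"
          using ab nin that by (auto simp: doubleton_eq_iff)
        then show ?thesis by (simp add: X_def)
      qed
      ultimately show ?thesis using fin nin by simp
    qed
    have "action_coeff c xp xm l1 l2 (a # b # zs) U W
      = ?t a U * (?t b U * ac U + (\<Sum>u\<in>U. ?w b u U * ac (insert b (U - {u}))))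
      + (\<Sum>u\<in>U. ?w a u U * (?t b (insert a (U - {u})) * ac (insert a (U - {u}))
         + (?w b a (insert a (U - {u})) * ac (insert b (U - {u}))
          + (\<Sum>w\<in>U - {u}. ?w b w (insert a (U - {u})) * X u w))))"
      using inner by (simp add: ac_def)
    also have "\<dots> = ?t a U * ?t b U * ac U
     + (\<Sum>u\<in>U. (?t a U * ?w b u U + ?w a u U * ?w b a (insert a (U - {u}))) * ac (insert b (U - {u})))
     + (\<Sum>u\<in>U. ?w a u U * ?t b (insert a (U - {u})) * ac (insert a (U - {u})))
     + (\<Sum>u\<in>U. \<Sum>w\<in>U - {u}. H a b u w * X u w)"
      by (simp add: H_def distrib_left distrib_right sum.distrib sum_distrib_left mult.assoc add_ac)
    finally show ?thesis .
  qed
  have single: "?t a U * ?w b u U + ?w a u U * ?w b a (insert a (U - {u})) = ?w b u U * ?t a (insert b (U - {u}))"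
    if ab: "{a, b} = {z1, z2}" and u: "u \<in> U" for a b u
  proof -
    have "insert b (insert a U) = insert z1 (insert z2 U)" "b \<noteq> a" "b \<notin> U" "a \<notin> U"
      using ab z by (auto simp: doubleton_eq_iff)
    then have "?w b u U * (?t a (insert b (U - {u})) - ?t a U) = ?w a u U * ?w b a (insert a (U - {u}))"
      using g u by (intro unwanted_tau) simp_all
    then show ?thesis by (simp add: algebra_simps)
  qed
  have double: "(\<Sum>u\<in>U. \<Sum>w\<in>U - {u}. H z1 z2 u w * X u w) = (\<Sum>u\<in>U. \<Sum>w\<in>U - {u}. H z2 z1 u w * X u w)"
  proof -
    have swap: "(\<Sum>u\<in>U. \<Sum>w\<in>U - {u}. f u w) = (\<Sum>u\<in>U. \<Sum>w\<in>U - {u}. f w u)" for f :: "complex \<Rightarrow> complex \<Rightarrow> complex"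
    proof -
      have "(\<Sum>u\<in>U. \<Sum>w\<in>U - {u}. f u w) = (\<Sum>u\<in>U. \<Sum>w | w \<in> U \<and> u \<noteq> w. f u w)"
        by (intro sum.cong) auto
      also have "\<dots> = (\<Sum>w\<in>U. \<Sum>u | u \<in> U \<and> u \<noteq> w. f u w)"
        by (rule sum.swap_restrict[OF fin fin])
      also have "\<dots> = (\<Sum>u\<in>U. \<Sum>w\<in>U - {u}. f w u)"
        by (intro sum.cong) auto
      finally show ?thesis .
    qed
    \<comment> \<open>The resulting set does not depend on which of \<open>u\<close> and
      \<open>w\<close> was replaced first, so the sum may be symmetrized at the price of a factor
      2.\<close>
    have dbl: "2 * (\<Sum>u\<in>U. \<Sum>w\<in>U - {u}. H a b u w * X u w)
        = (\<Sum>u\<in>U. \<Sum>w\<in>U - {u}. (H a b u w + H a b w u) * X u w)" for a b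
    proof -
      have "(\<Sum>u\<in>U. \<Sum>w\<in>U - {u}. H a b u w * X u w) = (\<Sum>u\<in>U. \<Sum>w\<in>U - {u}. H a b w u * X w u)"
        by (rule swap)
      also have "\<dots> = (\<Sum>u\<in>U. \<Sum>w\<in>U - {u}. H a b w u * X u w)"
        by (intro sum.cong refl arg_cong2[where f="(*)"]) (simp add: X_def insert_commute)
      finally have "2 * (\<Sum>u\<in>U. \<Sum>w\<in>U - {u}. H a b u w * X u w)
        = (\<Sum>u\<in>U. \<Sum>w\<in>U - {u}. H a b u w * X u w) + (\<Sum>u\<in>U. \<Sum>w\<in>U - {u}. H a b w u * X u w)"
        by (simp only: mult_2)
      then show ?thesis by (simp only: distrib_right sum.distrib)
    qed
    have "(\<Sum>u\<in>U. \<Sum>w\<in>U - {u}. (H z1 z2 u w + H z1 z2 w u) * X u w)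
      = (\<Sum>u\<in>U. \<Sum>w\<in>U - {u}. (H z2 z1 u w + H z2 z1 w u) * X u w)"
      unfolding H_def using unwanted_unwanted[OF g z _ _ _ refl, of _ _ xp xm l1 l2]
      by (intro sum.cong refl arg_cong2[where f="(*)"]) auto
    then show ?thesis unfolding dbl[symmetric] by simp
  qed
  show ?thesis
    unfolding expand[OF refl] expand[OF insert_commute] double
    using single[OF refl] single[OF insert_commute] by (simp add: algebra_simps)
qed

lemma action_coeff_rotate:
  assumes "gset c (insert z (U \<union> set vs))" "c \<noteq> 0" "distinct (z # vs)" "z \<notin> U" "set vs \<inter> U = {}"
  shows "action_coeff c xp xm l1 l2 (z # vs) U W = action_coeff c xp xm l1 l2 (vs @ [z]) U W"
  using assms
proof (induction vs arbitrary: U)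
  case (Cons v vs)
  have fin: "finite U" using Cons.prems by (simp add: gset_def)
  have "action_coeff c xp xm l1 l2 (z # v # vs) U W = action_coeff c xp xm l1 l2 (v # z # vs) U W"
    using Cons.prems by (intro action_coeff_swap) (auto elim: gset_mono)
  also have "\<dots> = action_coeff c xp xm l1 l2 ((v # vs) @ [z]) U W"
  proof -
    have "action_coeff c xp xm l1 l2 (z # vs) U W = action_coeff c xp xm l1 l2 (vs @ [z]) U W"
      using Cons.prems by (intro Cons.IH) (auto elim: gset_mono)
    moreover have "action_coeff c xp xm l1 l2 (z # vs) (insert v (U - {u})) W
        = action_coeff c xp xm l1 l2 (vs @ [z]) (insert v (U - {u})) W" for u
      using Cons.prems by (intro Cons.IH) (auto elim: gset_mono)
    ultimately show ?thesis by (simp del: action_coeff.simps(2) add: action_coeff.simps(2)[of _ _ _ _ _ v])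
  qed
  finally show ?case .
qed simp

text \<open>As \<open>z\<close> does not belong to \<open>W\<close>, the last step cannot be a
  replacement, which would insert \<open>z\<close>.\<close>

lemma action_coeff_last:
  assumes "z \<notin> W" "finite U" "z \<notin> U" "distinct vs" "z \<notin> set vs" "set vs \<inter> U = {}"
  shows "action_coeff c xp xm l1 l2 (vs @ [z]) U W = tau_hat c xp xm l1 l2 z W * action_coeff c xp xm l1 l2 vs U W"
  using assms
proof (induction vs arbitrary: U)
  case Nil
  then have "insert z (U - {u}) \<noteq> W" for u by auto
  then show ?case by simp
next
  case (Cons v vs)
  have "action_coeff c xp xm l1 l2 (vs @ [z]) U W = tau_hat c xp xm l1 l2 z W * action_coeff c xp xm l1 l2 vs U W"
    "action_coeff c xp xm l1 l2 (vs @ [z]) (insert v (U - {u})) W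
      = tau_hat c xp xm l1 l2 z W * action_coeff c xp xm l1 l2 vs (insert v (U - {u})) W" for u
    using Cons.prems by (auto intro!: Cons.IH)
  then show ?case by (simp add: sum_distrib_left algebra_simps)
qed

text \<open>The coefficient with the additional point \<open>z\<close> is evaluated twice: applied
  first, \<open>z\<close> gives the expansion over \<open>u\<close>; moved to the end, it
  contributes the eigenvalue at \<open>set vs\<close>.\<close>

lemma action_coeff_relation:
  assumes "gset c (insert z (U \<union> set vs))" "c \<noteq> 0" "distinct (z # vs)" "z \<notin> U" "set vs \<inter> U = {}"
  shows "(tau_hat c xp xm l1 l2 z (set vs) - tau_hat c xp xm l1 l2 z U) * action_coeff c xp xm l1 l2 vs U (set vs)
     = (\<Sum>u\<in>U. unwanted_coeff c xp xm l1 l2 z u U * action_coeff c xp xm l1 l2 vs (insert z (U - {u})) (set vs))"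
proof -
  have "finite U" using assms by (simp add: gset_def)
  then have "action_coeff c xp xm l1 l2 (z # vs) U (set vs)
      = tau_hat c xp xm l1 l2 z (set vs) * action_coeff c xp xm l1 l2 vs U (set vs)"
    using action_coeff_last[of z "set vs" U vs c xp xm l1 l2] assms
    by (simp only: action_coeff_rotate[OF assms]) simp
  then show ?thesis by (simp add: algebra_simps)
qed


subsection \<open>Universality of the scalar product\<close>


text \<open>The dual vacuum is postponed to \<open>refl_alg_dual\<close>: all axioms here are
  identities between vectors and pass to direct products, see \<open>refl_alg_prod\<close>. In the
  relation of \<open>cc\<close> and \<open>b\<close> the lower diagonal entry is written out in
  terms of \<open>A\<close>.\<close>

locale refl_alg = refl_half smul c P UNIV A b vac m
  for smul :: "complex \<Rightarrow> 'm::ab_group_add \<Rightarrow> 'm" and c P A b vac m +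
  fixes cc :: "complex \<Rightarrow> 'm \<Rightarrow> 'm"
  assumes A_add: "u \<in> P \<Longrightarrow> A u (x + y) = A u x + A u y"
    and A_scale: "u \<in> P \<Longrightarrow> A u (smul r x) = smul r (A u x)"
    and cc_add: "u \<in> P \<Longrightarrow> cc u (x + y) = cc u x + cc u y"
    and cc_scale: "u \<in> P \<Longrightarrow> cc u (smul r x) = smul r (cc u x)"
    and cc_even: "u \<in> P \<Longrightarrow> cc (- u) x = cc u x"
    and cc_vac: "u \<in> P \<Longrightarrow> cc u vac = 0"
    and cc_b: "v \<in> P \<Longrightarrow> u \<in> P \<Longrightarrow> v \<noteq> u \<Longrightarrow> v \<noteq> - u \<Longrightarrow> c - 2 * v \<noteq> 0 \<Longrightarrow> c - 2 * u \<noteq> 0 \<Longrightarrow>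
      cc v (b u x) = b u (cc v x)
        + smul (c / ((v + u) * (c - 2 * v) * (c - 2 * u)))
          (A u (A v x)
            - (smul (c / (2 * v)) (A v (smul (c / (2 * u)) (A u x) + smul ((2 * u - c) / (2 * u)) (A (- u) x)))
              + smul ((2 * v - c) / (2 * v)) (A (- v) (smul (c / (2 * u)) (A u x) + smul ((2 * u - c) / (2 * u)) (A (- u) x)))))
        + smul (c * (v + u - c) / ((v - u) * (v + u) * (c - 2 * v) * (c - 2 * u)))
          (A u (smul (c / (2 * v)) (A v x) + smul ((2 * v - c) / (2 * v)) (A (- v) x))
            - A v (smul (c / (2 * u)) (A u x) + smul ((2 * u - c) / (2 * u)) (A (- u) x)))"
begin

abbreviation dd :: "complex \<Rightarrow> 'm \<Rightarrow> 'm" where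
  "dd u x \<equiv> smul (c / (2 * u)) (A u x) + smul ((2 * u - c) / (2 * u)) (A (- u) x)"

definition gen :: "nat \<Rightarrow> complex set \<Rightarrow> 'm set" where
  "gen k Q = {bv W |W. W \<subseteq> Q \<and> card W = k}"

lemma linear_span:
  assumes "x \<in> span S" and f: "\<And>x y. f (x + y) = f x + f y" "\<And>r x. f (smul r x) = smul r (f x)"
    and S: "\<And>x. x \<in> S \<Longrightarrow> f x \<in> span S'"
  shows "f x \<in> span S'"
  using assms(1)
proof (induction rule: span_induct)
  case base
  have "f 0 = 0" using f(2)[of 0 0] by simp
  then show ?case
    by (auto simp: subspace_def f span_zero intro: span_add span_scale)
next
  case (step x)
  then show ?case by (rule S)
qed

lemma sign:
  assumes "u \<in> P" "c \<noteq> 0"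
  obtains u' where "u' \<in> {u, - u}" "c - 2 * u' \<noteq> 0"
  using assms by (cases "c - 2 * u = 0") auto

lemma A_gen:
  assumes x: "x \<in> span (gen k Q)" and g: "good_set P (insert z Q)" "z \<notin> Q" and y: "y \<in> {z, - z}"
  shows "A y x \<in> span (gen k (insert z Q))"
proof (rule linear_span[OF x])
  have P: "z \<in> P" "y \<in> P" "Q \<subseteq> P" "finite Q" using g y by (auto simp: good_set_def P_uminus)
  show "A y (x + x') = A y x + A y x'" "A y (smul r x) = smul r (A y x)" for x x' r
    using P by (simp_all add: A_add A_scale)
  have zQ: "- z \<notin> Q" using g by (auto simp: good_set_def)
  fix x assume "x \<in> gen k Q"
  then obtain W where W: "W \<subseteq> Q" "card W = k" "x = bv W" by (auto simp: gen_def)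
  have fW: "finite W" using W(1) P(4) by (rule finite_subset)
  have "z \<noteq> 0" using P P_nz by auto
  then have g': "good_set P (insert y W)" "y \<notin> W"
    using g W(1) y zQ P fW by (auto simp: good_set_def)
  have "bv (insert y (W - {u})) \<in> gen k (insert z Q)" if u: "u \<in> W" for u
  proof -
    have "bv (insert y (W - {u})) = bv (insert z (W - {u}))"
      using bv_insert_uminus[of "W - {u}" z] y W g zQ P fW by auto
    moreover have "card (insert z (W - {u})) = k"
    proof -
      have "z \<notin> W" using W(1) g(2) by auto
      then show ?thesis using card_Suc_Diff1[OF fW u] W(2) fW by simp
    qed
    ultimately show ?thesis using W by (auto simp: gen_def)
  qed
  moreover have "bv W \<in> gen k (insert z Q)" using W by (auto simp: gen_def)
  ultimately show "A y x \<in> span (gen k (insert z Q))"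
    unfolding W(3) A_bv[OF g'] by (intro span_add span_scale span_sum) (auto intro: span_base)
qed

lemma b_gen:
  assumes x: "x \<in> span (gen k Q)" and g: "good_set P (insert u Q)" "u \<notin> Q"
  shows "b u x \<in> span (gen (Suc k) (insert u Q))"
proof (rule linear_span[OF x])
  have P: "u \<in> P" "Q \<subseteq> P" "finite Q" using g by (auto simp: good_set_def)
  show "b u (x + x') = b u x + b u x'" "b u (smul r x) = smul r (b u x)" for x x' r
    using P by (simp_all add: b_add b_scale)
  fix x assume "x \<in> gen k Q"
  then obtain W where W: "W \<subseteq> Q" "card W = k" "x = bv W" by (auto simp: gen_def)
  have fW: "finite W" using W(1) P(3) by (rule finite_subset)
  have uW: "u \<notin> W" "insert u W \<subseteq> P" using W(1) g(2) P by auto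
  have "b u x = bv (insert u W)" using bv_insert[OF fW uW(2,1)] W(3) by simp
  moreover have "card (insert u W) = Suc k" using uW W(2) fW by simp
  ultimately show "b u x \<in> span (gen (Suc k) (insert u Q))"
    using W by (intro span_base) (auto simp: gen_def)
qed

lemma cc_zero: "v \<in> P \<Longrightarrow> cc v 0 = 0"
  using cc_scale[of v 0 0] by simp

text \<open>Commuting \<open>cc v\<close> with a \<open>b\<close> replaces the pair by two operators
  \<open>A\<close>, which preserve the number of the remaining \<open>b\<close> and may bring in the
  parameter \<open>v\<close>; at the vacuum \<open>cc v\<close> gives 0.\<close>

lemma cc_bv:
  assumes "c \<noteq> 0" "good_set P (insert v W)" "v \<notin> W"
  shows "cc v (bv W) \<in> span (gen (card W - 1) (insert v W))"
proof -
  have "finite W" using assms(2) by (simp add: good_set_def)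
  then show ?thesis using assms(2,3)
  proof (induction W rule: finite_induct)
    case empty
    then show ?case by (simp add: bv_empty cc_vac good_set_def span_zero)
  next
    case (insert u W)
    have P: "v \<in> P" "u \<in> P" "W \<subseteq> P" using insert.prems by (auto simp: good_set_def)
    \<comment> \<open>The relation \<open>cc_b\<close> divides by \<open>c - 2 * v\<close> and
      \<open>c - 2 * u\<close>; by evenness the signs of \<open>v\<close> and \<open>u\<close> are
      free.\<close>
    obtain v' where v': "v' \<in> {v, - v}" "c - 2 * v' \<noteq> 0" using sign[OF P(1) assms(1)] .
    obtain u' where u': "u' \<in> {u, - u}" "c - 2 * u' \<noteq> 0" using sign[OF P(2) assms(1)] .
    have P': "v' \<in> P" "u' \<in> P" using v' u' P P_uminus by auto
    have ne: "v' \<noteq> u'" "v' \<noteq> - u'"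
      using insert.prems v'(1) u'(1) by (auto simp: good_set_def)
    have signs: "v' = v \<or> v' = - v" "u' = u \<or> u' = - u" using v' u' by auto
    have bu: "b u' x = b u x" for x using u'(1) b_even[OF P(2)] by auto
    have cv: "cc v' x = cc v x" for x using v'(1) cc_even[OF P(1)] by auto
    let ?Q = "insert u (insert v W)" and ?k = "card W"
    have Q: "insert v (insert u W) = ?Q" by (rule insert_commute)
    have g: "good_set P (insert v W)" "good_set P ?Q" "good_set P (insert u W)" "good_set P (insert v (insert u W))"
      using insert.prems(1) by (auto simp: insert_commute elim: good_set_mono)
    have nin: "v \<notin> W" "u \<notin> insert v W" "u \<notin> W" "v \<notin> insert u W" using insert by auto
    define X where "X = bv W"
    have X: "X \<in> span (gen ?k W)" by (auto simp: X_def gen_def intro: span_base)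
    have Av: "A y X \<in> span (gen ?k (insert v W))" if "y = v' \<or> y = - v'" for y
      using that signs by (intro A_gen[OF X g(1) nin(1)]) auto
    have Au: "A y X \<in> span (gen ?k (insert u W))" if "y = u' \<or> y = - u'" for y
      using that signs by (intro A_gen[OF X g(3) nin(3)]) auto
    have dv: "dd v' X \<in> span (gen ?k (insert v W))" and du: "dd u' X \<in> span (gen ?k (insert u W))"
      using Av Au by (auto intro: span_add span_scale)
    have Auv: "A y x \<in> span (gen ?k ?Q)" if "y = u' \<or> y = - u'" "x \<in> span (gen ?k (insert v W))" for y x
      using that signs by (intro A_gen[OF that(2) g(2) nin(2)]) auto
    have Avu: "A y x \<in> span (gen ?k ?Q)" if "y = v' \<or> y = - v'" "x \<in> span (gen ?k (insert u W))" for y x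
      using that signs A_gen[OF that(2) g(4) nin(4), of y] by (auto simp: Q)
    have "b u (cc v X) \<in> span (gen ?k ?Q)"
    proof (cases "W = {}")
      case True
      then show ?thesis using P by (simp add: X_def bv_empty cc_vac b_zero span_zero)
    next
      case False
      have "cc v X \<in> span (gen (?k - 1) (insert v W))"
        unfolding X_def by (rule insert.IH[OF g(1) nin(1)])
      from b_gen[OF this g(2) nin(2)] show ?thesis
        using False insert.hyps(1) by (simp add: card_gt_0_iff)
    qed
    moreover have "A u' (A v' X) - dd v' (dd u' X) \<in> span (gen ?k ?Q)"
      using Auv[of u' "A v' X"] Av[of v'] Avu[of v' "dd u' X"] Avu[of "- v'" "dd u' X"] du
      by (intro span_diff span_add span_scale) auto
    moreover have "A u' (dd v' X) - A v' (dd u' X) \<in> span (gen ?k ?Q)"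
      using Auv[of u' "dd v' X"] Avu[of v' "dd u' X"] du dv by (intro span_diff) auto
    ultimately have "cc v (b u X) \<in> span (gen ?k ?Q)"
      unfolding cc_b[OF P' ne v'(2) u'(2), of X, unfolded bu cv]
      by (intro span_add span_scale) auto
    moreover have "b u X = bv (insert u W)"
      using bv_insert[of W u] P insert.hyps by (simp add: X_def)
    ultimately show ?case using insert.hyps by (simp add: Q)
  qed
qed

text \<open>Used in two cases: with equally many \<open>cc\<close> and \<open>b\<close> a multiple
  of the vacuum remains, and with one \<open>cc\<close> less a combination of vectors
  \<open>b w vac\<close>.\<close>

lemma foldr_cc:
  assumes "c \<noteq> 0" "good_set P (U \<union> set vs)" "distinct vs" "set vs \<inter> U = {}" "length vs \<le> card U"
  shows "foldr cc vs (bv U) \<in> span (gen (card U - length vs) (U \<union> set vs))"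
  using assms(2-)
proof (induction vs)
  case Nil
  then show ?case by (auto simp: gen_def intro: span_base)
next
  case (Cons v vs)
  let ?k = "card U - length (v # vs)"
  have k: "card U - length vs = Suc ?k" using Cons.prems by simp
  have P: "v \<in> P" using Cons.prems by (auto simp: good_set_def)
  have *: "foldr cc vs (bv U) \<in> span (gen (Suc ?k) (U \<union> set vs))"
    unfolding k[symmetric] using Cons.prems by (intro Cons.IH) (auto elim: good_set_mono)
  have "cc v (foldr cc vs (bv U)) \<in> span (gen ?k (U \<union> set (v # vs)))"
  proof (rule linear_span[OF *])
    show "cc v (x + x') = cc v x + cc v x'" "cc v (smul r x) = smul r (cc v x)" for x x' r
      using P by (simp_all add: cc_add cc_scale)
    fix x assume "x \<in> gen (Suc ?k) (U \<union> set vs)"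
    then obtain W where W: "W \<subseteq> U \<union> set vs" "card W = Suc ?k" "x = bv W" by (auto simp: gen_def)
    have "cc v (bv W) \<in> span (gen (card W - 1) (insert v W))"
      using W Cons.prems by (intro cc_bv assms(1)) (auto elim!: good_set_mono)
    also have "\<dots> \<subseteq> span (gen ?k (U \<union> set (v # vs)))"
      using W by (intro span_mono) (auto simp: gen_def)
    finally show "cc v x \<in> span (gen ?k (U \<union> set (v # vs)))" by (simp add: W)
  qed
  then show ?case by simp
qed

end

text \<open>The pairing of \<open>cc v (b u vac)\<close> with the dual vacuum, see
  \<open>d_cc_b\<close>; the last four arguments are the eigenvalues of \<open>A\<close> at
  \<open>v\<close>, \<open>- v\<close>, \<open>u\<close>, \<open>- u\<close>.\<close>

definition one_point :: "complex \<Rightarrow> complex \<Rightarrow> complex \<Rightarrow> complex \<Rightarrow> complex \<Rightarrow> complex \<Rightarrow> complex \<Rightarrow> complex" where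
  "one_point c v u mv mv' mu mu' =
    c / ((v + u) * (c - 2 * v) * (c - 2 * u)) * (mv * mu -
       (c / (2 * v) * mv + (2 * v - c) / (2 * v) * mv') * (c / (2 * u) * mu + (2 * u - c) / (2 * u) * mu'))
    + c * (v + u - c) / ((v - u) * (v + u) * (c - 2 * v) * (c - 2 * u))
      * ((c / (2 * v) * mv + (2 * v - c) / (2 * v) * mv') * mu - mv * (c / (2 * u) * mu + (2 * u - c) / (2 * u) * mu'))"

lemma one_point_linear:
  "one_point c v u (x * a1 + y * a2) (x * b1 + y * b2) mu mu'
   = x * one_point c v u a1 b1 mu mu' + y * one_point c v u a2 b2 mu mu'"
proof -
  have "k1 * ((x * a1 + y * a2) * mu - (e * (x * a1 + y * a2) + f * (x * b1 + y * b2)) * D)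
      + k2 * ((e * (x * a1 + y * a2) + f * (x * b1 + y * b2)) * mu - (x * a1 + y * a2) * D)
    = x * (k1 * (a1 * mu - (e * a1 + f * b1) * D) + k2 * ((e * a1 + f * b1) * mu - a1 * D))
    + y * (k1 * (a2 * mu - (e * a2 + f * b2) * D) + k2 * ((e * a2 + f * b2) * mu - a2 * D))"
    for k1 k2 e f D :: complex
    by (simp add: algebra_simps)
  then show ?thesis unfolding one_point_def .
qed

locale refl_alg_dual = refl_alg smul c P A b vac m cc
  for smul :: "complex \<Rightarrow> 'm::ab_group_add \<Rightarrow> 'm" and c P A b vac m cc +
  fixes d :: "'m \<Rightarrow> complex"
  assumes c_nz: "c \<noteq> 0"
    and d_add: "d (x + y) = d x + d y" and d_scale: "d (smul r x) = r * d x" and d_vac: "d vac = 1"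
    and d_b: "u \<in> P \<Longrightarrow> d (b u x) = 0" and d_A: "u \<in> P \<Longrightarrow> d (A u x) = m u * d x"
begin

lemma d_diff: "d (x - y) = d x - d y"
  using d_add[of "x - y" y] by simp

lemma d_cc_b:
  assumes "v \<in> P" "u \<in> P" "v \<noteq> u" "v \<noteq> - u" "c - 2 * v \<noteq> 0" "c - 2 * u \<noteq> 0"
  shows "d (cc v (b u vac)) = one_point c v u (m v) (m (- v)) (m u) (m (- u))"
proof -
  have gen: "k1 * (mu * mv - (e * (mv * D) + f * (mv' * D))) + k2 * (mu * (e * mv + f * mv') - mv * D)
    = k1 * (mv * mu - (e * mv + f * mv') * D) + k2 * ((e * mv + f * mv') * mu - mv * D)"
    for k1 mu mv mv' e f D k2 :: complex
    by (simp add: algebra_simps)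
  have P: "- u \<in> P" "- v \<in> P" using assms P_uminus by auto
  note r = d_add d_scale d_diff d_b[OF assms(2)] d_A[OF assms(1)] d_A[OF assms(2)] d_A[OF P(1)] d_A[OF P(2)]
    d_vac mult_1_right add_0
  show ?thesis
    unfolding cc_b[OF assms] one_point_def r gen ..
qed

end

text \<open>Shrinking the parameter set frees the eigenvalue function outside it. Models that differ
  at \<open>v\<close> and \<open>- v\<close> become comparable in this way.\<close>

lemma refl_alg_restrict:
  assumes "refl_alg smul c P A b vac m cc" "P' \<subseteq> P" "\<And>u. u \<in> P' \<Longrightarrow> - u \<in> P'"
    and "\<And>u. u \<in> P' \<Longrightarrow> m' u = m u"
  shows "refl_alg smul c P' A b vac m' cc"
proof -
  interpret refl_alg smul c P A b vac m cc by (rule assms)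
  have PP: "u \<in> P" if "u \<in> P'" for u using that assms(2) by blast
  have nz: "0 \<notin> P'" using PP P_nz by blast
  show ?thesis
    by (unfold_locales;
        ((rule cc_b A_b b_comm; simp add: PP)
          | (simp add: PP nz assms(3,4) b_add b_scale b_even A_add A_scale cc_add cc_scale cc_even cc_vac A_vac)))
qed

text \<open>Used for scalars and also, with the spectral parameter in place of the scalar, for the
  operator families of a direct product.\<close>

definition smul_prod :: "(complex \<Rightarrow> 'a \<Rightarrow> 'a) \<Rightarrow> (complex \<Rightarrow> 'b \<Rightarrow> 'b) \<Rightarrow> complex \<Rightarrow> 'a \<times> 'b \<Rightarrow> 'a \<times> 'b" where
  "smul_prod s1 s2 r x = (s1 r (fst x), s2 r (snd x))"

lemma refl_alg_prod:
  assumes R1: "refl_alg s1 c P A1 b1 vac1 m cc1" and R2: "refl_alg s2 c P A2 b2 vac2 m cc2"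
  shows "refl_alg (smul_prod s1 s2) c P (smul_prod A1 A2) (smul_prod b1 b2) (vac1, vac2) m (smul_prod cc1 cc2)"
proof -
  interpret R1: refl_alg s1 c P A1 b1 vac1 m cc1 by (rule R1)
  interpret R2: refl_alg s2 c P A2 b2 vac2 m cc2 by (rule R2)
  note rules = smul_prod_def R1.b_add R2.b_add R1.b_scale R2.b_scale R1.b_even R2.b_even R1.A_vac R2.A_vac
    R1.A_add R2.A_add R1.A_scale R2.A_scale R1.cc_add R2.cc_add R1.cc_scale R2.cc_scale R1.cc_even R2.cc_even
    R1.cc_vac R2.cc_vac zero_prod_def R1.P_uminus R1.P_nz
  show ?thesis
  proof unfold_locales
    show "smul_prod b1 b2 u (smul_prod b1 b2 v x) = smul_prod b1 b2 v (smul_prod b1 b2 u x)"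
      if "u \<in> P" "v \<in> P" "x \<in> UNIV" for u v x
      using R1.b_comm[OF that(1,2)] R2.b_comm[OF that(1,2)] by (simp add: smul_prod_def)
  next
    fix z u and x :: "'a \<times> 'b" assume *: "z \<in> P" "u \<in> P" "z \<noteq> u" "z \<noteq> - u" "x \<in> UNIV"
    show "smul_prod A1 A2 z (smul_prod b1 b2 u x) =
       smul_prod s1 s2 (Fr c u z) (smul_prod b1 b2 u (smul_prod A1 A2 z x))
       + smul_prod s1 s2 ((2 * z - c) * Yr c z u) (smul_prod b1 b2 z (smul_prod A1 A2 u x))
       + smul_prod s1 s2 ((2 * z - c) * Yr c z (- u)) (smul_prod b1 b2 z (smul_prod A1 A2 (- u) x))"
      using R1.A_b[OF *(1-4)] R2.A_b[OF *(1-4)] by (simp add: smul_prod_def)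
  next
    fix v u and x :: "'a \<times> 'b"
    assume *: "v \<in> P" "u \<in> P" "v \<noteq> u" "v \<noteq> - u" "c - 2 * v \<noteq> 0" "c - 2 * u \<noteq> 0"
    show "smul_prod cc1 cc2 v (smul_prod b1 b2 u x) = smul_prod b1 b2 u (smul_prod cc1 cc2 v x)
        + smul_prod s1 s2 (c / ((v + u) * (c - 2 * v) * (c - 2 * u)))
          (smul_prod A1 A2 u (smul_prod A1 A2 v x)
            - (smul_prod s1 s2 (c / (2 * v)) (smul_prod A1 A2 v (smul_prod s1 s2 (c / (2 * u)) (smul_prod A1 A2 u x) + smul_prod s1 s2 ((2 * u - c) / (2 * u)) (smul_prod A1 A2 (- u) x)))
              + smul_prod s1 s2 ((2 * v - c) / (2 * v)) (smul_prod A1 A2 (- v) (smul_prod s1 s2 (c / (2 * u)) (smul_prod A1 A2 u x) + smul_prod s1 s2 ((2 * u - c) / (2 * u)) (smul_prod A1 A2 (- u) x)))))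
        + smul_prod s1 s2 (c * (v + u - c) / ((v - u) * (v + u) * (c - 2 * v) * (c - 2 * u)))
          (smul_prod A1 A2 u (smul_prod s1 s2 (c / (2 * v)) (smul_prod A1 A2 v x) + smul_prod s1 s2 ((2 * v - c) / (2 * v)) (smul_prod A1 A2 (- v) x))
            - smul_prod A1 A2 v (smul_prod s1 s2 (c / (2 * u)) (smul_prod A1 A2 u x) + smul_prod s1 s2 ((2 * u - c) / (2 * u)) (smul_prod A1 A2 (- u) x)))"
      unfolding smul_prod_def prod.sel plus_prod_def minus_prod_def fst_conv snd_conv
        R1.cc_b[OF *] R2.cc_b[OF *] ..
  qed (auto simp: rules R1.scale_right_distrib R2.scale_right_distrib R1.scale_left_distrib R2.scale_left_distrib)
qed

lemma foldr_smul_prod: "foldr (smul_prod f g) us (x, y) = (foldr f us x, foldr g us y)"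
  by (induction us) (simp_all add: smul_prod_def)

lemma op_vec_prod: "op_vec (smul_prod b1 b2) (x, y) U = (op_vec b1 x U, op_vec b2 y U)"
  by (simp add: op_vec_def foldr_smul_prod)

text \<open>In the direct product with vacuum \<open>(vac1, vac2)\<close>, the vector left after all
  \<open>cc\<close> have acted is a multiple of this vacuum. The factor is the same in both
  components and equals both scalar products.\<close>

lemma scalar_product_universal:
  assumes "refl_alg_dual s1 c P A1 b1 vac1 m1 cc1 d1" "refl_alg_dual s2 c P A2 b2 vac2 m2 cc2 d2"
    and m: "\<And>u. u \<in> P \<Longrightarrow> m1 u = m2 u"
    and g: "good_set P (U \<union> set vs)" "distinct vs" "set vs \<inter> U = {}" "length vs = card U"
  shows "d1 (foldr cc1 vs (op_vec b1 vac1 U)) = d2 (foldr cc2 vs (op_vec b2 vac2 U))"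
proof -
  interpret R1: refl_alg_dual s1 c P A1 b1 vac1 m1 cc1 d1 by fact
  interpret R2: refl_alg_dual s2 c P A2 b2 vac2 m2 cc2 d2 by fact
  have R2': "refl_alg s2 c P A2 b2 vac2 m1 cc2"
    by (rule refl_alg_restrict[OF R2.refl_alg_axioms subset_refl]) (simp_all add: R1.P_uminus m)
  interpret R: refl_alg "smul_prod s1 s2" c P "smul_prod A1 A2" "smul_prod b1 b2" "(vac1, vac2)" m1 "smul_prod cc1 cc2"
    by (rule refl_alg_prod[OF R1.refl_alg_axioms R2'])
  define x where "x = foldr (smul_prod cc1 cc2) vs (R.bv U)"
  have "x \<in> R.span (R.gen 0 (U \<union> set vs))"
    using R.foldr_cc[OF R1.c_nz g(1-3)] g(4) by (simp add: x_def)
  then have "d1 (fst x) = d2 (snd x)"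
  proof (induction rule: R.span_induct)
    case base
    have "d1 0 = 0" "d2 0 = 0" using R1.d_scale[of 0 0] R2.d_scale[of 0 0] by simp_all
    then show ?case by (auto simp: R.subspace_def smul_prod_def R1.d_add R2.d_add R1.d_scale R2.d_scale)
  next
    case (step x)
    then obtain W where W: "W \<subseteq> U \<union> set vs" "card W = 0" "x = R.bv W" by (auto simp: R.gen_def)
    have "finite W" using W(1) g(1) by (auto simp: good_set_def intro: finite_subset)
    then have "x = (vac1, vac2)" using W(2,3) R.bv_empty by simp
    then show ?case by (simp add: R1.d_vac R2.d_vac)
  qed
  then show ?thesis
    by (simp add: x_def op_vec_prod foldr_smul_prod)
qed

text \<open>The triple product is formed over the parameters other than \<open>v\<close> and
  \<open>- v\<close>, where the eigenvalues agree. All \<open>cc\<close> except \<open>cc v\<close>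
  leave a combination of vectors \<open>b w\<close> applied to the vacuum, with coefficients common
  to the three models; \<open>cc v\<close> then contributes \<open>one_point\<close>, which is
  linear in the eigenvalues at \<open>v\<close> and \<open>- v\<close>.\<close>

lemma scalar_product_linear:
  assumes "refl_alg_dual s1 c P A1 b1 vac1 m1 cc1 d1" "refl_alg_dual s2 c P A2 b2 vac2 m2 cc2 d2"
    "refl_alg_dual s3 c P A3 b3 vac3 m3 cc3 d3"
    and m: "\<And>u. u \<in> P - {v, - v} \<Longrightarrow> m1 u = m3 u" "\<And>u. u \<in> P - {v, - v} \<Longrightarrow> m2 u = m3 u"
      "\<And>u. u \<in> {v, - v} \<Longrightarrow> m3 u = x * m1 u + y * m2 u"
    and g: "good_set P (U \<union> set (v # vs))" "distinct (v # vs)" "set (v # vs) \<inter> U = {}" "length (v # vs) = card U"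
  shows "d3 (foldr cc3 (v # vs) (op_vec b3 vac3 U))
    = x * d1 (foldr cc1 (v # vs) (op_vec b1 vac1 U)) + y * d2 (foldr cc2 (v # vs) (op_vec b2 vac2 U))"
proof -
  interpret R1: refl_alg_dual s1 c P A1 b1 vac1 m1 cc1 d1 by fact
  interpret R2: refl_alg_dual s2 c P A2 b2 vac2 m2 cc2 d2 by fact
  interpret R3: refl_alg_dual s3 c P A3 b3 vac3 m3 cc3 d3 by fact
  let ?P = "P - {v, - v}"
  have v: "v \<in> P" using g by (simp add: good_set_def)
  have P': "?P \<subseteq> P" "\<And>u. u \<in> ?P \<Longrightarrow> - u \<in> ?P" by (auto simp: R1.P_uminus)
  have R1': "refl_alg s1 c ?P A1 b1 vac1 m3 cc1"
    by (rule refl_alg_restrict[OF R1.refl_alg_axioms P']) (simp_all add: m)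
  have R2': "refl_alg s2 c ?P A2 b2 vac2 m3 cc2"
    by (rule refl_alg_restrict[OF R2.refl_alg_axioms P']) (simp_all add: m)
  have R3': "refl_alg s3 c ?P A3 b3 vac3 m3 cc3"
    by (rule refl_alg_restrict[OF R3.refl_alg_axioms P']) simp_all
  note R12 = refl_alg_prod[OF R1' R2']
  interpret R: refl_alg "smul_prod s3 (smul_prod s1 s2)" c ?P "smul_prod A3 (smul_prod A1 A2)"
    "smul_prod b3 (smul_prod b1 b2)" "(vac3, (vac1, vac2))" m3 "smul_prod cc3 (smul_prod cc1 cc2)"
    by (rule refl_alg_prod[OF R3' R12])
  define X where "X = foldr (smul_prod cc3 (smul_prod cc1 cc2)) vs (R.bv U)"
  have "good_set ?P (U \<union> set vs)"
    using g(1-3) by (auto simp: good_set_def)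
  moreover have "card U - length vs = 1" using g(4) by simp
  ultimately have "X \<in> R.span (R.gen 1 (U \<union> set vs))"
    using R.foldr_cc[OF R1.c_nz, of U vs] g(2-4) by (simp add: X_def)
  then have "d3 (cc3 v (fst X)) = x * d1 (cc1 v (fst (snd X))) + y * d2 (cc2 v (snd (snd X)))"
  proof (induction rule: R.span_induct)
    case base
    have "d1 0 = 0" "d2 0 = 0" "d3 0 = 0"
      using R1.d_scale[of 0 0] R2.d_scale[of 0 0] R3.d_scale[of 0 0] by simp_all
    then show ?case
      using v by (simp add: R.subspace_def smul_prod_def R1.d_add R2.d_add R3.d_add R1.d_scale R2.d_scale R3.d_scale
          R1.cc_add R2.cc_add R3.cc_add R1.cc_scale R2.cc_scale R3.cc_scale R1.cc_zero R2.cc_zero R3.cc_zero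
          distrib_left mult.left_commute)
  next
    case (step X)
    then obtain W where W: "W \<subseteq> U \<union> set vs" "card W = 1" "X = R.bv W" by (auto simp: R.gen_def)
    then obtain w where w: "W = {w}" by (auto simp: card_1_singleton_iff)
    have wP: "w \<in> ?P" using W w g(1-3) by (auto simp: good_set_def)
    have X: "X = (b3 w vac3, (b1 w vac1, b2 w vac2))"
      using R.bv_insert[of "{}" w] wP by (simp add: W w R.bv_empty smul_prod_def)
    obtain v' where v': "v' \<in> {v, - v}" "c - 2 * v' \<noteq> 0" using R1.sign[OF v R1.c_nz] .
    have wP': "w \<in> P" using wP by simp
    obtain w' where w': "w' \<in> {w, - w}" "c - 2 * w' \<noteq> 0" using R1.sign[OF wP' R1.c_nz] .
    have signs: "v' = v \<or> v' = - v" "w' = w \<or> w' = - w" using v'(1) w'(1) by auto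
    have wv: "w \<noteq> v" "w \<noteq> - v" using wP by auto
    have in_P: "v' \<in> P" "w' \<in> P" using signs v wP' R1.P_uminus[OF v] R1.P_uminus[OF wP'] by auto
    moreover have ne: "v' \<noteq> w'" "v' \<noteq> - w'" using signs wv by (metis minus_minus)+
    moreover have ne': "w' \<noteq> v" "w' \<noteq> - v" using signs(2) wv by (metis minus_minus)+
    moreover have "- w' \<noteq> v" "- w' \<noteq> - v" using ne' by (metis minus_minus)+
    ultimately have P2: "v' \<in> P" "w' \<in> P" "v' \<noteq> w'" "v' \<noteq> - w'" "w' \<in> ?P" "- w' \<in> ?P"
      using R1.P_uminus[OF in_P(2)] by blast+
    have "d3 (cc3 v' (b3 w' vac3)) = x * d1 (cc1 v' (b1 w' vac1)) + y * d2 (cc2 v' (b2 w' vac2))"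
    proof -
      have "m3 v' = x * m1 v' + y * m2 v'" "m3 (- v') = x * m1 (- v') + y * m2 (- v')"
        using m(3) v'(1) by auto
      then show ?thesis
        unfolding R1.d_cc_b[OF P2(1-4) v'(2) w'(2)] R2.d_cc_b[OF P2(1-4) v'(2) w'(2)] R3.d_cc_b[OF P2(1-4) v'(2) w'(2)]
        using m(1,2)[OF P2(5)] m(1,2)[OF P2(6)] by (simp add: one_point_linear)
    qed
    moreover have "cc3 v' = cc3 v" "cc1 v' = cc1 v" "cc2 v' = cc2 v"
      using v'(1) v by (auto simp: fun_eq_iff R1.cc_even R2.cc_even R3.cc_even)
    moreover have "b3 w' = b3 w" "b1 w' = b1 w" "b2 w' = b2 w"
      using w'(1) wP' by (auto simp: fun_eq_iff R1.b_even R2.b_even R3.b_even)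
    ultimately show ?case by (simp add: X)
  qed
  then show ?thesis
    by (simp add: X_def op_vec_prod op_vec_prod foldr_smul_prod)
qed


subsection \<open>Models with prescribed vacuum eigenvalues\<close>


lemma (in generalized_model) refl_alg_dual: 
  "refl_alg_dual smul c (D - {0}) (aop xm) (bop xm) vac (mval xm) (cop xm) dvac"
proof -
  interpret h: refl_half smul c "D - {0}" UNIV "aop xm" "bop xm" vac "mval xm"
    by (rule half_primal)
  show ?thesis
    by unfold_locales
      ((rule cop_bop; simp) | (simp add: mon_rules cop_rules cop_even cop_vac c_nonzero dvac_rules dvac_vac dvac_bop dvac_aop))+
qed

text \<open>Highest weight modules of the Yangian as multi-variable formal power series. On the site \<open>i\<close> the
  off-diagonal entries raise and lower the exponent \<open>g i\<close>. A single site has vacuum eigenvalues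
  \<open>u - al\<close> and \<open>u - be\<close>.\<close>

definition csm :: "complex \<Rightarrow> ((nat \<Rightarrow> nat) \<Rightarrow> complex) \<Rightarrow> (nat \<Rightarrow> nat) \<Rightarrow> complex" where
  "csm r F = (\<lambda>g. r * F g)"

lemma csm_vector_space: "vector_space csm"
  by unfold_locales (simp_all add: csm_def fun_eq_iff algebra_simps)

definition site :: "complex \<Rightarrow> nat \<Rightarrow> complex \<Rightarrow> complex \<Rightarrow> complex \<Rightarrow> 2 \<Rightarrow> 2 \<Rightarrow>
    ((nat \<Rightarrow> nat) \<Rightarrow> complex) \<Rightarrow> (nat \<Rightarrow> nat) \<Rightarrow> complex" where
  "site c i al be u p q F =
    (if p = 1 then
       if q = 1 then (\<lambda>g. (u - al - c * of_nat (g i)) * F g)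
       else (\<lambda>g. if g i = 0 then 0 else F (g(i := g i - 1)))
     else
       if q = 1 then (\<lambda>g. c * of_nat (g i + 1) * (be - al - c * of_nat (g i)) * F (g(i := g i + 1)))
       else (\<lambda>g. (u - be + c * of_nat (g i)) * F g))"

lemma site_simps:
  "site c i al be u 1 1 F g = (u - al - c * of_nat (g i)) * F g"
  "site c i al be u 1 2 F g = (if g i = 0 then 0 else F (g(i := g i - 1)))"
  "site c i al be u 2 1 F g = c * of_nat (g i + 1) * (be - al - c * of_nat (g i)) * F (g(i := g i + 1))"
  "site c i al be u 2 2 F g = (u - be + c * of_nat (g i)) * F g"
  by (simp_all add: site_def not_1_2)

lemma site_linear: "Vector_Spaces.linear csm csm (site c i al be u p q)"
  by (intro Vector_Spaces.linear.intro csm_vector_space module_hom.intro module_hom_axioms.intro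
      csm_vector_space[unfolded vector_space_def, folded module_def])
    (auto simp: site_def csm_def fun_eq_iff algebra_simps)

lemma site_commute:
  assumes "i \<noteq> k"
  shows "site c i al be u p q (site c k al' be' v r s F) = site c k al' be' v r s (site c i al be u p q F)"
proof -
  have twist: "g(i := x, k := y) = g(k := y, i := x)" for g :: "nat \<Rightarrow> nat" and x y
    using assms by (rule fun_upd_twist)
  show ?thesis
    using exhaust_2[of p] exhaust_2[of q] exhaust_2[of r] exhaust_2[of s] assms
    by (elim disjE) (simp_all add: fun_eq_iff site_simps twist)
qed

lemma site_RTT:
  assumes "u \<noteq> v"
  shows "site c n al be u i j (site c n al be v k l x) + csm (g_rat c u v) (site c n al be u k j (site c n al be v i l x))
       = site c n al be v k l (site c n al be u i j x) + csm (g_rat c u v) (site c n al be v k j (site c n al be u i l x))"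
proof
  fix g
  have nz: "u - v \<noteq> 0" using assms by simp
  have gen: "X + g_rat c u v * Y = Z + g_rat c u v * W" if "(u - v) * X + c * Y = (u - v) * Z + c * W" for X Y Z W
    using that nz by (simp add: g_rat_def field_simps)
  show "(site c n al be u i j (site c n al be v k l x) + csm (g_rat c u v) (site c n al be u k j (site c n al be v i l x))) g
       = (site c n al be v k l (site c n al be u i j x) + csm (g_rat c u v) (site c n al be v k j (site c n al be u i l x))) g"
    unfolding plus_fun_apply csm_def
  \<comment> \<open>The entry with indices 1, 2 vanishes at exponent 0 and otherwise uses a natural
    subtraction, so the two cases are separated.\<close>
  proof (rule gen, cases "g n")
    case 0
    then have g: "g(n := 0) = g" by (simp add: fun_upd_idem)
    show "(u - v) * site c n al be u i j (site c n al be v k l x) g + c * site c n al be u k j (site c n al be v i l x) g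
       = (u - v) * site c n al be v k l (site c n al be u i j x) g + c * site c n al be v k j (site c n al be u i l x) g"
      using exhaust_2[of i] exhaust_2[of j] exhaust_2[of k] exhaust_2[of l]
      by (elim disjE; simp add: site_simps 0 g; (simp add: algebra_simps)?)
  next
    case (Suc m)
    then have g: "g(n := Suc m) = g" by (simp add: fun_upd_idem)
    show "(u - v) * site c n al be u i j (site c n al be v k l x) g + c * site c n al be u k j (site c n al be v i l x) g
       = (u - v) * site c n al be v k l (site c n al be u i j x) g + c * site c n al be v k j (site c n al be u i l x) g"
      using exhaust_2[of i] exhaust_2[of j] exhaust_2[of k] exhaust_2[of l]
      by (elim disjE; simp add: site_simps Suc g; (simp add: algebra_simps)?)
  qed
qed

text \<open>The comultiplication of the Yangian. A new site gets the number
  \<open>length ps\<close>, so distinct sites act on distinct exponents and commute.\<close>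

fun chain :: "complex \<Rightarrow> (complex \<times> complex) list \<Rightarrow> complex \<Rightarrow> 2 \<Rightarrow> 2 \<Rightarrow>
    ((nat \<Rightarrow> nat) \<Rightarrow> complex) \<Rightarrow> (nat \<Rightarrow> nat) \<Rightarrow> complex" where
  "chain c [] u p q F = (if p = q then F else 0)"
| "chain c (x # ps) u p q F =
     (\<Sum>a\<in>UNIV. site c (length ps) (fst x) (snd x) u p a (chain c ps u a q F))"

lemma chain_linear: "Vector_Spaces.linear csm csm (chain c ps u p q)"
proof (induction ps arbitrary: p q)
  case Nil
  show ?case
    by (intro Vector_Spaces.linear.intro csm_vector_space module_hom.intro module_hom_axioms.intro
      csm_vector_space[unfolded vector_space_def, folded module_def])
    (auto simp: csm_def fun_eq_iff)
next
  case (Cons x ps)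
  interpret vector_space csm by (rule csm_vector_space)
  note r = linear_rules[OF Cons.IH] linear_rules[OF site_linear]
  show ?case
    by (intro Vector_Spaces.linear.intro csm_vector_space module_hom.intro module_hom_axioms.intro
      csm_vector_space[unfolded vector_space_def, folded module_def])
    (simp_all only: chain.simps r sum.distrib scale_sum_right)
qed

lemma site_chain_commute:
  "length ps \<le> k \<Longrightarrow> site c k al be u p q (chain c ps v r s F) = chain c ps v r s (site c k al be u p q F)"
proof (induction ps arbitrary: r s F)
  case Nil
  then show ?case using linear_rules(3)[OF site_linear] by simp
next
  case (Cons x ps)
  then have k: "k \<noteq> length ps" "length ps \<le> k" by auto
  show ?case
    by (simp only: chain.simps linear_rules(6)[OF site_linear] site_commute[OF k(1)] Cons.IH[OF k(2)])
qed

text \<open>Entries of the new site commute with those of the shorter chain, so a product of two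
  entries can be sorted by factors. The exchange relation is then applied to the site and, by
  induction, to the rest.\<close>

lemma chain_RTT:
  assumes "u \<noteq> v"
  shows "chain c ps u i j (chain c ps v k l x) + csm (g_rat c u v) (chain c ps u k j (chain c ps v i l x))
       = chain c ps v k l (chain c ps u i j x) + csm (g_rat c u v) (chain c ps v k j (chain c ps u i l x))"
proof (induction ps arbitrary: i j k l x)
  case Nil
  interpret vector_space csm by (rule csm_vector_space)
  show ?case by auto
next
  case (Cons w ps)
  interpret vector_space csm by (rule csm_vector_space)
  let ?s = "site c (length ps) (fst w) (snd w)" and ?q = "chain c ps" and ?g = "csm (g_rat c u v)"
  have com: "?q y p q (?s z r t F) = ?s z r t (?q y p q F)" for y z p q r t F
    using site_chain_commute[of ps "length ps" c "fst w" "snd w" z r t y p q F] by simp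
  have sl: "?s z p q (x + y) = ?s z p q x + ?s z p q y" "?s z p q (csm r x) = csm r (?s z p q x)"
    "?s z p q (sum h S) = (\<Sum>a\<in>S. ?s z p q (h a))" for z p q x y r h and S :: "2 set"
    by (rule linear_rules[OF site_linear])+
  have ql: "?q z p q (sum h S) = (\<Sum>a\<in>S. ?q z p q (h a))" for z p q h and S :: "2 set"
    by (rule linear_rules[OF chain_linear])
  have prod: "chain c (w # ps) y i j (chain c (w # ps) z k l x)
      = (\<Sum>a\<in>UNIV. \<Sum>b\<in>UNIV. ?s y i a (?s z k b (?q y a j (?q z b l x))))" for y z i j k l
    by (simp add: ql sl com)
  have "chain c (w # ps) u i j (chain c (w # ps) v k l x) + ?g (chain c (w # ps) u k j (chain c (w # ps) v i l x))
    = (\<Sum>a\<in>UNIV. \<Sum>b\<in>UNIV. ?s u i a (?s v k b (?q u a j (?q v b l x))) + ?g (?s u k a (?s v i b (?q u a j (?q v b l x)))))"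
    unfolding prod by (simp add: scale_sum_right sum.distrib)
  also have "\<dots> = (\<Sum>a\<in>UNIV. \<Sum>b\<in>UNIV. ?s v k b (?s u i a (?q u a j (?q v b l x))) + ?g (?s v k a (?s u i b (?q u a j (?q v b l x)))))"
    by (intro sum.cong refl) (rule site_RTT[OF assms])
  also have "\<dots> = (\<Sum>a\<in>UNIV. \<Sum>b\<in>UNIV. ?s v k b (?s u i a (?q u a j (?q v b l x))))
      + (\<Sum>b\<in>UNIV. \<Sum>a\<in>UNIV. ?g (?s v k a (?s u i b (?q u a j (?q v b l x)))))"
    unfolding sum.distrib by (intro arg_cong2[where f="(+)"] refl sum.swap)
  also have "\<dots> = (\<Sum>a\<in>UNIV. \<Sum>b\<in>UNIV. ?s v k b (?s u i a (?q u a j (?q v b l x) + ?g (?q u b j (?q v a l x)))))"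
    by (simp add: sum.distrib sl)
  also have "\<dots> = (\<Sum>a\<in>UNIV. \<Sum>b\<in>UNIV. ?s v k b (?s u i a (?q v b l (?q u a j x) + ?g (?q v b j (?q u a l x)))))"
    unfolding Cons.IH[of _ j _ l x] ..
  also have "\<dots> = (\<Sum>b\<in>UNIV. \<Sum>a\<in>UNIV. ?s v k b (?s u i a (?q v b l (?q u a j x))))
      + ?g (\<Sum>b\<in>UNIV. \<Sum>a\<in>UNIV. ?s v k b (?s u i a (?q v b j (?q u a l x))))"
  proof -
    have "(\<Sum>a\<in>UNIV. \<Sum>b\<in>UNIV. ?s v k b (?s u i a (?q v b l (?q u a j x) + ?g (?q v b j (?q u a l x)))))
      = (\<Sum>a\<in>UNIV. \<Sum>b\<in>UNIV. ?s v k b (?s u i a (?q v b l (?q u a j x))))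
        + ?g (\<Sum>a\<in>UNIV. \<Sum>b\<in>UNIV. ?s v k b (?s u i a (?q v b j (?q u a l x))))"
      by (simp only: sum.distrib sl scale_sum_right)
    then show ?thesis
      using sum.swap[of "\<lambda>a b. ?s v k b (?s u i a (?q v b l (?q u a j x)))" UNIV UNIV]
        sum.swap[of "\<lambda>a b. ?s v k b (?s u i a (?q v b j (?q u a l x)))" UNIV UNIV] by (simp only:)
  qed
  also have "\<dots> = chain c (w # ps) v k l (chain c (w # ps) u i j x) + ?g (chain c (w # ps) v k j (chain c (w # ps) u i l x))"
    unfolding prod ..
  finally show ?case .
qed

definition chain_vac :: "(nat \<Rightarrow> nat) \<Rightarrow> complex" where
  "chain_vac g = (if g = (\<lambda>_. 0) then 1 else 0)"

definition chain_dvac :: "((nat \<Rightarrow> nat) \<Rightarrow> complex) \<Rightarrow> complex" where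
  "chain_dvac F = F (\<lambda>_. 0)"

lemma site_vac:
  "site c i al be u 1 1 chain_vac = csm (u - al) chain_vac" "site c i al be u 2 2 chain_vac = csm (u - be) chain_vac"
  "site c i al be u 2 1 chain_vac = 0"
proof -
  have "g(i := Suc (g i)) \<noteq> (\<lambda>_. 0)" for g :: "nat \<Rightarrow> nat"
    by (metis fun_upd_same nat.distinct(1))
  then show "site c i al be u 1 1 chain_vac = csm (u - al) chain_vac"
    "site c i al be u 2 2 chain_vac = csm (u - be) chain_vac" "site c i al be u 2 1 chain_vac = 0"
    by (auto simp: fun_eq_iff site_simps csm_def chain_vac_def)
qed

lemma chain_vac_action:
  "chain c ps u 1 1 chain_vac = csm (\<Prod>x\<leftarrow>ps. u - fst x) chain_vac"
  "chain c ps u 2 2 chain_vac = csm (\<Prod>x\<leftarrow>ps. u - snd x) chain_vac"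
  "chain c ps u 2 1 chain_vac = 0"
proof (induction ps)
  case Nil
  case 1 show ?case by (simp add: csm_def)
  case 2 show ?case by (simp add: csm_def)
  case 3 show ?case by (simp add: not_1_2)
next
  case (Cons x ps)
  interpret vector_space csm by (rule csm_vector_space)
  note r = linear_rules[OF chain_linear] linear_rules[OF site_linear]
  have "site c (length ps) (fst x) (snd x) u 2 1 (chain c ps u 1 2 chain_vac) = 0"
    by (simp only: site_chain_commute[OF order_refl] site_vac r)
  then show "chain c (x # ps) u 1 1 chain_vac = csm (\<Prod>x\<leftarrow>x # ps. u - fst x) chain_vac"
    "chain c (x # ps) u 2 2 chain_vac = csm (\<Prod>x\<leftarrow>x # ps. u - snd x) chain_vac"
    "chain c (x # ps) u 2 1 chain_vac = 0"
    by (simp_all only: chain.simps sum_2 Cons r site_vac scale_zero_right add_0_right add_0_left scale_scale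
        list.map prod_list.Cons mult.commute)
qed

lemma chain_dvac_action:
  "chain_dvac (chain c ps u 1 1 F) = (\<Prod>x\<leftarrow>ps. u - fst x) * chain_dvac F"
  "chain_dvac (chain c ps u 2 2 F) = (\<Prod>x\<leftarrow>ps. u - snd x) * chain_dvac F"
  "chain_dvac (chain c ps u 1 2 F) = 0"
proof (induction ps arbitrary: F)
  case Nil
  case 1 show ?case by (simp add: chain_dvac_def)
  case 2 show ?case by (simp add: chain_dvac_def)
  case 3 show ?case by (simp add: chain_dvac_def not_1_2)
next
  case (Cons x ps)
  have s: "chain_dvac (F + G) = chain_dvac F + chain_dvac G"
    "chain_dvac (site c i al be u 1 1 F) = (u - al) * chain_dvac F"
    "chain_dvac (site c i al be u 2 2 F) = (u - be) * chain_dvac F"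
    "chain_dvac (site c i al be u 1 2 F) = 0" for F G i al be
    by (simp_all add: chain_dvac_def site_simps)
  have "chain_dvac (site c (length ps) (fst x) (snd x) u 2 1 (chain c ps u 1 2 F)) = 0" for F
    by (simp add: site_chain_commute Cons)
  then show "chain_dvac (chain c (x # ps) u 1 1 F) = (\<Prod>x\<leftarrow>x # ps. u - fst x) * chain_dvac F"
    "chain_dvac (chain c (x # ps) u 2 2 F) = (\<Prod>x\<leftarrow>x # ps. u - snd x) * chain_dvac F"
    "chain_dvac (chain c (x # ps) u 1 2 F) = 0" for F
    by (simp_all add: sum_2 s Cons)
qed

lemma generalized_model_chain:
  assumes "c \<noteq> 0"
  shows "generalized_model csm c UNIV (\<lambda>u. \<chi> i j. chain c ps u i j) chain_vac chain_dvac
     (\<lambda>u. \<Prod>x\<leftarrow>ps. u - fst x) (\<lambda>u. \<Prod>x\<leftarrow>ps. u - snd x)"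
proof -
  interpret vector_space csm by (rule csm_vector_space)
  show ?thesis
  proof (intro generalized_model.intro generalized_model_axioms.intro csm_vector_space)
    show "Vector_Spaces.linear csm csm ((\<chi> i j. chain c ps u i j) $ i $ j)" for u i j
      by (simp add: chain_linear)
    show "Vector_Spaces.linear csm (*) chain_dvac"
      by (intro Vector_Spaces.linear.intro csm_vector_space vector_space_over_itself.vector_space_axioms
          module_hom.intro module_hom_axioms.intro csm_vector_space[unfolded vector_space_def, folded module_def]
          vector_space_over_itself.module_axioms)
        (simp_all add: chain_dvac_def csm_def)
    fix u v :: complex assume "u \<noteq> v"
    have lin: "Vector_Spaces.linear csm csm ((\<chi> i j. chain c ps u i j) $ i $ j)" for u i j
      by (simp add: chain_linear)
    show "lift_mat csm (R_mat c u v) \<odot> tensor1 (\<chi> i j. chain c ps u i j) \<odot> tensor2 (\<chi> i j. chain c ps v i j)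
      = tensor2 (\<chi> i j. chain c ps v i j) \<odot> tensor1 (\<chi> i j. chain c ps u i j) \<odot> lift_mat csm (R_mat c u v)"
    proof (intro vec_eq_iff[THEN iffD2] allI)
      fix p q :: "2 \<times> 2"
      obtain i k j l where "p = (i, k)" "q = (j, l)" by fastforce
      then show "(lift_mat csm (R_mat c u v) \<odot> tensor1 (\<chi> i j. chain c ps u i j) \<odot> tensor2 (\<chi> i j. chain c ps v i j)) $ p $ q
        = (tensor2 (\<chi> i j. chain c ps v i j) \<odot> tensor1 (\<chi> i j. chain c ps u i j) \<odot> lift_mat csm (R_mat c u v)) $ p $ q"
        using chain_RTT[OF \<open>u \<noteq> v\<close>, of c ps]
        by (simp add: RTT_matrix_entries[OF csm_vector_space lin lin])
    qed
  qed (simp_all add: assms chain_vac_action chain_dvac_action, simp add: chain_dvac_def chain_vac_def)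
qed

lemma polynomial_interpolation:
  fixes f :: "complex \<Rightarrow> complex"
  assumes "finite X"
  shows "\<exists>p. \<forall>x\<in>X. poly p x = f x"
  using assms
proof (induction X rule: finite_induct)
  case (insert x X)
  then obtain p where p: "\<forall>x\<in>X. poly p x = f x" by blast
  define w where "w = (\<Prod>y\<in>X. [:- y, 1:])"
  have w: "poly w x \<noteq> 0" "\<forall>y\<in>X. poly w y = 0"
    using insert.hyps by (auto simp: w_def poly_prod)
  have "\<forall>y\<in>insert x X. poly (p + smult ((f x - poly p x) / poly w x) w) y = f y"
    using p w by auto
  then show ?case by blast
qed simp

text \<open>Adding to an interpolation polynomial a monic polynomial of degree \<open>N\<close> that
  vanishes on \<open>X\<close> gives a monic polynomial with the prescribed values, which factors
  over the complex numbers. All large \<open>N\<close> are covered because \<open>l1\<close> and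
  \<open>l2\<close> of a chain have equally many factors.\<close>

lemma product_interpolation:
  fixes f :: "complex \<Rightarrow> complex"
  assumes "finite X"
  shows "\<exists>N0. \<forall>N\<ge>N0. \<exists>xs. length xs = N \<and> (\<forall>x\<in>X. (\<Prod>a\<leftarrow>xs. x - a) = f x)"
proof -
  obtain p where p: "\<forall>x\<in>X. poly p x = f x" using polynomial_interpolation[OF assms] by blast
  have "\<exists>xs. length xs = N \<and> (\<forall>x\<in>X. (\<Prod>a\<leftarrow>xs. x - a) = f x)" if N: "N \<ge> card X + degree p + 1" for N
  proof -
    define w where "w = (\<Prod>y\<in>X. [:- y, 1:]) * [:0, 1:] ^ (N - card X)"
    have d: "degree (\<Prod>y\<in>X. [:- y, 1:] :: complex poly) = card X"
      by (subst degree_prod_sum_eq) simp_all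
    have l: "lead_coeff (\<Prod>y\<in>X. [:- y, 1:] :: complex poly) = 1"
      unfolding lead_coeff_prod by simp
    have l': "lead_coeff ([:0, 1:] ^ (N - card X) :: complex poly) = 1"
      unfolding lead_coeff_power by simp
    have d': "degree ([:0, 1:] ^ (N - card X) :: complex poly) = N - card X"
      by (subst degree_power_eq) simp_all
    have nz: "(\<Prod>y\<in>X. [:- y, 1:] :: complex poly) \<noteq> 0" "([:0, 1:] ^ (N - card X) :: complex poly) \<noteq> 0"
      using l l' by (metis leading_coeff_0_iff zero_neq_one)+
    have dw: "degree w = N"
      unfolding w_def degree_mult_eq[OF nz] d d' using N by simp
    have lw: "lead_coeff w = 1"
      unfolding w_def lead_coeff_mult l l' by simp
    define q where "q = p + w"
    have q: "degree q = N" "lead_coeff q = 1"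
      using dw lw N by (simp_all add: q_def degree_add_eq_right lead_coeff_add_le coeff_eq_0)
    define A where "A = proots q"
    have A: "size A = degree q" "q = smult (lead_coeff q) (\<Prod>x\<in>#A. [:- x, 1:])"
      unfolding A_def by (rule size_proots_complex, rule complex_poly_decompose_multiset[symmetric])
    obtain xs where xs: "mset xs = A" using ex_mset[of A] by (elim exE)
    have "poly q x = (\<Prod>a\<leftarrow>xs. x - a)" for x
    proof -
      have "q = (\<Prod>x\<in>#mset xs. [:- x, 1:])"
        using A(2)[unfolded q(2)] unfolding xs smult_1_left .
      also have "\<dots> = (\<Prod>a\<leftarrow>xs. [:- a, 1:])"
        by (simp only: mset_map[symmetric] prod_mset_prod_list)
      finally have "q = (\<Prod>a\<leftarrow>xs. [:- a, 1:])" .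
      moreover have "poly (\<Prod>a\<leftarrow>xs. [:- a, 1:]) x = (\<Prod>a\<leftarrow>xs. x - a)"
        by (induction xs) (simp_all add: algebra_simps)
      ultimately show ?thesis by simp
    qed
    moreover have "poly w x = 0" if "x \<in> X" for x
      using that assms by (auto simp: w_def poly_prod)
    ultimately have "\<forall>x\<in>X. (\<Prod>a\<leftarrow>xs. x - a) = f x"
      using p by (metis q_def poly_add add.right_neutral)
    moreover have "length xs = N" using xs A(1) q(1) by (metis size_mset)
    ultimately show ?thesis by blast
  qed
  then show ?thesis by blast
qed

lemma model_exists:
  fixes f1 f2 :: "complex \<Rightarrow> complex"
  assumes "c \<noteq> 0" "finite X"
  obtains T l1 l2 where "generalized_model csm c UNIV T chain_vac chain_dvac l1 l2"
    "\<And>x. x \<in> X \<Longrightarrow> l1 x = f1 x" "\<And>x. x \<in> X \<Longrightarrow> l2 x = f2 x"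
proof -
  obtain N1 N2 where N: "\<forall>N\<ge>N1. \<exists>xs. length xs = N \<and> (\<forall>x\<in>X. (\<Prod>a\<leftarrow>xs. x - a) = f1 x)"
    "\<forall>N\<ge>N2. \<exists>xs. length xs = N \<and> (\<forall>x\<in>X. (\<Prod>a\<leftarrow>xs. x - a) = f2 x)"
    using product_interpolation[OF assms(2)] by metis
  obtain xs ys where xy: "length xs = max N1 N2" "\<forall>x\<in>X. (\<Prod>a\<leftarrow>xs. x - a) = f1 x"
    "length ys = max N1 N2" "\<forall>x\<in>X. (\<Prod>a\<leftarrow>ys. x - a) = f2 x"
    using N by (meson max.cobounded1 max.cobounded2)
  then have m: "map fst (zip xs ys) = xs" "map snd (zip xs ys) = ys" by simp_all
  have e: "(\<Prod>x\<leftarrow>zip xs ys. u - fst x) = (\<Prod>a\<leftarrow>xs. u - a)" "(\<Prod>x\<leftarrow>zip xs ys. u - snd x) = (\<Prod>a\<leftarrow>ys. u - a)" for u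
  proof -
    have "(\<Prod>x\<leftarrow>zip xs ys. u - fst x) = (\<Prod>a\<leftarrow>map fst (zip xs ys). u - a)"
      "(\<Prod>x\<leftarrow>zip xs ys. u - snd x) = (\<Prod>a\<leftarrow>map snd (zip xs ys). u - a)"
      by (simp_all add: o_def)
    then show "(\<Prod>x\<leftarrow>zip xs ys. u - fst x) = (\<Prod>a\<leftarrow>xs. u - a)" "(\<Prod>x\<leftarrow>zip xs ys. u - snd x) = (\<Prod>a\<leftarrow>ys. u - a)"
      unfolding m .
  qed
  show ?thesis
    by (rule that[OF generalized_model_chain[OF assms(1), of "zip xs ys"]]) (use xy(2,4) in \<open>simp_all only: e\<close>)
qed


subsection \<open>Domain wall partition functions\<close>


text \<open>The scalar products of single-row Bethe vectors with \<open>l1 = 1\<close> on the first and \<open>l2 = 1\<close> on the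
  second set of parameters, where \<open>l2\<close> and \<open>l1\<close> vanish, respectively (the domain wall partition
  function).\<close>

fun dwpf :: "complex \<Rightarrow> complex list \<Rightarrow> complex set \<Rightarrow> complex" where
  "dwpf c [] X = (if X = {} then 1 else 0)"
| "dwpf c (y # ys) X = - (\<Sum>x\<in>X. g_rat c y x * (\<Prod>w\<in>X - {x}. f_rat c w y * f_rat c x w) * dwpf c ys (X - {x}))"

context generalized_model
begin

abbreviation tb :: "complex \<Rightarrow> 'h \<Rightarrow> 'h" where
  "tb u \<equiv> t u 1 2"

abbreviation tvec :: "complex set \<Rightarrow> 'h" where
  "tvec \<equiv> op_vec tb vac"

lemma t11_t12:
  assumes "u \<in> D" "v \<in> D" "u \<noteq> v"
  shows "t u 1 1 (tb v x) = smul (f_rat c v u) (tb v (t u 1 1 x)) - smul (g_rat c v u) (tb u (t v 1 1 x))"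
proof -
  have "f_rat c v u = 1 + g_rat c v u" using assms by (simp add: f_rat_def g_rat_def add_divide_distrib)
  then show ?thesis
    using RTT_entry[OF assms(2,1), of 1 2 1 1 x] assms by (simp add: scale_left_distrib algebra_simps)
qed

lemma t22_t12:
  assumes "u \<in> D" "v \<in> D" "u \<noteq> v"
  shows "t u 2 2 (tb v x) = smul (f_rat c u v) (tb v (t u 2 2 x)) - smul (g_rat c u v) (tb u (t v 2 2 x))"
proof -
  have "f_rat c u v = 1 + g_rat c u v" using assms by (simp add: f_rat_def g_rat_def add_divide_distrib)
  then show ?thesis
    using RTT_entry[OF assms, of 2 2 1 2 x] assms by (simp add: scale_left_distrib algebra_simps)
qed

lemma t21_t12:
  assumes "u \<in> D" "v \<in> D" "u \<noteq> v"
  shows "t u 2 1 (tb v x) = tb v (t u 2 1 x)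
    + smul (g_rat c u v) (t u 2 2 (t v 1 1 x)) - smul (g_rat c u v) (t v 2 2 (t u 1 1 x))"
proof -
  have "g_rat c v u = - g_rat c u v" unfolding g_rat_def by (metis minus_diff_eq divide_minus_right)
  then show ?thesis
    using RTT_entry[OF assms(2,1), of 1 2 2 1 x] assms by (simp add: algebra_simps)
qed

lemma t21_t22:
  assumes "u \<in> D" "v \<in> D" "u \<noteq> v"
  shows "t v 2 1 (t u 2 2 x) = smul (f_rat c u v) (t u 2 2 (t v 2 1 x)) - smul (g_rat c u v) (t v 2 2 (t u 2 1 x))"
proof -
  have "f_rat c u v = 1 + g_rat c u v" using assms by (simp add: f_rat_def g_rat_def add_divide_distrib)
  then show ?thesis
    using RTT_entry[OF assms, of 2 2 2 1 x] assms by (simp add: scale_left_distrib algebra_simps)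
qed

lemma tb_commute:
  assumes "u \<in> D" "v \<in> D"
  shows "tb u (tb v x) = tb v (tb u x)"
proof (cases "u = v")
  case False
  have *: "tb u (tb v x) = tb v (tb u x)" if uv: "u \<in> D" "v \<in> D" "u \<noteq> v" "1 + g_rat c u v \<noteq> 0" for u v
  proof -
    have "smul (1 + g_rat c u v) (tb u (tb v x)) = smul (1 + g_rat c u v) (tb v (tb u x))"
      using RTT_entry[OF uv(1-3), of 1 2 1 2 x] by (simp add: scale_left_distrib)
    then show ?thesis using uv(4) by simp
  qed
  have "g_rat c v u = - g_rat c u v" unfolding g_rat_def by (metis minus_diff_eq divide_minus_right)
  then have "1 + g_rat c u v \<noteq> 0 \<or> 1 + g_rat c v u \<noteq> 0"
    by (auto simp: add_eq_0_iff)
  then show ?thesis using *[OF assms False] *[OF assms(2,1)] False by auto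
qed simp

sublocale tb: comm_family D UNIV tb vac
  by unfold_locales (auto intro: tb_commute)

text \<open>In every exchanged term \<open>l1\<close> is evaluated at a point of \<open>X\<close>,
  where it vanishes; the term that keeps its argument survives.\<close>

lemma t11_tvec:
  assumes "finite X" "insert y X \<subseteq> D" "y \<notin> X" "\<And>x. x \<in> X \<Longrightarrow> l1 x = 0"
  shows "t y 1 1 (tvec X) = smul (l1 y * (\<Prod>x\<in>X. f_rat c x y)) (tvec X)"
  using assms
proof (induction X arbitrary: y rule: finite_induct)
  case empty
  then show ?case by (simp add: tb.bv_empty T11_vac)
next
  case (insert x X)
  have v: "tvec (insert x X) = tb x (tvec X)"
    using insert by (intro tb.bv_insert) auto
  have A: "t x 1 1 (tvec X) = 0"
    using insert by (subst insert.IH) auto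
  have "t y 1 1 (tb x (tvec X)) = smul (f_rat c x y) (tb x (t y 1 1 (tvec X)))"
    using t11_t12[of y x] insert.prems by (auto simp: A t_rules)
  also have "t y 1 1 (tvec X) = smul (l1 y * (\<Prod>x\<in>X. f_rat c x y)) (tvec X)"
    using insert by (intro insert.IH) auto
  finally show ?case using insert by (simp add: v t_rules mult_ac)
qed

lemma t22_tvec:
  assumes "finite X" "insert y X \<subseteq> D" "y \<notin> X"
  shows "t y 2 2 (tvec X) = smul (l2 y * (\<Prod>x\<in>X. f_rat c y x)) (tvec X)
     - (\<Sum>x\<in>X. smul (g_rat c y x * l2 x * (\<Prod>w\<in>X - {x}. f_rat c x w)) (tvec (insert y (X - {x}))))"
  using assms
proof (induction X arbitrary: y rule: finite_induct)
  case empty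
  then show ?case by (simp add: tb.bv_empty T22_vac)
next
  case (insert x X)
  have fin: "finite X" and D: "x \<in> D" "y \<in> D" "X \<subseteq> D" and ne: "y \<noteq> x" "y \<notin> X" "x \<notin> X" using insert by auto
  have v: "tvec (insert z X) = tb z (tvec X)" if "z \<in> D" "z \<notin> X" for z
    using that D fin by (intro tb.bv_insert) auto
  define B2 where "B2 w = tvec (insert y (insert x X - {w}))" for w
  have B2: "tb x (tvec (insert y (X - {w}))) = B2 w" "tb y (tvec (insert x (X - {w}))) = B2 w" if "w \<in> X" for w
  proof -
    have e: "insert y (insert x X - {w}) = insert x (insert y (X - {w}))" "insert y (insert x X - {w}) = insert y (insert x (X - {w}))"
      using that ne by auto
    show "tb x (tvec (insert y (X - {w}))) = B2 w"
      unfolding B2_def e(1) using D fin ne by (subst (2) tb.bv_insert) auto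
    show "tb y (tvec (insert x (X - {w}))) = B2 w"
      unfolding B2_def e(2) using D fin ne by (subst (2) tb.bv_insert) auto
  qed
  have B2x: "tb y (tvec X) = B2 x" using v[of y] D ne by (simp add: B2_def)
  define k where "k z w = g_rat c z w * l2 w * (\<Prod>u\<in>X - {w}. f_rat c w u)" for z w
  have IHy: "t y 2 2 (tvec X) = smul (l2 y * (\<Prod>x\<in>X. f_rat c y x)) (tvec X)
     - (\<Sum>w\<in>X. smul (k y w) (tvec (insert y (X - {w}))))"
    unfolding k_def using D ne by (intro insert.IH) auto
  have IHx: "t x 2 2 (tvec X) = smul (l2 x * (\<Prod>w\<in>X. f_rat c x w)) (tvec X)
     - (\<Sum>w\<in>X. smul (k x w) (tvec (insert x (X - {w}))))"
    unfolding k_def using D ne by (intro insert.IH) auto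
  have coef: "f_rat c y x * k y w - g_rat c y x * k x w
      = g_rat c y w * l2 w * (\<Prod>u\<in>insert x X - {w}. f_rat c w u)" if w: "w \<in> X" for w
  proof -
    have nz: "y - x \<noteq> 0" "y - w \<noteq> 0" "x - w \<noteq> 0" "w - x \<noteq> 0" using w ne by auto
    have "insert x X - {w} = insert x (X - {w})" using w ne by auto
    then have "(\<Prod>u\<in>insert x X - {w}. f_rat c w u) = f_rat c w x * (\<Prod>u\<in>X - {w}. f_rat c w u)"
      using fin ne by simp
    moreover have "f_rat c y x * g_rat c y w - g_rat c y x * g_rat c x w = g_rat c y w * f_rat c w x"
    proof -
      have s: "x - w = - (w - x)" by simp
      show ?thesis unfolding f_rat_def g_rat_def s
        using nz(1,2,4) by (simp only: divide_minus_right) (simp add: divide_simps, simp add: algebra_simps)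
    qed
    ultimately have 1: "g_rat c y w * l2 w * (\<Prod>u\<in>insert x X - {w}. f_rat c w u)
        = (f_rat c y x * g_rat c y w - g_rat c y x * g_rat c x w) * (l2 w * (\<Prod>u\<in>X - {w}. f_rat c w u))"
      by (simp add: mult_ac)
    show ?thesis unfolding 1 k_def by (simp only: left_diff_distrib mult.assoc)
  qed
  have "t y 2 2 (tb x (tvec X)) = smul (f_rat c y x) (tb x (t y 2 2 (tvec X)))
      - smul (g_rat c y x) (tb y (t x 2 2 (tvec X)))"
    using t22_t12[of y x] D ne by auto
  also have "tb x (t y 2 2 (tvec X)) = smul (l2 y * (\<Prod>x\<in>X. f_rat c y x)) (tb x (tvec X))
     - (\<Sum>w\<in>X. smul (k y w) (B2 w))"
    unfolding IHy using D by (simp add: t_rules B2)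
  also have "tb y (t x 2 2 (tvec X)) = smul (l2 x * (\<Prod>w\<in>X. f_rat c x w)) (B2 x)
     - (\<Sum>w\<in>X. smul (k x w) (B2 w))"
    unfolding IHx using D by (simp add: t_rules B2 B2x)
  also have "smul (f_rat c y x) (smul (l2 y * (\<Prod>x\<in>X. f_rat c y x)) (tb x (tvec X)) - (\<Sum>w\<in>X. smul (k y w) (B2 w)))
      - smul (g_rat c y x) (smul (l2 x * (\<Prod>w\<in>X. f_rat c x w)) (B2 x) - (\<Sum>w\<in>X. smul (k x w) (B2 w)))
    = smul (f_rat c y x * (l2 y * (\<Prod>x\<in>X. f_rat c y x))) (tb x (tvec X))
      - (smul (g_rat c y x * (l2 x * (\<Prod>w\<in>X. f_rat c x w))) (B2 x)
      + (\<Sum>w\<in>X. smul (f_rat c y x * k y w - g_rat c y x * k x w) (B2 w)))"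
  proof -
    have grp: "X - A - (Y - B) = X - (Y + (A - B))" for X Y A B :: 'h
      by (simp add: algebra_simps)
    show ?thesis
      by (simp only: scale_right_diff_distrib scale_left_diff_distrib scale_sum_right scale_scale sum_subtractf) (rule grp)
  qed
  also have "(\<Sum>w\<in>X. smul (f_rat c y x * k y w - g_rat c y x * k x w) (B2 w))
    = (\<Sum>w\<in>X. smul (g_rat c y w * l2 w * (\<Prod>u\<in>insert x X - {w}. f_rat c w u)) (B2 w))"
    by (intro sum.cong refl) (simp only: coef)
  finally show ?case
    using fin ne D by (simp add: v B2_def mult_ac)
qed

text \<open>Commuting \<open>t y 2 1\<close> with \<open>tb x\<close> gives two products of diagonal
  entries; the one with \<open>t x 1 1\<close> acting first is zero since \<open>l1\<close> vanishes
  on \<open>X\<close>. The other is evaluated by \<open>t11_tvec\<close> and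
  \<open>t22_tvec\<close>, and the rational identity \<open>id\<close> merges the resulting
  coefficients.\<close>

lemma t21_tvec:
  assumes "finite X" "insert y X \<subseteq> D" "y \<notin> X" "\<And>x. x \<in> X \<Longrightarrow> l1 x = 0"
  shows "t y 2 1 (tvec X) = - (\<Sum>x\<in>X. smul (l1 y * (g_rat c y x * l2 x * (\<Prod>w\<in>X - {x}. f_rat c w y * f_rat c x w)))
      (tvec (X - {x})))"
  using assms
proof (induction X rule: finite_induct)
  case empty
  then show ?case by (simp add: tb.bv_empty T21_vac)
next
  case (insert x X)
  have fin: "finite X" and D: "x \<in> D" "y \<in> D" "X \<subseteq> D" and ne: "y \<noteq> x" "y \<notin> X" "x \<notin> X" using insert by auto
  have l0: "\<And>x. x \<in> X \<Longrightarrow> l1 x = 0" "l1 x = 0" using insert.prems by auto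
  have v: "tvec (insert x X) = tb x (tvec X)"
    using D fin ne by (intro tb.bv_insert) auto
  have B2: "tb x (tvec (X - {w})) = tvec (insert x X - {w})" "tvec (insert x (X - {w})) = tvec (insert x X - {w})"
    if "w \<in> X" for w
  proof -
    have e: "insert x (X - {w}) = insert x X - {w}" using that ne by auto
    show "tvec (insert x (X - {w})) = tvec (insert x X - {w})" by (simp add: e)
    show "tb x (tvec (X - {w})) = tvec (insert x X - {w})"
      unfolding e[symmetric] by (rule tb.bv_insert[symmetric]) (use D fin ne in auto)
  qed
  define K where "K w = l2 w * (\<Prod>u\<in>X - {w}. f_rat c u y * f_rat c w u)" for w
  define F where "F = (\<Prod>u\<in>X. f_rat c u y)"
  have Ax: "t x 1 1 (tvec X) = 0" using t11_tvec[OF fin, of x] D ne l0 by simp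
  have Ay: "t y 1 1 (tvec X) = smul (l1 y * F) (tvec X)"
    unfolding F_def using D ne l0 by (intro t11_tvec fin) auto
  have "t y 2 1 (tb x (tvec X)) = tb x (t y 2 1 (tvec X)) - smul (g_rat c y x) (t x 2 2 (t y 1 1 (tvec X)))"
    using t21_t12[of y x] D ne by (simp add: Ax t_rules)
  also have "tb x (t y 2 1 (tvec X)) = - (\<Sum>w\<in>X. smul (l1 y * (g_rat c y w * K w)) (tvec (insert x X - {w})))"
    using insert.IH D ne l0 by (simp add: t_rules B2 K_def mult.assoc)
  also have "smul (g_rat c y x) (t x 2 2 (t y 1 1 (tvec X)))
    = smul (l1 y * (g_rat c y x * l2 x * (F * (\<Prod>w\<in>X. f_rat c x w)))) (tvec X)
     - (\<Sum>w\<in>X. smul (g_rat c y x * (l1 y * F) * (g_rat c x w * l2 w * (\<Prod>u\<in>X - {w}. f_rat c w u))) (tvec (insert x X - {w})))"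
    unfolding Ay using t22_tvec[OF fin, of x] D ne
    by (simp add: t_rules scale_right_diff_distrib scale_sum_right B2 mult_ac)
  also have "- (\<Sum>w\<in>X. smul (l1 y * (g_rat c y w * K w)) (tvec (insert x X - {w})))
     - (smul (l1 y * (g_rat c y x * l2 x * (F * (\<Prod>w\<in>X. f_rat c x w)))) (tvec X)
     - (\<Sum>w\<in>X. smul (g_rat c y x * (l1 y * F) * (g_rat c x w * l2 w * (\<Prod>u\<in>X - {w}. f_rat c w u))) (tvec (insert x X - {w}))))
    = - (smul (l1 y * (g_rat c y x * l2 x * (F * (\<Prod>w\<in>X. f_rat c x w)))) (tvec X)
      + (\<Sum>w\<in>X. smul (l1 y * (g_rat c y w * K w) - g_rat c y x * (l1 y * F) * (g_rat c x w * l2 w * (\<Prod>u\<in>X - {w}. f_rat c w u)))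
         (tvec (insert x X - {w}))))"
    by (simp add: scale_left_diff_distrib sum_subtractf)
  also have "(\<Sum>w\<in>X. smul (l1 y * (g_rat c y w * K w) - g_rat c y x * (l1 y * F) * (g_rat c x w * l2 w * (\<Prod>u\<in>X - {w}. f_rat c w u)))
         (tvec (insert x X - {w})))
    = (\<Sum>w\<in>X. smul (l1 y * (g_rat c y w * l2 w * (\<Prod>u\<in>insert x X - {w}. f_rat c u y * f_rat c w u))) (tvec (insert x X - {w})))"
  proof (intro sum.cong refl arg_cong2[where f=smul])
    fix w assume w: "w \<in> X"
    have nz: "y - x \<noteq> 0" "y - w \<noteq> 0" "w - x \<noteq> 0" using w ne by auto
    define P1 where "P1 = (\<Prod>u\<in>X - {w}. f_rat c u y)"
    define P2 where "P2 = (\<Prod>u\<in>X - {w}. f_rat c w u)"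
    have "insert x X - {w} = insert x (X - {w})" using w ne by auto
    then have 1: "(\<Prod>u\<in>insert x X - {w}. f_rat c u y * f_rat c w u) = f_rat c x y * f_rat c w x * (P1 * P2)"
      using fin ne by (simp add: P1_def P2_def prod.distrib mult_ac)
    have 2: "K w = l2 w * (P1 * P2)" by (simp add: K_def P1_def P2_def prod.distrib)
    have 3: "F = f_rat c w y * P1" using fin w by (simp add: F_def P1_def prod.remove)
    have id: "g_rat c y w - g_rat c y x * g_rat c x w * f_rat c w y = g_rat c y w * (f_rat c x y * f_rat c w x)"
    proof -
      have s: "x - w = - (w - x)" "w - y = - (y - w)" "x - y = - (y - x)" by simp_all
      show ?thesis unfolding f_rat_def g_rat_def s
        using nz by (simp only: divide_minus_right) (simp add: divide_simps, simp add: algebra_simps)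
    qed
    have "l1 y * (g_rat c y w * K w) - g_rat c y x * (l1 y * F) * (g_rat c x w * l2 w * P2)
      = l1 y * l2 w * P1 * P2 * (g_rat c y w - g_rat c y x * g_rat c x w * f_rat c w y)"
      unfolding 2 3 by (simp add: algebra_simps)
    then show "l1 y * (g_rat c y w * K w) - g_rat c y x * (l1 y * F) * (g_rat c x w * l2 w * (\<Prod>u\<in>X - {w}. f_rat c w u))
      = l1 y * (g_rat c y w * l2 w * (\<Prod>u\<in>insert x X - {w}. f_rat c u y * f_rat c w u))"
      unfolding 1 id P2_def[symmetric] by (simp add: mult_ac)
  qed
  finally show ?case
    using fin ne by (simp add: v F_def prod.distrib)
qed

text \<open>Origin of the recursion \<open>dwpf\<close>: with \<open>l1 = 1\<close> on
  \<open>ys\<close> and \<open>l2 = 1\<close> on \<open>X\<close> no data of the model remain in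
  \<open>t21_tvec\<close>. A vector with leftover operators \<open>tb\<close> is annihilated by the
  dual vacuum.\<close>

lemma fold_t21_tvec:
  assumes "finite X" "set ys \<union> X \<subseteq> D" "set ys \<inter> X = {}"
    "\<And>x. x \<in> X \<Longrightarrow> l1 x = 0" "\<And>x. x \<in> X \<Longrightarrow> l2 x = 1" "\<And>y. y \<in> set ys \<Longrightarrow> l1 y = 1"
  shows "dvac (fold (\<lambda>y. t y 2 1) ys (tvec X)) = dwpf c ys X"
  using assms
proof (induction ys arbitrary: X)
  case Nil
  show ?case
  proof (cases "X = {}")
    case False
    then obtain x where x: "x \<in> X" by blast
    then have X: "insert x (X - {x}) = X" by blast
    have "tvec (insert x (X - {x})) = tb x (tvec (X - {x}))"
      using Nil.prems x by (intro tb.bv_insert) auto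
    then have "dvac (tvec X) = dvac (tb x (tvec (X - {x})))" unfolding X by simp
    also have "\<dots> = 0" using Nil.prems x by (intro dvac_T12) auto
    finally show ?thesis using False by simp
  qed (simp add: tb.bv_empty dvac_vac)
next
  case (Cons y ys)
  have fl: "dvac (fold (\<lambda>y. t y 2 1) ys (- (\<Sum>x\<in>X. smul (k x) (w x)))) = - (\<Sum>x\<in>X. k x * dvac (fold (\<lambda>y. t y 2 1) ys (w x)))"
    for k and w :: "complex \<Rightarrow> 'h"
  proof -
    have "set ys \<subseteq> D" using Cons.prems by auto
    then have "fold (\<lambda>y. t y 2 1) ys (- (\<Sum>x\<in>X. smul (k x) (w x))) = - (\<Sum>x\<in>X. smul (k x) (fold (\<lambda>y. t y 2 1) ys (w x)))"
    proof (induction ys arbitrary: w)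
      case (Cons a ys)
      then have "t a 2 1 (- (\<Sum>x\<in>X. smul (k x) (w x))) = - (\<Sum>x\<in>X. smul (k x) (t a 2 1 (w x)))"
        by (simp add: t_rules)
      then show ?case using Cons by simp
    qed simp
    then show ?thesis by (simp only: dvac_rules)
  qed
  have "t y 2 1 (tvec X) = - (\<Sum>x\<in>X. smul (g_rat c y x * (\<Prod>w\<in>X - {x}. f_rat c w y * f_rat c x w)) (tvec (X - {x})))"
    using Cons.prems by (subst t21_tvec) (auto simp: mult_ac)
  then have "dvac (fold (\<lambda>y. t y 2 1) (y # ys) (tvec X))
    = - (\<Sum>x\<in>X. g_rat c y x * (\<Prod>w\<in>X - {x}. f_rat c w y * f_rat c x w) * dvac (fold (\<lambda>y. t y 2 1) ys (tvec (X - {x}))))"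
    by (simp add: fl)
  also have "\<dots> = dwpf c (y # ys) X"
  proof -
    have "dvac (fold (\<lambda>y. t y 2 1) ys (tvec (X - {x}))) = dwpf c ys (X - {x})" for x
      using Cons.prems by (intro Cons.IH) auto
    then show ?thesis by simp
  qed
  finally show ?case .
qed

end


subsection \<open>The scalar product with a dual eigenvector\<close>


definition refl_sp ::
  "(complex \<Rightarrow> 'h::ab_group_add \<Rightarrow> 'h) \<Rightarrow> complex \<Rightarrow> complex \<Rightarrow> (complex \<Rightarrow> ('h \<Rightarrow> 'h)^2^2)
   \<Rightarrow> 'h \<Rightarrow> ('h \<Rightarrow> complex) \<Rightarrow> complex list \<Rightarrow> complex set \<Rightarrow> complex" where
  "refl_sp smul c xm T vac dvac vs U =
     dual_bethe_vector smul c xm T dvac vs (bethe_vector_of_set smul c xm T vac U)"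

definition cfg :: "complex list \<Rightarrow> complex set \<Rightarrow> bool" where
  "cfg vs U \<longleftrightarrow> finite U \<and> distinct vs \<and> set vs \<inter> U = {} \<and> (\<forall>x\<in>U \<union> set vs. - x \<notin> U \<union> set vs)
     \<and> length vs = card U"

text \<open>The reflection matrix at \<open>u\<close> contains \<open>T\<close> at \<open>u\<close>
  and at \<open>- u\<close>; these are the points at which a model must be defined and its data
  known.\<close>

definition pmset :: "complex set \<Rightarrow> complex set" where
  "pmset S = S \<union> uminus ` S"

lemma pmset_uminus: "x \<in> pmset S \<Longrightarrow> - x \<in> pmset S"
  by (auto simp: pmset_def)

lemma pmset_zero: "(\<And>x. x \<in> S \<Longrightarrow> - x \<notin> S) \<Longrightarrow> 0 \<notin> pmset S"
  unfolding pmset_def by (metis Un_iff image_iff neg_equal_0_iff_equal)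

lemma foldr_dual: "foldr (\<lambda>u \<phi> x. \<phi> (f u x)) (rev vs) d = (\<lambda>x. d (foldr f vs x))"
  by (induction vs arbitrary: d) simp_all

lemma refl_alg_dual_restrict:
  assumes "refl_alg_dual smul c P A b vac m cc d" "P' \<subseteq> P" "\<And>u. u \<in> P' \<Longrightarrow> - u \<in> P'"
  shows "refl_alg_dual smul c P' A b vac m cc d"
proof -
  interpret refl_alg_dual smul c P A b vac m cc d by fact
  show ?thesis
    by (intro refl_alg_dual.intro refl_alg_restrict[OF refl_alg_axioms assms(2,3)] refl_alg_dual_axioms.intro)
      (use assms(2) in \<open>simp_all add: c_nz d_add d_scale d_vac d_b d_A subset_iff\<close>)
qed

text \<open>The factor by which \<open>B(z)\<close> differs from the single entry
  \<open>t (- z) 1 2\<close> if \<open>l1\<close> is 0 at the points \<open>- z\<close> and 1 at the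
  points \<open>z\<close>. The \<open>f_rat\<close> come from moving \<open>t z 1 1\<close> to the
  vacuum.\<close>

fun coefZ :: "complex \<Rightarrow> complex \<Rightarrow> complex list \<Rightarrow> complex" where
  "coefZ c xm [] = 1"
| "coefZ c xm (z # zs) =
     - (xm + z - c/2) * (f_rat c (- z) z * (\<Prod>w\<in>set zs. f_rat c (- w) z)) * coefZ c xm zs"

text \<open>The factor by which \<open>C(v)\<close> differs from the single entry
  \<open>t (e v) 2 1\<close> if \<open>l2\<close> is 0 at \<open>e v\<close> and 1 at
  \<open>- e v\<close>. The list \<open>ys\<close> holds the arguments of the entries already
  standing on the left, which the accompanying \<open>2 2\<close> entry has to pass on its way to
  the dual vacuum.\<close>

fun coefV :: "complex \<Rightarrow> complex \<Rightarrow> (complex \<Rightarrow> complex) \<Rightarrow> complex list \<Rightarrow> complex list \<Rightarrow> complex" where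
  "coefV c xm e ys [] = 1"
| "coefV c xm e ys (v # vs) =
     (if e v = - v then ((xm + v - c/2) * (c / (2 * v)) - (xm - v + c/2)) * (\<Prod>y\<leftarrow>ys. f_rat c v y)
      else (xm + v - c/2) * f_rat c (- v) v * (\<Prod>y\<leftarrow>ys. f_rat c (- v) y))
     * coefV c xm e (ys @ [e v]) vs"

context generalized_model
begin

lemma dual_bethe_eq:
  assumes "set vs \<subseteq> D"
  shows "dual_bethe_vector smul c xm T dvac vs x = dvac (foldr (\<lambda>v. mon xm v 2 1) vs x)"
proof -
  have "foldr (\<lambda>v. refl_monodromy smul c xm T v $ 2 $ 1) vs x = foldr (\<lambda>v. mon xm v 2 1) vs x"
    using assms by (induction vs) (simp_all add: refl_monodromy_entry)
  then show ?thesis by (simp add: dual_bethe_vector_def)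
qed

lemma foldr_mon21:
  assumes "set vs \<subseteq> D - {0}"
  shows "foldr (\<lambda>v. mon xm v 2 1) vs x = smul (\<Prod>v\<leftarrow>vs. c - 2 * v) (foldr (cop xm) vs x)"
  using assms by (induction vs) (simp_all add: mon21 cop_rules mon_rules mult.commute)

lemma foldr_cop_smul:
  assumes "set vs \<subseteq> D - {0}"
  shows "foldr (cop xm) vs (smul r x) = smul r (foldr (cop xm) vs x)"
    "foldr (cop xm) vs (x + y) = foldr (cop xm) vs x + foldr (cop xm) vs y"
    "foldr (cop xm) vs (sum f S) = (\<Sum>i\<in>S. foldr (cop xm) vs (f i))"
proof -
  have z: "cop xm u 0 = 0" if "u \<in> D" for u using cop_rules(2)[OF that, of xm 0 0] by simp
  have *: "foldr (cop xm) vs (smul r x) = smul r (foldr (cop xm) vs x)"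
    "foldr (cop xm) vs (x + y) = foldr (cop xm) vs x + foldr (cop xm) vs y"
    "foldr (cop xm) vs 0 = 0" for r x y
    using assms by (induction vs) (simp_all add: cop_rules z)
  show "foldr (cop xm) vs (smul r x) = smul r (foldr (cop xm) vs x)"
    "foldr (cop xm) vs (x + y) = foldr (cop xm) vs x + foldr (cop xm) vs y" by (fact *)+
  show "foldr (cop xm) vs (sum f S) = (\<Sum>i\<in>S. foldr (cop xm) vs (f i))"
    by (induction S rule: infinite_finite_induct) (simp_all add: *)
qed

lemma dvac_foldr_cop:
  assumes "set vs \<subseteq> D - {0}" "distinct vs"
  shows "(\<lambda>x. dvac (foldr (cop xm) vs x)) = op_vec (\<lambda>u \<phi> x. \<phi> (cop xm u x)) dvac (set vs)"
  using comm_family.foldr_bv[OF refl_half.axioms(2)[OF half_dual], of "rev vs" xm] assms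
  by (simp add: foldr_dual)

lemma refl_sp_eq:
  assumes "set vs \<subseteq> D - {0}" "finite U" "U \<subseteq> D - {0}"
  shows "refl_sp smul c xm T vac dvac vs U
    = (\<Prod>v\<leftarrow>vs. c - 2 * v) * (\<Prod>u\<in>U. c - 2 * u) * dvac (foldr (cop xm) vs (bvec xm U))"
proof -
  have "set vs \<subseteq> D" using assms(1) by blast
  then show ?thesis
    unfolding refl_sp_def dual_bethe_eq[OF \<open>set vs \<subseteq> D\<close>] foldr_mon21[OF assms(1)] Bvec_eq[OF assms(2,3)]
      foldr_cop_smul(1)[OF assms(1)]
    by (simp add: dvac_rules)
qed

lemma refl_scalar_product_eq:
  assumes "set us \<subseteq> D - {0}" "distinct us"
  shows "refl_scalar_product smul c xm T vac dvac vs us = refl_sp smul c xm T vac dvac vs (set us)"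
  unfolding refl_scalar_product_def refl_sp_def
  by (simp add: bethe_vector_eq[OF assms] Bvec_eq assms)

text \<open>This is \<open>transfer_bv\<close> for the dual half: every unwanted term carries a
  factor \<open>Phi\<close> at a point of \<open>set vs\<close>.\<close>

lemma dual_eigenvector:
  assumes g: "good_set (D - {0}) (insert z (set vs))" "z \<notin> set vs" "distinct vs"
    and on_shell: "\<And>v. v \<in> set vs \<Longrightarrow> Phi c xp xm (\<lambda>x. l1 x * l2 (- x)) v (set vs) = 0"
  shows "dvac (foldr (cop xm) vs (tr xp xm z x)) = tau_hat c xp xm l1 l2 z (set vs) * dvac (foldr (cop xm) vs x)"
proof -
  interpret h: refl_half "\<lambda>r \<phi> x. r * \<phi> x" c "D - {0}" "{\<phi>. Vector_Spaces.linear smul (*) \<phi>}"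
    "\<lambda>u \<phi> x. \<phi> (aop xm u x)" "\<lambda>u \<phi> x. \<phi> (cop xm u x)" dvac "mval xm"
    by (rule half_dual)
  have vs: "set vs \<subseteq> D - {0}" and z: "z \<in> D" "z \<noteq> 0" using g by (auto simp: good_set_def)
  define F where "F = (\<lambda>x. dvac (foldr (cop xm) vs x))"
  have F: "op_vec (\<lambda>u \<phi> x. \<phi> (cop xm u x)) dvac (set vs) = F"
    unfolding F_def by (rule dvac_foldr_cop[OF vs g(3), symmetric])
  have lin: "F (smul r x) = r * F x" "F (x + y) = F x + F y" for r x y
    by (simp_all add: F_def foldr_cop_smul[OF vs] dvac_rules)
  have m: "mval xm u = (u + xm - c/2) * (l1 u * l2 (- u))" for u by (simp add: mval_def)
  have zero: "(\<Sum>u\<in>set vs. (\<lambda>x. c * (4 * z\<^sup>2 - c\<^sup>2) / (2 * u * (z\<^sup>2 - u\<^sup>2)) * Phi c xp xm (\<lambda>x. l1 x * l2 (- x)) u (set vs)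
        * op_vec (\<lambda>u \<phi> x. \<phi> (cop xm u x)) dvac (insert z (set vs - {u})) x)) = (\<lambda>x. 0)"
    unfolding zero_fun_def[symmetric] by (rule sum.neutral) (simp add: on_shell zero_fun_def)
  have "(\<lambda>x. alpha c xp z * F (aop xm z x)) + (\<lambda>x. alpha c xp (- z) * F (aop xm (- z) x))
    = (\<lambda>x. (alpha c xp z * (mval xm z * FP c z (set vs)) + alpha c xp (- z) * (mval xm (- z) * FP c (- z) (set vs))) * F x)
      + (\<lambda>x. 0)"
    using h.transfer_bv[OF g(1,2) m, of xp] unfolding zero F .
  from fun_cong[OF this, of x] have "F (tr xp xm z x)
    = (alpha c xp z * (mval xm z * FP c z (set vs)) + alpha c xp (- z) * (mval xm (- z) * FP c (- z) (set vs))) * F x"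
    by (simp add: transfer_eq[OF z] lin)
  then show ?thesis
    by (simp add: F_def tau_hat_alt mval_def mult.assoc)
qed

lemma refl_sp_relation:
  assumes g: "pool (insert z U)" "z \<notin> U" "good_set (D - {0}) (insert z (set vs))" "z \<notin> set vs" "distinct vs"
    and on_shell: "\<And>v. v \<in> set vs \<Longrightarrow> Phi c xp xm (\<lambda>x. l1 x * l2 (- x)) v (set vs) = 0"
  defines "S \<equiv> refl_sp smul c xm T vac dvac vs"
  shows "(tau_hat c xp xm l1 l2 z (set vs) - tau_hat c xp xm l1 l2 z U) * S U
     = (\<Sum>u\<in>U. unwanted_coeff c xp xm l1 l2 z u U * S (insert z (U - {u})))"
proof -
  have vs: "set vs \<subseteq> D - {0}" using g(3) by (auto simp: good_set_def)
  then have vsD: "set vs \<subseteq> D" by blast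
  define k where "k = (\<Prod>v\<leftarrow>vs. c - 2 * v)"
  have S: "S W = k * dvac (foldr (cop xm) vs (Bvec xm W))" for W
    unfolding S_def refl_sp_def dual_bethe_eq[OF vsD] foldr_mon21[OF vs] by (simp add: dvac_rules k_def)
  have "tau_hat c xp xm l1 l2 z (set vs) * dvac (foldr (cop xm) vs (Bvec xm U))
     = dvac (foldr (cop xm) vs (tr xp xm z (Bvec xm U)))"
    by (rule dual_eigenvector[OF g(3-5) on_shell, symmetric])
  also have "\<dots> = tau_hat c xp xm l1 l2 z U * dvac (foldr (cop xm) vs (Bvec xm U))
     + (\<Sum>u\<in>U. unwanted_coeff c xp xm l1 l2 z u U * dvac (foldr (cop xm) vs (Bvec xm (insert z (U - {u})))))"
    unfolding transfer_Bvec[OF g(1,2)] by (simp only: foldr_cop_smul[OF vs] dvac_rules)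
  finally have E: "tau_hat c xp xm l1 l2 z (set vs) * dvac (foldr (cop xm) vs (Bvec xm U))
     = tau_hat c xp xm l1 l2 z U * dvac (foldr (cop xm) vs (Bvec xm U))
     + (\<Sum>u\<in>U. unwanted_coeff c xp xm l1 l2 z u U * dvac (foldr (cop xm) vs (Bvec xm (insert z (U - {u})))))" .
  have "(tau_hat c xp xm l1 l2 z (set vs) - tau_hat c xp xm l1 l2 z U) * S U
    = k * (tau_hat c xp xm l1 l2 z (set vs) * dvac (foldr (cop xm) vs (Bvec xm U))
       - tau_hat c xp xm l1 l2 z U * dvac (foldr (cop xm) vs (Bvec xm U)))"
    by (simp add: S left_diff_distrib right_diff_distrib)
  also have "\<dots> = (\<Sum>u\<in>U. unwanted_coeff c xp xm l1 l2 z u U * S (insert z (U - {u})))"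
    unfolding E by (simp add: S sum_distrib_left mult.left_commute)
  finally show ?thesis .
qed

text \<open>\<open>B(z)\<close> is a sum of two products: one acts through
  \<open>t (- z) 1 1\<close> and vanishes with \<open>l1 (- z)\<close>, the other leaves
  \<open>t (- z) 1 2\<close> up to a scalar.\<close>

lemma foldr_mon12_typed:
  assumes "distinct zs" "set zs \<subseteq> D - {0}" "\<And>x. x \<in> set zs \<Longrightarrow> - x \<notin> set zs"
    "\<And>z. z \<in> set zs \<Longrightarrow> l1 (- z) = 0" "\<And>z. z \<in> set zs \<Longrightarrow> l1 z = 1"
  shows "foldr (\<lambda>z. mon xm z 1 2) zs vac = smul (coefZ c xm zs) (tvec (uminus ` set zs))"
  using assms
proof (induction zs)
  case Nil
  then show ?case by (simp add: tb.bv_empty)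
next
  case (Cons z zs)
  let ?X = "uminus ` set zs"
  have D: "z \<in> D" "- z \<in> D" "?X \<subseteq> D" "z \<noteq> 0" "set zs \<subseteq> D" using Cons.prems by (auto intro: D_uminus)
  have nin: "- z \<notin> ?X" "z \<notin> ?X" "z \<noteq> - z" using Cons.prems(1,3) D(4) by auto
  have l1X: "l1 x = 0" if "x \<in> ?X" for x using that Cons.prems(4) by auto
  have l1z: "l1 (- z) = 0" "l1 z = 1" using Cons.prems by auto
  have IH: "foldr (\<lambda>z. mon xm z 1 2) zs vac = smul (coefZ c xm zs) (tvec ?X)"
    by (rule Cons.IH) (use Cons.prems in auto)
  have A0: "t (- z) 1 1 (tvec ?X) = 0"
    using t11_tvec[of ?X "- z"] D nin(1) l1X l1z by simp
  have v: "tb (- z) (tvec ?X) = tvec (insert (- z) ?X)"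
    using D nin(1) by (intro tb.bv_insert[symmetric]) auto
  have A1: "t z 1 1 (tvec (insert (- z) ?X)) = smul (f_rat c (- z) z * (\<Prod>w\<in>set zs. f_rat c (- w) z)) (tvec (insert (- z) ?X))"
  proof -
    have "(\<Prod>x\<in>insert (- z) ?X. f_rat c x z) = f_rat c (- z) z * (\<Prod>w\<in>set zs. f_rat c (- w) z)"
      using nin(1) by (simp add: prod.reindex inj_on_def)
    moreover have "l1 x = 0" if "x \<in> insert (- z) ?X" for x using that l1X l1z by auto
    ultimately show ?thesis using t11_tvec[of "insert (- z) ?X" z] D nin l1z by simp
  qed
  have "mon xm z 1 2 (tvec ?X) = smul (- (xm + z - c/2)) (t z 1 1 (tb (- z) (tvec ?X)))"
    by (simp add: mon_def sum_2 th_def kap_def not_1_2 t_rules[OF D(1)] t_rules[OF D(2)] A0 del: minus_diff_eq)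
  then show ?case
    by (simp add: IH mon_rules D v A1 mult_ac)
qed

text \<open>In an exchanged term \<open>t y 2 2\<close> travels to the left instead and ends in
  \<open>l2 y = 0\<close>. The induction runs from the right end because the neighbour of
  \<open>t u 2 2\<close> is passed first.\<close>

lemma dvac_t21_t22:
  assumes "insert u (set ys) \<subseteq> D" "u \<notin> set ys" "\<And>y. y \<in> set ys \<Longrightarrow> l2 y = 0" "distinct ys"
  shows "dvac (foldr (\<lambda>y. t y 2 1) ys (t u 2 2 x)) = l2 u * (\<Prod>y\<leftarrow>ys. f_rat c u y) * dvac (foldr (\<lambda>y. t y 2 1) ys x)"
  using assms
proof (induction ys arbitrary: u x rule: rev_induct)
  case Nil
  then show ?case by (simp add: dvac_T22)
next
  case (snoc y ys)
  have D: "u \<in> D" "y \<in> D" "set ys \<subseteq> D" "u \<noteq> y" using snoc.prems by auto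
  have lin: "foldr (\<lambda>y. t y 2 1) ys (smul r x - smul r' x') = smul r (foldr (\<lambda>y. t y 2 1) ys x) - smul r' (foldr (\<lambda>y. t y 2 1) ys x')"
    for r x r' x'
    using D(3) by (induction ys) (simp_all add: t_rules)
  have "dvac (foldr (\<lambda>y. t y 2 1) ys (t y 2 2 (t u 2 1 x))) = l2 y * (\<Prod>w\<leftarrow>ys. f_rat c y w) * dvac (foldr (\<lambda>y. t y 2 1) ys (t u 2 1 x))"
    using snoc.prems by (intro snoc.IH) auto
  then have 0: "dvac (foldr (\<lambda>y. t y 2 1) ys (t y 2 2 (t u 2 1 x))) = 0"
    using snoc.prems(3)[of y] by simp
  have 1: "dvac (foldr (\<lambda>y. t y 2 1) ys (t u 2 2 (t y 2 1 x))) = l2 u * (\<Prod>y\<leftarrow>ys. f_rat c u y) * dvac (foldr (\<lambda>y. t y 2 1) ys (t y 2 1 x))"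
    using snoc.prems by (intro snoc.IH) auto
  show ?case
    by (simp add: t21_t22[OF D(1,2,4)] lin dvac_rules 0 1 mult_ac)
qed

lemma dvac_foldr_mon21_typed:
  assumes "distinct vs" "set vs \<subseteq> D - {0}" "\<And>x. x \<in> set vs \<Longrightarrow> - x \<notin> set vs"
    "\<And>v. v \<in> set vs \<Longrightarrow> e v \<in> {v, - v}"
    "\<And>v. v \<in> set vs \<Longrightarrow> l2 (e v) = 0" "\<And>v. v \<in> set vs \<Longrightarrow> l2 (- e v) = 1"
    "set ys \<subseteq> D" "\<And>y. y \<in> set ys \<Longrightarrow> l2 y = 0" "distinct ys"
    "\<And>v. v \<in> set vs \<Longrightarrow> v \<notin> set ys \<and> - v \<notin> set ys"
  shows "dvac (foldr (\<lambda>y. t y 2 1) ys (foldr (\<lambda>v. mon xm v 2 1) vs x))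
    = coefV c xm e ys vs * dvac (foldr (\<lambda>y. t y 2 1) (ys @ map e vs) x)"
  using assms
proof (induction vs arbitrary: ys)
  case (Cons v vs)
  let ?E = "\<lambda>x. dvac (foldr (\<lambda>y. t y 2 1) ys x)"
  define X where "X = foldr (\<lambda>v. mon xm v 2 1) vs x"
  have D: "v \<in> D" "- v \<in> D" "v \<noteq> 0" using Cons.prems(2) by (auto intro: D_uminus)
  have ev: "e v = v \<or> e v = - v" "l2 (e v) = 0" "l2 (- e v) = 1" using Cons.prems(4,5,6)[of v] by auto
  have nin: "v \<notin> set ys" "- v \<notin> set ys" using Cons.prems(10)[of v] by auto
  have lin: "?E (smul r x) = r * ?E x" "?E (x + y) = ?E x + ?E y" "?E (x - y) = ?E x - ?E y" "?E (- x) = - ?E x" for r x y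
  proof -
    have "foldr (\<lambda>y. t y 2 1) ys (smul r x) = smul r (foldr (\<lambda>y. t y 2 1) ys x)"
      "foldr (\<lambda>y. t y 2 1) ys (x + y) = foldr (\<lambda>y. t y 2 1) ys x + foldr (\<lambda>y. t y 2 1) ys y"
      "foldr (\<lambda>y. t y 2 1) ys (x - y) = foldr (\<lambda>y. t y 2 1) ys x - foldr (\<lambda>y. t y 2 1) ys y"
      "foldr (\<lambda>y. t y 2 1) ys (- x) = - foldr (\<lambda>y. t y 2 1) ys x"
      using Cons.prems(7) by (induction ys) (simp_all add: t_rules)
    then show "?E (smul r x) = r * ?E x" "?E (x + y) = ?E x + ?E y" "?E (x - y) = ?E x - ?E y" "?E (- x) = - ?E x"
      by (simp_all add: dvac_rules)
  qed
  have D22: "?E (t v 2 2 x) = l2 v * (\<Prod>y\<leftarrow>ys. f_rat c v y) * ?E x"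
    "?E (t (- v) 2 2 x) = l2 (- v) * (\<Prod>y\<leftarrow>ys. f_rat c (- v) y) * ?E x" for x
    using Cons.prems(7-9) D nin by (auto intro!: dvac_t21_t22)
  have mon: "mon xm v 2 1 X = smul (xm + v - c/2) (t v 2 1 (t (- v) 2 2 X)) - smul (xm - v + c/2) (t v 2 2 (t (- v) 2 1 X))"
    by (simp add: mon_def sum_2 th_def kap_def not_1_2 t_rules[OF D(1)])
  have ne: "- v \<noteq> v" using D(3) by simp
  have g: "g_rat c (- v) v = - (c / (2 * v))" by (simp add: g_rat_def)
  \<comment> \<open>The \<open>2 2\<close> entry is moved to the left, where \<open>D22\<close>
    evaluates it. For \<open>e v = - v\<close> the reordered product vanishes and the exchange term
    with \<open>c / (2 * v)\<close> survives.\<close>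
  have C: "?E (t v 2 1 (t (- v) 2 2 X)) = f_rat c (- v) v * ?E (t (- v) 2 2 (t v 2 1 X)) + c / (2 * v) * ?E (t v 2 2 (t (- v) 2 1 X))"
    unfolding t21_t22[OF D(2,1) ne] by (simp add: lin g)
  have step: "?E (mon xm v 2 1 X)
    = (if e v = - v then ((xm + v - c/2) * (c / (2 * v)) - (xm - v + c/2)) * (\<Prod>y\<leftarrow>ys. f_rat c v y)
      else (xm + v - c/2) * f_rat c (- v) v * (\<Prod>y\<leftarrow>ys. f_rat c (- v) y)) * ?E (t (e v) 2 1 X)"
  proof (cases "e v = - v")
    case True
    then have l: "l2 (- v) = 0" "l2 v = 1" using ev by simp_all
    have gen: "k1 * (f * 0 + d * (p * y)) - k2 * (p * y) = (k1 * d - k2) * p * y" for k1 f d p y k2 :: complex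
      by (simp add: algebra_simps)
    have E: "?E (t (- v) 2 2 (t v 2 1 X)) = 0" "?E (t v 2 2 (t (- v) 2 1 X)) = (\<Prod>y\<leftarrow>ys. f_rat c v y) * ?E (t (e v) 2 1 X)"
      by (simp_all add: D22 l True)
    show ?thesis unfolding mon lin C E by (simp only: gen True refl if_True)
  next
    case False
    then have l: "l2 v = 0" "l2 (- v) = 1" "e v = v" using ev by auto
    show ?thesis unfolding mon lin C using False by (simp add: D22 l)
  qed
  have "dvac (foldr (\<lambda>y. t y 2 1) (ys @ [e v]) X) = coefV c xm e (ys @ [e v]) vs * dvac (foldr (\<lambda>y. t y 2 1) ((ys @ [e v]) @ map e vs) x)"
    unfolding X_def
  proof (rule Cons.IH)
    show "set (ys @ [e v]) \<subseteq> D" "distinct (ys @ [e v])"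
      using Cons.prems(7,9) ev(1) D nin by auto
    show "l2 y = 0" if "y \<in> set (ys @ [e v])" for y using that Cons.prems(8) ev by auto
    show "w \<notin> set (ys @ [e v]) \<and> - w \<notin> set (ys @ [e v])" if "w \<in> set vs" for w
    proof -
      have "w \<noteq> v" "- w \<noteq> v" using that Cons.prems(1) Cons.prems(3)[of w] by auto
      moreover have "w \<noteq> - v" using \<open>- w \<noteq> v\<close> by (metis minus_minus)
      ultimately show ?thesis using that Cons.prems(10)[of w] ev(1) by auto
    qed
  qed (use Cons.prems in auto)
  then show ?case by (simp add: X_def[symmetric] step)
qed simp

text \<open>Each \<open>B(z)\<close> and each \<open>C(v)\<close> degenerates to one entry of
  \<open>T\<close>, so a single-row scalar product is left. The list is reversed because the
  rightmost \<open>t y 2 1\<close> acts first, and the points of \<open>zs\<close> are negated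
  because \<open>B(z)\<close> leaves \<open>t (- z) 1 2\<close>.\<close>

lemma refl_sp_typed:
  assumes vs: "distinct vs" "set vs \<subseteq> D - {0}" "\<And>x. x \<in> set vs \<Longrightarrow> - x \<notin> set vs"
    "\<And>v. v \<in> set vs \<Longrightarrow> e v \<in> {v, - v}"
    "\<And>v. v \<in> set vs \<Longrightarrow> l2 (e v) = 0" "\<And>v. v \<in> set vs \<Longrightarrow> l2 (- e v) = 1" "\<And>v. v \<in> set vs \<Longrightarrow> l1 (e v) = 1"
    and zs: "distinct zs" "set zs \<subseteq> D - {0}" "\<And>x. x \<in> set zs \<Longrightarrow> - x \<notin> set zs"
    "\<And>z. z \<in> set zs \<Longrightarrow> l1 (- z) = 0" "\<And>z. z \<in> set zs \<Longrightarrow> l1 z = 1" "\<And>z. z \<in> set zs \<Longrightarrow> l2 (- z) = 1"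
    and disj: "\<And>v z. v \<in> set vs \<Longrightarrow> z \<in> set zs \<Longrightarrow> v \<noteq> z \<and> v \<noteq> - z"
  shows "refl_sp smul c xm T vac dvac vs (set zs)
    = coefV c xm e [] vs * coefZ c xm zs * dwpf c (rev (map e vs)) (uminus ` set zs)"
proof -
  have D: "set vs \<subseteq> D" "set zs \<subseteq> D" using vs(2) zs(2) by auto
  have B: "Bvec xm (set zs) = foldr (\<lambda>z. mon xm z 1 2) zs vac"
  proof -
    have "bethe_vector smul c xm T vac zs = foldr (\<lambda>z. mon xm z 1 2) zs vac"
      unfolding bethe_vector_def using D(2) by (induction zs) (simp_all add: refl_monodromy_entry)
    then show ?thesis using bethe_vector_eq[OF zs(2,1)] Bvec_eq[OF finite_set zs(2)] by metis
  qed
  have B: "Bvec xm (set zs) = smul (coefZ c xm zs) (tvec (uminus ` set zs))"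
    by (rule trans[OF B foldr_mon12_typed]) (fact zs)+
  let ?X = "uminus ` set zs"
  have "refl_sp smul c xm T vac dvac vs (set zs)
    = dvac (foldr (\<lambda>y. t y 2 1) [] (foldr (\<lambda>v. mon xm v 2 1) vs (smul (coefZ c xm zs) (tvec ?X))))"
    unfolding refl_sp_def dual_bethe_eq[OF D(1)] B by simp
  also have "\<dots> = coefV c xm e [] vs * dvac (foldr (\<lambda>y. t y 2 1) ([] @ map e vs) (smul (coefZ c xm zs) (tvec ?X)))"
    by (rule dvac_foldr_mon21_typed) (use vs(1-6) in auto)
  also have "foldr (\<lambda>y. t y 2 1) ([] @ map e vs) (smul (coefZ c xm zs) (tvec ?X))
     = smul (coefZ c xm zs) (foldr (\<lambda>y. t y 2 1) (map e vs) (tvec ?X))"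
  proof -
    have "set (map e vs) \<subseteq> D" using vs(4) D(1) D_uminus by fastforce
    then have "foldr (\<lambda>y. t y 2 1) (map e vs) (smul r x) = smul r (foldr (\<lambda>y. t y 2 1) (map e vs) x)" for r x
      by (induction "map e vs" arbitrary: vs) (auto simp: t_rules)
    then show ?thesis by simp
  qed
  also have "dvac (smul (coefZ c xm zs) (foldr (\<lambda>y. t y 2 1) (map e vs) (tvec ?X)))
    = coefZ c xm zs * dvac (fold (\<lambda>y. t y 2 1) (rev (map e vs)) (tvec ?X))"
    by (simp add: dvac_rules foldr_conv_fold)
  also have "dvac (fold (\<lambda>y. t y 2 1) (rev (map e vs)) (tvec ?X)) = dwpf c (rev (map e vs)) ?X"
  proof (rule fold_t21_tvec)
    have ey: "\<exists>v\<in>set vs. y = v \<or> y = - v" if "y \<in> set (rev (map e vs))" for y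
      using that vs(4) by auto
    show "set (rev (map e vs)) \<union> ?X \<subseteq> D" using ey D D_uminus by fastforce
    show "set (rev (map e vs)) \<inter> ?X = {}"
    proof (rule ccontr)
      assume "set (rev (map e vs)) \<inter> ?X \<noteq> {}"
      then obtain y where y: "y \<in> set (rev (map e vs))" "y \<in> ?X" by blast
      then obtain z where "z \<in> set zs" "y = - z" by blast
      with ey[OF y(1)] obtain v where v: "v \<in> set vs" "v = - z \<or> - v = - z" by metis
      then show False using disj[OF v(1) \<open>z \<in> set zs\<close>] by auto
    qed
  qed (use zs vs(7) in auto)
  finally show ?thesis by simp
qed

end


section \<open>Dependence of the scalar product on the vacuum data\<close>

context generalized_model
begin

lemma refl_alg_dual_at:
  assumes "0 \<notin> S" "S \<subseteq> D" "\<And>x. x \<in> S \<Longrightarrow> - x \<in> S"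
  shows "refl_alg_dual smul c S (aop xm) (bop xm) vac (mval xm) (cop xm) dvac"
  by (rule refl_alg_dual_restrict[OF refl_alg_dual]) (use assms in auto)

lemma dvac_foldr_cop_perm:
  assumes "set vs \<subseteq> D - {0}" "distinct vs" "set ws = set vs" "distinct ws"
  shows "dvac (foldr (cop xm) vs x) = dvac (foldr (cop xm) ws x)"
proof -
  have "(\<lambda>x. dvac (foldr (cop xm) vs x)) = (\<lambda>x. dvac (foldr (cop xm) ws x))"
    using dvac_foldr_cop[OF assms(1,2), of xm] dvac_foldr_cop[of ws xm] assms by simp
  then show ?thesis by (rule fun_cong)
qed

lemma refl_sp_cop:
  assumes "cfg vs U" "pmset (U \<union> set vs) \<subseteq> D"
  shows "refl_sp smul c xm T vac dvac vs U
    = (\<Prod>v\<leftarrow>vs. c - 2 * v) * (\<Prod>u\<in>U. c - 2 * u) * dvac (foldr (cop xm) vs (bvec xm U))"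
    "0 \<notin> pmset (U \<union> set vs)" "good_set (pmset (U \<union> set vs)) (U \<union> set vs)"
    "refl_alg_dual smul c (pmset (U \<union> set vs)) (aop xm) (bop xm) vac (mval xm) (cop xm) dvac"
    "set vs \<subseteq> D - {0}"
proof -
  show nz: "0 \<notin> pmset (U \<union> set vs)"
    using assms(1) by (intro pmset_zero) (auto simp: cfg_def)
  have sub: "U \<union> set vs \<subseteq> pmset (U \<union> set vs)" by (simp add: pmset_def)
  then have "U \<union> set vs \<subseteq> D - {0}" using assms(2) nz by blast
  then show "refl_sp smul c xm T vac dvac vs U
    = (\<Prod>v\<leftarrow>vs. c - 2 * v) * (\<Prod>u\<in>U. c - 2 * u) * dvac (foldr (cop xm) vs (bvec xm U))"
    "set vs \<subseteq> D - {0}"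
    using assms(1) by (auto simp: cfg_def intro!: refl_sp_eq)
  show "good_set (pmset (U \<union> set vs)) (U \<union> set vs)"
    using assms(1) sub by (simp add: good_set_def cfg_def)
  show "refl_alg_dual smul c (pmset (U \<union> set vs)) (aop xm) (bop xm) vac (mval xm) (cop xm) dvac"
    using nz assms(2) by (intro refl_alg_dual_at pmset_uminus)
qed

end

lemma refl_sp_universal:
  assumes M: "generalized_model s1 c D1 T1 vac1 d1 p1 q1" "generalized_model s2 c D2 T2 vac2 d2 p2 q2"
    and g: "cfg vs U" "pmset (U \<union> set vs) \<subseteq> D1" "pmset (U \<union> set vs) \<subseteq> D2"
    and pq: "\<And>x. x \<in> pmset (U \<union> set vs) \<Longrightarrow> p1 x * q1 (- x) = p2 x * q2 (- x)"
  shows "refl_sp s1 c xm T1 vac1 d1 vs U = refl_sp s2 c xm T2 vac2 d2 vs U"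
proof -
  interpret M1: generalized_model s1 c D1 T1 vac1 d1 p1 q1 by (rule M)
  interpret M2: generalized_model s2 c D2 T2 vac2 d2 p2 q2 by (rule M)
  have "d1 (foldr (M1.cop xm) vs (op_vec (M1.bop xm) vac1 U)) = d2 (foldr (M2.cop xm) vs (op_vec (M2.bop xm) vac2 U))"
  proof (rule scalar_product_universal[OF M1.refl_sp_cop(4)[OF g(1,2)] M2.refl_sp_cop(4)[OF g(1,3)] _ M1.refl_sp_cop(3)[OF g(1,2)]])
    show "M1.mval xm u = M2.mval xm u" if "u \<in> pmset (U \<union> set vs)" for u
      using pq[OF that] by (simp add: M1.mval_def M2.mval_def mult.assoc)
  qed (use g(1) in \<open>simp_all add: cfg_def\<close>)
  then show ?thesis
    unfolding M1.refl_sp_cop(1)[OF g(1,2)] M2.refl_sp_cop(1)[OF g(1,3)] by simp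
qed

lemma refl_sp_linear:
  assumes M: "generalized_model s1 c D1 T1 vac1 d1 p1 q1" "generalized_model s2 c D2 T2 vac2 d2 p2 q2"
      "generalized_model s3 c D3 T3 vac3 d3 p3 q3"
    and g: "cfg vs U" "pmset (U \<union> set vs) \<subseteq> D1" "pmset (U \<union> set vs) \<subseteq> D2" "pmset (U \<union> set vs) \<subseteq> D3"
    and v: "v \<in> set vs"
    and pq: "\<And>x. x \<in> pmset (U \<union> set vs) - {v, - v} \<Longrightarrow> p1 x * q1 (- x) = p3 x * q3 (- x)"
      "\<And>x. x \<in> pmset (U \<union> set vs) - {v, - v} \<Longrightarrow> p2 x * q2 (- x) = p3 x * q3 (- x)"
      "\<And>u. u \<in> {v, - v} \<Longrightarrow> p3 u * q3 (- u) = x * (p1 u * q1 (- u)) + y * (p2 u * q2 (- u))"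
  shows "refl_sp s3 c xm T3 vac3 d3 vs U
    = x * refl_sp s1 c xm T1 vac1 d1 vs U + y * refl_sp s2 c xm T2 vac2 d2 vs U"
proof -
  interpret M1: generalized_model s1 c D1 T1 vac1 d1 p1 q1 by (rule M)
  interpret M2: generalized_model s2 c D2 T2 vac2 d2 p2 q2 by (rule M)
  interpret M3: generalized_model s3 c D3 T3 vac3 d3 p3 q3 by (rule M)
  have dist: "distinct vs" using g(1) by (simp add: cfg_def)
  \<comment> \<open>\<open>scalar_product_linear\<close> singles out the head of the list; as the
    \<open>cop\<close> commute, \<open>v\<close> may be moved there.\<close>
  define ws where "ws = remove1 v vs"
  have ws: "set (v # ws) = set vs" "distinct (v # ws)" "length (v # ws) = length vs"
    using v dist by (auto simp: ws_def set_remove1_eq length_remove1 dest: length_pos_if_in_set)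
  have "d3 (foldr (M3.cop xm) (v # ws) (op_vec (M3.bop xm) vac3 U))
    = x * d1 (foldr (M1.cop xm) (v # ws) (op_vec (M1.bop xm) vac1 U))
    + y * d2 (foldr (M2.cop xm) (v # ws) (op_vec (M2.bop xm) vac2 U))"
  proof (rule scalar_product_linear[OF M1.refl_sp_cop(4)[OF g(1,2)] M2.refl_sp_cop(4)[OF g(1,3)] M3.refl_sp_cop(4)[OF g(1,4)]])
    show "M1.mval xm u = M3.mval xm u" "M2.mval xm u = M3.mval xm u" if "u \<in> pmset (U \<union> set vs) - {v, - v}" for u
      using pq(1)[OF that] pq(2)[OF that] by (simp_all add: M1.mval_def M2.mval_def M3.mval_def mult.assoc)
    show "M3.mval xm u = x * M1.mval xm u + y * M2.mval xm u" if "u \<in> {v, - v}" for u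
    proof -
      have gen: "k * p = x * (k * p1) + y * (k * p2)" if "p = x * p1 + y * p2" for k p p1 p2 :: complex
        unfolding that by (simp add: algebra_simps)
      show ?thesis using pq(3)[OF that] unfolding M1.mval_def M2.mval_def M3.mval_def by (rule gen)
    qed
    show "good_set (pmset (U \<union> set vs)) (U \<union> set (v # ws))" unfolding ws by (rule M1.refl_sp_cop(3)[OF g(1,2)])
    show "set (v # ws) \<inter> U = {}" "length (v # ws) = card U"
      using g(1) ws by (simp_all add: cfg_def del: list.set)
  qed (rule ws)
  moreover have "d1 (foldr (M1.cop xm) vs b) = d1 (foldr (M1.cop xm) (v # ws) b)" for b
    by (rule M1.dvac_foldr_cop_perm[OF M1.refl_sp_cop(5)[OF g(1,2)] dist ws(1,2)])
  moreover have "d2 (foldr (M2.cop xm) vs b) = d2 (foldr (M2.cop xm) (v # ws) b)" for b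
    by (rule M2.dvac_foldr_cop_perm[OF M2.refl_sp_cop(5)[OF g(1,3)] dist ws(1,2)])
  moreover have "d3 (foldr (M3.cop xm) vs b) = d3 (foldr (M3.cop xm) (v # ws) b)" for b
    by (rule M3.dvac_foldr_cop_perm[OF M3.refl_sp_cop(5)[OF g(1,4)] dist ws(1,2)])
  moreover have gen: "k * (x * r + y * s) = x * (k * r) + y * (k * s)" for k r s by (simp add: algebra_simps)
  ultimately show ?thesis
    unfolding M1.refl_sp_cop(1)[OF g(1,2)] M2.refl_sp_cop(1)[OF g(1,3)] M3.refl_sp_cop(1)[OF g(1,4)]
    by (simp only: gen)
qed

text \<open>The scalar product as a function of \<open>a u = \<lambda>\<^sub>1(u) \<lambda>\<^sub>2(-u)\<close>, on which alone it depends.\<close>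

definition sfun :: "complex \<Rightarrow> complex \<Rightarrow> (complex \<Rightarrow> complex) \<Rightarrow> complex list \<Rightarrow> complex set \<Rightarrow> complex" where
  "sfun c xm a vs U = (SOME s. \<exists>T l1 l2. generalized_model csm c UNIV T chain_vac chain_dvac l1 l2
     \<and> (\<forall>x\<in>pmset (U \<union> set vs). l1 x * l2 (- x) = a x) \<and> s = refl_sp csm c xm T chain_vac chain_dvac vs U)"

lemma finite_pmset: "finite S \<Longrightarrow> finite (pmset S)"
  by (simp add: pmset_def)

lemma data_model:
  assumes "c \<noteq> 0" "finite S"
  obtains T l1 l2 where "generalized_model csm c UNIV T chain_vac chain_dvac l1 l2"
    "\<And>x. x \<in> pmset S \<Longrightarrow> l1 x * l2 (- x) = a x"
proof -
  obtain T l1 l2 where M: "generalized_model csm c UNIV T chain_vac chain_dvac l1 l2"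
    and l: "\<And>x. x \<in> pmset S \<Longrightarrow> l1 x = a x" "\<And>x. x \<in> pmset S \<Longrightarrow> l2 x = 1"
    by (rule model_exists[OF assms(1) finite_pmset[OF assms(2)], of a "\<lambda>_. 1"]) blast
  show ?thesis by (rule that[OF M]) (simp add: l pmset_uminus)
qed

text \<open>By \<open>refl_sp_universal\<close> the model chosen in \<open>sfun\<close> does not
  matter, and \<open>data_model\<close> ensures that there is one.\<close>

lemma refl_sp_sfun:
  assumes M: "generalized_model smul c D T vac dvac l1 l2"
    and g: "cfg vs U" "pmset (U \<union> set vs) \<subseteq> D"
    and a: "\<And>x. x \<in> pmset (U \<union> set vs) \<Longrightarrow> l1 x * l2 (- x) = a x"
  shows "refl_sp smul c xm T vac dvac vs U = sfun c xm a vs U"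
proof -
  let ?P = "\<lambda>s T l1 l2. generalized_model csm c UNIV T chain_vac chain_dvac l1 l2
     \<and> (\<forall>x\<in>pmset (U \<union> set vs). l1 x * l2 (- x) = a x) \<and> s = refl_sp csm c xm T chain_vac chain_dvac vs U"
  have "c \<noteq> 0" using M by (rule generalized_model.c_nonzero)
  moreover have "finite (U \<union> set vs)" using g(1) by (simp add: cfg_def)
  ultimately obtain T0 k1 k2 where "?P (refl_sp csm c xm T0 chain_vac chain_dvac vs U) T0 k1 k2"
    by (rule data_model[of c "U \<union> set vs" a]) blast
  then have "\<exists>s T l1 l2. ?P s T l1 l2" by blast
  then have "\<exists>T l1 l2. ?P (sfun c xm a vs U) T l1 l2"
    unfolding sfun_def by (rule someI_ex)
  then obtain T1 m1 m2 where N: "?P (sfun c xm a vs U) T1 m1 m2" by blast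
  then have "refl_sp smul c xm T vac dvac vs U = refl_sp csm c xm T1 chain_vac chain_dvac vs U"
    by (intro refl_sp_universal[OF M _ g(1,2)]) (auto simp: a)
  then show ?thesis using N by simp
qed

lemma sfun_linear:
  assumes "c \<noteq> 0" "cfg vs U" "v \<in> set vs"
  shows "sfun c xm a vs U = a v * sfun c xm (a(v := 1, - v := 0)) vs U + a (- v) * sfun c xm (a(v := 0, - v := 1)) vs U"
proof -
  have ne: "- v \<noteq> v" using assms(2,3) unfolding cfg_def by (metis Un_iff)
  have fin: "finite (U \<union> set vs)" using assms(2) by (simp add: cfg_def)
  obtain T1 p1 q1 where M1: "generalized_model csm c UNIV T1 chain_vac chain_dvac p1 q1"
    and l1: "\<And>x. x \<in> pmset (U \<union> set vs) \<Longrightarrow> p1 x * q1 (- x) = (a(v := 1, - v := 0)) x"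
    by (rule data_model[OF assms(1) fin, of "a(v := 1, - v := 0)"]) blast
  obtain T2 p2 q2 where M2: "generalized_model csm c UNIV T2 chain_vac chain_dvac p2 q2"
    and l2: "\<And>x. x \<in> pmset (U \<union> set vs) \<Longrightarrow> p2 x * q2 (- x) = (a(v := 0, - v := 1)) x"
    by (rule data_model[OF assms(1) fin, of "a(v := 0, - v := 1)"]) blast
  obtain T3 p3 q3 where M3: "generalized_model csm c UNIV T3 chain_vac chain_dvac p3 q3"
    and l3: "\<And>x. x \<in> pmset (U \<union> set vs) \<Longrightarrow> p3 x * q3 (- x) = a x"
    by (rule data_model[OF assms(1) fin, of "a"]) blast
  have vP: "v \<in> pmset (U \<union> set vs)" "- v \<in> pmset (U \<union> set vs)" using assms(3) by (auto simp: pmset_def)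
  have "refl_sp csm c xm T3 chain_vac chain_dvac vs U = a v * refl_sp csm c xm T1 chain_vac chain_dvac vs U
    + a (- v) * refl_sp csm c xm T2 chain_vac chain_dvac vs U"
  proof (rule refl_sp_linear[OF M1 M2 M3 assms(2) subset_UNIV subset_UNIV subset_UNIV assms(3)])
    show "p1 x * q1 (- x) = p3 x * q3 (- x)" "p2 x * q2 (- x) = p3 x * q3 (- x)"
      if "x \<in> pmset (U \<union> set vs) - {v, - v}" for x
      using that l1[of x] l2[of x] l3[of x] by simp_all
    show "p3 u * q3 (- u) = a v * (p1 u * q1 (- u)) + a (- v) * (p2 u * q2 (- u))" if "u \<in> {v, - v}" for u
      using that l1[OF vP(1)] l2[OF vP(1)] l3[OF vP(1)] l1[OF vP(2)] l2[OF vP(2)] l3[OF vP(2)] ne by auto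
  qed
  moreover have "refl_sp csm c xm T1 chain_vac chain_dvac vs U = sfun c xm (a(v := 1, - v := 0)) vs U"
    by (rule refl_sp_sfun[OF M1 assms(2) subset_UNIV l1])
  moreover have "refl_sp csm c xm T2 chain_vac chain_dvac vs U = sfun c xm (a(v := 0, - v := 1)) vs U"
    by (rule refl_sp_sfun[OF M2 assms(2) subset_UNIV l2])
  moreover have "refl_sp csm c xm T3 chain_vac chain_dvac vs U = sfun c xm a vs U"
    by (rule refl_sp_sfun[OF M3 assms(2) subset_UNIV l3])
  ultimately show ?thesis by (simp only:)
qed

lemma sfun_typed:
  assumes "c \<noteq> 0" "cfg vs (set zs)" "distinct zs"
    and e: "\<And>v. v \<in> set vs \<Longrightarrow> e v \<in> {v, - v}"
    and a: "\<And>v. v \<in> set vs \<Longrightarrow> a (e v) = 1 \<and> a (- e v) = 0" "\<And>z. z \<in> set zs \<Longrightarrow> a z = 1 \<and> a (- z) = 0"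
  shows "sfun c xm a vs (set zs) = coefV c xm e [] vs * coefZ c xm zs * dwpf c (rev (map e vs)) (uminus ` set zs)"
proof -
  let ?S = "set zs \<union> set vs"
  have g: "finite ?S" "distinct vs" "\<And>x. x \<in> ?S \<Longrightarrow> - x \<notin> ?S" "set vs \<inter> set zs = {}"
    using assms(2) by (simp_all add: cfg_def)
  have nz: "0 \<notin> ?S" using g(3)[of 0] by auto
  \<comment> \<open>The data \<open>a\<close> prescribe only products of \<open>l1\<close> and
    \<open>l2\<close>; these are split so that \<open>l2\<close> vanishes at \<open>e v\<close> and
    \<open>l1\<close> at \<open>- z\<close>, as \<open>refl_sp_typed\<close> demands.\<close>
  obtain T l1 l2 where M: "generalized_model csm c UNIV T chain_vac chain_dvac l1 l2"
    and l: "\<And>x. x \<in> pmset ?S \<Longrightarrow> l1 x = (if x \<in> e ` set vs \<union> set zs then 1 else 0)"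
      "\<And>x. x \<in> pmset ?S \<Longrightarrow> l2 x = (if x \<in> e ` set vs then 0 else 1)"
    by (rule model_exists[OF assms(1) finite_pmset[OF g(1)],
          of "\<lambda>x. if x \<in> e ` set vs \<union> set zs then 1 else 0" "\<lambda>x. if x \<in> e ` set vs then 0 else 1"]) blast
  have pm: "x \<in> pmset ?S" "- x \<in> pmset ?S" if "x \<in> ?S" for x using that by (auto simp: pmset_def)
  have disj: "v \<noteq> z" "v \<noteq> - z" if "v \<in> set vs" "z \<in> set zs" for v z
    using that g(3)[of z] g(4) by (auto simp del: g(3))
  have eimg: "- e v \<notin> e ` set vs" "- e v \<notin> set zs" if v: "v \<in> set vs" for v
  proof -
    have ev: "- e v = v \<and> e v = - v \<or> - e v = - v \<and> e v = v" using e[OF v] by auto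
    show "- e v \<notin> set zs" using ev disj[OF v] by (metis minus_minus)
    show "- e v \<notin> e ` set vs"
    proof
      assume "- e v \<in> e ` set vs"
      then obtain w where w: "w \<in> set vs" "- e v = e w" by blast
      show False
      proof (cases "w = v")
        case True
        then have "e v = 0" using w by simp
        then show False using ev v nz by auto
      next
        case False
        have "e w = w \<or> e w = - w" using e[OF w(1)] by auto
        then have "w = - v" using ev w(2) False by (metis minus_minus)
        then show False using g(3)[of v] v w by auto
      qed
    qed
  qed
  have ze: "z \<notin> e ` set vs" "- z \<notin> e ` set vs" if z: "z \<in> set zs" for z
  proof -
    have "e v \<noteq> z \<and> e v \<noteq> - z" if v: "v \<in> set vs" for v
      using e[OF v] disj[OF v z] by (metis insert_iff minus_minus singletonD)
    then show "z \<notin> e ` set vs" "- z \<notin> e ` set vs" by (metis imageE)+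
  qed
  have ev: "e v \<in> pmset ?S" "- e v \<in> pmset ?S" if "v \<in> set vs" for v
    using e[OF that] that pm[of v] by auto
  have lv: "l1 (e v) = 1" "l2 (e v) = 0" "l1 (- e v) = 0" "l2 (- e v) = 1" if "v \<in> set vs" for v
    using that l[OF ev(1)[OF that]] l[OF ev(2)[OF that]] eimg[OF that] by auto
  have lz: "l1 z = 1" "l1 (- z) = 0" "l2 (- z) = 1" if "z \<in> set zs" for z
  proof -
    have "- z \<notin> set zs" using that g(3)[of z] by auto
    then show "l1 z = 1" "l1 (- z) = 0" "l2 (- z) = 1"
      using that l(1)[OF pm(1), of z] l(1)[OF pm(2), of z] l(2)[OF pm(2), of z] ze[OF that] by auto
  qed
  have "l1 x * l2 (- x) = a x" if x: "x \<in> pmset ?S" for x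
  proof -
    consider z where "z \<in> set zs" "x = z \<or> x = - z" | v where "v \<in> set vs" "x = v \<or> x = - v"
      using x unfolding pmset_def by blast
    then show ?thesis
    proof cases
      case 1
      then show ?thesis using lz[OF 1(1)] a(2)[OF 1(1)] by auto
    next
      case 2
      then have "x = e v \<or> x = - e v" using e[OF 2(1)] by auto
      then show ?thesis using lv[OF 2(1)] a(1)[OF 2(1)] by auto
    qed
  qed
  then have "sfun c xm a vs (set zs) = refl_sp csm c xm T chain_vac chain_dvac vs (set zs)"
    by (rule refl_sp_sfun[OF M assms(2) subset_UNIV, symmetric])
  also have "\<dots> = coefV c xm e [] vs * coefZ c xm zs * dwpf c (rev (map e vs)) (uminus ` set zs)"
  proof (rule generalized_model.refl_sp_typed[OF M g(2)])
    show "set vs \<subseteq> UNIV - {0}" "set zs \<subseteq> UNIV - {0}" using nz by auto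
    show "- x \<notin> set vs" if "x \<in> set vs" for x using g(3)[of x] that by auto
    show "- x \<notin> set zs" if "x \<in> set zs" for x using g(3)[of x] that by auto
    show "v \<noteq> z \<and> v \<noteq> - z" if "v \<in> set vs" "z \<in> set zs" for v z using disj[OF that] by simp
  qed (fact e assms(3) lv lz)+
  finally show ?thesis .
qed

lemma tau_hat_cong:
  assumes "l1 z * l2 (- z) = k1 z * k2 (- z)" "l1 (- z) * l2 z = k1 (- z) * k2 z"
  shows "tau_hat c xp xm l1 l2 z U = tau_hat c xp xm k1 k2 z U"
    "unwanted_coeff c xp xm l1 l2 y z U = unwanted_coeff c xp xm k1 k2 y z U"
  by (simp_all add: tau_hat_def unwanted_coeff_def tau_residue_def assms)

lemma action_coeff_cong:
  assumes "\<And>x. x \<in> pmset (U \<union> set zs) \<Longrightarrow> l1 x * l2 (- x) = k1 x * k2 (- x)"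
  shows "action_coeff c xp xm l1 l2 zs U W = action_coeff c xp xm k1 k2 zs U W"
  using assms
proof (induction zs arbitrary: U)
  case (Cons z zs)
  have l: "l1 x * l2 (- x) = k1 x * k2 (- x)" "l1 (- x) * l2 x = k1 (- x) * k2 x" if "x \<in> insert z U" for x
    using Cons.prems[of x] Cons.prems[of "- x"] that by (auto simp: pmset_def)
  have "action_coeff c xp xm l1 l2 zs U W = action_coeff c xp xm k1 k2 zs U W"
    by (rule Cons.IH) (rule Cons.prems, auto simp: pmset_def)
  moreover have "action_coeff c xp xm l1 l2 zs (insert z (U - {u})) W = action_coeff c xp xm k1 k2 zs (insert z (U - {u})) W" for u
    by (rule Cons.IH) (rule Cons.prems, auto simp: pmset_def)
  moreover have "tau_hat c xp xm l1 l2 z U = tau_hat c xp xm k1 k2 z U"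
    by (rule tau_hat_cong) (rule l, simp)+
  moreover have "unwanted_coeff c xp xm l1 l2 z u U = unwanted_coeff c xp xm k1 k2 z u U" if "u \<in> U" for u
    by (rule tau_hat_cong) (rule l, simp add: that)+
  ultimately show ?case by simp
qed simp

lemma sfun_relation:
  assumes "c \<noteq> 0" and g: "gset c (insert z (U \<union> set vs))" "cfg vs U" "z \<notin> U" "z \<notin> set vs"
    and on_shell: "\<And>v. v \<in> set vs \<Longrightarrow> Phi c xp xm a v (set vs) = 0"
  shows "(tau_hat c xp xm a (\<lambda>_. 1) z (set vs) - tau_hat c xp xm a (\<lambda>_. 1) z U) * sfun c xm a vs U
     = (\<Sum>u\<in>U. unwanted_coeff c xp xm a (\<lambda>_. 1) z u U * sfun c xm a vs (insert z (U - {u})))"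
proof -
  let ?S = "insert z (U \<union> set vs)"
  note G = g(1)[unfolded gset_def]
  have fin: "finite ?S" by (rule conjunct1[OF G])
  have pm: "- x \<notin> ?S" and cx: "c + 2 * x \<noteq> 0" if "x \<in> ?S" for x
    by (rule conjunct1[OF bspec[OF conjunct2[OF G] that]], rule conjunct2[OF bspec[OF conjunct2[OF G] that]])
  \<comment> \<open>One chain with the data at all points involved, including \<open>z\<close>, so
    that all values of \<open>sfun\<close> in the relation are scalar products in the same
    model.\<close>
  obtain T l1 l2 where M: "generalized_model csm c UNIV T chain_vac chain_dvac l1 l2"
    and l: "\<And>x. x \<in> pmset ?S \<Longrightarrow> l1 x * l2 (- x) = a x"
    by (rule data_model[OF assms(1) fin, of a]) blast
  interpret generalized_model csm c UNIV T chain_vac chain_dvac l1 l2 by (rule M)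
  have nz: "0 \<notin> ?S" using pm[of 0] by auto
  have l': "l1 x * l2 (- x) = a x" "l1 (- x) * l2 x = a (- x)" if "x \<in> ?S" for x
    using l[of x] l[of "- x"] that by (auto simp: pmset_def)
  have S: "sfun c xm a vs W = refl_sp csm c xm T chain_vac chain_dvac vs W" if "cfg vs W" "W \<subseteq> ?S" for W
  proof (rule refl_sp_sfun[OF M that(1) subset_UNIV, symmetric])
    show "l1 x * l2 (- x) = a x" if "x \<in> pmset (W \<union> set vs)" for x
      using that \<open>W \<subseteq> ?S\<close> by (intro l) (auto simp: pmset_def)
  qed
  have cfg': "cfg vs (insert z (U - {u}))" if "u \<in> U" for u
  proof -
    have "card (insert z (U - {u})) = card U"
      using that g(2,3) card_Suc_Diff1[of U u] by (simp add: cfg_def)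
    moreover have "- x \<notin> insert z (U - {u}) \<union> set vs" if "x \<in> insert z (U - {u}) \<union> set vs" for x
      using pm[of x] that by blast
    ultimately show ?thesis using g(2,4) unfolding cfg_def by auto
  qed
  have E: "(tau_hat c xp xm l1 l2 z (set vs) - tau_hat c xp xm l1 l2 z U) * refl_sp csm c xm T chain_vac chain_dvac vs U
     = (\<Sum>u\<in>U. unwanted_coeff c xp xm l1 l2 z u U * refl_sp csm c xm T chain_vac chain_dvac vs (insert z (U - {u})))"
  proof (rule refl_sp_relation[OF _ g(3) _ g(4)])
    show "pool (insert z U)"
      unfolding pool_def good_set_def using fin nz cx pm by auto
    show "good_set (UNIV - {0}) (insert z (set vs))"
      unfolding good_set_def using nz pm by auto
    show "distinct vs" using g(2) by (simp add: cfg_def)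
    show "Phi c xp xm (\<lambda>x. l1 x * l2 (- x)) v (set vs) = 0" if "v \<in> set vs" for v
      using on_shell[OF that] l'[of v] that by (simp add: Phi_def)
  qed
  have t: "tau_hat c xp xm l1 l2 z W = tau_hat c xp xm a (\<lambda>_. 1) z W" for W
    by (rule tau_hat_cong) (use l'[of z] in simp_all)
  have w: "unwanted_coeff c xp xm l1 l2 z u U = unwanted_coeff c xp xm a (\<lambda>_. 1) z u U" if "u \<in> U" for u
    by (rule tau_hat_cong) (use l'[of u] that in simp_all)
  have "refl_sp csm c xm T chain_vac chain_dvac vs U = sfun c xm a vs U"
    by (rule S[symmetric, OF g(2)]) auto
  moreover have "refl_sp csm c xm T chain_vac chain_dvac vs (insert z (U - {u})) = sfun c xm a vs (insert z (U - {u}))" if "u \<in> U" for u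
    by (rule S[symmetric, OF cfg'[OF that]]) auto
  ultimately show ?thesis using E t w by simp
qed

text \<open>Induction on the number of points of \<open>Z\<close> missing from \<open>W\<close>,
  with a maximum principle on each level. At a set where \<open>cmod (X W)\<close> is maximal,
  replacing a point outside \<open>Z\<close> leads to the previous level, where \<open>X\<close> is
  0, and replacing a point of \<open>Z\<close> stays on the level. Strict dominance then forces the
  maximum to be 0.\<close>

lemma star_unique:
  fixes X :: "complex set \<Rightarrow> complex" and t w n
  assumes fin: "finite Q" and Z: "Z \<subseteq> Q" "card Z = n" "X Z = 0"
    and rel: "\<And>W z. W \<subseteq> Q \<Longrightarrow> card W = n \<Longrightarrow> z \<in> Z \<Longrightarrow> z \<notin> W \<Longrightarrow>
      t z W * X W = (\<Sum>u\<in>W. w z u W * X (insert z (W - {u})))"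
    and dom: "\<And>W z. W \<subseteq> Q \<Longrightarrow> card W = n \<Longrightarrow> z \<in> Z \<Longrightarrow> z \<notin> W \<Longrightarrow>
      (\<Sum>u\<in>W \<inter> Z. cmod (w z u W)) < cmod (t z W)"
    and W: "W \<subseteq> Q" "card W = n"
  shows "X W = 0"
  using W
proof (induction "card (Z - W)" arbitrary: W)
  case 0
  have f: "finite Z" "finite W" using fin Z 0 by (auto intro: finite_subset)
  then have "Z \<subseteq> W" using 0(1) by simp
  then show ?case using card_subset_eq[of W Z] f Z 0 by simp
next
  case (Suc k)
  define F where "F = {W. W \<subseteq> Q \<and> card W = n \<and> card (Z - W) = Suc k}"
  have fF: "finite F" using fin by (simp add: F_def)
  have WF: "W \<in> F" using Suc by (simp add: F_def)
  define M where "M = Max ((cmod \<circ> X) ` F)"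
  have "M \<in> (cmod \<circ> X) ` F" unfolding M_def using fF WF by (intro Max_in) auto
  then obtain W0 where W0: "W0 \<in> F" "M = cmod (X W0)" by auto
  have le: "cmod (X V) \<le> M" if "V \<in> F" for V
    unfolding M_def using fF that by (intro Max_ge) auto
  have W0': "W0 \<subseteq> Q" "card W0 = n" "card (Z - W0) = Suc k" using W0 by (auto simp: F_def)
  have f0: "finite Z" "finite W0" using fin Z W0' by (auto intro: finite_subset)
  obtain z where z: "z \<in> Z" "z \<notin> W0" using W0'(3) by (metis DiffE card.empty ex_in_conv nat.distinct(1))
  have "M = 0"
  proof (rule ccontr)
    assume "M \<noteq> 0"
    then have M: "M > 0" using W0(2) by simp
    have sub: "insert z (W0 - {u}) \<subseteq> Q" "card (insert z (W0 - {u})) = n" if "u \<in> W0" for u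
      using that W0' z Z f0 card_Suc_Diff1[of W0 u] by auto
    have out: "X (insert z (W0 - {u})) = 0" if u: "u \<in> W0" "u \<notin> Z" for u
    proof -
      have "Z - insert z (W0 - {u}) = (Z - W0) - {z}" using u by auto
      then have "k = card (Z - insert z (W0 - {u}))" using W0'(3) z f0 by simp
      then show ?thesis using sub[OF u(1)] by (rule Suc.hyps(1))
    qed
    have inn: "cmod (X (insert z (W0 - {u}))) \<le> M" if u: "u \<in> W0" "u \<in> Z" for u
    proof -
      have "Z - insert z (W0 - {u}) = insert u ((Z - W0) - {z})" using u z by auto
      then have "card (Z - insert z (W0 - {u})) = Suc k" using W0'(3) z f0 u by simp
      then show ?thesis using sub[OF u(1)] by (intro le) (simp add: F_def)
    qed
    have "cmod (t z W0) * M = cmod (\<Sum>u\<in>W0. w z u W0 * X (insert z (W0 - {u})))"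
      using rel[OF W0'(1,2) z] by (metis W0(2) norm_mult)
    also have "(\<Sum>u\<in>W0. w z u W0 * X (insert z (W0 - {u}))) = (\<Sum>u\<in>W0 \<inter> Z. w z u W0 * X (insert z (W0 - {u})))"
      using f0 out by (intro sum.mono_neutral_right) auto
    also have "cmod \<dots> \<le> (\<Sum>u\<in>W0 \<inter> Z. cmod (w z u W0) * M)"
      by (rule sum_norm_le) (auto simp: norm_mult intro!: mult_left_mono inn)
    also have "\<dots> = (\<Sum>u\<in>W0 \<inter> Z. cmod (w z u W0)) * M" by (simp add: sum_distrib_right)
    also have "\<dots> < cmod (t z W0) * M" using dom[OF W0'(1,2) z] M by (intro mult_strict_right_mono)
    finally show False by simp
  qed
  then show ?case using le[OF WF] by simp
qed

text \<open>The difference of the two sides, as a function of \<open>U\<close>, satisfies the same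
  homogeneous relations and vanishes at \<open>U = Z\<close>, so \<open>star_unique\<close> applies
  to it.\<close>

lemma pairing_proportional:
  assumes c: "c \<noteq> 0" and g: "gset c (U \<union> Z \<union> set vs)" "distinct vs" "set vs \<inter> (U \<union> Z) = {}"
    "card U = length vs" "card Z = length vs"
    and on_shell: "\<And>v. v \<in> set vs \<Longrightarrow> Phi c xp xm a v (set vs) = 0"
    and dom: "\<And>W z. W \<subseteq> U \<union> Z \<Longrightarrow> card W = length vs \<Longrightarrow> z \<in> Z \<Longrightarrow> z \<notin> W \<Longrightarrow>
      (\<Sum>u\<in>W \<inter> Z. cmod (unwanted_coeff c xp xm a (\<lambda>_. 1) z u W))
      < cmod (tau_hat c xp xm a (\<lambda>_. 1) z (set vs) - tau_hat c xp xm a (\<lambda>_. 1) z W)"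
  shows "sfun c xm a vs U * action_coeff c xp xm a (\<lambda>_. 1) vs Z (set vs)
    = action_coeff c xp xm a (\<lambda>_. 1) vs U (set vs) * sfun c xm a vs Z"
proof -
  let ?R = "\<lambda>W. action_coeff c xp xm a (\<lambda>_. 1) vs W (set vs)" and ?S = "sfun c xm a vs"
  let ?w = "\<lambda>z u W. unwanted_coeff c xp xm a (\<lambda>_. 1) z u W" and ?t = "\<lambda>z W. tau_hat c xp xm a (\<lambda>_. 1) z W"
  have "?S U * ?R Z - ?R U * ?S Z = 0"
  proof (rule star_unique[where Q = "U \<union> Z" and Z = Z and n = "length vs" and X = "\<lambda>W. ?S W * ?R Z - ?R W * ?S Z"
        and t = "\<lambda>z W. ?t z (set vs) - ?t z W" and w = ?w])
    show "finite (U \<union> Z)" using g(1) by (simp add: gset_def)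
    fix W z assume W: "W \<subseteq> U \<union> Z" "card W = length vs" and z: "z \<in> Z" "z \<notin> W"
    have G: "gset c (insert z (W \<union> set vs))" by (rule gset_mono[OF g(1)]) (use W z in auto)
    have fin: "finite W" using G by (simp add: gset_def)
    have zv: "z \<notin> set vs" "set vs \<inter> W = {}" using g(3) z W by auto
    have cf: "cfg vs W" unfolding cfg_def using G zv g(2) W fin by (auto simp: gset_def)
    have S: "(?t z (set vs) - ?t z W) * ?S W = (\<Sum>u\<in>W. ?w z u W * ?S (insert z (W - {u})))"
      by (rule sfun_relation[OF c G cf z(2) zv(1) on_shell])
    have R: "(?t z (set vs) - ?t z W) * ?R W = (\<Sum>u\<in>W. ?w z u W * ?R (insert z (W - {u})))"
      by (rule action_coeff_relation[OF G c _ z(2) zv(2)]) (use g(2) zv in simp)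
    have gen: "d * (s * r - r' * s') = (d * s) * r - (d * r') * s'" for d s r r' s' :: complex
      by (simp add: algebra_simps)
    have gen2: "k * (s * r - r' * s') = k * s * r - k * r' * s'" for k s r r' s' :: complex
      by (simp add: algebra_simps)
    show "(?t z (set vs) - ?t z W) * (?S W * ?R Z - ?R W * ?S Z)
      = (\<Sum>u\<in>W. ?w z u W * (?S (insert z (W - {u})) * ?R Z - ?R (insert z (W - {u})) * ?S Z))"
      unfolding gen S R gen2 sum_subtractf sum_distrib_right ..
  qed (use g dom in auto)
  then show ?thesis by simp
qed


subsection \<open>Limits of coinciding parameters\<close>


lemma sfun_cong:
  assumes "\<And>x. x \<in> pmset (U \<union> set vs) \<Longrightarrow> a x = b x"
  shows "sfun c xm a vs U = sfun c xm b vs U"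
  unfolding sfun_def using assms by (simp cong: conj_cong)

lemma tendsto_Fr:
  assumes "(f \<longlongrightarrow> x) F" "(g \<longlongrightarrow> w) F" "w\<^sup>2 - x\<^sup>2 \<noteq> 0"
  shows "((\<lambda>d. Fr c (f d) (g d)) \<longlongrightarrow> Fr c x w) F"
  unfolding Fr_def using assms by (intro tendsto_intros) auto

lemma tendsto_Fr_pole:
  assumes "w \<noteq> 0"
  shows "((\<lambda>d. d * Fr c w (w + d)) \<longlongrightarrow> (c\<^sup>2 - 2 * c * w) / (2 * w)) (at 0)"
proof (rule Lim_transform_eventually)
  have "((\<lambda>d. ((w + d - c)\<^sup>2 - w\<^sup>2) / (2 * w + d)) \<longlongrightarrow> ((w + 0 - c)\<^sup>2 - w\<^sup>2) / (2 * w + 0)) (at 0)"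
    using assms by (intro tendsto_intros) auto
  moreover have "((w + 0 - c)\<^sup>2 - w\<^sup>2) / (2 * w + 0) = (c\<^sup>2 - 2 * c * w) / (2 * w)"
    by (simp add: power2_eq_square algebra_simps)
  ultimately show "((\<lambda>d. ((w + d - c)\<^sup>2 - w\<^sup>2) / (2 * w + d)) \<longlongrightarrow> (c\<^sup>2 - 2 * c * w) / (2 * w)) (at 0)"
    by (simp only:)
  have "((w + d - c)\<^sup>2 - w\<^sup>2) / (2 * w + d) = d * Fr c w (w + d)" if "d \<noteq> 0" for d
  proof -
    have "(w + d)\<^sup>2 - w\<^sup>2 = d * (2 * w + d)" by (simp add: power2_eq_square algebra_simps)
    then show ?thesis using that by (simp add: Fr_def)
  qed
  then show "\<forall>\<^sub>F d in at 0. ((w + d - c)\<^sup>2 - w\<^sup>2) / (2 * w + d) = d * Fr c w (w + d)"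
    by (auto simp: eventually_at_filter)
qed

lemma tendsto_shift: "((\<lambda>d. w + d) \<longlongrightarrow> w) (at (0::complex))"
  by (intro tendsto_eq_intros) auto

locale shifted_points =
  fixes c xp xm :: complex and vs :: "complex list" and U :: "complex set"
  assumes c_nz: "c \<noteq> 0" and gUV: "gset c (U \<union> set vs)" and dist: "distinct vs"
    and disj: "set vs \<inter> U = {}" and cardU: "card U = length vs"
begin

definition Z :: "complex \<Rightarrow> complex set \<Rightarrow> complex set" where
  "Z d J = (\<lambda>v. v + d) ` J"

text \<open>Excludes finitely many shifts, so it holds for all small nonzero ones, see
  \<open>ok_eventually\<close>.\<close>

definition ok :: "complex \<Rightarrow> bool" where
  "ok d \<longleftrightarrow> d \<noteq> 0 \<and> (\<forall>v\<in>set vs. c + 2 * (v + d) \<noteq> 0 \<and> (\<forall>s\<in>pmset (U \<union> set vs). v + d \<noteq> s)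
     \<and> (\<forall>w\<in>set vs. v + d \<noteq> - (w + d)))"

text \<open>The default 0 provides the value at the negatives of the shifted points, see
  \<open>dat_Z\<close>.\<close>

definition dat :: "(complex \<Rightarrow> complex) \<Rightarrow> complex \<Rightarrow> complex \<Rightarrow> complex" where
  "dat a d x = (if x \<in> pmset (U \<union> set vs) then a x else if x - d \<in> set vs then 1 else 0)"

lemma fin: "finite U"
  using gUV by (simp add: gset_def)

lemma ok_eventually: "\<forall>\<^sub>F d in at 0. ok d"
proof -
  have ne: "\<forall>\<^sub>F d in at (0::complex). d \<noteq> y" for y
    by (rule eventually_neq_at_within)
  have 1: "\<forall>\<^sub>F d in at 0. c + 2 * (v + d) \<noteq> 0" for v :: complex
    by (rule eventually_mono[OF ne[of "- (c + 2 * v) / 2"]]) (auto simp: add_eq_0_iff algebra_simps)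
  have 2: "\<forall>\<^sub>F d in at 0. v + d \<noteq> s" for v s :: complex
    by (rule eventually_mono[OF ne[of "s - v"]]) auto
  have 3: "\<forall>\<^sub>F d in at 0. v + d \<noteq> - (w + d)" for v w :: complex
  proof (rule eventually_mono[OF ne[of "- (v + w) / 2"]])
    fix d assume "d \<noteq> - (v + w) / 2"
    moreover have "d = - (v + w) / 2" if "v + d = - (w + d)"
    proof -
      have "2 * d = - (v + w)" using that by (simp add: algebra_simps eq_neg_iff_add_eq_0)
      then show ?thesis by (metis nonzero_mult_div_cancel_left zero_neq_numeral)
    qed
    ultimately show "v + d \<noteq> - (w + d)" by blast
  qed
  show ?thesis
    unfolding ok_def
    by (intro eventually_conj eventually_ball_finite ballI ne 1 2 3 finite_set finite_pmset) (simp add: fin)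
qed

lemma dat_pm: "x \<in> pmset (U \<union> set vs) \<Longrightarrow> dat a d x = a x"
  by (simp add: dat_def)

lemma dat_V: "x \<in> set vs \<Longrightarrow> dat a d x = a x" "x \<in> set vs \<Longrightarrow> dat a d (- x) = a (- x)"
  by (simp_all add: dat_def pmset_def)

lemma ok_nonmem:
  assumes "ok d" "v \<in> set vs"
  shows "v + d \<notin> pmset (U \<union> set vs)" "- (v + d) \<notin> pmset (U \<union> set vs)" "- (v + d) \<notin> Z d (set vs)"
proof -
  show 1: "v + d \<notin> pmset (U \<union> set vs)" using assms by (auto simp: ok_def)
  then show "- (v + d) \<notin> pmset (U \<union> set vs)" by (metis pmset_uminus minus_minus)
  show "- (v + d) \<notin> Z d (set vs)" using assms unfolding ok_def Z_def by (metis imageE)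
qed

lemma dat_Z:
  assumes "ok d" "v \<in> set vs"
  shows "dat a d (v + d) = 1" "dat a d (- (v + d)) = 0"
proof -
  show "dat a d (v + d) = 1" using ok_nonmem[OF assms] assms by (simp add: dat_def)
  have "- (v + d) - d \<notin> set vs" using ok_nonmem(3)[OF assms] unfolding Z_def by (metis diff_add_cancel imageI)
  then show "dat a d (- (v + d)) = 0" using ok_nonmem(2)[OF assms] unfolding dat_def by (simp only: if_False)
qed

lemma Z_disjoint: "ok d \<Longrightarrow> J \<subseteq> set vs \<Longrightarrow> Z d J \<inter> pmset (U \<union> set vs) = {}"
  using ok_nonmem(1) unfolding Z_def by blast

lemma Z_gset:
  assumes "ok d"
  shows "gset c (U \<union> Z d (set vs) \<union> set vs)"
proof -
  have "- x \<notin> U \<union> Z d (set vs) \<union> set vs \<and> c + 2 * x \<noteq> 0" if x: "x \<in> U \<union> Z d (set vs) \<union> set vs" for x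
  proof (cases "x \<in> U \<union> set vs")
    case True
    then have "- x \<in> pmset (U \<union> set vs)" by (simp add: pmset_def)
    then have "- x \<notin> Z d (set vs)" using Z_disjoint[OF assms subset_refl] by blast
    then show ?thesis using True gUV by (auto simp: gset_def)
  next
    case False
    then obtain v where v: "v \<in> set vs" "x = v + d" using x by (auto simp: Z_def)
    have "U \<union> set vs \<subseteq> pmset (U \<union> set vs)" by (simp add: pmset_def)
    then have "- x \<notin> U \<union> set vs" using ok_nonmem(2)[OF assms v(1)] unfolding v(2) by blast
    moreover have "- x \<notin> Z d (set vs)" unfolding v(2) by (rule ok_nonmem(3)[OF assms v(1)])
    moreover have "c + 2 * x \<noteq> 0" using assms v unfolding ok_def by blast
    ultimately show ?thesis by blast
  qed
  then show ?thesis using fin unfolding gset_def Z_def by (metis List.finite_set finite_UnI finite_imageI)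
qed

lemma card_Z: "card (Z d J) = card J"
  unfolding Z_def by (rule card_image) simp

lemma Z_remove: "Z d J - {v + d} = Z d (J - {v})"
  by (auto simp: Z_def)

lemma Un_Z_remove:
  assumes "ok d" "A \<subseteq> U \<union> set vs" "v \<in> set vs"
  shows "(A \<union> Z d J) - {v + d} = A \<union> Z d (J - {v})"
proof -
  have "v + d \<notin> A" using ok_nonmem(1)[OF assms(1,3)] assms(2) by (auto simp: pmset_def)
  then show ?thesis using Z_remove[of d J v] by blast
qed

lemma FP_Un_Z:
  assumes "ok d" "A \<subseteq> U \<union> set vs" "J \<subseteq> set vs"
  shows "FP c z (A \<union> Z d J) = FP c z A * (\<Prod>j\<in>J. Fr c (j + d) z)"
proof -
  have "finite A" "finite J" using assms fin by (auto intro: finite_subset)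
  moreover have "A \<inter> Z d J = {}" using Z_disjoint[OF assms(1,3)] assms(2) by (auto simp: pmset_def)
  ultimately have "FP c z (A \<union> Z d J) = FP c z A * FP c z (Z d J)"
    unfolding FP_def Z_def by (intro prod.union_disjoint) auto
  then show ?thesis by (simp add: FP_def Z_def prod.reindex)
qed

lemma sq_ne: "x \<in> U \<union> set vs \<Longrightarrow> y \<in> U \<union> set vs \<Longrightarrow> x \<noteq> y \<Longrightarrow> x\<^sup>2 - y\<^sup>2 \<noteq> 0"
  by (rule gset_sq[OF gUV])

lemma V_nz: "v \<in> set vs \<Longrightarrow> v \<noteq> 0"
  using gsetD(1)[OF gUV, of v] by simp

lemma tendsto_FP:
  assumes "A \<subseteq> U \<union> set vs" "w \<in> set vs" "w \<notin> A"
  shows "((\<lambda>d. FP c (w + d) A) \<longlongrightarrow> FP c w A) (at 0)"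
  unfolding FP_def
  by (intro tendsto_prod tendsto_Fr tendsto_shift tendsto_const sq_ne) (use assms in auto)

lemma tendsto_FP_pole:
  assumes "A \<subseteq> U \<union> set vs" "w \<in> set vs"
  shows "((\<lambda>d. d * FP c (w + d) A) \<longlongrightarrow> (if w \<in> A then (c\<^sup>2 - 2 * c * w) / (2 * w) * FP c w (A - {w}) else 0)) (at 0)"
proof (cases "w \<in> A")
  case True
  have "finite A" using assms fin by (auto intro: finite_subset)
  then have e: "d * FP c (w + d) A = (d * Fr c w (w + d)) * FP c (w + d) (A - {w})" for d
    using FP_remove[OF _ True, of c "w + d"] by simp
  have "((\<lambda>d. (d * Fr c w (w + d)) * FP c (w + d) (A - {w})) \<longlongrightarrow> (c\<^sup>2 - 2 * c * w) / (2 * w) * FP c w (A - {w})) (at 0)"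
    by (intro tendsto_mult tendsto_Fr_pole V_nz tendsto_FP) (use assms in auto)
  then show ?thesis unfolding e using True by (simp only: if_True)
next
  case False
  have "((\<lambda>d. d * FP c (w + d) A) \<longlongrightarrow> 0 * FP c w A) (at 0)"
    by (intro tendsto_mult tendsto_FP tendsto_ident_at) (use assms False in auto)
  then show ?thesis using False by simp
qed

lemma tendsto_FPZ:
  assumes "J \<subseteq> set vs" "w \<in> set vs" "w \<notin> J"
  shows "((\<lambda>d. \<Prod>j\<in>J. Fr c (j + d) (w + d)) \<longlongrightarrow> FP c w J) (at 0)"
  unfolding FP_def
  by (intro tendsto_prod tendsto_Fr tendsto_shift tendsto_const sq_ne) (use assms in auto)

lemma tau_dat:
  assumes "ok d" "v \<in> set vs"
  shows "tau_hat c xp xm (dat a d) (\<lambda>_. 1) (v + d) W = alpha c xp (v + d) * ((v + d + xm - c/2) * FP c (v + d) W)"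
  unfolding tau_hat_alt by (simp only: dat_Z[OF assms] mult_1_right mult_1_left mult_zero_left mult_zero_right add_0_right)

text \<open>The unwanted coefficient for replacing \<open>w + d\<close> by \<open>z\<close>, see
  \<open>unwanted_dat\<close>. As the data vanish at \<open>- (w + d)\<close>, one of the two terms
  of \<open>Phi\<close> is gone.\<close>

definition unw :: "complex \<Rightarrow> complex \<Rightarrow> complex \<Rightarrow> complex set \<Rightarrow> complex set \<Rightarrow> complex" where
  "unw d z w A J = c * (c + 2 * z) * (wf_coeff c (w + d) / (z\<^sup>2 - (w + d)\<^sup>2)
     * ((w + d + xp - c/2) * ((w + d + xm - c/2) * (FP c (w + d) A * (\<Prod>j\<in>J. Fr c (j + d) (w + d))))))"

lemma unwanted_dat:
  assumes d: "ok d" and A: "A \<subseteq> U \<union> set vs" "J \<subseteq> set vs" "w \<in> J"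
    and z: "z \<in> U \<union> Z d (set vs) \<union> set vs" "z \<notin> A \<union> Z d J"
  shows "unwanted_coeff c xp xm (dat a d) (\<lambda>_. 1) z (w + d) (A \<union> Z d J) = unw d z w A (J - {w})"
proof -
  have w: "w \<in> set vs" using A by blast
  have ZJ: "Z d J \<subseteq> Z d (set vs)" using A(2) unfolding Z_def by blast
  have "gset c (insert z (A \<union> Z d J))"
    by (rule gset_mono[OF Z_gset[OF d]]) (use A z ZJ in blast)
  moreover have "w + d \<in> A \<union> Z d J" using A(3) by (simp add: Z_def)
  moreover have "Phi c xp xm (\<lambda>x. dat a d x * 1) (w + d) (A \<union> Z d J)
    = (w + d + xp - c/2) * ((w + d + xm - c/2) * (FP c (w + d) A * (\<Prod>j\<in>J - {w}. Fr c (j + d) (w + d))))"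
  proof -
    have "J - {w} \<subseteq> set vs" using A(2) by blast
    note FP = FP_Un_Z[OF d A(1) this, of "w + d"]
    show ?thesis
      unfolding Phi_def Un_Z_remove[OF d A(1) w] FP dat_Z[OF d w]
      by (simp only: mult_1_right mult_zero_left mult_zero_right diff_0_right)
  qed
  ultimately show ?thesis
    unfolding unw_def by (simp only: unwanted_coeff_gset[OF _ c_nz _ z(2)])
qed

text \<open>After multiplication by \<open>d\<close> the eigenvalue at \<open>set vs\<close> tends
  to the nonzero number \<open>K\<close>, everything else to 0. The set \<open>W\<close> varies with
  \<open>d\<close>, but in the form \<open>A \<union> Z d J\<close> with
  \<open>A \<subseteq> U\<close> and \<open>J \<subseteq> set vs\<close> there are finitely many
  cases, and finitely many eventual statements hold together.\<close>

lemma dominance: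
  assumes nz: "\<forall>v\<in>set vs. c - 2 * v \<noteq> 0 \<and> v + xp - c/2 \<noteq> 0 \<and> v + xm - c/2 \<noteq> 0 \<and> FP c v (set vs - {v}) \<noteq> 0"
  shows "\<forall>\<^sub>F d in at 0. \<forall>W z. W \<subseteq> U \<union> Z d (set vs) \<longrightarrow> z \<in> Z d (set vs) \<longrightarrow> z \<notin> W \<longrightarrow>
      (\<Sum>u\<in>W \<inter> Z d (set vs). cmod (unwanted_coeff c xp xm (dat a d) (\<lambda>_. 1) z u W))
      < cmod (tau_hat c xp xm (dat a d) (\<lambda>_. 1) z (set vs) - tau_hat c xp xm (dat a d) (\<lambda>_. 1) z W)"
proof -
  define tW where "tW d v A J = alpha c xp (v + d) * ((v + d + xm - c/2) * (FP c (v + d) A * (\<Prod>j\<in>J. Fr c (j + d) (v + d))))"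
    for d v A J
  define tV where "tV d v = alpha c xp (v + d) * ((v + d + xm - c/2) * FP c (v + d) (set vs))" for d v
  have key: "\<forall>\<^sub>F d in at 0. (\<Sum>j\<in>J. cmod (d * unw d (v + d) j A (J - {j}))) < cmod (d * tV d v - d * tW d v A J)"
    if A: "A \<subseteq> U" and J: "J \<subseteq> set vs" and v: "v \<in> set vs" "v \<notin> J" for A J v
  proof -
    have vn: "v \<noteq> 0" "v + v \<noteq> 0" using V_nz[OF v(1)] by auto
    have al: "((\<lambda>d. alpha c xp (v + d)) \<longlongrightarrow> alpha c xp v) (at 0)"
      unfolding alpha_def using vn by (intro tendsto_intros tendsto_shift) auto
    have xmv: "((\<lambda>d. v + d + xm - c/2) \<longlongrightarrow> v + xm - c/2) (at 0)"
      by (intro tendsto_intros tendsto_shift)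
    have A': "A \<subseteq> U \<union> set vs" "v \<notin> A" using A v disj by auto
    have "((\<lambda>d. d * tW d v A J) \<longlongrightarrow> 0 * (alpha c xp v * ((v + xm - c/2) * (FP c v A * FP c v J)))) (at 0)"
      unfolding tW_def by (intro tendsto_mult tendsto_ident_at al xmv tendsto_FP tendsto_FPZ A' J v)
    moreover define K where "K = alpha c xp v * ((v + xm - c/2) * ((c\<^sup>2 - 2 * c * v) / (2 * v) * FP c v (set vs - {v})))"
    have "((\<lambda>d. alpha c xp (v + d) * ((v + d + xm - c/2) * (d * FP c (v + d) (set vs)))) \<longlongrightarrow> K) (at 0)"
    proof -
      have "((\<lambda>d. d * FP c (v + d) (set vs)) \<longlongrightarrow> (c\<^sup>2 - 2 * c * v) / (2 * v) * FP c v (set vs - {v})) (at 0)"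
        using tendsto_FP_pole[of "set vs" v] v(1) by (simp only: if_True Un_upper2)
      from tendsto_mult[OF al tendsto_mult[OF xmv this]] show ?thesis unfolding K_def .
    qed
    then have "((\<lambda>d. d * tV d v) \<longlongrightarrow> K) (at 0)"
      by (simp add: tV_def mult.left_commute)
    ultimately have 1: "((\<lambda>d. cmod (d * tV d v - d * tW d v A J)) \<longlongrightarrow> cmod (K - 0)) (at 0)"
      by (intro tendsto_intros) simp_all
    have "((\<lambda>d. d * unw d (v + d) j A (J - {j})) \<longlongrightarrow> 0 * (c * (c + 2 * v) * (wf_coeff c j / (v\<^sup>2 - j\<^sup>2)
     * ((j + xp - c/2) * ((j + xm - c/2) * (FP c j A * FP c j (J - {j}))))))) (at 0)" if j: "j \<in> J" for j
    proof -
      have jv: "j \<in> set vs" "j \<notin> A" using j J A disj by auto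
      have ne: "v\<^sup>2 - j\<^sup>2 \<noteq> 0" using jv j v by (intro sq_ne) auto
      have wf: "((\<lambda>d. wf_coeff c (j + d)) \<longlongrightarrow> wf_coeff c j) (at 0)"
        unfolding wf_coeff_def using V_nz[OF jv(1)] by (intro tendsto_intros tendsto_shift) auto
      show ?thesis unfolding unw_def
        by (intro tendsto_mult tendsto_ident_at tendsto_const tendsto_divide tendsto_add tendsto_diff tendsto_power
            tendsto_shift wf ne tendsto_FP tendsto_FPZ A' jv) (use J in auto)
    qed
    then have "((\<lambda>d. cmod (d * unw d (v + d) j A (J - {j}))) \<longlongrightarrow> 0) (at 0)" if "j \<in> J" for j
      using that by (intro tendsto_norm_zero) simp
    then have 2: "((\<lambda>d. \<Sum>j\<in>J. cmod (d * unw d (v + d) j A (J - {j}))) \<longlongrightarrow> (\<Sum>j\<in>J. 0)) (at 0)"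
      by (intro tendsto_sum)
    have "K \<noteq> 0"
    proof -
      have "c + 2 * v \<noteq> 0" using gsetD(2)[OF gUV, of v] v by simp
      then have "2 * v + c \<noteq> 0" by (simp add: add.commute)
      moreover have "c\<^sup>2 - 2 * c * v = c * (c - 2 * v)" by (simp add: power2_eq_square algebra_simps)
      ultimately show ?thesis using bspec[OF nz v(1)] vn c_nz by (simp add: K_def alpha_def)
    qed
    then have "0 < cmod (K - 0) - (\<Sum>j\<in>J. 0::real)" by simp
    from order_tendstoD(1)[OF tendsto_diff[OF 1 2] this] show ?thesis
      by (rule eventually_mono) simp
  qed
  have "\<forall>\<^sub>F d in at 0. \<forall>A\<in>Pow U. \<forall>J\<in>Pow (set vs). \<forall>v\<in>set vs - J.
     (\<Sum>j\<in>J. cmod (d * unw d (v + d) j A (J - {j}))) < cmod (d * tV d v - d * tW d v A J)"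
    by (intro eventually_ball_finite ballI key) (auto simp: fin)
  with ok_eventually show ?thesis
  proof (rule eventually_elim2, intro allI impI)
    fix d W z
    assume d: "ok d" and dom: "\<forall>A\<in>Pow U. \<forall>J\<in>Pow (set vs). \<forall>v\<in>set vs - J.
     (\<Sum>j\<in>J. cmod (d * unw d (v + d) j A (J - {j}))) < cmod (d * tV d v - d * tW d v A J)"
      and W: "W \<subseteq> U \<union> Z d (set vs)" and z: "z \<in> Z d (set vs)" "z \<notin> W"
    define A where "A = W \<inter> U"
    define J where "J = {j \<in> set vs. j + d \<in> W}"
    obtain v where v: "v \<in> set vs" "z = v + d" using z by (auto simp: Z_def)
    have A: "A \<subseteq> U" and J: "J \<subseteq> set vs" and vJ: "v \<notin> J" using v z by (auto simp: A_def J_def)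
    have A': "A \<subseteq> U \<union> set vs" using A by blast
    have WAJ: "W = A \<union> Z d J" using W by (auto simp: A_def J_def Z_def)
    have WZ: "W \<inter> Z d (set vs) = Z d J" by (auto simp: J_def Z_def)
    have dn: "d \<noteq> 0" using d by (simp add: ok_def)
    have t: "tau_hat c xp xm (dat a d) (\<lambda>_. 1) z (set vs) = tV d v"
      "tau_hat c xp xm (dat a d) (\<lambda>_. 1) z W = tW d v A J"
      unfolding v(2) tau_dat[OF d v(1)] tV_def tW_def WAJ FP_Un_Z[OF d A' J] by (rule refl)+
    have "(\<Sum>u\<in>W \<inter> Z d (set vs). cmod (unwanted_coeff c xp xm (dat a d) (\<lambda>_. 1) z u W))
      = (\<Sum>j\<in>J. cmod (unwanted_coeff c xp xm (dat a d) (\<lambda>_. 1) z (j + d) W))"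
      unfolding WZ by (simp add: Z_def sum.reindex)
    also have "\<dots> = (\<Sum>j\<in>J. cmod (unw d (v + d) j A (J - {j})))"
    proof (intro sum.cong refl arg_cong[where f = cmod])
      fix j assume j: "j \<in> J"
      show "unwanted_coeff c xp xm (dat a d) (\<lambda>_. 1) z (j + d) W = unw d (v + d) j A (J - {j})"
        unfolding WAJ v(2)[symmetric] by (rule unwanted_dat[OF d A' J j]) (use z WAJ in auto)
    qed
    finally have s: "(\<Sum>u\<in>W \<inter> Z d (set vs). cmod (unwanted_coeff c xp xm (dat a d) (\<lambda>_. 1) z u W))
      = (\<Sum>j\<in>J. cmod (unw d (v + d) j A (J - {j})))" .
    have "(\<Sum>j\<in>J. cmod (d * unw d (v + d) j A (J - {j}))) < cmod (d * tV d v - d * tW d v A J)"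
      using dom A J v(1) vJ by blast
    then have "cmod d * (\<Sum>j\<in>J. cmod (unw d (v + d) j A (J - {j}))) < cmod d * cmod (tV d v - tW d v A J)"
      by (simp add: norm_mult sum_distrib_left right_diff_distrib[symmetric])
    then show "(\<Sum>u\<in>W \<inter> Z d (set vs). cmod (unwanted_coeff c xp xm (dat a d) (\<lambda>_. 1) z u W))
      < cmod (tau_hat c xp xm (dat a d) (\<lambda>_. 1) z (set vs) - tau_hat c xp xm (dat a d) (\<lambda>_. 1) z W)"
      unfolding s t using dn by simp
  qed
qed

end


section \<open>Leading terms of both sides at the shifted points\<close>

context shifted_points
begin

lemma V_sum_nz: "x \<in> set vs \<Longrightarrow> y \<in> set vs \<Longrightarrow> x + y \<noteq> 0"
  using gsetD(3)[OF gUV, of x y] by (simp add: eq_neg_iff_add_eq_0)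

text \<open>The limit of \<open>d\<close> times the coefficient of replacing \<open>v + d\<close> by
  \<open>v\<close>, when the other points tend to those of \<open>set vs - {v}\<close>. The factor
  \<open>- 1 / (2 * v)\<close> is the limit of \<open>d / (v^2 - (v + d)^2)\<close>.\<close>

definition kap :: "complex \<Rightarrow> complex" where
  "kap v = c * (c + 2 * v) * (wf_coeff c v * (- 1 / (2 * v)) * ((v + xp - c/2) * ((v + xm - c/2) * FP c v (set vs - {v}))))"

text \<open>For \<open>j = v\<close> the pole lies in the denominator
  \<open>v^2 - (v + d)^2\<close>; for other \<open>j\<close> a pole can come only from the factor
  \<open>Fr\<close> with \<open>j\<close> in \<open>A\<close>.\<close>

definition unw_lim :: "complex \<Rightarrow> complex \<Rightarrow> complex set \<Rightarrow> complex set \<Rightarrow> complex" where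
  "unw_lim v j A J =
     (if j = v then c * (c + 2 * v) * (wf_coeff c v * (- 1 / (2 * v)) * ((v + xp - c/2) * ((v + xm - c/2) * (FP c v A * FP c v J))))
      else c * (c + 2 * v) * (wf_coeff c j / (v\<^sup>2 - j\<^sup>2) * ((j + xp - c/2) * ((j + xm - c/2)
        * ((if j \<in> A then (c\<^sup>2 - 2 * c * j) / (2 * j) * FP c j (A - {j}) else 0) * FP c j J)))))"

lemma tendsto_unw:
  assumes "v \<in> set vs" "v \<notin> A" "A \<subseteq> set vs" "j \<in> set vs" "J \<subseteq> set vs" "j \<notin> J"
  shows "((\<lambda>d. d * unw d v j A J) \<longlongrightarrow> unw_lim v j A J) (at 0)"
proof -
  have wf: "((\<lambda>d. wf_coeff c (j + d)) \<longlongrightarrow> wf_coeff c j) (at 0)"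
    unfolding wf_coeff_def using V_nz[OF assms(4)] by (intro tendsto_intros tendsto_shift) auto
  have lin: "((\<lambda>d. j + d + x - c/2) \<longlongrightarrow> j + x - c/2) (at 0)" for x
    by (intro tendsto_intros tendsto_shift)
  have A: "A \<subseteq> U \<union> set vs" using assms by blast
  have J: "((\<lambda>d. \<Prod>i\<in>J. Fr c (i + d) (j + d)) \<longlongrightarrow> FP c j J) (at 0)"
    by (rule tendsto_FPZ) (use assms in auto)
  show ?thesis
  proof (cases "j = v")
    case True
    have "((\<lambda>d. - 1 / (2 * v + d)) \<longlongrightarrow> - 1 / (2 * v + 0)) (at 0)"
      using V_nz[OF assms(1)] by (intro tendsto_intros) auto
    moreover have "\<forall>\<^sub>F d in at 0. - 1 / (2 * v + d) = d / (v\<^sup>2 - (v + d)\<^sup>2)"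
    proof -
      have "- 1 / (2 * v + d) = d / (v\<^sup>2 - (v + d)\<^sup>2)" if "d \<noteq> 0" for d
      proof -
        have "v\<^sup>2 - (v + d)\<^sup>2 = d * (- (2 * v + d))" by (simp add: power2_eq_square algebra_simps)
        then show ?thesis using that by (simp del: minus_add_distrib)
      qed
      then show ?thesis by (auto simp: eventually_at_filter)
    qed
    ultimately have P: "((\<lambda>d. d / (v\<^sup>2 - (v + d)\<^sup>2)) \<longlongrightarrow> - 1 / (2 * v)) (at 0)"
      by (auto intro: Lim_transform_eventually)
    have FA: "((\<lambda>d. FP c (j + d) A) \<longlongrightarrow> FP c j A) (at 0)"
      by (rule tendsto_FP[OF A]) (use assms True in auto)
    have e: "d * unw d v j A J = c * (c + 2 * v) * (wf_coeff c (j + d) * (d / (v\<^sup>2 - (v + d)\<^sup>2))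
        * ((j + d + xp - c/2) * ((j + d + xm - c/2) * (FP c (j + d) A * (\<Prod>i\<in>J. Fr c (i + d) (j + d))))))" for d
      by (simp add: unw_def True)
    have "((\<lambda>d. d * unw d v j A J) \<longlongrightarrow> c * (c + 2 * v) * (wf_coeff c j * (- 1 / (2 * v))
        * ((j + xp - c/2) * ((j + xm - c/2) * (FP c j A * FP c j J))))) (at 0)"
      unfolding e by (intro tendsto_mult tendsto_const wf P lin FA J)
    then show ?thesis using True by (simp add: unw_lim_def)
  next
    case False
    have ne: "v\<^sup>2 - j\<^sup>2 \<noteq> 0" using assms False by (intro sq_ne) auto
    have e: "d * unw d v j A J = c * (c + 2 * v) * (wf_coeff c (j + d) / (v\<^sup>2 - (j + d)\<^sup>2)
        * ((j + d + xp - c/2) * ((j + d + xm - c/2) * (d * FP c (j + d) A * (\<Prod>i\<in>J. Fr c (i + d) (j + d))))))" for d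
      by (simp add: unw_def mult.left_commute)
    have "((\<lambda>d. d * unw d v j A J) \<longlongrightarrow> c * (c + 2 * v) * (wf_coeff c j / (v\<^sup>2 - j\<^sup>2) * ((j + xp - c/2) * ((j + xm - c/2)
        * ((if j \<in> A then (c\<^sup>2 - 2 * c * j) / (2 * j) * FP c j (A - {j}) else 0) * FP c j J))))) (at 0)"
      unfolding e
      by (intro tendsto_mult tendsto_const tendsto_divide tendsto_diff tendsto_power tendsto_shift wf lin J ne
          tendsto_FP_pole[OF A assms(4)])
    then show ?thesis using False by (simp add: unw_lim_def)
  qed
qed

text \<open>All of \<open>set vs\<close> has to be present at the end, and each element can enter
  only at its own step. Hence the step at \<open>v\<close> must be a replacement, and it must not
  remove an element of \<open>A\<close>.\<close>

lemma action_coeff_Z_step: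
  assumes d: "ok d" and r: "distinct (v # rest)" "set (v # rest) \<subseteq> set vs" and J: "J \<subseteq> set vs"
  defines "A \<equiv> set vs - set (v # rest)"
  shows "action_coeff c xp xm (dat a d) (\<lambda>_. 1) (v # rest) (A \<union> Z d J) (set vs)
    = (\<Sum>j\<in>J. unw d v j A (J - {j})
        * action_coeff c xp xm (dat a d) (\<lambda>_. 1) rest ((set vs - set rest) \<union> Z d (J - {j})) (set vs))"
proof -
  let ?ac = "action_coeff c xp xm (dat a d) (\<lambda>_. 1) rest" and ?un = "unwanted_coeff c xp xm (dat a d) (\<lambda>_. 1)"
  let ?W = "A \<union> Z d J"
  have A: "A \<subseteq> U \<union> set vs" "A \<subseteq> set vs" by (auto simp: A_def)
  have v: "v \<in> set vs" using r by simp
  have ZV: "Z d J \<inter> set vs = {}" using Z_disjoint[OF d J] by (auto simp: pmset_def)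
  have fJ: "finite J" using J finite_subset by blast
  have fW: "finite ?W" unfolding A_def Z_def using fJ by simp
  have vW: "v \<notin> ?W" using ZV v by (auto simp: A_def)
  have rW: "set rest \<inter> ?W = {}" using ZV r by (auto simp: A_def)
  have 0: "?ac ?W (set vs) = 0"
    by (rule action_coeff_eq_0[OF fW _ rW]) (use r v vW in auto)
  have A0: "?ac (insert v (?W - {u})) (set vs) = 0" if u: "u \<in> A" for u
  proof (rule action_coeff_eq_0)
    have "u \<in> set vs" "u \<notin> insert v (?W - {u}) \<union> set rest" using u by (auto simp: A_def)
    then show "\<not> (set vs \<subseteq> insert v (?W - {u}) \<union> set rest \<and> card (set vs) = card (insert v (?W - {u})))" by blast
  qed (use fW r rW in auto)
  have "action_coeff c xp xm (dat a d) (\<lambda>_. 1) (v # rest) ?W (set vs)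
    = (\<Sum>u\<in>?W. ?un v u ?W * ?ac (insert v (?W - {u})) (set vs))"
    by (simp only: action_coeff.simps 0 mult_zero_right add_0_left)
  also have "\<dots> = (\<Sum>u\<in>Z d J. ?un v u ?W * ?ac (insert v (?W - {u})) (set vs))"
    using fW A0 by (intro sum.mono_neutral_right) auto
  also have "\<dots> = (\<Sum>j\<in>J. ?un v (j + d) ?W * ?ac (insert v (?W - {j + d})) (set vs))"
    by (simp add: Z_def sum.reindex)
  also have "\<dots> = (\<Sum>j\<in>J. unw d v j A (J - {j}) * ?ac ((set vs - set rest) \<union> Z d (J - {j})) (set vs))"
  proof (intro sum.cong refl)
    fix j assume j: "j \<in> J"
    have "?un v (j + d) ?W = unw d v j A (J - {j})"
      by (rule unwanted_dat[OF d A(1) J j _ vW]) (use v in blast)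
    moreover have "insert v (?W - {j + d}) = (set vs - set rest) \<union> Z d (J - {j})"
    proof -
      have "?W - {j + d} = A \<union> Z d (J - {j})" by (rule Un_Z_remove[OF d A(1)]) (use j J in blast)
      moreover have "insert v A = set vs - set rest" using r by (auto simp: A_def)
      ultimately show ?thesis by (metis Un_insert_left)
    qed
    ultimately show "?un v (j + d) ?W * ?ac (insert v (?W - {j + d})) (set vs)
      = unw d v j A (J - {j}) * ?ac ((set vs - set rest) \<union> Z d (J - {j})) (set vs)" by (simp only:)
  qed
  finally show ?thesis .
qed

text \<open>The recursion passes through all \<open>J\<close>, but except for
  \<open>J = set rest\<close> the mere existence of a limit suffices: such limits get multiplied by
  \<open>unw_lim\<close> at some \<open>j \<noteq> v\<close> outside \<open>A\<close>, which is
  0.\<close>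

lemma action_coeff_limit:
  assumes "distinct rest" "set rest \<subseteq> set vs" "J \<subseteq> set vs" "card J = length rest"
  shows "\<exists>L. ((\<lambda>d. d ^ length rest * action_coeff c xp xm (dat a d) (\<lambda>_. 1) rest ((set vs - set rest) \<union> Z d J) (set vs))
      \<longlongrightarrow> L) (at 0) \<and> (J = set rest \<longrightarrow> L = (\<Prod>v\<leftarrow>rest. kap v))"
  using assms
proof (induction rest arbitrary: J)
  case Nil
  then have "J = {}" using finite_subset[of J "set vs"] by simp
  then show ?case by (intro exI[of _ 1]) (simp add: Z_def)
next
  case (Cons v rest)
  define A where "A = set vs - set (v # rest)"
  have fJ: "finite J" using Cons.prems(3) finite_subset by blast
  have "\<forall>j\<in>J. \<exists>L. ((\<lambda>d. d ^ length rest * action_coeff c xp xm (dat a d) (\<lambda>_. 1) rest ((set vs - set rest) \<union> Z d (J - {j})) (set vs))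
      \<longlongrightarrow> L) (at 0) \<and> (J - {j} = set rest \<longrightarrow> L = (\<Prod>v\<leftarrow>rest. kap v))"
  proof
    fix j assume "j \<in> J"
    then have "card (J - {j}) = length rest" using Cons.prems(4) fJ by simp
    then show "\<exists>L. ((\<lambda>d. d ^ length rest * action_coeff c xp xm (dat a d) (\<lambda>_. 1) rest ((set vs - set rest) \<union> Z d (J - {j})) (set vs))
      \<longlongrightarrow> L) (at 0) \<and> (J - {j} = set rest \<longrightarrow> L = (\<Prod>v\<leftarrow>rest. kap v))"
      using Cons.prems by (intro Cons.IH) auto
  qed
  from bchoice[OF this] obtain L where L0: "\<forall>j\<in>J. ((\<lambda>d. d ^ length rest * action_coeff c xp xm (dat a d) (\<lambda>_. 1) rest ((set vs - set rest) \<union> Z d (J - {j})) (set vs))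
      \<longlongrightarrow> L j) (at 0) \<and> (J - {j} = set rest \<longrightarrow> L j = (\<Prod>v\<leftarrow>rest. kap v))" ..
  note L = conjunct1[OF bspec[OF L0]] mp[OF conjunct2[OF bspec[OF L0]]]
  have v: "v \<in> set vs" "v \<notin> A" "A \<subseteq> set vs" using Cons.prems(2) by (auto simp: A_def)
  have "((\<lambda>d. \<Sum>j\<in>J. (d * unw d v j A (J - {j})) * (d ^ length rest * action_coeff c xp xm (dat a d) (\<lambda>_. 1) rest ((set vs - set rest) \<union> Z d (J - {j})) (set vs)))
     \<longlongrightarrow> (\<Sum>j\<in>J. unw_lim v j A (J - {j}) * L j)) (at 0)"
    using Cons.prems(3) by (intro tendsto_sum tendsto_mult L tendsto_unw v) auto
  moreover have "\<forall>\<^sub>F d in at 0. (\<Sum>j\<in>J. (d * unw d v j A (J - {j})) * (d ^ length rest * action_coeff c xp xm (dat a d) (\<lambda>_. 1) rest ((set vs - set rest) \<union> Z d (J - {j})) (set vs)))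
     = d ^ length (v # rest) * action_coeff c xp xm (dat a d) (\<lambda>_. 1) (v # rest) (A \<union> Z d J) (set vs)"
    using ok_eventually
  proof (rule eventually_mono)
    fix d assume d: "ok d"
    have gen: "(d * x) * (d ^ n * y) = d ^ Suc n * (x * y)" for x y :: complex and n by simp
    show "(\<Sum>j\<in>J. (d * unw d v j A (J - {j})) * (d ^ length rest * action_coeff c xp xm (dat a d) (\<lambda>_. 1) rest ((set vs - set rest) \<union> Z d (J - {j})) (set vs)))
     = d ^ length (v # rest) * action_coeff c xp xm (dat a d) (\<lambda>_. 1) (v # rest) (A \<union> Z d J) (set vs)"
      unfolding A_def action_coeff_Z_step[OF d Cons.prems(1-3)] gen sum_distrib_left list.size(4) add_Suc_right add_0_right ..
  qed
  ultimately have lim: "((\<lambda>d. d ^ length (v # rest) * action_coeff c xp xm (dat a d) (\<lambda>_. 1) (v # rest) (A \<union> Z d J) (set vs))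
     \<longlongrightarrow> (\<Sum>j\<in>J. unw_lim v j A (J - {j}) * L j)) (at 0)"
    by (rule Lim_transform_eventually)
  moreover have "(\<Sum>j\<in>J. unw_lim v j A (J - {j}) * L j) = (\<Prod>v\<leftarrow>v # rest. kap v)" if J: "J = set (v # rest)"
  proof -
    have Jv: "J - {v} = set rest" using J Cons.prems(1) by auto
    have "unw_lim v j A (J - {j}) = 0" if "j \<in> J - {v}" for j
      using that J by (auto simp: unw_lim_def A_def)
    then have "(\<Sum>j\<in>J. unw_lim v j A (J - {j}) * L j) = (\<Sum>j\<in>{v}. unw_lim v j A (J - {j}) * L j)"
      using fJ J by (intro sum.mono_neutral_right) auto
    also have "\<dots> = unw_lim v v A (set rest) * (\<Prod>v\<leftarrow>rest. kap v)" using L(2)[OF _ Jv] J Jv by simp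
    also have "unw_lim v v A (set rest) = kap v"
    proof -
      have "FP c v A * FP c v (set rest) = FP c v (A \<union> set rest)"
        unfolding FP_def by (rule prod.union_disjoint[symmetric]) (auto simp: A_def)
      also have "A \<union> set rest = set vs - {v}" using Cons.prems(1,2) by (auto simp: A_def)
      finally show ?thesis by (simp add: unw_lim_def kap_def)
    qed
    finally show ?thesis by simp
  qed
  ultimately show ?case unfolding A_def by blast
qed

lemma tendsto_f_rat:
  assumes "(f \<longlongrightarrow> x) F" "(g \<longlongrightarrow> y) F" "x - y \<noteq> 0"
  shows "((\<lambda>d. f_rat c (f d) (g d)) \<longlongrightarrow> f_rat c x y) F" "((\<lambda>d. g_rat c (f d) (g d)) \<longlongrightarrow> g_rat c x y) F"
  unfolding f_rat_def g_rat_def using assms by (intro tendsto_intros; simp)+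

lemma tendsto_mshift: "((\<lambda>d. - (w + d)) \<longlongrightarrow> - w) (at (0::complex))"
  by (intro tendsto_minus tendsto_shift)

lemma coefZ_limit:
  assumes "distinct ws" "set ws \<subseteq> set vs"
  shows "((\<lambda>d. coefZ c xm (map (\<lambda>v. v + d) ws)) \<longlongrightarrow> coefZ c xm ws) (at 0)"
  using assms
proof (induction ws)
  case (Cons z ws)
  have f: "((\<lambda>d. f_rat c (- (w + d)) (z + d)) \<longlongrightarrow> f_rat c (- w) z) (at 0)" if "w \<in> set (z # ws)" for w
  proof (rule tendsto_f_rat(1)[OF tendsto_mshift tendsto_shift])
    have "- w - z = - (w + z)" by simp
    then show "- w - z \<noteq> 0" using V_sum_nz[of w z] that Cons.prems(2) by (metis list.set_intros(1) neg_equal_0_iff_equal subsetD)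
  qed
  have e: "(\<Prod>w\<in>set (map (\<lambda>v. v + d) ws). f_rat c (- w) (z + d)) = (\<Prod>w\<in>set ws. f_rat c (- (w + d)) (z + d))" for d
    by (simp add: prod.reindex del: minus_add_distrib)
  have "((\<lambda>d. - (xm + (z + d) - c/2) * (f_rat c (- (z + d)) (z + d) * (\<Prod>w\<in>set ws. f_rat c (- (w + d)) (z + d)))
      * coefZ c xm (map (\<lambda>v. v + d) ws)) \<longlongrightarrow> coefZ c xm (z # ws)) (at 0)"
    unfolding coefZ.simps
    by (intro tendsto_mult tendsto_prod tendsto_minus tendsto_diff tendsto_add tendsto_const tendsto_shift f Cons.IH tendsto_ident_at)
      (use Cons.prems in auto)
  then show ?case by (simp only: list.map coefZ.simps e)
qed simp

text \<open>The coefficient of the pole of order \<open>length ws\<close> of \<open>dwpf\<close> as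
  its arguments coincide pairwise; each pair contributes \<open>- c\<close> through
  \<open>g_rat\<close>.\<close>

fun DL :: "complex list \<Rightarrow> complex" where
  "DL [] = 1"
| "DL (w # ws) = - (c * (\<Prod>k\<in>set ws. f_rat c (- k) (- w) * f_rat c (- w) (- k)) * DL ws)"

text \<open>The argument \<open>e w\<close> meets a point \<open>- (j + d)\<close> in the limit only
  if \<open>e w = - w\<close> and \<open>j = w\<close>. A pole of full order requires this for every
  \<open>w\<close>.\<close>

lemma dwpf_limit:
  assumes "distinct ws" "set ws \<subseteq> set vs" "\<And>w. w \<in> set ws \<Longrightarrow> e w \<in> {w, - w}" "J \<subseteq> set vs" "card J = length ws"
  shows "((\<lambda>d. d ^ length ws * dwpf c (map e ws) (uminus ` Z d J))
    \<longlongrightarrow> (if J = set ws \<and> (\<forall>w\<in>set ws. e w = - w) then DL ws else 0)) (at 0)"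
  using assms
proof (induction ws arbitrary: J)
  case Nil
  then have "J = {}" using finite_subset[of J "set vs"] by simp
  then show ?case by (simp add: Z_def)
next
  case (Cons w ws)
  let ?y = "e w"
  let ?lim = "\<lambda>J. if J = set ws \<and> (\<forall>w\<in>set ws. e w = - w) then DL ws else 0"
  define T where "T d j = g_rat c ?y (- (j + d)) * (\<Prod>k\<in>J - {j}. f_rat c (- (k + d)) ?y * f_rat c (- (j + d)) (- (k + d)))" for d j
  define D where "D d j = d ^ length ws * dwpf c (map e ws) (uminus ` Z d (J - {j}))" for d j
  have fJ: "finite J" using Cons.prems(4) finite_subset by blast
  have w: "w \<in> set vs" "w \<noteq> 0" "w \<notin> set ws" using Cons.prems(1,2) V_nz by auto
  have ey: "?y = w \<or> ?y = - w" using Cons.prems(3)[of w] by auto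
  have step: "d ^ length (w # ws) * dwpf c (map e (w # ws)) (uminus ` Z d J) = - (\<Sum>j\<in>J. (d * T d j) * D d j)" for d
  proof -
    have inj: "inj_on (\<lambda>j. - (j + d)) B" for B by (simp add: inj_on_def)
    have im: "uminus ` Z d B = (\<lambda>j. - (j + d)) ` B" for B by (simp add: Z_def image_image)
    have rem: "(\<lambda>j. - (j + d)) ` J - {- (j + d)} = (\<lambda>j. - (j + d)) ` (J - {j})" for j by auto
    have gen: "(d * (x * p)) * (d ^ n * y) = d ^ Suc n * (x * p * y)" for x p y :: complex and n by simp
    show ?thesis
      unfolding T_def D_def im list.map dwpf.simps sum.reindex[OF inj] o_def rem prod.reindex[OF inj] gen
      by (simp only: mult_minus_right sum_distrib_left list.size(4) add_Suc_right add_0_right)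
  qed
  have DIH: "((\<lambda>d. D d j) \<longlongrightarrow> ?lim (J - {j})) (at 0)" if "j \<in> J" for j
    unfolding D_def
  proof (rule Cons.IH)
    show "card (J - {j}) = length ws" using Cons.prems(5) fJ that by simp
  qed (use Cons.prems in auto)
  have ff: "((\<lambda>d. f_rat c (- (j + d)) (- (k + d))) \<longlongrightarrow> f_rat c (- j) (- k)) (at 0)" if "j \<noteq> k" for j k
    by (rule tendsto_f_rat(1)[OF tendsto_mshift tendsto_mshift]) (use that in simp)
  have fy: "((\<lambda>d. f_rat c (- (k + d)) ?y) \<longlongrightarrow> f_rat c (- k) ?y) (at 0)"
    "((\<lambda>d. g_rat c ?y (- (k + d))) \<longlongrightarrow> g_rat c ?y (- k)) (at 0)" if "?y \<noteq> - k" for k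
  proof -
    have n: "- k - ?y \<noteq> 0" "?y - - k \<noteq> 0" using that by (metis eq_iff_diff_eq_0)+
    show "((\<lambda>d. f_rat c (- (k + d)) ?y) \<longlongrightarrow> f_rat c (- k) ?y) (at 0)"
      by (rule tendsto_f_rat(1)[OF tendsto_mshift tendsto_const n(1)])
    show "((\<lambda>d. g_rat c ?y (- (k + d))) \<longlongrightarrow> g_rat c ?y (- k)) (at 0)"
      by (rule tendsto_f_rat(2)[OF tendsto_const tendsto_mshift n(2)])
  qed
  show ?case
  proof (cases "?y = - w \<and> w \<in> J")
    case True
    have yk: "?y \<noteq> - k" if "k \<noteq> w" for k using True that by simp
    have Tw: "((\<lambda>d. d * T d w) \<longlongrightarrow> c * (\<Prod>k\<in>J - {w}. f_rat c (- k) (- w) * f_rat c (- w) (- k))) (at 0)"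
    proof -
      have "((\<lambda>d. \<Prod>k\<in>J - {w}. f_rat c (- (k + d)) ?y * f_rat c (- (w + d)) (- (k + d)))
        \<longlongrightarrow> (\<Prod>k\<in>J - {w}. f_rat c (- k) ?y * f_rat c (- w) (- k))) (at 0)"
        by (intro tendsto_prod tendsto_mult fy ff yk) auto
      moreover have "\<forall>\<^sub>F d in at 0. c = d * g_rat c ?y (- (w + d))"
        using True by (auto simp: eventually_at_filter g_rat_def)
      then have "((\<lambda>d. d * g_rat c ?y (- (w + d))) \<longlongrightarrow> c) (at 0)"
        by (rule Lim_transform_eventually[OF tendsto_const])
      ultimately have "((\<lambda>d. (d * g_rat c ?y (- (w + d))) * (\<Prod>k\<in>J - {w}. f_rat c (- (k + d)) ?y * f_rat c (- (w + d)) (- (k + d))))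
        \<longlongrightarrow> c * (\<Prod>k\<in>J - {w}. f_rat c (- k) ?y * f_rat c (- w) (- k))) (at 0)"
        by (intro tendsto_mult)
      then show ?thesis using True by (simp add: T_def mult.assoc)
    qed
    \<comment> \<open>For \<open>j \<noteq> w\<close> the factor with \<open>k = w\<close> still has
      a pole, so \<open>d * T d j\<close> has a finite limit. The term disappears nevertheless,
      because \<open>w\<close> stays in the set and \<open>D d j\<close> tends to 0.\<close>
    have Tj: "\<exists>l. ((\<lambda>d. d * T d j) \<longlongrightarrow> l) (at 0)" if j: "j \<in> J - {w}" for j
    proof -
      have "((\<lambda>d. d - c) \<longlongrightarrow> 0 - c) (at 0)" by (intro tendsto_intros)
      moreover have "\<forall>\<^sub>F d in at 0. d - c = d * f_rat c (- (w + d)) ?y"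
      proof -
        have "d - c = d * f_rat c (- (w + d)) ?y" if "d \<noteq> 0" for d
        proof -
          have "- (w + d) - ?y = - d" using True by simp
          then show ?thesis using that by (simp add: f_rat_def)
        qed
        then show ?thesis by (auto simp: eventually_at_filter)
      qed
      ultimately have P: "((\<lambda>d. d * f_rat c (- (w + d)) ?y) \<longlongrightarrow> 0 - c) (at 0)"
        by (rule Lim_transform_eventually)
      have yj: "?y \<noteq> - j" using yk[of j] j by blast
      have "w \<in> J - {j}" "finite (J - {j})" using True j fJ by auto
      then have e: "(\<Prod>k\<in>J - {j}. F k) = F w * (\<Prod>k\<in>J - {j} - {w}. F k)" for F :: "complex \<Rightarrow> complex"
        by (rule prod.remove[rotated])
      have Q: "((\<lambda>d. \<Prod>k\<in>J - {j} - {w}. f_rat c (- (k + d)) ?y * f_rat c (- (j + d)) (- (k + d)))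
        \<longlongrightarrow> (\<Prod>k\<in>J - {j} - {w}. f_rat c (- k) ?y * f_rat c (- j) (- k))) (at 0)"
        by (intro tendsto_prod tendsto_mult fy ff yk) auto
      have jw: "j \<noteq> w" using j by blast
      have eT: "d * T d j = g_rat c ?y (- (j + d)) * ((d * f_rat c (- (w + d)) ?y) * f_rat c (- (j + d)) (- (w + d))
          * (\<Prod>k\<in>J - {j} - {w}. f_rat c (- (k + d)) ?y * f_rat c (- (j + d)) (- (k + d))))" for d
        unfolding T_def e by (simp only: mult_ac)
      show ?thesis unfolding eT
        by (rule exI) (rule tendsto_mult[OF fy(2)[OF yj] tendsto_mult[OF tendsto_mult[OF P ff[OF jw]] Q]])
    qed
    have "((\<lambda>d. (d * T d j) * D d j) \<longlongrightarrow> (if j = w then c * (\<Prod>k\<in>J - {w}. f_rat c (- k) (- w) * f_rat c (- w) (- k)) * ?lim (J - {w}) else 0)) (at 0)"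
      if j: "j \<in> J" for j
    proof (cases "j = w")
      case True
      then show ?thesis using tendsto_mult[OF Tw DIH[OF j, unfolded True]] by simp
    next
      case False
      then obtain l where l: "((\<lambda>d. d * T d j) \<longlongrightarrow> l) (at 0)" using Tj[of j] j by auto
      have "w \<in> J - {j}" using True False by auto
      then have "?lim (J - {j}) = 0" using w(3) by auto
      then have "((\<lambda>d. D d j) \<longlongrightarrow> 0) (at 0)" using DIH[OF j] by simp
      from tendsto_mult[OF l this] show ?thesis using False by simp
    qed
    then have "((\<lambda>d. - (\<Sum>j\<in>J. (d * T d j) * D d j)) \<longlongrightarrow> - (\<Sum>j\<in>J. if j = w then c * (\<Prod>k\<in>J - {w}. f_rat c (- k) (- w) * f_rat c (- w) (- k)) * ?lim (J - {w}) else 0)) (at 0)"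
      by (intro tendsto_minus tendsto_sum)
    moreover have "- (\<Sum>j\<in>J. if j = w then c * (\<Prod>k\<in>J - {w}. f_rat c (- k) (- w) * f_rat c (- w) (- k)) * ?lim (J - {w}) else 0)
      = - (c * (\<Prod>k\<in>J - {w}. f_rat c (- k) (- w) * f_rat c (- w) (- k)) * ?lim (J - {w}))"
      using fJ True by (simp only: sum.delta if_True)
    moreover have "\<dots> = (if J = set (w # ws) \<and> (\<forall>w\<in>set (w # ws). e w = - w) then DL (w # ws) else 0)"
    proof (cases "J - {w} = set ws")
      case J: True
      then have "J = set (w # ws)" using True by auto
      then show ?thesis using J True by simp
    next
      case J: False
      then have "J \<noteq> set (w # ws)" using w(3) by auto
      then show ?thesis using J by (simp only: simp_thms if_False mult_zero_right minus_zero)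
    qed
    ultimately show ?thesis unfolding step by simp
  next
    case False
    have yk: "?y \<noteq> - k" if k: "k \<in> J" for k
    proof
      assume y: "?y = - k"
      have "k \<in> set vs" using k Cons.prems(4) by blast
      then have "w + k \<noteq> 0" using V_sum_nz w(1) by blast
      then have "w \<noteq> - k" by auto
      then have "k = w" using y ey by auto
      then show False using False y k by simp
    qed
    have "((\<lambda>d. (d * T d j) * D d j) \<longlongrightarrow> (0 * (g_rat c ?y (- j) * (\<Prod>k\<in>J - {j}. f_rat c (- k) ?y * f_rat c (- j) (- k)))) * ?lim (J - {j})) (at 0)"
      if j: "j \<in> J" for j
      unfolding T_def using j by (intro tendsto_mult tendsto_prod tendsto_ident_at fy ff yk DIH) auto
    then have "((\<lambda>d. - (\<Sum>j\<in>J. (d * T d j) * D d j)) \<longlongrightarrow> - (\<Sum>j\<in>J. 0)) (at 0)"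
      by (intro tendsto_minus tendsto_sum) simp
    moreover have "\<not> (J = set (w # ws) \<and> (\<forall>w\<in>set (w # ws). e w = - w))" using False by auto
    ultimately show ?thesis unfolding step by (simp only: if_False sum.neutral_const minus_zero)
  qed
qed

lemma cfg_Z:
  assumes "ok d"
  shows "cfg vs (Z d (set vs))"
proof -
  have "set vs \<inter> Z d (set vs) = {}" using Z_disjoint[OF assms subset_refl] by (auto simp: pmset_def)
  moreover have "- x \<notin> Z d (set vs) \<union> set vs" if "x \<in> Z d (set vs) \<union> set vs" for x
    using Z_gset[OF assms] that by (auto simp: gset_def)
  ultimately show ?thesis
    unfolding cfg_def using dist by (auto simp: card_Z distinct_card) (simp add: Z_def)
qed

lemma coefV_cong:
  assumes "\<And>v. v \<in> set ws \<Longrightarrow> e v = e' v"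
  shows "coefV c xm e ys ws = coefV c xm e' ys ws"
  using assms by (induction ws arbitrary: ys) simp_all

text \<open>Leading coefficient of the scalar product at the shifted points if the data are 0 at all
  \<open>v\<close> and 1 at all \<open>- v\<close>.\<close>

definition Lam :: complex where
  "Lam = coefV c xm uminus [] vs * coefZ c xm vs * DL (rev vs)"

text \<open>With \<open>e v\<close> the point of the pair at which the data are 1,
  \<open>sfun_typed\<close> makes the scalar product explicit. By \<open>dwpf_limit\<close> the
  limit is zero unless \<open>e v = - v\<close> for all \<open>v\<close>, which the product of the
  \<open>b (- v)\<close> records.\<close>

lemma sfun_typed_limit:
  assumes "\<And>v. v \<in> set vs \<Longrightarrow> b v = 1 \<and> b (- v) = 0 \<or> b v = 0 \<and> b (- v) = 1"
  shows "((\<lambda>d. d ^ length vs * sfun c xm (dat b d) vs (Z d (set vs))) \<longlongrightarrow> (\<Prod>v\<in>set vs. b (- v)) * Lam) (at 0)"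
proof -
  define e where "e v = (if b v = 1 then v else - v)" for v
  have e: "e v \<in> {v, - v}" for v by (simp add: e_def)
  have be: "b (e v) = 1" "b (- e v) = 0" if "v \<in> set vs" for v using assms[OF that] by (auto simp: e_def)
  have lim: "((\<lambda>d. coefV c xm e [] vs * coefZ c xm (map (\<lambda>v. v + d) vs) * (d ^ length (rev vs) * dwpf c (map e (rev vs)) (uminus ` Z d (set vs))))
     \<longlongrightarrow> coefV c xm e [] vs * coefZ c xm vs * (if set vs = set (rev vs) \<and> (\<forall>w\<in>set (rev vs). e w = - w) then DL (rev vs) else 0)) (at 0)"
    by (intro tendsto_mult tendsto_const coefZ_limit dwpf_limit e) (use dist in \<open>auto simp: distinct_card\<close>)
  have "(\<Prod>v\<in>set vs. b (- v)) * Lam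
      = coefV c xm e [] vs * coefZ c xm vs * (if set vs = set (rev vs) \<and> (\<forall>w\<in>set (rev vs). e w = - w) then DL (rev vs) else 0)"
  proof (cases "\<forall>v\<in>set vs. e v = - v")
    case True
    then have "b (- v) = 1" if "v \<in> set vs" for v using be(1)[OF that] that by simp
    then have "(\<Prod>v\<in>set vs. b (- v)) = 1" by (intro prod.neutral ballI)
    moreover have "coefV c xm e [] vs = coefV c xm uminus [] vs" using True by (intro coefV_cong) auto
    ultimately show ?thesis using True by (simp add: Lam_def)
  next
    case False
    then obtain v where v: "v \<in> set vs" "e v \<noteq> - v" by blast
    then have "b (- v) = 0" using be(2)[OF v(1)] e[of v] by auto
    then have "(\<Prod>v\<in>set vs. b (- v)) = 0" using v(1) by (intro prod_zero) auto
    then show ?thesis using False by auto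
  qed
  then have lim: "((\<lambda>d. coefV c xm e [] vs * coefZ c xm (map (\<lambda>v. v + d) vs) * (d ^ length (rev vs) * dwpf c (map e (rev vs)) (uminus ` Z d (set vs))))
     \<longlongrightarrow> (\<Prod>v\<in>set vs. b (- v)) * Lam) (at 0)" using lim by (simp only:)
  have "\<forall>\<^sub>F d in at 0. coefV c xm e [] vs * coefZ c xm (map (\<lambda>v. v + d) vs) * (d ^ length (rev vs) * dwpf c (map e (rev vs)) (uminus ` Z d (set vs)))
     = d ^ length vs * sfun c xm (dat b d) vs (Z d (set vs))"
    using ok_eventually
  proof (rule eventually_mono)
    fix d assume d: "ok d"
    have Zs: "set (map (\<lambda>v. v + d) vs) = Z d (set vs)" by (simp add: Z_def)
    have "sfun c xm (dat b d) vs (set (map (\<lambda>v. v + d) vs))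
      = coefV c xm e [] vs * coefZ c xm (map (\<lambda>v. v + d) vs) * dwpf c (rev (map e vs)) (uminus ` set (map (\<lambda>v. v + d) vs))"
    proof (rule sfun_typed[OF c_nz _ _ e])
      show "cfg vs (set (map (\<lambda>v. v + d) vs))" unfolding Zs by (rule cfg_Z[OF d])
      show "distinct (map (\<lambda>v. v + d) vs)" using dist by (simp add: distinct_map)
      show "dat b d (e v) = 1 \<and> dat b d (- e v) = 0" if v: "v \<in> set vs" for v
      proof -
        have "e v \<in> pmset (U \<union> set vs)" "- e v \<in> pmset (U \<union> set vs)" using e[of v] v by (auto simp: pmset_def)
        then show ?thesis using be[OF v] by (simp add: dat_pm)
      qed
      show "dat b d z = 1 \<and> dat b d (- z) = 0" if z: "z \<in> set (map (\<lambda>v. v + d) vs)" for z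
      proof -
        obtain v where "v \<in> set vs" "z = v + d" using z by auto
        then show ?thesis using dat_Z[OF d, of v b] by simp
      qed
    qed
    then show "coefV c xm e [] vs * coefZ c xm (map (\<lambda>v. v + d) vs) * (d ^ length (rev vs) * dwpf c (map e (rev vs)) (uminus ` Z d (set vs)))
     = d ^ length vs * sfun c xm (dat b d) vs (Z d (set vs))"
      unfolding Zs by (simp add: rev_map mult_ac)
  qed
  with lim show ?thesis by (rule Lim_transform_eventually)
qed

text \<open>Both sides are linear in each pair \<open>b v\<close>, \<open>b (- v)\<close>. In the
  induction, \<open>Y\<close> is the set of points at which the data are no longer restricted to 0
  and 1.\<close>

lemma sfun_limit:
  "((\<lambda>d. d ^ length vs * sfun c xm (dat b d) vs (Z d (set vs))) \<longlongrightarrow> (\<Prod>v\<in>set vs. b (- v)) * Lam) (at 0)"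
proof -
  have "\<forall>b. (\<forall>v\<in>set vs - Y. b v = 1 \<and> b (- v) = 0 \<or> b v = 0 \<and> b (- v) = 1) \<longrightarrow>
    ((\<lambda>d. d ^ length vs * sfun c xm (dat b d) vs (Z d (set vs))) \<longlongrightarrow> (\<Prod>v\<in>set vs. b (- v)) * Lam) (at 0)"
    if "finite Y" "Y \<subseteq> set vs" for Y
    using that
  proof (induction Y rule: finite_induct)
    case empty
    show ?case by (intro allI impI sfun_typed_limit) simp
  next
    case (insert v Y)
    have v: "v \<in> set vs" using insert.prems by simp
    have vv: "v \<noteq> - v" using V_sum_nz[OF v v] by (metis add.right_inverse)
    show ?case
    proof (intro allI impI)
      fix b :: "complex \<Rightarrow> complex" assume b: "\<forall>w\<in>set vs - insert v Y. b w = 1 \<and> b (- w) = 0 \<or> b w = 0 \<and> b (- w) = 1"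
      let ?b = "\<lambda>(x::complex) (y::complex). b(v := x, - v := y)"
      let ?S = "\<lambda>b d. d ^ length vs * sfun c xm (dat b d) vs (Z d (set vs))"
      have nv: "w \<noteq> - v" "- w \<noteq> v" if "w \<in> set vs" for w using V_sum_nz[OF that v] by auto
      have lim: "(?S (?b x y) \<longlongrightarrow> (\<Prod>w\<in>set vs. (?b x y) (- w)) * Lam) (at 0)" if "x = 1 \<and> y = 0 \<or> x = 0 \<and> y = 1" for x y :: complex
      proof -
        have "(?b x y) w = 1 \<and> (?b x y) (- w) = 0 \<or> (?b x y) w = 0 \<and> (?b x y) (- w) = 1" if "w \<in> set vs - Y" for w
        proof (cases "w = v")
          case True
          then show ?thesis using vv \<open>x = 1 \<and> y = 0 \<or> x = 0 \<and> y = 1\<close> by auto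
        next
          case False
          then show ?thesis using b that nv[of w] by auto
        qed
        then show ?thesis using insert.IH insert.prems by blast
      qed
      have pr: "(\<Prod>w\<in>set vs. (?b x y) (- w)) = y * (\<Prod>w\<in>set vs - {v}. b (- w))" for x y :: complex
      proof -
        have "(\<Prod>w\<in>set vs - {v}. (?b x y) (- w)) = (\<Prod>w\<in>set vs - {v}. b (- w))"
          by (rule prod.cong) (use nv in auto)
        then show ?thesis using v by (simp add: prod.remove)
      qed
      have l: "((\<lambda>d. b v * ?S (?b 1 0) d + b (- v) * ?S (?b 0 1) d)
        \<longlongrightarrow> b v * ((\<Prod>w\<in>set vs. (?b 1 0) (- w)) * Lam) + b (- v) * ((\<Prod>w\<in>set vs. (?b 0 1) (- w)) * Lam)) (at 0)"
        by (intro tendsto_add tendsto_mult tendsto_const lim) simp_all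
      have q: "b v * ((\<Prod>w\<in>set vs. (?b 1 0) (- w)) * Lam) + b (- v) * ((\<Prod>w\<in>set vs. (?b 0 1) (- w)) * Lam)
        = (\<Prod>w\<in>set vs. b (- w)) * Lam"
        unfolding pr using v by (simp add: prod.remove)
      have ev: "\<forall>\<^sub>F d in at 0. b v * ?S (?b 1 0) d + b (- v) * ?S (?b 0 1) d = ?S b d"
        using ok_eventually
      proof (rule eventually_mono)
        fix d assume d: "ok d"
        have vp: "v \<in> pmset (U \<union> set vs)" "- v \<in> pmset (U \<union> set vs)" using v by (auto simp: pmset_def)
        have e: "dat (?b x y) d = (dat b d)(v := x, - v := y)" for x y :: complex
          using vp by (auto simp: dat_def fun_eq_iff)
        have gen: "p * (k * s) + q * (k * s') = k * (p * s + q * s')" for p k s q s' :: complex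
          by (simp add: algebra_simps)
        show "b v * ?S (?b 1 0) d + b (- v) * ?S (?b 0 1) d = ?S b d"
          unfolding e gen using sfun_linear[OF c_nz cfg_Z[OF d] v, of xm "dat b d"]
          by (simp only: dat_V[OF v])
      qed
      from Lim_transform_eventually[OF l ev]
      show "(?S b \<longlongrightarrow> (\<Prod>w\<in>set vs. b (- w)) * Lam) (at 0)" unfolding q .
    qed
  qed
  from this[of "set vs"] show ?thesis by simp
qed

text \<open>\<open>pairing_proportional\<close> for the shifted points, multiplied by
  \<open>d ^ length vs\<close>: the quantities at \<open>U\<close> do not depend on
  \<open>d\<close>, those at the shifted points have limits.\<close>

lemma scalar_product_ratio:
  assumes nz: "\<forall>v\<in>set vs. c - 2 * v \<noteq> 0 \<and> v + xp - c/2 \<noteq> 0 \<and> v + xm - c/2 \<noteq> 0 \<and> FP c v (set vs - {v}) \<noteq> 0"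
    and on_shell: "\<And>v. v \<in> set vs \<Longrightarrow> Phi c xp xm a v (set vs) = 0"
  shows "sfun c xm a vs U * (\<Prod>v\<leftarrow>vs. kap v)
    = action_coeff c xp xm a (\<lambda>_. 1) vs U (set vs) * ((\<Prod>v\<in>set vs. a (- v)) * Lam)"
proof -
  let ?S = "\<lambda>d. sfun c xm (dat a d) vs (Z d (set vs))"
  let ?R = "\<lambda>d. action_coeff c xp xm (dat a d) (\<lambda>_. 1) vs (Z d (set vs)) (set vs)"
  have R: "((\<lambda>d. d ^ length vs * ?R d) \<longlongrightarrow> (\<Prod>v\<leftarrow>vs. kap v)) (at 0)"
    using action_coeff_limit[OF dist subset_refl subset_refl, of a] dist by (auto simp: distinct_card)
  have "((\<lambda>d. sfun c xm a vs U * (d ^ length vs * ?R d)) \<longlongrightarrow> sfun c xm a vs U * (\<Prod>v\<leftarrow>vs. kap v)) (at 0)"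
    by (intro tendsto_mult tendsto_const R)
  moreover have "\<forall>\<^sub>F d in at 0. sfun c xm a vs U * (d ^ length vs * ?R d)
      = action_coeff c xp xm a (\<lambda>_. 1) vs U (set vs) * (d ^ length vs * ?S d)"
    using ok_eventually dominance[OF nz, of a]
  proof eventually_elim
    case (elim d)
    have "sfun c xm (dat a d) vs U * ?R d = action_coeff c xp xm (dat a d) (\<lambda>_. 1) vs U (set vs) * ?S d"
    proof (rule pairing_proportional[OF c_nz Z_gset[OF elim(1)] dist _ cardU])
      show "set vs \<inter> (U \<union> Z d (set vs)) = {}"
        using disj Z_disjoint[OF elim(1) subset_refl] by (auto simp: pmset_def)
      show "card (Z d (set vs)) = length vs" using dist by (simp add: card_Z distinct_card)
      show "Phi c xp xm (dat a d) v (set vs) = 0" if "v \<in> set vs" for v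
        using on_shell[OF that] dat_V[OF that] by (simp add: Phi_def)
    qed (use elim(2) in blast)
    moreover have "sfun c xm (dat a d) vs U = sfun c xm a vs U"
      by (rule sfun_cong) (rule dat_pm)
    moreover have "action_coeff c xp xm (dat a d) (\<lambda>_. 1) vs U (set vs) = action_coeff c xp xm a (\<lambda>_. 1) vs U (set vs)"
      by (rule action_coeff_cong) (simp add: dat_pm)
    ultimately show ?case by (simp add: mult.left_commute)
  qed
  ultimately have "((\<lambda>d. action_coeff c xp xm a (\<lambda>_. 1) vs U (set vs) * (d ^ length vs * ?S d))
      \<longlongrightarrow> sfun c xm a vs U * (\<Prod>v\<leftarrow>vs. kap v)) (at 0)"
    by (rule Lim_transform_eventually)
  moreover have "((\<lambda>d. action_coeff c xp xm a (\<lambda>_. 1) vs U (set vs) * (d ^ length vs * ?S d))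
      \<longlongrightarrow> action_coeff c xp xm a (\<lambda>_. 1) vs U (set vs) * ((\<Prod>v\<in>set vs. a (- v)) * Lam)) (at 0)"
    by (intro tendsto_mult tendsto_const sfun_limit)
  ultimately show ?thesis by (rule tendsto_unique[rotated]) simp
qed

end


subsection \<open>The normalization factor\<close>


fun pair_prod :: "('a \<Rightarrow> 'a \<Rightarrow> complex) \<Rightarrow> 'a list \<Rightarrow> complex" where
  "pair_prod H [] = 1"
| "pair_prod H (x # xs) = (\<Prod>y\<leftarrow>xs. H x y) * pair_prod H xs"

lemma prod_list_mult: "(\<Prod>x\<leftarrow>xs. F x * G x) = (\<Prod>x\<leftarrow>xs. F x) * (\<Prod>x\<leftarrow>xs. G x :: complex)"
  by (induction xs) (simp_all add: mult_ac)

lemma prod_list_rev: "(\<Prod>x\<leftarrow>rev xs. F x) = (\<Prod>x\<leftarrow>xs. F x :: complex)"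
  by (induction xs) (simp_all add: mult.commute)

lemma pair_prod_mult: "pair_prod (\<lambda>x y. H x y * K x y) xs = pair_prod H xs * pair_prod K xs"
  by (induction xs) (simp_all add: prod_list_mult mult_ac)

lemma pair_prod_snoc: "pair_prod H (xs @ [y]) = pair_prod H xs * (\<Prod>x\<leftarrow>xs. H x y)"
  by (induction xs) (simp_all add: mult_ac)

lemma pair_prod_rev:
  assumes "\<And>x y. H x y = H y x"
  shows "pair_prod H (rev xs) = pair_prod H xs"
proof (induction xs)
  case (Cons x xs)
  have "(\<Prod>y\<leftarrow>xs. H y x) = (\<Prod>y\<leftarrow>xs. H x y)" by (simp add: assms[of _ x])
  then show ?case using Cons by (simp add: pair_prod_snoc prod_list_rev mult.commute)
qed simp

lemma pair_prod_cong:
  assumes "distinct xs" "\<And>x y. x \<in> set xs \<Longrightarrow> y \<in> set xs \<Longrightarrow> x \<noteq> y \<Longrightarrow> H x y = K x y"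
  shows "pair_prod H xs = pair_prod K xs"
  using assms
proof (induction xs)
  case (Cons x xs)
  have "map (H x) xs = map (K x) xs" using Cons.prems by (intro map_cong refl) auto
  moreover have "pair_prod H xs = pair_prod K xs" using Cons.prems by (intro Cons.IH) auto
  ultimately show ?case by (simp only: pair_prod.simps)
qed simp

text \<open>Each unordered pair of elements contributes \<open>H\<close> in both orders.\<close>

lemma pair_prod_set:
  assumes "distinct xs"
  shows "(\<Prod>x\<leftarrow>xs. \<Prod>y\<in>set xs - {x}. H y x) = pair_prod (\<lambda>x y. H x y * H y x) xs"
  using assms
proof (induction xs)
  case (Cons x xs)
  have "(\<Prod>y\<leftarrow>xs. \<Prod>z\<in>set (x # xs) - {y}. H z y) = (\<Prod>y\<leftarrow>xs. H x y * (\<Prod>z\<in>set xs - {y}. H z y))"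
  proof (intro arg_cong[where f = prod_list] map_cong refl)
    fix y assume "y \<in> set xs"
    then have "set (x # xs) - {y} = insert x (set xs - {y})" using Cons.prems by auto
    then show "(\<Prod>z\<in>set (x # xs) - {y}. H z y) = H x y * (\<Prod>z\<in>set xs - {y}. H z y)" using Cons.prems by simp
  qed
  moreover have "set (x # xs) - {x} = set xs" using Cons.prems by auto
  moreover have "(\<Prod>y\<in>set xs. H y x) = (\<Prod>y\<leftarrow>xs. H y x)" using Cons.prems by (intro prod.distinct_set_conv_list) auto
  ultimately show ?case using Cons.IH Cons.prems by (simp add: prod_list_mult mult_ac)
qed simp

lemma prod_nth: "(\<Prod>i<length xs. F (xs ! i)) = (\<Prod>x\<leftarrow>xs. F x :: complex)"
  by (induction xs) (simp_all add: prod.lessThan_Suc_shift del: prod.lessThan_Suc)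

lemma prod_nth_le: "(\<Prod>j<length xs. \<Prod>i\<le>j. F (xs ! i) (xs ! j)) = (\<Prod>x\<leftarrow>xs. F x x) * pair_prod F xs"
proof (induction xs rule: rev_induct)
  case (snoc x xs)
  have "(\<Prod>j<length xs. \<Prod>i\<le>j. F ((xs @ [x]) ! i) ((xs @ [x]) ! j)) = (\<Prod>j<length xs. \<Prod>i\<le>j. F (xs ! i) (xs ! j))"
    by (intro prod.cong refl) (simp add: nth_append)
  moreover have "(\<Prod>i<length xs. F ((xs @ [x]) ! i) x) = (\<Prod>y\<leftarrow>xs. F y x)"
    unfolding prod_nth[symmetric] by (intro prod.cong refl) (simp add: nth_append)
  moreover have "{..length xs} = insert (length xs) {..<length xs}" by auto
  ultimately show ?case using snoc by (simp add: pair_prod_snoc mult_ac)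
qed simp

text \<open>The growing list \<open>ys\<close> of the recursion amounts to one factor for each pair
  of elements of \<open>ws\<close>.\<close>

lemma coefV_uminus:
  assumes "\<And>v. v \<in> set ws \<Longrightarrow> v \<noteq> 0"
  shows "coefV c xm uminus ys ws = (\<Prod>v\<leftarrow>ws. (2 * v - c) / (2 * v) * (v - xm + c/2)) * (\<Prod>v\<leftarrow>ws. \<Prod>y\<leftarrow>ys. f_rat c v y)
    * pair_prod (\<lambda>v w. f_rat c w (- v)) ws"
  using assms
proof (induction ws arbitrary: ys)
  case (Cons v ws)
  have "v \<noteq> 0" using Cons.prems by simp
  then have 1: "(xm + v - c/2) * (c / (2 * v)) - (xm - v + c/2) = (2 * v - c) / (2 * v) * (v - xm + c/2)"
    by (simp add: divide_simps) (simp add: algebra_simps)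
  have IH: "coefV c xm uminus (ys @ [- v]) ws = (\<Prod>v\<leftarrow>ws. (2 * v - c) / (2 * v) * (v - xm + c/2))
    * (\<Prod>w\<leftarrow>ws. \<Prod>y\<leftarrow>ys @ [- v]. f_rat c w y) * pair_prod (\<lambda>v w. f_rat c w (- v)) ws"
    by (rule Cons.IH) (simp add: Cons.prems)
  have gen: "(k * P) * (K * (Q * R) * S) = k * K * (P * Q) * (R * S)" for k P K Q R S :: complex by (simp only: mult_ac)
  show ?case
    unfolding coefV.simps if_True refl[THEN eqTrueI] 1 IH map_append prod_list.append prod_list_mult pair_prod.simps
      list.map prod_list.Cons prod_list.Nil mult_1_right by (rule gen)
qed simp

lemma coefZ_pair_prod:
  assumes "distinct zs"
  shows "coefZ c xm zs = (\<Prod>z\<leftarrow>zs. - (xm + z - c/2) * f_rat c (- z) z) * pair_prod (\<lambda>v w. f_rat c (- w) v) zs"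
  using assms
proof (induction zs)
  case (Cons z zs)
  have "(\<Prod>w\<in>set zs. f_rat c (- w) z) = (\<Prod>w\<leftarrow>zs. f_rat c (- w) z)"
    using Cons.prems by (intro prod.distinct_set_conv_list) auto
  then have e: "coefZ c xm (z # zs) = - (xm + z - c/2) * (f_rat c (- z) z * (\<Prod>w\<leftarrow>zs. f_rat c (- w) z)) * coefZ c xm zs"
    by (simp only: coefZ.simps)
  have IH: "coefZ c xm zs = (\<Prod>z\<leftarrow>zs. - (xm + z - c/2) * f_rat c (- z) z) * pair_prod (\<lambda>v w. f_rat c (- w) v) zs"
    using Cons by simp
  have gen: "k * (f * p) * (K * P) = k * f * K * (p * P)" for k f p K P :: complex by (simp only: mult_ac)
  show ?case unfolding e IH pair_prod.simps list.map prod_list.Cons by (rule gen)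
qed simp

lemma Phi_eq_0_iff:
  "Phi c xp xm (\<lambda>x. l1 x * l2 (- x)) v V = 0 \<longleftrightarrow>
    (v + xp - c/2) * ((v + xm - c/2) * (l1 v * l2 (- v)) * FP c v (V - {v}))
    = (v - xp + c/2) * (v - xm + c/2) * (l1 (- v) * l2 v) * FP c (- v) (V - {v})"
proof -
  have e: "- v + xp - c/2 = - (v - xp + c/2)" "- v + xm - c/2 = - (v - xm + c/2)" by simp_all
  have gen: "p - - y * (- y' * b * q) = 0 \<longleftrightarrow> p = y * y' * b * q" for p y y' b q :: complex
    by (simp add: mult.assoc)
  show ?thesis unfolding Phi_def e minus_minus by (rule gen)
qed

context shifted_points
begin

lemma DL_pair_prod:
  "distinct ws \<Longrightarrow> DL ws = (\<Prod>w\<leftarrow>ws. - c) * pair_prod (\<lambda>v w. f_rat c (- w) (- v) * f_rat c (- v) (- w)) ws"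
proof (induction ws)
  case (Cons w ws)
  have "(\<Prod>k\<in>set ws. f_rat c (- k) (- w) * f_rat c (- w) (- k)) = (\<Prod>k\<leftarrow>ws. f_rat c (- k) (- w) * f_rat c (- w) (- k))"
    using Cons.prems by (intro prod.distinct_set_conv_list) auto
  then show ?case using Cons by simp
qed simp

text \<open>The origin of \<open>dual_factor\<close>. The Bethe equations enter once for each
  \<open>v\<close>, in \<open>D1\<close>, where they trade \<open>l1 v * l2 (- v)\<close> for
  \<open>l1 (- v) * l2 v\<close>. What remains splits into factors for single points and for pairs,
  compared in \<open>diag\<close> and \<open>pair\<close>.\<close>

lemma ratio_identity:
  assumes nz: "\<And>v. v \<in> set vs \<Longrightarrow> v - xp + c/2 \<noteq> 0" "\<And>v w. v \<in> set vs \<Longrightarrow> w \<in> set vs \<Longrightarrow> v \<noteq> w \<Longrightarrow> f_rat c v (- w) \<noteq> 0"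
    and on_shell: "\<And>v. v \<in> set vs \<Longrightarrow> Phi c xp xm (\<lambda>x. l1 x * l2 (- x)) v (set vs) = 0"
  shows "(\<Prod>v\<in>set vs. l1 (- v) * l2 (- (- v))) * Lam = dual_factor c xp xm l1 l2 vs * (\<Prod>v\<leftarrow>vs. kap v)"
proof -
  define G where "G x y = f_rat c (- x) y / f_rat c x (- y)" for x y
  define s where "s v = - ((v + xm - c/2) * (v - xm + c/2) * (l1 (- v) * l2 v) * (c * (c + 2 * v) * (wf_coeff c v * (- 1 / (2 * v)))))" for v
  define D1 where "D1 v = - ((v + xm - c/2) * l1 v * l2 (- v)) / (v - xp + c/2)" for v
  have DF: "dual_factor c xp xm l1 l2 vs = (\<Prod>v\<leftarrow>vs. D1 v) * ((\<Prod>v\<leftarrow>vs. G v v) * pair_prod G vs)"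
    using prod_nth[where F = D1 and xs = vs] prod_nth_le[where F = G and xs = vs]
    unfolding dual_factor_def D1_def G_def by (simp only:)
  have D1: "D1 v * kap v = s v * FP c (- v) (set vs - {v})" if v: "v \<in> set vs" for v
  proof -
    have B: "(v + xp - c/2) * ((v + xm - c/2) * (l1 v * l2 (- v)) * FP c v (set vs - {v}))
      = (v - xp + c/2) * (v - xm + c/2) * (l1 (- v) * l2 v) * FP c (- v) (set vs - {v})"
      using on_shell[OF v] unfolding Phi_eq_0_iff .
    have gen: "- (x * l * m) / y * (k * (p * q * (z * (x * P)))) = - (x * x' * b * (k * (p * q))) * Q"
      if "z * (x * (l * m) * P) = y * x' * b * Q" "y \<noteq> 0" for x l m y k p q z P x' b Q :: complex
    proof -
      have "- (x * l * m) / y * (k * (p * q * (z * (x * P)))) = - (x * k * (p * q)) / y * (z * (x * (l * m) * P))"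
        by (simp add: mult_ac)
      also have "\<dots> = - (x * x' * b * (k * (p * q))) * Q" unfolding that(1) using that(2) by (simp add: field_simps)
      finally show ?thesis .
    qed
    show ?thesis unfolding D1_def kap_def s_def by (rule gen[OF B nz(1)[OF v]])
  qed
  have v0: "v \<noteq> 0" "c + 2 * v \<noteq> 0" if "v \<in> set vs" for v
    using gsetD(1,2)[OF gUV, of v] that by simp_all
  have diag: "l1 (- v) * l2 (- (- v)) * ((2 * v - c) / (2 * v) * (v - xm + c/2)) * (- (xm + v - c/2) * f_rat c (- v) v) * (- c) = s v * G v v"
    if v: "v \<in> set vs" for v
  proof -
    have f: "f_rat c v (- v) = (c + 2 * v) / (2 * v)" using v0[OF v] by (simp add: f_rat_def algebra_simps)
    have gen: "L * (w * X) * (- Y * F) * (- c) = - (Y' * X * L * (c * C * (w * (- 1 / d)))) * (F / (C / d))"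
      if "C \<noteq> 0" "d \<noteq> 0" "Y' = Y" for L w X Y Y' F C d :: complex
      using that by (simp add: field_simps)
    show ?thesis unfolding s_def G_def f wf_coeff_def minus_minus
      by (rule gen) (use v0[OF v] in auto)
  qed
  have pair: "f_rat c w (- v) * f_rat c (- w) v * (f_rat c (- w) (- v) * f_rat c (- v) (- w))
     = G v w * (Fr c v (- w) * Fr c w (- v))" if vw: "v \<in> set vs" "w \<in> set vs" "v \<noteq> w" for v w
  proof -
    have e: "f_rat c (- w) (- v) = f_rat c v w" "f_rat c (- v) (- w) = f_rat c w v" "f_rat c (- w) v = f_rat c (- v) w"
      by (simp_all add: f_rat_def algebra_simps)
    have gen: "a * b * (p * q) = b / r * (q * a * (p * r))" if "r \<noteq> 0" for a b p q r :: complex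
      using that by simp
    show ?thesis unfolding G_def f_rat_pair(2)[symmetric] e by (rule gen[OF nz(2)[OF vw]])
  qed
  have "(\<Prod>v\<in>set vs. l1 (- v) * l2 (- (- v))) = (\<Prod>v\<leftarrow>vs. l1 (- v) * l2 (- (- v)))"
    by (rule prod.distinct_set_conv_list[OF dist])
  moreover have "coefV c xm uminus [] vs = (\<Prod>v\<leftarrow>vs. (2 * v - c) / (2 * v) * (v - xm + c/2)) * pair_prod (\<lambda>v w. f_rat c w (- v)) vs"
  proof -
    have "(\<Prod>v\<leftarrow>vs. \<Prod>y\<leftarrow>[]. f_rat c v y) = 1" by (induction vs) simp_all
    moreover have "coefV c xm uminus [] vs = (\<Prod>v\<leftarrow>vs. (2 * v - c) / (2 * v) * (v - xm + c/2))
      * (\<Prod>v\<leftarrow>vs. \<Prod>y\<leftarrow>[]. f_rat c v y) * pair_prod (\<lambda>v w. f_rat c w (- v)) vs"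
      by (rule coefV_uminus) (rule v0(1))
    ultimately show ?thesis by (simp only: mult_1_right)
  qed
  moreover have "DL (rev vs) = (\<Prod>w\<leftarrow>vs. - c) * pair_prod (\<lambda>v w. f_rat c (- w) (- v) * f_rat c (- v) (- w)) vs"
    using dist by (simp only: DL_pair_prod distinct_rev prod_list_rev pair_prod_rev[OF mult.commute])
  ultimately have "(\<Prod>v\<in>set vs. l1 (- v) * l2 (- (- v))) * Lam
    = (\<Prod>v\<leftarrow>vs. l1 (- v) * l2 (- (- v)) * ((2 * v - c) / (2 * v) * (v - xm + c/2)) * (- (xm + v - c/2) * f_rat c (- v) v) * (- c))
      * pair_prod (\<lambda>v w. f_rat c w (- v) * f_rat c (- w) v * (f_rat c (- w) (- v) * f_rat c (- v) (- w))) vs"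
    unfolding Lam_def coefZ_pair_prod[OF dist] by (simp only: prod_list_mult pair_prod_mult mult_ac)
  also have "\<dots> = (\<Prod>v\<leftarrow>vs. s v * G v v) * pair_prod (\<lambda>v w. G v w * (Fr c v (- w) * Fr c w (- v))) vs"
    by (intro arg_cong2[where f = "(*)"] arg_cong[where f = prod_list] map_cong refl diag pair_prod_cong dist pair)
  also have "\<dots> = ((\<Prod>v\<leftarrow>vs. s v) * pair_prod (\<lambda>v w. Fr c v (- w) * Fr c w (- v)) vs) * ((\<Prod>v\<leftarrow>vs. G v v) * pair_prod G vs)"
    unfolding prod_list_mult pair_prod_mult[of G] by (simp only: mult_ac)
  also have "pair_prod (\<lambda>v w. Fr c v (- w) * Fr c w (- v)) vs = (\<Prod>v\<leftarrow>vs. FP c (- v) (set vs - {v}))"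
    unfolding FP_def by (rule pair_prod_set[OF dist, symmetric])
  also have "(\<Prod>v\<leftarrow>vs. s v) * (\<Prod>v\<leftarrow>vs. FP c (- v) (set vs - {v})) = (\<Prod>v\<leftarrow>vs. D1 v * kap v)"
    unfolding prod_list_mult[symmetric]
    by (intro arg_cong[where f = prod_list] map_cong refl) (simp only: D1)
  also have "\<dots> * ((\<Prod>v\<leftarrow>vs. G v v) * pair_prod G vs) = dual_factor c xp xm l1 l2 vs * (\<Prod>v\<leftarrow>vs. kap v)"
    unfolding DF prod_list_mult by (simp only: mult_ac)
  finally show ?thesis .
qed

end

section \<open>From the Bethe equations to the conclusion\<close>

lemma FP_nonzero:
  assumes "bethe_regular c xp xm l1 l2 vs" "v \<in> set vs"
  shows "FP c v (set vs - {v}) \<noteq> 0" "FP c (- v) (set vs - {v}) \<noteq> 0"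
proof -
  have "f_rat c w v \<noteq> 0 \<and> f_rat c (- w) v \<noteq> 0 \<and> f_rat c v w \<noteq> 0 \<and> f_rat c v (- w) \<noteq> 0" if "w \<in> set vs - {v}" for w
    using assms that unfolding bethe_regular_def by (metis DiffE insertCI)
  then have "Fr c w v \<noteq> 0" "Fr c w (- v) \<noteq> 0" if "w \<in> set vs - {v}" for w
    using that by (metis f_rat_pair(1) mult_eq_0_iff, metis f_rat_pair(2) mult_eq_0_iff)
  then show "FP c v (set vs - {v}) \<noteq> 0" "FP c (- v) (set vs - {v}) \<noteq> 0"
    by (simp_all add: FP_def)
qed

lemma bethe_equations_Phi:
  assumes r: "bethe_regular c xp xm l1 l2 vs" and b: "bethe_equations c xp xm l1 l2 vs" and "distinct vs" and v: "v \<in> set vs"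
  shows "Phi c xp xm (\<lambda>x. l1 x * l2 (- x)) v (set vs) = 0" "v + xp - c/2 \<noteq> 0" "v + xm - c/2 \<noteq> 0"
proof -
  let ?P = "FP c v (set vs - {v})" and ?Q = "FP c (- v) (set vs - {v})"
  obtain i where i: "i < length vs" "v = vs ! i" using v by (metis in_set_conv_nth)
  have im: "set vs - {v} = (!) vs ` ({..<length vs} - {i})"
    using i \<open>distinct vs\<close> by (auto simp: set_conv_nth nth_eq_iff_index_eq)
  have inj: "inj_on ((!) vs) ({..<length vs} - {i})"
    using \<open>distinct vs\<close> by (auto simp: inj_on_def nth_eq_iff_index_eq)
  have "(\<Prod>j\<in>{..<length vs} - {i}. (f_rat c (vs!i) (vs!j) * f_rat c (vs!i) (- (vs!j))) / (f_rat c (vs!j) (vs!i) * f_rat c (- (vs!j)) (vs!i)))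
    = (\<Prod>w\<in>set vs - {v}. Fr c w (- v) / Fr c w v)"
    unfolding im prod.reindex[OF inj] by (simp add: f_rat_pair i(2) o_def)
  also have "\<dots> = ?Q / ?P" by (simp add: FP_def prod_dividef)
  finally have E: "((v + xp - c/2) * (v + xm - c/2)) / ((v - xp + c/2) * (v - xm + c/2)) * ((l1 v * l2 (- v)) / (l1 (- v) * l2 v)) = ?Q / ?P"
    using b i unfolding bethe_equations_def by simp
  have nz: "v - xp + c/2 \<noteq> 0" "v - xm + c/2 \<noteq> 0" "l1 (- v) \<noteq> 0" "l2 v \<noteq> 0"
    using r v by (simp_all add: bethe_regular_def)
  note PQ = FP_nonzero[OF r v]
  have gen: "x * (x' * a * P) = y * b * Q" if "x * x' / y * (a / b) = Q / P" "y \<noteq> 0" "b \<noteq> 0" "P \<noteq> 0"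
    for x x' y a b P Q :: complex
    using that by (simp add: field_simps)
  have "(v + xp - c/2) * ((v + xm - c/2) * (l1 v * l2 (- v)) * ?P) = (v - xp + c/2) * (v - xm + c/2) * (l1 (- v) * l2 v) * ?Q"
    by (rule gen[OF E]) (use nz PQ in simp_all)
  then show "Phi c xp xm (\<lambda>x. l1 x * l2 (- x)) v (set vs) = 0"
    unfolding Phi_eq_0_iff .
  \<comment> \<open>The right side of the Bethe equation is nonzero, hence so are the factors of the
    numerator on the left.\<close>
  have "?Q / ?P \<noteq> 0" using PQ by simp
  then show "v + xp - c/2 \<noteq> 0" "v + xm - c/2 \<noteq> 0" unfolding E[symmetric] by auto
qed

lemma (in generalized_model) scalar_product_eq_coefficient:
  assumes len: "length us = length vs" and D: "set us \<union> set vs \<subseteq> D" and gen: "generic_parameters c us vs"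
    and r: "bethe_regular c xp xm l1 l2 vs" and b: "bethe_equations c xp xm l1 l2 vs"
  shows "refl_scalar_product smul c xm T vac dvac vs us
    = dual_factor c xp xm l1 l2 vs * R_hat c xp xm l1 l2 vs (set us) (set vs)"
proof -
  let ?a = "\<lambda>x. l1 x * l2 (- x)" and ?S = "set us \<union> set vs"
  have dist: "distinct us" "distinct vs" and disj: "set vs \<inter> set us = {}"
    and pm: "\<And>x y. x \<in> ?S \<Longrightarrow> y \<in> ?S \<Longrightarrow> x \<noteq> - y" and cx: "\<And>x. x \<in> ?S \<Longrightarrow> c + 2 * x \<noteq> 0"
    using gen unfolding generic_parameters_def distinct_append set_append set_map by blast+
  have g: "gset c ?S" unfolding gset_def using pm cx by fastforce
  have nz: "0 \<notin> ?S" using gsetD(1)[OF g] by blast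
  have card: "card (set us) = length vs" using len dist by (simp add: distinct_card)
  have U: "set us \<subseteq> D - {0}" "set vs \<subseteq> D - {0}" using D nz by auto
  have R: "R_hat c xp xm l1 l2 vs (set us) (set vs) = action_coeff c xp xm l1 l2 vs (set us) (set vs)"
  proof -
    have "set us \<union> set vs - set vs = set us" using disj by auto
    then show ?thesis by (simp add: R_hat_def)
  qed
  have S: "refl_scalar_product smul c xm T vac dvac vs us = refl_sp smul c xm T vac dvac vs (set us)"
    by (rule refl_scalar_product_eq[OF U(1) dist(1)])
  show ?thesis
  \<comment> \<open>If \<open>c = 2 * v\<close>, then \<open>kap\<close> vanishes at
    \<open>v\<close> and the comparison of leading terms breaks down. In this case
    \<open>C(v)\<close> is zero, and so is the factor f(- v, v) of
    \<open>dual_factor\<close>.\<close>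
  proof (cases "\<exists>v\<in>set vs. c - 2 * v = 0")
    case True
    then obtain v where v: "v \<in> set vs" "c - 2 * v = 0" by blast
    then have "(\<Prod>v\<leftarrow>vs. c - 2 * v) = 0" by (auto simp: prod_list_zero_iff)
    then have "refl_sp smul c xm T vac dvac vs (set us) = 0"
      by (simp add: refl_sp_eq[OF U(2) finite_set U(1)])
    moreover have "dual_factor c xp xm l1 l2 vs = 0"
    proof -
      obtain j where j: "j < length vs" "v = vs ! j" using v(1) by (metis in_set_conv_nth)
      have "f_rat c (- v) v = 0" using v(2) by (simp add: f_rat_def algebra_simps)
      then have "(\<Prod>i\<le>j. f_rat c (- (vs!i)) (vs!j) / f_rat c (vs!i) (- (vs!j))) = 0"
        using j \<open>f_rat c (- v) v = 0\<close> by (intro prod_zero finite_atMost bexI[of _ j]) simp_all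
      then have "(\<Prod>j<length vs. \<Prod>i\<le>j. f_rat c (- (vs!i)) (vs!j) / f_rat c (vs!i) (- (vs!j))) = 0"
        by (rule prod_zero[OF finite_lessThan bexI[of _ j]]) (simp add: j(1))
      then show ?thesis by (simp add: dual_factor_def)
    qed
    ultimately show ?thesis by (simp add: S)
  next
    case False
    interpret sp: shifted_points c xp xm vs "set us"
      by unfold_locales (use c_nonzero g dist disj card in auto)
    note Phi = bethe_equations_Phi[OF r b dist(2)]
    have nzv: "\<forall>v\<in>set vs. c - 2 * v \<noteq> 0 \<and> v + xp - c/2 \<noteq> 0 \<and> v + xm - c/2 \<noteq> 0 \<and> FP c v (set vs - {v}) \<noteq> 0"
      using False Phi(2,3) FP_nonzero(1)[OF r] by blast
    have ratio: "sfun c xm ?a vs (set us) * (\<Prod>v\<leftarrow>vs. sp.kap v)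
      = action_coeff c xp xm ?a (\<lambda>_. 1) vs (set us) (set vs) * ((\<Prod>v\<in>set vs. ?a (- v)) * sp.Lam)"
      by (rule sp.scalar_product_ratio[OF nzv Phi(1)])
    have id: "(\<Prod>v\<in>set vs. ?a (- v)) * sp.Lam = dual_factor c xp xm l1 l2 vs * (\<Prod>v\<leftarrow>vs. sp.kap v)"
    proof (rule sp.ratio_identity)
      show "v - xp + c/2 \<noteq> 0" if "v \<in> set vs" for v using r that by (simp add: bethe_regular_def)
      show "f_rat c v (- w) \<noteq> 0" if "v \<in> set vs" "w \<in> set vs" "v \<noteq> w" for v w
        using r that by (simp add: bethe_regular_def)
    qed (rule Phi(1))
    have "sp.kap v \<noteq> 0" if v: "v \<in> set vs" for v
    proof -
      have "2 * v - c \<noteq> 0" using nzv v by (metis eq_iff_diff_eq_0)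
      moreover have "c + 2 * v \<noteq> 0" "v \<noteq> 0" using cx[of v] v nz by auto
      ultimately show ?thesis using nzv v c_nonzero by (simp add: sp.kap_def wf_coeff_def)
    qed
    then have k: "(\<Prod>v\<leftarrow>vs. sp.kap v) \<noteq> 0" by (auto simp: prod_list_zero_iff)
    have "sfun c xm ?a vs (set us) = dual_factor c xp xm l1 l2 vs * action_coeff c xp xm ?a (\<lambda>_. 1) vs (set us) (set vs)"
    proof -
      have gen: "s = q * r" if "s * k = r * (q * k)" "k \<noteq> 0" for s k r q :: complex using that by simp
      show ?thesis by (rule gen[OF ratio[unfolded id] k])
    qed
    moreover have "refl_sp smul c xm T vac dvac vs (set us) = sfun c xm ?a vs (set us)"
    proof (rule refl_sp_sfun[OF generalized_model_axioms])
      have pm': "- x \<notin> ?S" if "x \<in> ?S" for x using pm[OF that, of "- x"] by (metis minus_minus)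
      show "cfg vs (set us)"
        unfolding cfg_def
      proof (intro conjI ballI)
        show "- x \<notin> set us \<union> set vs" if "x \<in> set us \<union> set vs" for x by (rule pm'[OF that])
      qed (rule finite_set dist disj card[symmetric])+
      show "pmset ?S \<subseteq> D"
      proof
        fix x assume "x \<in> pmset ?S"
        then obtain y where "y \<in> ?S" "x = y \<or> x = - y" unfolding pmset_def by blast
        then show "x \<in> D" using D D_uminus[of y] by auto
      qed
    qed simp
    moreover have "action_coeff c xp xm l1 l2 vs (set us) (set vs) = action_coeff c xp xm ?a (\<lambda>_. 1) vs (set us) (set vs)"
      by (rule action_coeff_cong) simp
    ultimately show ?thesis by (simp add: S R)
  qed
qed

theorem theorem4p1:
  fixes smul :: "complex \<Rightarrow> 'h::ab_group_add \<Rightarrow> 'h"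
    and c xi_plus xi_minus :: complex
    and D :: "complex set"
    and T :: "complex \<Rightarrow> ('h \<Rightarrow> 'h)^2^2"
    and vac :: 'h
    and dvac :: "'h \<Rightarrow> complex"
    and lambda1 lambda2 :: "complex \<Rightarrow> complex"
    and us vs :: "complex list"
    and n :: nat
  assumes "generalized_model smul c D T vac dvac lambda1 lambda2"
    and "length us = n" and "length vs = n"
    and "set us \<union> set vs \<subseteq> D"
    and "generic_parameters c us vs"
  shows "fold (refl_transfer smul c xi_plus xi_minus T) vs (bethe_vector smul c xi_minus T vac us)
       = (\<Sum>etaII \<in> {W. W \<subseteq> set us \<union> set vs \<and> card (set us \<union> set vs - W) = card W}.
            smul (R_hat c xi_plus xi_minus lambda1 lambda2 vs (set us \<union> set vs - etaII) etaII)
              (bethe_vector_of_set smul c xi_minus T vac etaII))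
    \<and> (bethe_regular c xi_plus xi_minus lambda1 lambda2 vs
       \<and> bethe_equations c xi_plus xi_minus lambda1 lambda2 vs \<longrightarrow>
         refl_scalar_product smul c xi_minus T vac dvac vs us
       = dual_factor c xi_plus xi_minus lambda1 lambda2 vs
         * R_hat c xi_plus xi_minus lambda1 lambda2 vs (set us) (set vs))"
proof (intro conjI impI)
  interpret generalized_model smul c D T vac dvac lambda1 lambda2 by (rule assms(1))
  show "fold (refl_transfer smul c xi_plus xi_minus T) vs (bethe_vector smul c xi_minus T vac us)
       = (\<Sum>etaII \<in> {W. W \<subseteq> set us \<union> set vs \<and> card (set us \<union> set vs - W) = card W}.
            smul (R_hat c xi_plus xi_minus lambda1 lambda2 vs (set us \<union> set vs - etaII) etaII)
              (bethe_vector_of_set smul c xi_minus T vac etaII))"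
    by (rule multiple_action[OF assms(2-5)])
  assume "bethe_regular c xi_plus xi_minus lambda1 lambda2 vs \<and> bethe_equations c xi_plus xi_minus lambda1 lambda2 vs"
  then show "refl_scalar_product smul c xi_minus T vac dvac vs us
       = dual_factor c xi_plus xi_minus lambda1 lambda2 vs * R_hat c xi_plus xi_minus lambda1 lambda2 vs (set us) (set vs)"
    using assms by (intro scalar_product_eq_coefficient) auto
qed

end
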